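(* Let $n\ge 3$ be an integer and let $(\mathcal{C},\Sigma,\Theta)$ be a pre-$n$-angulated category. Then the following statements are equivalent. (a) $\Theta$ satisfies (N4-1): Whenever $X_1\xrightarrow{f_1}X_2\xrightarrow{f_2}\cdots\xrightarrow{f_{n-1}}X_n\xrightarrow{f_n}\Sigma X_1$ and $X_1\xrightarrow{g_1}Y_2\xrightarrow{g_2}Y_3\xrightarrow{g_3}\cdots\xrightarrow{g_{n-1}}Y_n\xrightarrow{g_n}\Sigma X_1$ are $n$-angles with the same first object $X_1$, and $\varphi_2:X_2\to Y_2$ is a morphism with $\varphi_2 f_1=g_1$, there exist morphisms $\varphi_i:X_i\to Y_i$ for $3\le i\le n$ such that $(1_{X_1},\varphi_2,\varphi_3,\ldots,\varphi_n)$ is a morphism of $n$-$\Sigma$-sequences from the first $n$-angle to the second, and the diagram with rows $X_2\xrightarrow{f_2}X_3\xrightarrow{f_3}\cdots\xrightarrow{f_{n-1}}X_n$ and $Y_2\xrightarrow{g_2}Y_3\xrightarrow{g_3}\cdots\xrightarrow{g_{n-1}}Y_n$ and vertical morphisms $\varphi_2,\ldots,\varphi_n$ is a homotopy cartesian diagram with differential $\Sigma f_1\cdot g_n$. (b) $\Theta$ satisfies (N4-4): Given morphisms $f_1:X_1\to X_2$, $\varphi_2:X_2\to Y_2$, $g_1=\varphi_2f_1$, and three $n$-angles $$X_1\xrightarrow{f_1}X_2\xrightarrow{f_2}X_3\xrightarrow{f_3}\cdots\xrightarrow{f_{n-1}}X_n\xrightarrow{f_n}\Sigma X_1,$$ $$X_1\xrightarrow{g_1}Y_2\xrightarrow{g_2}Y_3\xrightarrow{g_3}\cdots\xrightarrow{g_{n-1}}Y_n\xrightarrow{g_n}\Sigma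 X_1,$$ $$X_2\xrightarrow{\varphi_2}Y_2\xrightarrow{h_2}Z_3\xrightarrow{h_3}\cdots\xrightarrow{h_{n-1}}Z_n\xrightarrow{h_n}\Sigma X_2,$$ there exist morphisms $\varphi_i:X_i\to Y_i$ for $3\le i\le n$, $\psi_j:Y_j\to Z_j$ for $3\le j\le n$ and $\theta_k:X_k\to Z_{k-1}$ for $4\le k\le n$ such that the five-row diagram $\mathcal{D}$ built from these data (described in the context) is commutative and each of its five rows is an $n$-angle. (c) $\Theta$ satisfies (N4-5): Given two morphisms $f_1:X_1\to X_2$ and $\varphi_2:X_2\to Y_2$, there exist objects $X_i,Y_i,Z_i$ ($3\le i\le n$) and morphisms $f_i$ ($2\le i\le n$), $g_i$ ($1\le i\le n$), $h_i$ ($2\le i\le n$), $\varphi_i$ ($3\le i\le n$), $\psi_j$ ($3\le j\le n$), $\theta_k$ ($4\le k\le n$), with sources and targets as in (b), such that the five-row diagram $\mathcal{D}$ built from these data (described in the context) is commutative and each of its five rows is an $n$-angle.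
   Context: Composition is written right to left ($gf$ or $g\cdot f$ means first $f$, then $g$), and matrices act on column vectors. Let $\mathcal{C}$ be an additive category with an automorphism $\Sigma:\mathcal{C}\to\mathcal{C}$, and $n\ge 3$. An $n$-$\Sigma$-sequence is a sequence of morphisms $X_\bullet=(X_1\xrightarrow{f_1}X_2\xrightarrow{f_2}\cdots\xrightarrow{f_{n-1}}X_n\xrightarrow{f_n}\Sigma X_1)$ in $\mathcal{C}$. Its left rotation is $X_2\xrightarrow{f_2}X_3\to\cdots\xrightarrow{f_{n-1}}X_n\xrightarrow{f_n}\Sigma X_1\xrightarrow{(-1)^n\Sigma f_1}\Sigma X_2$. A morphism of $n$-$\Sigma$-sequences $X_\bullet\to Y_\bullet$ (with $Y_\bullet$ having morphisms $g_i$) is a tuple $(\varphi_1,\ldots,\varphi_n)$, $\varphi_i:X_i\to Y_i$, with $\varphi_{i+1}f_i=g_i\varphi_i$ for $1\le i\le n-1$ and $\Sigma\varphi_1\cdot f_n=g_n\varphi_n$; it is an isomorphism if all $\varphi_i$ are isomorphisms. Let $\Theta$ be a collection of $n$-$\Sigma$-sequences. $(\mathcal{C},\Sigma,\Theta)$ is a pre-$n$-angulated category, and the elements of $\Theta$ are called $n$-angles, if: (N1)(a) $\Theta$ is closed under isomorphisms, direct sums and direct summands; (b) for each object $X$ the trivial sequence $X\xrightarrow{1}X\to 0\to\cdots\to 0\to\Sigma X$ is in $\Theta$; (c) for each morphism $f_1:X_1\to X_2$ there is an $n$-$\Sigma$-sequence in $\Theta$ whose first morphism is $f_1$. (N2)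 An $n$-$\Sigma$-sequence is in $\Theta$ if and only if its left rotation is in $\Theta$. (N3) Given $X_\bullet,Y_\bullet\in\Theta$ (with morphisms $f_i$, $g_i$) and $\varphi_1:X_1\to Y_1$, $\varphi_2:X_2\to Y_2$ with $\varphi_2f_1=g_1\varphi_1$, there are $\varphi_3,\ldots,\varphi_n$ such that $(\varphi_1,\ldots,\varphi_n)$ is a morphism of $n$-$\Sigma$-sequences. Homotopy cartesian diagram: a commutative diagram with rows $A_1\xrightarrow{a_1}A_2\xrightarrow{a_2}\cdots\xrightarrow{a_{n-2}}A_{n-1}$ and $B_1\xrightarrow{b_1}B_2\xrightarrow{b_2}\cdots\xrightarrow{b_{n-2}}B_{n-1}$ and vertical morphisms $\alpha_i:A_i\to B_i$ ($1\le i\le n-1$) is called homotopy cartesian with differential $\partial:B_{n-1}\to\Sigma A_1$ if the $n$-$\Sigma$-sequence $$A_1\xrightarrow{\begin{pmatrix}-a_1\\ \alpha_1\end{pmatrix}}A_2\oplus B_1\xrightarrow{\begin{pmatrix}-a_2&0\\ \alpha_2&b_1\end{pmatrix}}A_3\oplus B_2\to\cdots\xrightarrow{\begin{pmatrix}-a_{n-2}&0\\ \alpha_{n-2}&b_{n-3}\end{pmatrix}}A_{n-1}\oplus B_{n-2}\xrightarrow{\begin{pmatrix}\alpha_{n-1}&b_{n-2}\end{pmatrix}}B_{n-1}\xrightarrow{\partial}\Sigma A_1$$ is an $n$-angle. The diagram $\mathcal{D}$. It has five rows, each an $n$-$\Sigma$-sequence: Row 1: $X_1\xrightarrow{f_1}X_2\xrightarrow{f_2}X_3\xrightarrow{f_3}\cdots\xrightarrow{f_{n-1}}X_n\xrightarrow{f_n}\Sigma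 X_1$. Row 2: $X_1\xrightarrow{g_1}Y_2\xrightarrow{g_2}Y_3\xrightarrow{g_3}\cdots\xrightarrow{g_{n-1}}Y_n\xrightarrow{g_n}\Sigma X_1$. Row 3: $$X_2\xrightarrow{\begin{pmatrix}-f_2\\ \varphi_2\end{pmatrix}}X_3\oplus Y_2\xrightarrow{\begin{pmatrix}-f_3&0\\ \varphi_3&g_2\end{pmatrix}}X_4\oplus Y_3\xrightarrow{\begin{pmatrix}-f_4&0\\ \varphi_4&g_3\end{pmatrix}}\cdots\xrightarrow{\begin{pmatrix}-f_{n-1}&0\\ \varphi_{n-1}&g_{n-2}\end{pmatrix}}X_n\oplus Y_{n-1}\xrightarrow{\begin{pmatrix}\varphi_n&g_{n-1}\end{pmatrix}}Y_n\xrightarrow{\Sigma f_1\cdot g_n}\Sigma X_2.$$ Row 4: $X_2\xrightarrow{\varphi_2}Y_2\xrightarrow{h_2}Z_3\xrightarrow{h_3}\cdots\xrightarrow{h_{n-1}}Z_n\xrightarrow{h_n}\Sigma X_2$. Row 5: $$X_3\xrightarrow{\begin{pmatrix}f_3\\ -\varphi_3\end{pmatrix}}X_4\oplus Y_3\xrightarrow{\begin{pmatrix}f_4&0\\ -\varphi_4&-g_3\\ \theta_4&\psi_3\end{pmatrix}}X_5\oplus Y_4\oplus Z_3\xrightarrow{\begin{pmatrix}f_5&0&0\\ -\varphi_5&-g_4&0\\ \theta_5&\psi_4&h_3\end{pmatrix}}X_6\oplus Y_5\oplus Z_4\to\cdots$$ $$\cdots\xrightarrow{\begin{pmatrix}f_{n-1}&0&0\\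 -\varphi_{n-1}&-g_{n-2}&0\\ \theta_{n-1}&\psi_{n-2}&h_{n-3}\end{pmatrix}}X_n\oplus Y_{n-1}\oplus Z_{n-2}\xrightarrow{\begin{pmatrix}-\varphi_n&-g_{n-1}&0\\ \theta_n&\psi_{n-1}&h_{n-2}\end{pmatrix}}Y_n\oplus Z_{n-1}\xrightarrow{\begin{pmatrix}\psi_n&h_{n-1}\end{pmatrix}}Z_n\xrightarrow{-\Sigma f_2\cdot h_n}\Sigma X_3.$$ That is, for $2\le k\le n$ the $k$-th object of Row 5 is $X_{k+2}\oplus Y_{k+1}\oplus Z_k$, where summands $X_j,Y_j$ with $j>n$ and the summand "$Z_2$" are omitted, the first object is $X_3$, and the $k$-th morphism for $1\le k\le n-1$ has the matrix with rows $(f_{k+2},0,0)$, $(-\varphi_{k+2},-g_{k+1},0)$, $(\theta_{k+2},\psi_{k+1},h_k)$, with entries belonging to omitted summands deleted. (E.g. for $n=3$ Row 5 is $X_3\xrightarrow{-\varphi_3}Y_3\xrightarrow{\psi_3}Z_3\xrightarrow{-\Sigma f_2\cdot h_3}\Sigma X_3$, and for $n=4$ it is $X_3\to X_4\oplus Y_3\to Y_4\oplus Z_3\to Z_4\to\Sigma X_3$.) Vertical morphisms of $\mathcal{D}$ (listed by column $1,2,\ldots,n$; in the last column, with entries $\Sigma$ of the first objects, the vertical morphism is $\Sigma$ of that of column 1): Row 1 to Row 2: $1_{X_1},\varphi_2,\varphi_3,\ldots,\varphi_n$. Row 2 to Row 3: $f_1$ in column 1; $\begin{pmatrix}0\\1\end{pmatrix}:Y_k\to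 X_{k+1}\oplus Y_k$ in column $k$ for $2\le k\le n-1$; $1_{Y_n}$ in column $n$. Row 3 to Row 4: $1_{X_2}$ in column 1; $\begin{pmatrix}0&1\end{pmatrix}:X_3\oplus Y_2\to Y_2$ in column 2; $\begin{pmatrix}\theta_{k+1}&\psi_k\end{pmatrix}:X_{k+1}\oplus Y_k\to Z_k$ in column $k$ for $3\le k\le n-1$; $\psi_n$ in column $n$. Row 4 to Row 5: $-f_2:X_2\to X_3$ in column 1; $\begin{pmatrix}0\\ g_2\end{pmatrix}:Y_2\to X_4\oplus Y_3$ in column 2 (just $g_2:Y_2\to Y_3$ if $n=3$); the canonical inclusion of the summand $Z_k$ in column $k$ for $3\le k\le n-1$; $1_{Z_n}$ in column $n$. "$\mathcal{D}$ is commutative" means that all squares commute, i.e. each of these four families of vertical morphisms is a morphism of $n$-$\Sigma$-sequences. *)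

theory Defs
  imports "HOL-Algebra.FiniteProduct"
begin

section \<open>Additive categories\<close>

record ('o, 'm) precat =
  Ob    :: "'o set"
  Arr   :: "'m set"
  Dom   :: "'m \<Rightarrow> 'o"
  Cod   :: "'m \<Rightarrow> 'o"
  Ident :: "'o \<Rightarrow> 'm"
  Comp  :: "'m \<Rightarrow> 'm \<Rightarrow> 'm"  (infixl \<open>\<cdot>\<index>\<close> 70)
  Add   :: "'m \<Rightarrow> 'm \<Rightarrow> 'm"
  Zero  :: "'o \<Rightarrow> 'o \<Rightarrow> 'm"

text \<open>Composition is written right to left. \<open>Zero C A B\<close> is the zero morphism from \<open>A\<close> to \<open>B\<close>.\<close>

definition hom_set :: "('o, 'm) precat \<Rightarrow> 'o \<Rightarrow> 'o \<Rightarrow> 'm set" where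
  "hom_set C A B = {f \<in> Arr C. Dom C f = A \<and> Cod C f = B}"

definition hom_grp :: "('o, 'm) precat \<Rightarrow> 'o \<Rightarrow> 'o \<Rightarrow> 'm monoid" where
  "hom_grp C A B = \<lparr>carrier = hom_set C A B, mult = Add C, one = Zero C A B\<rparr>"

definition neg :: "('o, 'm) precat \<Rightarrow> 'm \<Rightarrow> 'm" where
  "neg C f = inv\<^bsub>hom_grp C (Dom C f) (Cod C f)\<^esub> f"

definition is_iso :: "('o, 'm) precat \<Rightarrow> 'm \<Rightarrow> bool" where
  "is_iso C f \<longleftrightarrow> f \<in> Arr C \<and>
     (\<exists>g \<in> hom_set C (Cod C f) (Dom C f).
        g \<cdot>\<^bsub>C\<^esub> f = Ident C (Dom C f) \<and> f \<cdot>\<^bsub>C\<^esub> g = Ident C (Cod C f))"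

definition is_zero_ob :: "('o, 'm) precat \<Rightarrow> 'o \<Rightarrow> bool" where
  "is_zero_ob C N \<longleftrightarrow> N \<in> Ob C \<and>
     (\<forall>A \<in> Ob C. (\<exists>!f. f \<in> hom_set C A N) \<and> (\<exists>!f. f \<in> hom_set C N A))"

record ('o, 'm) biproduct_data =
  BOb :: 'o
  Inj1 :: 'm
  Inj2 :: 'm
  Prj1 :: 'm
  Prj2 :: 'm

definition is_biproduct ::
  "('o, 'm) precat \<Rightarrow> 'o \<Rightarrow> 'o \<Rightarrow> ('o, 'm) biproduct_data \<Rightarrow> bool" where
  "is_biproduct C A B P \<longleftrightarrow> BOb P \<in> Ob C \<and>
     Inj1 P \<in> hom_set C A (BOb P) \<and> Inj2 P \<in> hom_set C B (BOb P) \<and>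
     Prj1 P \<in> hom_set C (BOb P) A \<and> Prj2 P \<in> hom_set C (BOb P) B \<and>
     Prj1 P \<cdot>\<^bsub>C\<^esub> Inj1 P = Ident C A \<and> Prj2 P \<cdot>\<^bsub>C\<^esub> Inj2 P = Ident C B \<and>
     Prj2 P \<cdot>\<^bsub>C\<^esub> Inj1 P = Zero C A B \<and> Prj1 P \<cdot>\<^bsub>C\<^esub> Inj2 P = Zero C B A \<and>
     Add C (Inj1 P \<cdot>\<^bsub>C\<^esub> Prj1 P) (Inj2 P \<cdot>\<^bsub>C\<^esub> Prj2 P) = Ident C (BOb P)"

locale additive_category =
  fixes C :: "('o, 'm) precat" (structure)
  assumes Dom_Ob: "f \<in> Arr C \<Longrightarrow> Dom C f \<in> Ob C"
    and Cod_Ob: "f \<in> Arr C \<Longrightarrow> Cod C f \<in> Ob C"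
    and Ident_hom: "A \<in> Ob C \<Longrightarrow> Ident C A \<in> hom_set C A A"
    and Comp_hom: "f \<in> hom_set C A B \<Longrightarrow> g \<in> hom_set C B D \<Longrightarrow> g \<cdot> f \<in> hom_set C A D"
    and Ident_left: "f \<in> hom_set C A B \<Longrightarrow> Ident C B \<cdot> f = f"
    and Ident_right: "f \<in> hom_set C A B \<Longrightarrow> f \<cdot> Ident C A = f"
    and Comp_assoc: "f \<in> hom_set C A B \<Longrightarrow> g \<in> hom_set C B D \<Longrightarrow> h \<in> hom_set C D E \<Longrightarrow>
           (h \<cdot> g) \<cdot> f = h \<cdot> (g \<cdot> f)"
    and hom_comm_group: "A \<in> Ob C \<Longrightarrow> B \<in> Ob C \<Longrightarrow> comm_group (hom_grp C A B)"
    and Comp_Add_left: "f \<in> hom_set C A B \<Longrightarrow> g \<in> hom_set C B D \<Longrightarrow> h \<in> hom_set C B D \<Longrightarrow>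
           Add C g h \<cdot> f = Add C (g \<cdot> f) (h \<cdot> f)"
    and Comp_Add_right: "f \<in> hom_set C A B \<Longrightarrow> g \<in> hom_set C A B \<Longrightarrow> h \<in> hom_set C B D \<Longrightarrow>
           h \<cdot> Add C f g = Add C (h \<cdot> f) (h \<cdot> g)"
    and zero_ob_exists: "\<exists>N. is_zero_ob C N"
    and biproduct_exists: "A \<in> Ob C \<Longrightarrow> B \<in> Ob C \<Longrightarrow> \<exists>P. is_biproduct C A B P"

text \<open>
  An automorphism is a functor with a two-sided inverse functor. Additivity is not required
  separately: an isomorphism of categories preserves biproducts and is therefore additive.
\<close>

record ('o, 'm) endo =
  OMap :: "'o \<Rightarrow> 'o"
  AMap :: "'m \<Rightarrow> 'm"

definition is_endofunctor :: "('o, 'm) precat \<Rightarrow> ('o, 'm) endo \<Rightarrow> bool" where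
  "is_endofunctor C F \<longleftrightarrow>
     (\<forall>A \<in> Ob C. OMap F A \<in> Ob C) \<and>
     (\<forall>f \<in> Arr C. AMap F f \<in> hom_set C (OMap F (Dom C f)) (OMap F (Cod C f))) \<and>
     (\<forall>A \<in> Ob C. AMap F (Ident C A) = Ident C (OMap F A)) \<and>
     (\<forall>f \<in> Arr C. \<forall>g \<in> Arr C. Dom C g = Cod C f \<longrightarrow>
        AMap F (g \<cdot>\<^bsub>C\<^esub> f) = AMap F g \<cdot>\<^bsub>C\<^esub> AMap F f)"

definition is_automorphism :: "('o, 'm) precat \<Rightarrow> ('o, 'm) endo \<Rightarrow> bool" where
  "is_automorphism C F \<longleftrightarrow> is_endofunctor C F \<and>
     (\<exists>G. is_endofunctor C G \<and>
        (\<forall>A \<in> Ob C. OMap G (OMap F A) = A \<and> OMap F (OMap G A) = A) \<and>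
        (\<forall>f \<in> Arr C. AMap G (AMap F f) = f \<and> AMap F (AMap G f) = f))"


section \<open>Finite direct sums and matrices of morphisms\<close>

text \<open>
  Zero object and binary direct sums are fixed by choice. All notions below are invariant under
  isomorphism, so they do not depend on this choice.
\<close>

definition zero_ob :: "('o, 'm) precat \<Rightarrow> 'o" where
  "zero_ob C = (SOME N. is_zero_ob C N)"

definition biproduct :: "('o, 'm) precat \<Rightarrow> 'o \<Rightarrow> 'o \<Rightarrow> ('o, 'm) biproduct_data" where
  "biproduct C A B = (SOME P. is_biproduct C A B P)"

text \<open>The direct sum of a one-element list is the object itself.\<close>

fun dsum :: "('o, 'm) precat \<Rightarrow> 'o list \<Rightarrow> 'o" where
  "dsum C [] = zero_ob C"
| "dsum C [A] = A"
| "dsum C (A # B # L) = BOb (biproduct C A (dsum C (B # L)))"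

fun dinj :: "('o, 'm) precat \<Rightarrow> 'o list \<Rightarrow> nat \<Rightarrow> 'm" where
  "dinj C [] i = undefined"
| "dinj C [A] i = Ident C A"
| "dinj C (A # B # L) 0 = Inj1 (biproduct C A (dsum C (B # L)))"
| "dinj C (A # B # L) (Suc i) = Inj2 (biproduct C A (dsum C (B # L))) \<cdot>\<^bsub>C\<^esub> dinj C (B # L) i"

fun dprj :: "('o, 'm) precat \<Rightarrow> 'o list \<Rightarrow> nat \<Rightarrow> 'm" where
  "dprj C [] i = undefined"
| "dprj C [A] i = Ident C A"
| "dprj C (A # B # L) 0 = Prj1 (biproduct C A (dsum C (B # L)))"
| "dprj C (A # B # L) (Suc i) = dprj C (B # L) i \<cdot>\<^bsub>C\<^esub> Prj2 (biproduct C A (dsum C (B # L)))"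

text \<open>
  \<open>mat C As Bs M\<close> is the morphism from the direct sum of \<open>As\<close> to that of \<open>Bs\<close> whose matrix, acting
  on column vectors, has list of rows \<open>M\<close>; so \<open>M ! i ! j\<close> is a morphism from \<open>As ! j\<close> to \<open>Bs ! i\<close>.
  The \<open>finprod\<close> is the sum in the additive group of morphisms.
\<close>

definition mat :: "('o, 'm) precat \<Rightarrow> 'o list \<Rightarrow> 'o list \<Rightarrow> 'm list list \<Rightarrow> 'm" where
  "mat C As Bs M = finprod (hom_grp C (dsum C As) (dsum C Bs))
     (\<lambda>(i, j). dinj C Bs i \<cdot>\<^bsub>C\<^esub> (M ! i ! j) \<cdot>\<^bsub>C\<^esub> dprj C As j)
     ({..<length Bs} \<times> {..<length As})"

text \<open>
  Omitted summands: \<open>keep bs xs\<close> retains the entries of \<open>xs\<close> at the positions where \<open>bs\<close> is true,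
  and \<open>mat_keep\<close> is \<open>mat\<close> after deleting the omitted summands of the source (mask \<open>cs\<close>) and of the
  target (mask \<open>rs\<close>), together with the corresponding columns and rows.
\<close>

definition keep :: "bool list \<Rightarrow> 'a list \<Rightarrow> 'a list" where
  "keep bs xs = map snd (filter fst (zip bs xs))"

definition mat_keep :: "('o, 'm) precat \<Rightarrow> bool list \<Rightarrow> 'o list \<Rightarrow> bool list \<Rightarrow> 'o list \<Rightarrow>
    'm list list \<Rightarrow> 'm" where
  "mat_keep C cs As rs Bs M = mat C (keep cs As) (keep rs Bs) (map (keep cs) (keep rs M))"


section \<open>\<open>n\<close>-\<open>\<Sigma>\<close>-sequences\<close>

text \<open>
  A pair \<open>(X, f)\<close> represents the sequence with objects \<open>X 1, \<dots>, X n\<close> and morphisms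
  \<open>f 1, \<dots>, f n\<close>; values at other indices are irrelevant. Since a collection of \<open>n\<close>-angles is
  closed under isomorphism, membership in it does not depend on those values.
\<close>

type_synonym ('o, 'm) nseq = "(nat \<Rightarrow> 'o) \<times> (nat \<Rightarrow> 'm)"

definition is_nseq :: "nat \<Rightarrow> ('o, 'm) precat \<Rightarrow> ('o, 'm) endo \<Rightarrow> ('o, 'm) nseq \<Rightarrow> bool" where
  "is_nseq n C S = (\<lambda>(X, f).
     (\<forall>i \<in> {1..n}. X i \<in> Ob C) \<and>
     (\<forall>i \<in> {1..<n}. f i \<in> hom_set C (X i) (X (i + 1))) \<and>
     f n \<in> hom_set C (X n) (OMap S (X 1)))"

definition left_rotation ::
  "nat \<Rightarrow> ('o, 'm) precat \<Rightarrow> ('o, 'm) endo \<Rightarrow> ('o, 'm) nseq \<Rightarrow> ('o, 'm) nseq" where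
  "left_rotation n C S = (\<lambda>(X, f).
     (\<lambda>i. if i = n then OMap S (X 1) else X (i + 1),
      \<lambda>i. if i = n then (if even n then AMap S (f 1) else neg C (AMap S (f 1))) else f (i + 1)))"

definition nseq_morphism :: "nat \<Rightarrow> ('o, 'm) precat \<Rightarrow> ('o, 'm) endo \<Rightarrow>
    ('o, 'm) nseq \<Rightarrow> ('o, 'm) nseq \<Rightarrow> (nat \<Rightarrow> 'm) \<Rightarrow> bool" where
  "nseq_morphism n C S = (\<lambda>(X, f) (Y, g) \<phi>.
     (\<forall>i \<in> {1..n}. \<phi> i \<in> hom_set C (X i) (Y i)) \<and>
     (\<forall>i \<in> {1..<n}. \<phi> (i + 1) \<cdot>\<^bsub>C\<^esub> f i = g i \<cdot>\<^bsub>C\<^esub> \<phi> i) \<and>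
     AMap S (\<phi> 1) \<cdot>\<^bsub>C\<^esub> f n = g n \<cdot>\<^bsub>C\<^esub> \<phi> n)"

definition nseq_isomorphism :: "nat \<Rightarrow> ('o, 'm) precat \<Rightarrow> ('o, 'm) endo \<Rightarrow>
    ('o, 'm) nseq \<Rightarrow> ('o, 'm) nseq \<Rightarrow> (nat \<Rightarrow> 'm) \<Rightarrow> bool" where
  "nseq_isomorphism n C S U V \<phi> \<longleftrightarrow>
     nseq_morphism n C S U V \<phi> \<and> (\<forall>i \<in> {1..n}. is_iso C (\<phi> i))"

text \<open>
  The last morphism of a direct sum is \<open>f n \<oplus> g n\<close> followed by the canonical isomorphism
  \<open>\<Sigma>(X 1) \<oplus> \<Sigma>(Y 1) \<cong> \<Sigma>(X 1 \<oplus> Y 1)\<close>, whose components are the images under \<open>\<Sigma>\<close> of the injections.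
\<close>

definition nseq_sum ::
  "nat \<Rightarrow> ('o, 'm) precat \<Rightarrow> ('o, 'm) endo \<Rightarrow> ('o, 'm) nseq \<Rightarrow> ('o, 'm) nseq \<Rightarrow> ('o, 'm) nseq" where
  "nseq_sum n C S = (\<lambda>(X, f) (Y, g).
     (\<lambda>i. dsum C [X i, Y i],
      \<lambda>i. if i = n
           then Add C (AMap S (dinj C [X 1, Y 1] 0) \<cdot>\<^bsub>C\<^esub> f n \<cdot>\<^bsub>C\<^esub> dprj C [X n, Y n] 0)
                      (AMap S (dinj C [X 1, Y 1] 1) \<cdot>\<^bsub>C\<^esub> g n \<cdot>\<^bsub>C\<^esub> dprj C [X n, Y n] 1)
           else mat C [X i, Y i] [X (i + 1), Y (i + 1)]
                  [[f i, Zero C (Y i) (X (i + 1))],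
                   [Zero C (X i) (Y (i + 1)), g i]]))"

definition trivial_nseq ::
  "nat \<Rightarrow> ('o, 'm) precat \<Rightarrow> ('o, 'm) endo \<Rightarrow> 'o \<Rightarrow> ('o, 'm) nseq" where
  "trivial_nseq n C S A =
     (let X = (\<lambda>i. if i \<le> 2 then A else zero_ob C)
      in (X, \<lambda>i. if i = 1 then Ident C A
                 else if i = n then Zero C (X n) (OMap S A)
                 else Zero C (X i) (X (i + 1))))"


section \<open>Pre-\<open>n\<close>-angulated categories\<close>

locale pre_n_angulated = additive_category C
  for n :: nat and C :: "('o, 'm) precat" (structure)
    and S :: "('o, 'm) endo" and \<Theta> :: "('o, 'm) nseq set" +
  assumes n_ge_3: "n \<ge> 3"
    and automorphism: "is_automorphism C S"
    and Theta_nseq: "U \<in> \<Theta> \<Longrightarrow> is_nseq n C S U"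
    and N1a_iso: "U \<in> \<Theta> \<Longrightarrow> is_nseq n C S V \<Longrightarrow> nseq_isomorphism n C S U V \<phi> \<Longrightarrow> V \<in> \<Theta>"
    and N1a_sum: "U \<in> \<Theta> \<Longrightarrow> V \<in> \<Theta> \<Longrightarrow> nseq_sum n C S U V \<in> \<Theta>"
    and N1a_summand: "is_nseq n C S U \<Longrightarrow> is_nseq n C S V \<Longrightarrow> nseq_sum n C S U V \<in> \<Theta> \<Longrightarrow>
           U \<in> \<Theta> \<and> V \<in> \<Theta>"
    and N1b: "A \<in> Ob C \<Longrightarrow> trivial_nseq n C S A \<in> \<Theta>"
    and N1c: "a \<in> Arr C \<Longrightarrow> \<exists>X f. (X, f) \<in> \<Theta> \<and> f 1 = a"
    and N2: "is_nseq n C S U \<Longrightarrow> U \<in> \<Theta> \<longleftrightarrow> left_rotation n C S U \<in> \<Theta>"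
    and N3: "(X, f) \<in> \<Theta> \<Longrightarrow> (Y, g) \<in> \<Theta> \<Longrightarrow>
           a \<in> hom_set C (X 1) (Y 1) \<Longrightarrow> b \<in> hom_set C (X 2) (Y 2) \<Longrightarrow> b \<cdot> f 1 = g 1 \<cdot> a \<Longrightarrow>
           \<exists>\<phi>. \<phi> 1 = a \<and> \<phi> 2 = b \<and> nseq_morphism n C S (X, f) (Y, g) \<phi>"


section \<open>Homotopy cartesian diagrams\<close>

text \<open>
  For \<open>1 \<le> k \<le> n\<close> the \<open>k\<close>-th object of the sequence is \<open>A k \<oplus> B (k - 1)\<close>, where the summand
  \<open>A n\<close> (for \<open>k = n\<close>) and the summand \<open>B 0\<close> (for \<open>k = 1\<close>) are omitted.
\<close>

definition cone_mask :: "nat \<Rightarrow> nat \<Rightarrow> bool list" where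
  "cone_mask n k = [k < n, 2 \<le> k]"

definition cone_nseq :: "nat \<Rightarrow> ('o, 'm) precat \<Rightarrow> (nat \<Rightarrow> 'o) \<Rightarrow> (nat \<Rightarrow> 'm) \<Rightarrow>
    (nat \<Rightarrow> 'o) \<Rightarrow> (nat \<Rightarrow> 'm) \<Rightarrow> (nat \<Rightarrow> 'm) \<Rightarrow> 'm \<Rightarrow> ('o, 'm) nseq" where
  "cone_nseq n C A a B b \<alpha> d =
     (\<lambda>k. dsum C (keep (cone_mask n k) [A k, B (k - 1)]),
      \<lambda>k. if k = n then d
           else mat_keep C (cone_mask n k) [A k, B (k - 1)]
                  (cone_mask n (k + 1)) [A (k + 1), B k]
                  [[neg C (a k), Zero C (B (k - 1)) (A (k + 1))],
                   [\<alpha> k, b (k - 1)]])"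

definition homotopy_cartesian :: "nat \<Rightarrow> ('o, 'm) precat \<Rightarrow> ('o, 'm) endo \<Rightarrow> ('o, 'm) nseq set \<Rightarrow>
    (nat \<Rightarrow> 'o) \<Rightarrow> (nat \<Rightarrow> 'm) \<Rightarrow> (nat \<Rightarrow> 'o) \<Rightarrow> (nat \<Rightarrow> 'm) \<Rightarrow> (nat \<Rightarrow> 'm) \<Rightarrow> 'm \<Rightarrow> bool" where
  "homotopy_cartesian n C S \<Theta> A a B b \<alpha> d \<longleftrightarrow>
     (\<forall>i \<in> {1..n - 1}. A i \<in> Ob C \<and> B i \<in> Ob C \<and> \<alpha> i \<in> hom_set C (A i) (B i)) \<and>
     (\<forall>i \<in> {1..<n - 1}. a i \<in> hom_set C (A i) (A (i + 1)) \<and> b i \<in> hom_set C (B i) (B (i + 1)) \<and>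
        \<alpha> (i + 1) \<cdot>\<^bsub>C\<^esub> a i = b i \<cdot>\<^bsub>C\<^esub> \<alpha> i) \<and>
     d \<in> hom_set C (B (n - 1)) (OMap S (A 1)) \<and>
     cone_nseq n C A a B b \<alpha> d \<in> \<Theta>"

definition N4_1 :: "nat \<Rightarrow> ('o, 'm) precat \<Rightarrow> ('o, 'm) endo \<Rightarrow> ('o, 'm) nseq set \<Rightarrow> bool" where
  "N4_1 n C S \<Theta> \<longleftrightarrow>
     (\<forall>X f Y g p. (X, f) \<in> \<Theta> \<and> (Y, g) \<in> \<Theta> \<and> Y 1 = X 1 \<and>
        p \<in> hom_set C (X 2) (Y 2) \<and> p \<cdot>\<^bsub>C\<^esub> f 1 = g 1 \<longrightarrow>
        (\<exists>\<phi>. \<phi> 1 = Ident C (X 1) \<and> \<phi> 2 = p \<and>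
           nseq_morphism n C S (X, f) (Y, g) \<phi> \<and>
           homotopy_cartesian n C S \<Theta>
             (\<lambda>i. X (i + 1)) (\<lambda>i. f (i + 1)) (\<lambda>i. Y (i + 1)) (\<lambda>i. g (i + 1)) (\<lambda>i. \<phi> (i + 1))
             (AMap S (f 1) \<cdot>\<^bsub>C\<^esub> g n)))"


section \<open>The five-row diagram\<close>

text \<open>
  Rows 1, 2 and 4 are \<open>(X, f)\<close>, \<open>(Y, g)\<close> and \<open>(Z, h)\<close>, indexed from 1, so that \<open>Y 1 = X 1\<close>,
  \<open>Z 1 = X 2\<close>, \<open>Z 2 = Y 2\<close>, \<open>h 1 = \<phi> 2\<close> and \<open>\<phi> 1\<close> is the identity of \<open>X 1\<close>.
\<close>

definition row3_mask :: "nat \<Rightarrow> nat \<Rightarrow> bool list" where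
  "row3_mask n k = [k + 1 \<le> n, 2 \<le> k]"

definition row3 :: "nat \<Rightarrow> ('o, 'm) precat \<Rightarrow> ('o, 'm) endo \<Rightarrow> (nat \<Rightarrow> 'o) \<Rightarrow> (nat \<Rightarrow> 'm) \<Rightarrow>
    (nat \<Rightarrow> 'o) \<Rightarrow> (nat \<Rightarrow> 'm) \<Rightarrow> (nat \<Rightarrow> 'm) \<Rightarrow> ('o, 'm) nseq" where
  "row3 n C S X f Y g \<phi> =
     (\<lambda>k. dsum C (keep (row3_mask n k) [X (k + 1), Y k]),
      \<lambda>k. if k = n then AMap S (f 1) \<cdot>\<^bsub>C\<^esub> g n
           else mat_keep C (row3_mask n k) [X (k + 1), Y k]
                  (row3_mask n (k + 1)) [X (k + 2), Y (k + 1)]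
                  [[neg C (f (k + 1)), Zero C (Y k) (X (k + 2))],
                   [\<phi> (k + 1), g k]])"

definition row5_mask :: "nat \<Rightarrow> nat \<Rightarrow> bool list" where
  "row5_mask n k = [k + 2 \<le> n, 2 \<le> k \<and> k + 1 \<le> n, 3 \<le> k]"

definition row5 :: "nat \<Rightarrow> ('o, 'm) precat \<Rightarrow> ('o, 'm) endo \<Rightarrow> (nat \<Rightarrow> 'o) \<Rightarrow> (nat \<Rightarrow> 'm) \<Rightarrow>
    (nat \<Rightarrow> 'o) \<Rightarrow> (nat \<Rightarrow> 'm) \<Rightarrow> (nat \<Rightarrow> 'o) \<Rightarrow> (nat \<Rightarrow> 'm) \<Rightarrow>
    (nat \<Rightarrow> 'm) \<Rightarrow> (nat \<Rightarrow> 'm) \<Rightarrow> (nat \<Rightarrow> 'm) \<Rightarrow> ('o, 'm) nseq" where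
  "row5 n C S X f Y g Z h \<phi> \<psi> \<theta> =
     (\<lambda>k. dsum C (keep (row5_mask n k) [X (k + 2), Y (k + 1), Z k]),
      \<lambda>k. if k = n then neg C (AMap S (f 2) \<cdot>\<^bsub>C\<^esub> h n)
           else mat_keep C (row5_mask n k) [X (k + 2), Y (k + 1), Z k]
                  (row5_mask n (k + 1)) [X (k + 3), Y (k + 2), Z (k + 1)]
                  [[f (k + 2), Zero C (Y (k + 1)) (X (k + 3)), Zero C (Z k) (X (k + 3))],
                   [neg C (\<phi> (k + 2)), neg C (g (k + 1)), Zero C (Z k) (Y (k + 2))],
                   [\<theta> (k + 2), \<psi> (k + 1), h k]])"

definition vert23 :: "nat \<Rightarrow> ('o, 'm) precat \<Rightarrow> (nat \<Rightarrow> 'o) \<Rightarrow> (nat \<Rightarrow> 'm) \<Rightarrow> (nat \<Rightarrow> 'o) \<Rightarrow>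
    nat \<Rightarrow> 'm" where
  "vert23 n C X f Y k =
     (if k = 1 then f 1
      else if k = n then Ident C (Y n)
      else mat C [Y k] [X (k + 1), Y k] [[Zero C (Y k) (X (k + 1))], [Ident C (Y k)]])"

definition vert34 :: "nat \<Rightarrow> ('o, 'm) precat \<Rightarrow> (nat \<Rightarrow> 'o) \<Rightarrow> (nat \<Rightarrow> 'o) \<Rightarrow> (nat \<Rightarrow> 'o) \<Rightarrow>
    (nat \<Rightarrow> 'm) \<Rightarrow> (nat \<Rightarrow> 'm) \<Rightarrow> nat \<Rightarrow> 'm" where
  "vert34 n C X Y Z \<psi> \<theta> k =
     (if k = 1 then Ident C (X 2)
      else if k = 2 then mat C [X 3, Y 2] [Y 2] [[Zero C (X 3) (Y 2), Ident C (Y 2)]]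
      else if k = n then \<psi> n
      else mat C [X (k + 1), Y k] [Z k] [[\<theta> (k + 1), \<psi> k]])"

text \<open>In columns \<open>3 \<le> k \<le> n - 1\<close>, \<open>vert45\<close> is the inclusion of \<open>Z k\<close>, the last summand in row 5.\<close>

definition vert45 :: "nat \<Rightarrow> ('o, 'm) precat \<Rightarrow> (nat \<Rightarrow> 'o) \<Rightarrow> (nat \<Rightarrow> 'm) \<Rightarrow> (nat \<Rightarrow> 'o) \<Rightarrow>
    (nat \<Rightarrow> 'm) \<Rightarrow> (nat \<Rightarrow> 'o) \<Rightarrow> nat \<Rightarrow> 'm" where
  "vert45 n C X f Y g Z k =
     (if k = 1 then neg C (f 2)
      else if k = 2 then
        (if n = 3 then g 2
         else mat C [Y 2] [X 4, Y 3] [[Zero C (Y 2) (X 4)], [g 2]])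
      else if k = n then Ident C (Z n)
      else let L = keep (row5_mask n k) [X (k + 2), Y (k + 1), Z k] in dinj C L (length L - 1))"

definition diagram_D :: "nat \<Rightarrow> ('o, 'm) precat \<Rightarrow> ('o, 'm) endo \<Rightarrow> ('o, 'm) nseq set \<Rightarrow>
    (nat \<Rightarrow> 'o) \<Rightarrow> (nat \<Rightarrow> 'm) \<Rightarrow> (nat \<Rightarrow> 'o) \<Rightarrow> (nat \<Rightarrow> 'm) \<Rightarrow> (nat \<Rightarrow> 'o) \<Rightarrow> (nat \<Rightarrow> 'm) \<Rightarrow>
    (nat \<Rightarrow> 'm) \<Rightarrow> (nat \<Rightarrow> 'm) \<Rightarrow> (nat \<Rightarrow> 'm) \<Rightarrow> bool" where
  "diagram_D n C S \<Theta> X f Y g Z h \<phi> \<psi> \<theta> \<longleftrightarrow>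
     Y 1 = X 1 \<and> Z 1 = X 2 \<and> Z 2 = Y 2 \<and> h 1 = \<phi> 2 \<and> \<phi> 1 = Ident C (X 1) \<and>
     (\<forall>i \<in> {2..n}. \<phi> i \<in> hom_set C (X i) (Y i)) \<and>
     (\<forall>j \<in> {3..n}. \<psi> j \<in> hom_set C (Y j) (Z j)) \<and>
     (\<forall>k \<in> {4..n}. \<theta> k \<in> hom_set C (X k) (Z (k - 1))) \<and>
     (X, f) \<in> \<Theta> \<and> (Y, g) \<in> \<Theta> \<and> row3 n C S X f Y g \<phi> \<in> \<Theta> \<and> (Z, h) \<in> \<Theta> \<and>
     row5 n C S X f Y g Z h \<phi> \<psi> \<theta> \<in> \<Theta> \<and>
     nseq_morphism n C S (X, f) (Y, g) \<phi> \<and>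
     nseq_morphism n C S (Y, g) (row3 n C S X f Y g \<phi>) (vert23 n C X f Y) \<and>
     nseq_morphism n C S (row3 n C S X f Y g \<phi>) (Z, h) (vert34 n C X Y Z \<psi> \<theta>) \<and>
     nseq_morphism n C S (Z, h) (row5 n C S X f Y g Z h \<phi> \<psi> \<theta>) (vert45 n C X f Y g Z)"

definition N4_4 :: "nat \<Rightarrow> ('o, 'm) precat \<Rightarrow> ('o, 'm) endo \<Rightarrow> ('o, 'm) nseq set \<Rightarrow> bool" where
  "N4_4 n C S \<Theta> \<longleftrightarrow>
     (\<forall>X f Y g Z h p. (X, f) \<in> \<Theta> \<and> (Y, g) \<in> \<Theta> \<and> (Z, h) \<in> \<Theta> \<and>
        Y 1 = X 1 \<and> Z 1 = X 2 \<and> Z 2 = Y 2 \<and>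
        p \<in> hom_set C (X 2) (Y 2) \<and> h 1 = p \<and> g 1 = p \<cdot>\<^bsub>C\<^esub> f 1 \<longrightarrow>
        (\<exists>\<phi> \<psi> \<theta>. \<phi> 2 = p \<and> diagram_D n C S \<Theta> X f Y g Z h \<phi> \<psi> \<theta>))"

definition N4_5 :: "nat \<Rightarrow> ('o, 'm) precat \<Rightarrow> ('o, 'm) endo \<Rightarrow> ('o, 'm) nseq set \<Rightarrow> bool" where
  "N4_5 n C S \<Theta> \<longleftrightarrow>
     (\<forall>a p. a \<in> Arr C \<and> p \<in> Arr C \<and> Dom C p = Cod C a \<longrightarrow>
        (\<exists>X f Y g Z h \<phi> \<psi> \<theta>. f 1 = a \<and> \<phi> 2 = p \<and> diagram_D n C S \<Theta> X f Y g Z h \<phi> \<psi> \<theta>))"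

end

theory Submission
  imports Defs
begin

text \<open>
  For (a) \<open>\<Longrightarrow>\<close> (b), applying (N4-1) to rows 1 and 2 gives row 3, and applying it again to rows 3 and 4, with the
  projection \<open>X\<^sub>3 \<oplus> Y\<^sub>2 \<rightarrow> Y\<^sub>2\<close>, gives an \<open>n\<close>-angle that is row 5 with an additional contractible summand
  \<open>Y\<^sub>2 \<rightarrow> Y\<^sub>2\<close>. Gaussian elimination exhibits row 5 as a direct summand of it. (b) \<open>\<Longrightarrow>\<close> (c) only completes morphisms
  to \<open>n\<close>-angles.

  For (c) \<open>\<Longrightarrow>\<close> (a), (N4-5) provides an \<open>n\<close>-angle that is the cone of a map \<open>\<phi>'\<close> between some pair of \<open>n\<close>-angles
  on \<open>f\<^sub>1\<close> and \<open>g\<^sub>1\<close>. If \<open>n > 3\<close>, such \<open>n\<close>-angles need not be isomorphic to the given ones, but by exactness of the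
  contravariant Hom functors the comparison maps from (N3) can be corrected in degree \<open>n\<close> so as to be inverse up to
  homotopy. If \<open>u\<close> and \<open>w\<close> are such maps, the cone of \<open>\<phi> = w \<phi>' u\<close> is a homotopy retract of the cone of \<open>\<phi>'\<close>, and it
  is Hom-exact. A Hom-exact sequence that is a homotopy retract of an \<open>n\<close>-angle is an \<open>n\<close>-angle: adding trivial
  \<open>n\<close>-angles to the larger sequence, one degree at a time, absorbs the homotopy and turns the retraction into a strict
  one with degreewise split complements.
\<close>

text \<open>Idempotents of an additive category need not split, so a retraction alone never gives
  access to (N1)(a): a complement must be exhibited in every degree. This is why
  \<open>is_summand\<close> accompanies the inclusions, and why trivial n-angles absorb the
  homotopy: their identity entry turns the new inclusion into a graph, which has an evident
  complement. The second obstacle is that rows 3 and 5 do not contain X_1 and Y_1, so a homotopy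
  with a component t from \<Sigma>V_1 to V_n cannot be carried over to cones. Such a component
  enters only through t d_n, and this can be added to the map in degree n instead. The homotopy that
  remains lives on positions 2 to n and starts with zeros, because comparison maps are chosen to be
  identities in degrees 1 and 2. Exactness at \<Sigma>X_1, available by rotation, closes the chase
  that proves a cone Hom-exact. The final criterion is economical: between a Hom-exact sequence and
  an n-angle, maps i and r with composite the identity in degree 1, where i has a complement,
  already suffice. Exactness manufactures the homotopy in all other degrees.\<close>

definition pos :: "bool list \<Rightarrow> nat \<Rightarrow> nat" where
  "pos bs i = length (filter id (take i bs))"

lemma keep_simps [simp]:
  "keep [] xs = []" "keep bs [] = []"
  "keep (b # bs) (x # xs) = (if b then x # keep bs xs else keep bs xs)"
  by (simp_all add: keep_def)

lemma pos_simps [simp]: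
  "pos bs 0 = 0" "pos (b # bs) (Suc i) = (if b then Suc (pos bs i) else pos bs i)"
  by (simp_all add: pos_def)

text \<open>Together with \<open>pos_surj\<close> and \<open>pos_inj\<close> this makes
  \<open>pos bs\<close> the bijection from the retained positions of a list onto the indices of the
  shortened list, so that entries can be addressed by their original position.\<close>

lemma keep_nth:
  assumes "length bs = length xs" "i < length bs" "bs ! i"
  shows "pos bs i < length (keep bs xs)" "keep bs xs ! pos bs i = xs ! i"
  using assms
proof (induction bs xs arbitrary: i rule: list_induct2)
  case (Cons b bs x xs)
  { case 1 then show ?case using Cons.IH(1) by (cases i) auto }
  { case 2 then show ?case using Cons.IH(2) by (cases i) auto }
qed simp_all

lemma pos_surj:
  assumes "length bs = length xs" "j < length (keep bs xs)"
  shows "\<exists>i<length bs. bs ! i \<and> pos bs i = j"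
  using assms
proof (induction bs xs arbitrary: j rule: list_induct2)
  case (Cons b bs x xs)
  show ?case
  proof (cases "b \<and> j = 0")
    case True
    then show ?thesis by (intro exI[of _ 0]) simp
  next
    case False
    define j' where "j' = (if b then j - 1 else j)"
    have "j' < length (keep bs xs)" using Cons.prems False by (auto simp: j'_def split: if_splits)
    then obtain i where "i < length bs" "bs ! i" "pos bs i = j'" using Cons.IH by blast
    then show ?thesis using False by (intro exI[of _ "Suc i"]) (auto simp: j'_def)
  qed
qed simp

lemma pos_inj:
  assumes "i < length bs" "j < length bs" "bs ! i" "bs ! j" "pos bs i = pos bs j"
  shows "i = j"
  using assms
proof (induction bs arbitrary: i j)
  case (Cons b bs)
  then show ?case by (cases i; cases j) (auto split: if_splits)
qed simp

lemma nth3: "[a, b, c] ! 0 = a" "[a, b, c] ! 1 = b" "[a, b, c] ! 2 = c"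
  by simp_all

lemma less_3_cases: "i < 3 \<Longrightarrow> i = 0 \<or> i = 1 \<or> i = (2::nat)"
  by auto

section \<open>Additive categories\<close>

context additive_category
begin

abbreviation mor :: "'o \<Rightarrow> 'o \<Rightarrow> 'm set" where "mor A B \<equiv> hom_set C A B"
abbreviation add_mor :: "'m \<Rightarrow> 'm \<Rightarrow> 'm"  (infixr \<open>\<oplus>\<close> 65) where "f \<oplus> g \<equiv> Add C f g"
abbreviation neg_mor :: "'m \<Rightarrow> 'm"  (\<open>\<ominus> _\<close> [80] 80) where "\<ominus> f \<equiv> neg C f"
abbreviation zero_mor :: "'o \<Rightarrow> 'o \<Rightarrow> 'm"  (\<open>\<zero>\<^bsub>_,_\<^esub>\<close>) where "\<zero>\<^bsub>A,B\<^esub> \<equiv> Zero C A B"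
abbreviation ident_mor :: "'o \<Rightarrow> 'm"  (\<open>\<one>\<^bsub>_\<^esub>\<close>) where "\<one>\<^bsub>A\<^esub> \<equiv> Ident C A"
abbreviation N :: "'o" where "N \<equiv> zero_ob C"

lemma mor_iff: "f \<in> mor A B \<longleftrightarrow> f \<in> Arr C \<and> Dom C f = A \<and> Cod C f = B"
  by (auto simp: hom_set_def)

lemma morI: "f \<in> Arr C \<Longrightarrow> Dom C f = A \<Longrightarrow> Cod C f = B \<Longrightarrow> f \<in> mor A B"
  by (simp add: mor_iff)

lemmas [simp] = Dom_Ob Cod_Ob

lemma mor_Ob: "f \<in> mor A B \<Longrightarrow> A \<in> Ob C" "f \<in> mor A B \<Longrightarrow> B \<in> Ob C"
  by (auto simp: mor_iff)

lemma comp_arr [simp]: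
  assumes "f \<in> Arr C" "g \<in> Arr C" "Dom C g = Cod C f"
  shows "g \<cdot> f \<in> Arr C" "Dom C (g \<cdot> f) = Dom C f" "Cod C (g \<cdot> f) = Cod C g"
  using Comp_hom[of f "Dom C f" "Cod C f" g "Cod C g"] assms by (auto simp: mor_iff)

lemma ident_arr [simp]:
  assumes "A \<in> Ob C"
  shows "\<one>\<^bsub>A\<^esub> \<in> Arr C" "Dom C (\<one>\<^bsub>A\<^esub>) = A" "Cod C (\<one>\<^bsub>A\<^esub>) = A"
  using Ident_hom[OF assms] by (auto simp: mor_iff)

lemma ident_comp [simp]: "f \<in> Arr C \<Longrightarrow> Cod C f = A \<Longrightarrow> \<one>\<^bsub>A\<^esub> \<cdot> f = f"
  using Ident_left[of f "Dom C f" A] by (auto simp: mor_iff)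

lemma comp_ident [simp]: "f \<in> Arr C \<Longrightarrow> Dom C f = A \<Longrightarrow> f \<cdot> \<one>\<^bsub>A\<^esub> = f"
  using Ident_right[of f A "Cod C f"] by (auto simp: mor_iff)

lemma assoc [simp]:
  "f \<in> Arr C \<Longrightarrow> g \<in> Arr C \<Longrightarrow> h \<in> Arr C \<Longrightarrow> Dom C g = Cod C f \<Longrightarrow> Dom C h = Cod C g \<Longrightarrow>
   (h \<cdot> g) \<cdot> f = h \<cdot> (g \<cdot> f)"
  using Comp_assoc[of f "Dom C f" "Cod C f" g "Cod C g" h "Cod C h"] by (auto simp: mor_iff)

lemma add_arr [simp]:
  assumes "f \<in> Arr C" "g \<in> Arr C" "Dom C g = Dom C f" "Cod C g = Cod C f"
  shows "f \<oplus> g \<in> Arr C" "Dom C (f \<oplus> g) = Dom C f" "Cod C (f \<oplus> g) = Cod C f"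
proof -
  interpret G: comm_group "hom_grp C (Dom C f) (Cod C f)"
    using assms by (intro hom_comm_group) auto
  have "f \<oplus> g \<in> mor (Dom C f) (Cod C f)"
    using G.m_closed[of f g] assms by (auto simp: hom_grp_def mor_iff)
  then show "f \<oplus> g \<in> Arr C" "Dom C (f \<oplus> g) = Dom C f" "Cod C (f \<oplus> g) = Cod C f"
    by (auto simp: mor_iff)
qed

lemma zero_arr [simp]:
  assumes "A \<in> Ob C" "B \<in> Ob C"
  shows "\<zero>\<^bsub>A,B\<^esub> \<in> Arr C" "Dom C (\<zero>\<^bsub>A,B\<^esub>) = A" "Cod C (\<zero>\<^bsub>A,B\<^esub>) = B"
proof -
  interpret G: comm_group "hom_grp C A B" using assms by (rule hom_comm_group)
  show "\<zero>\<^bsub>A,B\<^esub> \<in> Arr C" "Dom C (\<zero>\<^bsub>A,B\<^esub>) = A" "Cod C (\<zero>\<^bsub>A,B\<^esub>) = B"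
    using G.one_closed by (auto simp: hom_grp_def mor_iff)
qed

lemma neg_arr [simp]:
  assumes "f \<in> Arr C"
  shows "\<ominus> f \<in> Arr C" "Dom C (\<ominus> f) = Dom C f" "Cod C (\<ominus> f) = Cod C f"
proof -
  interpret G: comm_group "hom_grp C (Dom C f) (Cod C f)"
    using assms by (intro hom_comm_group) auto
  have "\<ominus> f \<in> mor (Dom C f) (Cod C f)"
    using G.inv_closed[of f] assms by (auto simp: hom_grp_def mor_iff neg_def)
  then show "\<ominus> f \<in> Arr C" "Dom C (\<ominus> f) = Dom C f" "Cod C (\<ominus> f) = Cod C f"
    by (auto simp: mor_iff)
qed

lemma add_assoc [simp]:
  assumes "f \<in> Arr C" "g \<in> Arr C" "h \<in> Arr C"
    "Dom C g = Dom C f" "Cod C g = Cod C f" "Dom C h = Dom C f" "Cod C h = Cod C f"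
  shows "(f \<oplus> g) \<oplus> h = f \<oplus> (g \<oplus> h)"
proof -
  interpret G: comm_group "hom_grp C (Dom C f) (Cod C f)"
    using assms by (intro hom_comm_group) auto
  show ?thesis using G.m_assoc[of f g h] assms by (auto simp: hom_grp_def mor_iff)
qed

lemma add_commute:
  assumes "f \<in> Arr C" "g \<in> Arr C" "Dom C g = Dom C f" "Cod C g = Cod C f"
  shows "f \<oplus> g = g \<oplus> f"
proof -
  interpret G: comm_group "hom_grp C (Dom C f) (Cod C f)"
    using assms by (intro hom_comm_group) auto
  show ?thesis using G.m_comm[of f g] assms by (auto simp: hom_grp_def mor_iff)
qed

lemma add_left_commute:
  assumes "f \<in> Arr C" "g \<in> Arr C" "h \<in> Arr C"
    "Dom C g = Dom C f" "Cod C g = Cod C f" "Dom C h = Dom C f" "Cod C h = Cod C f"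
  shows "f \<oplus> (g \<oplus> h) = g \<oplus> (f \<oplus> h)"
proof -
  have "f \<oplus> (g \<oplus> h) = (f \<oplus> g) \<oplus> h" using assms by (subst add_assoc) simp_all
  also have "f \<oplus> g = g \<oplus> f" by (rule add_commute) (use assms in simp_all)
  also have "(g \<oplus> f) \<oplus> h = g \<oplus> (f \<oplus> h)" by (subst add_assoc) (use assms in simp_all)
  finally show ?thesis .
qed

lemmas add_ac = add_commute add_left_commute

lemma zero_add [simp]:
  assumes "f \<in> Arr C" "Dom C f = A" "Cod C f = B"
  shows "\<zero>\<^bsub>A,B\<^esub> \<oplus> f = f" "f \<oplus> \<zero>\<^bsub>A,B\<^esub> = f"
proof -
  interpret G: comm_group "hom_grp C A B"
    using assms by (intro hom_comm_group) auto
  show "\<zero>\<^bsub>A,B\<^esub> \<oplus> f = f" "f \<oplus> \<zero>\<^bsub>A,B\<^esub> = f"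
    using G.l_one[of f] G.r_one[of f] assms by (auto simp: hom_grp_def mor_iff)
qed

lemma add_neg [simp]:
  assumes "f \<in> Arr C"
  shows "f \<oplus> \<ominus> f = \<zero>\<^bsub>Dom C f,Cod C f\<^esub>" "\<ominus> f \<oplus> f = \<zero>\<^bsub>Dom C f,Cod C f\<^esub>"
proof -
  interpret G: comm_group "hom_grp C (Dom C f) (Cod C f)"
    using assms by (intro hom_comm_group) auto
  show "f \<oplus> \<ominus> f = \<zero>\<^bsub>Dom C f,Cod C f\<^esub>" "\<ominus> f \<oplus> f = \<zero>\<^bsub>Dom C f,Cod C f\<^esub>"
    using G.r_inv[of f] G.l_inv[of f] assms by (auto simp: hom_grp_def mor_iff neg_def)
qed

lemma add_neg_cancel [simp]:
  assumes "f \<in> Arr C" "g \<in> Arr C" "Dom C g = Dom C f" "Cod C g = Cod C f"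
  shows "f \<oplus> \<ominus> f \<oplus> g = g" "\<ominus> f \<oplus> f \<oplus> g = g"
proof -
  show "f \<oplus> \<ominus> f \<oplus> g = g"
    using add_assoc[of f "\<ominus> f" g] assms by simp
  show "\<ominus> f \<oplus> f \<oplus> g = g"
    using add_assoc[of "\<ominus> f" f g] assms by simp
qed

lemma add_neg_cancel' [simp]:
  assumes "f \<in> Arr C" "g \<in> Arr C" "Dom C g = Dom C f" "Cod C g = Cod C f"
  shows "f \<oplus> g \<oplus> \<ominus> f = g" "\<ominus> f \<oplus> g \<oplus> f = g"
  by (subst add_left_commute; use assms in simp)+

lemma add_left_cancel:
  assumes "f \<in> Arr C" "g \<in> Arr C" "h \<in> Arr C"
    "Dom C g = Dom C f" "Cod C g = Cod C f" "Dom C h = Dom C f" "Cod C h = Cod C f"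
    and "f \<oplus> g = f \<oplus> h"
  shows "g = h"
proof -
  have "\<ominus> f \<oplus> f \<oplus> g = \<ominus> f \<oplus> f \<oplus> h" by (rule arg_cong[OF assms(8)])
  then show ?thesis using assms(1-7) by simp
qed

lemma neg_unique:
  assumes "f \<in> Arr C" "g \<in> Arr C" "Dom C g = Dom C f" "Cod C g = Cod C f"
    and "f \<oplus> g = \<zero>\<^bsub>Dom C f,Cod C f\<^esub>"
  shows "\<ominus> f = g"
  by (rule add_left_cancel[of f]) (use assms in simp_all)

lemma neg_neg [simp]: "f \<in> Arr C \<Longrightarrow> \<ominus> (\<ominus> f) = f"
  by (rule neg_unique) simp_all

lemma neg_zero [simp]: "A \<in> Ob C \<Longrightarrow> B \<in> Ob C \<Longrightarrow> \<ominus> \<zero>\<^bsub>A,B\<^esub> = \<zero>\<^bsub>A,B\<^esub>"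
  by (rule neg_unique) simp_all

lemma neg_add [simp]:
  assumes "f \<in> Arr C" "g \<in> Arr C" "Dom C g = Dom C f" "Cod C g = Cod C f"
  shows "\<ominus> (f \<oplus> g) = \<ominus> f \<oplus> \<ominus> g"
proof (rule neg_unique)
  have "g \<oplus> (\<ominus> f \<oplus> \<ominus> g) = \<ominus> f" using assms by simp
  then show "(f \<oplus> g) \<oplus> (\<ominus> f \<oplus> \<ominus> g) = \<zero>\<^bsub>Dom C (f \<oplus> g),Cod C (f \<oplus> g)\<^esub>"
    using assms(1-4) by simp
qed (use assms in simp_all)

lemma add_eq_iff:
  assumes "f \<in> Arr C" "g \<in> Arr C" "h \<in> Arr C"
    "Dom C g = Dom C f" "Cod C g = Cod C f" "Dom C h = Dom C f" "Cod C h = Cod C f"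
  shows "f \<oplus> g = h \<longleftrightarrow> f = h \<oplus> \<ominus> g"
proof
  assume "f \<oplus> g = h"
  then have "h \<oplus> \<ominus> g = (f \<oplus> g) \<oplus> \<ominus> g" by simp
  also have "\<dots> = f" using assms by (simp del: add_neg_cancel')
  finally show "f = h \<oplus> \<ominus> g" ..
next
  assume f: "f = h \<oplus> \<ominus> g"
  have "f \<oplus> g = (h \<oplus> \<ominus> g) \<oplus> g" by (rule arg_cong[OF f])
  also have "\<dots> = h" using assms by simp
  finally show "f \<oplus> g = h" .
qed

lemma comp_add [simp]:
  "f \<in> Arr C \<Longrightarrow> g \<in> Arr C \<Longrightarrow> h \<in> Arr C \<Longrightarrow> Dom C g = Dom C f \<Longrightarrow> Cod C g = Cod C f \<Longrightarrow>
   Dom C h = Cod C f \<Longrightarrow> h \<cdot> (f \<oplus> g) = h \<cdot> f \<oplus> h \<cdot> g"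
  using Comp_Add_right[of f "Dom C f" "Cod C f" g h "Cod C h"] by (auto simp: mor_iff)

lemma add_comp [simp]:
  "f \<in> Arr C \<Longrightarrow> g \<in> Arr C \<Longrightarrow> h \<in> Arr C \<Longrightarrow> Dom C g = Dom C f \<Longrightarrow> Cod C g = Cod C f \<Longrightarrow>
   Dom C f = Cod C h \<Longrightarrow> (f \<oplus> g) \<cdot> h = f \<cdot> h \<oplus> g \<cdot> h"
  using Comp_Add_left[of h "Dom C h" "Dom C f" f "Cod C f" g] by (auto simp: mor_iff)

lemma comp_zero [simp]:
  assumes "f \<in> Arr C" "Dom C f = B" "A \<in> Ob C"
  shows "f \<cdot> \<zero>\<^bsub>A,B\<^esub> = \<zero>\<^bsub>A,Cod C f\<^esub>"
proof -
  have "B \<in> Ob C" using assms by auto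
  then have "f \<cdot> \<zero>\<^bsub>A,B\<^esub> \<oplus> f \<cdot> \<zero>\<^bsub>A,B\<^esub> = f \<cdot> \<zero>\<^bsub>A,B\<^esub> \<oplus> \<zero>\<^bsub>A,Cod C f\<^esub>"
    using assms comp_add[of "\<zero>\<^bsub>A,B\<^esub>" "\<zero>\<^bsub>A,B\<^esub>" f, symmetric] by (simp del: comp_add)
  then show ?thesis
    by (rule add_left_cancel[rotated -1]) (use assms \<open>B \<in> Ob C\<close> in simp_all)
qed

lemma zero_comp [simp]:
  assumes "f \<in> Arr C" "Cod C f = A" "B \<in> Ob C"
  shows "\<zero>\<^bsub>A,B\<^esub> \<cdot> f = \<zero>\<^bsub>Dom C f,B\<^esub>"
proof -
  have "A \<in> Ob C" using assms by auto
  then have "\<zero>\<^bsub>A,B\<^esub> \<cdot> f \<oplus> \<zero>\<^bsub>A,B\<^esub> \<cdot> f = \<zero>\<^bsub>A,B\<^esub> \<cdot> f \<oplus> \<zero>\<^bsub>Dom C f,B\<^esub>"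
    using assms add_comp[of "\<zero>\<^bsub>A,B\<^esub>" "\<zero>\<^bsub>A,B\<^esub>" f, symmetric] by (simp del: add_comp)
  then show ?thesis
    by (rule add_left_cancel[rotated -1]) (use assms \<open>A \<in> Ob C\<close> in simp_all)
qed

lemma comp_neg [simp]:
  assumes "f \<in> Arr C" "g \<in> Arr C" "Dom C g = Cod C f"
  shows "g \<cdot> \<ominus> f = \<ominus> (g \<cdot> f)"
  by (rule neg_unique[symmetric]) (use assms in \<open>simp_all flip: comp_add\<close>)

lemma neg_comp [simp]:
  assumes "f \<in> Arr C" "g \<in> Arr C" "Dom C g = Cod C f"
  shows "\<ominus> g \<cdot> f = \<ominus> (g \<cdot> f)"
  by (rule neg_unique[symmetric]) (use assms in \<open>simp_all flip: add_comp\<close>)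

text \<open>The simplifier nests compositions to the right, so an equation for
  \<open>g \<cdot> f\<close> no longer matches inside \<open>g \<cdot> (f \<cdot> x)\<close>;
  applying this rule with \<open>THEN\<close> gives the form that does.\<close>

lemma reassoc:
  assumes "g \<cdot> f = h" "f \<in> Arr C" "g \<in> Arr C" "Dom C g = Cod C f" "x \<in> Arr C" "Cod C x = Dom C f"
  shows "g \<cdot> (f \<cdot> x) = h \<cdot> x"
  using assms assoc[of x f g] by simp

lemma zero_ob_zero: "is_zero_ob C N"
  unfolding zero_ob_def using zero_ob_exists by (rule someI_ex)

lemma zero_ob_Ob [simp]: "N \<in> Ob C"
  using zero_ob_zero by (simp add: is_zero_ob_def)

lemma from_zero_ob: "f \<in> Arr C \<Longrightarrow> Dom C f = N \<Longrightarrow> f = \<zero>\<^bsub>N,Cod C f\<^esub>"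
  using zero_ob_zero Cod_Ob[of f] zero_arr[of N "Cod C f"] unfolding is_zero_ob_def mor_iff by blast

lemma to_zero_ob: "f \<in> Arr C \<Longrightarrow> Cod C f = N \<Longrightarrow> f = \<zero>\<^bsub>Dom C f,N\<^esub>"
  using zero_ob_zero Dom_Ob[of f] zero_arr[of "Dom C f" N] unfolding is_zero_ob_def mor_iff by blast

lemma ident_zero_ob [simp]: "\<one>\<^bsub>N\<^esub> = \<zero>\<^bsub>N,N\<^esub>"
  using from_zero_ob [of "\<one>\<^bsub>N\<^esub>"] by simp

lemma biproduct: "A \<in> Ob C \<Longrightarrow> B \<in> Ob C \<Longrightarrow> is_biproduct C A B (biproduct C A B)"
  unfolding biproduct_def using biproduct_exists by (metis someI_ex)

lemma biproduct_rules:
  assumes "is_biproduct C A B P"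
  shows "BOb P \<in> Ob C" "A \<in> Ob C" "B \<in> Ob C"
    "Inj1 P \<in> Arr C" "Dom C (Inj1 P) = A" "Cod C (Inj1 P) = BOb P"
    "Inj2 P \<in> Arr C" "Dom C (Inj2 P) = B" "Cod C (Inj2 P) = BOb P"
    "Prj1 P \<in> Arr C" "Dom C (Prj1 P) = BOb P" "Cod C (Prj1 P) = A"
    "Prj2 P \<in> Arr C" "Dom C (Prj2 P) = BOb P" "Cod C (Prj2 P) = B"
    "Prj1 P \<cdot> Inj1 P = \<one>\<^bsub>A\<^esub>" "Prj2 P \<cdot> Inj2 P = \<one>\<^bsub>B\<^esub>"
    "Prj2 P \<cdot> Inj1 P = \<zero>\<^bsub>A,B\<^esub>" "Prj1 P \<cdot> Inj2 P = \<zero>\<^bsub>B,A\<^esub>"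
    "Inj1 P \<cdot> Prj1 P \<oplus> Inj2 P \<cdot> Prj2 P = \<one>\<^bsub>BOb P\<^esub>"
    "x \<in> Arr C \<Longrightarrow> Cod C x = A \<Longrightarrow> Prj1 P \<cdot> (Inj1 P \<cdot> x) = x"
    "y \<in> Arr C \<Longrightarrow> Cod C y = B \<Longrightarrow> Prj2 P \<cdot> (Inj2 P \<cdot> y) = y"
    "x \<in> Arr C \<Longrightarrow> Cod C x = A \<Longrightarrow> Prj2 P \<cdot> (Inj1 P \<cdot> x) = \<zero>\<^bsub>Dom C x,B\<^esub>"
    "y \<in> Arr C \<Longrightarrow> Cod C y = B \<Longrightarrow> Prj1 P \<cdot> (Inj2 P \<cdot> y) = \<zero>\<^bsub>Dom C y,A\<^esub>"
    "z \<in> Arr C \<Longrightarrow> Cod C z = BOb P \<Longrightarrow> Inj1 P \<cdot> (Prj1 P \<cdot> z) \<oplus> Inj2 P \<cdot> (Prj2 P \<cdot> z) = z"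
proof -
  note a = assms[unfolded is_biproduct_def mor_iff]
  show t: "BOb P \<in> Ob C" "A \<in> Ob C" "B \<in> Ob C"
    "Inj1 P \<in> Arr C" "Dom C (Inj1 P) = A" "Cod C (Inj1 P) = BOb P"
    "Inj2 P \<in> Arr C" "Dom C (Inj2 P) = B" "Cod C (Inj2 P) = BOb P"
    "Prj1 P \<in> Arr C" "Dom C (Prj1 P) = BOb P" "Cod C (Prj1 P) = A"
    "Prj2 P \<in> Arr C" "Dom C (Prj2 P) = BOb P" "Cod C (Prj2 P) = B"
    using a by auto
  show e: "Prj1 P \<cdot> Inj1 P = \<one>\<^bsub>A\<^esub>" "Prj2 P \<cdot> Inj2 P = \<one>\<^bsub>B\<^esub>"
    "Prj2 P \<cdot> Inj1 P = \<zero>\<^bsub>A,B\<^esub>" "Prj1 P \<cdot> Inj2 P = \<zero>\<^bsub>B,A\<^esub>"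
    "Inj1 P \<cdot> Prj1 P \<oplus> Inj2 P \<cdot> Prj2 P = \<one>\<^bsub>BOb P\<^esub>"
    using a by auto
  show "x \<in> Arr C \<Longrightarrow> Cod C x = A \<Longrightarrow> Prj1 P \<cdot> (Inj1 P \<cdot> x) = x"
    "y \<in> Arr C \<Longrightarrow> Cod C y = B \<Longrightarrow> Prj2 P \<cdot> (Inj2 P \<cdot> y) = y"
    "x \<in> Arr C \<Longrightarrow> Cod C x = A \<Longrightarrow> Prj2 P \<cdot> (Inj1 P \<cdot> x) = \<zero>\<^bsub>Dom C x,B\<^esub>"
    "y \<in> Arr C \<Longrightarrow> Cod C y = B \<Longrightarrow> Prj1 P \<cdot> (Inj2 P \<cdot> y) = \<zero>\<^bsub>Dom C y,A\<^esub>"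
    using t e(1-4)[THEN reassoc] by simp_all
  assume z: "z \<in> Arr C" "Cod C z = BOb P"
  then show "Inj1 P \<cdot> (Prj1 P \<cdot> z) \<oplus> Inj2 P \<cdot> (Prj2 P \<cdot> z) = z"
    using arg_cong[OF e(5), of "\<lambda>u. u \<cdot> z"] t by simp
qed

lemma is_biproductI:
  assumes "Inj1 P \<in> mor A (BOb P)" "Inj2 P \<in> mor B (BOb P)"
    "Prj1 P \<in> mor (BOb P) A" "Prj2 P \<in> mor (BOb P) B"
    "Prj1 P \<cdot> Inj1 P = \<one>\<^bsub>A\<^esub>" "Prj2 P \<cdot> Inj2 P = \<one>\<^bsub>B\<^esub>"
    "Prj2 P \<cdot> Inj1 P = \<zero>\<^bsub>A,B\<^esub>" "Prj1 P \<cdot> Inj2 P = \<zero>\<^bsub>B,A\<^esub>"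
    "Inj1 P \<cdot> Prj1 P \<oplus> Inj2 P \<cdot> Prj2 P = \<one>\<^bsub>BOb P\<^esub>"
  shows "is_biproduct C A B P"
  unfolding is_biproduct_def using assms mor_Ob(2)[OF assms(1)] by simp

lemma biproduct_mono:
  assumes P: "is_biproduct C A B P" and "f \<in> mor D (BOb P)" "g \<in> mor D (BOb P)"
    "Prj1 P \<cdot> f = Prj1 P \<cdot> g" "Prj2 P \<cdot> f = Prj2 P \<cdot> g"
  shows "f = g"
proof -
  have "f = Inj1 P \<cdot> (Prj1 P \<cdot> f) \<oplus> Inj2 P \<cdot> (Prj2 P \<cdot> f)"
    by (rule biproduct_rules(25)[OF P, symmetric]) (use assms in \<open>simp_all add: mor_iff\<close>)
  also have "\<dots> = g"
    unfolding assms(4,5) by (rule biproduct_rules(25)[OF P]) (use assms in \<open>simp_all add: mor_iff\<close>)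
  finally show ?thesis .
qed

lemma biproduct_epi:
  assumes P: "is_biproduct C A B P" and f: "f \<in> mor (BOb P) D" and g: "g \<in> mor (BOb P) D"
    and eq: "f \<cdot> Inj1 P = g \<cdot> Inj1 P" "f \<cdot> Inj2 P = g \<cdot> Inj2 P"
  shows "f = g"
proof -
  note b = biproduct_rules[OF P]
  have *: "h = (h \<cdot> Inj1 P) \<cdot> Prj1 P \<oplus> (h \<cdot> Inj2 P) \<cdot> Prj2 P" if "h \<in> mor (BOb P) D" for h
    using arg_cong[OF b(20), of "\<lambda>u. h \<cdot> u", symmetric] that b(1-15) by (simp add: mor_iff)
  show ?thesis
    by (subst *[OF f], subst *[OF g], simp only: eq)
qed

section \<open>Direct sums and matrices with omitted summands\<close>

lemma dsum_Ob [simp]: "set L \<subseteq> Ob C \<Longrightarrow> dsum C L \<in> Ob C"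
  by (induction L rule: induct_list012) (auto intro: biproduct_rules(1)[OF biproduct])

lemma dinj_arr:
  assumes "set L \<subseteq> Ob C" "i < length L"
  shows "dinj C L i \<in> mor (L ! i) (dsum C L)"
  using assms
proof (induction L arbitrary: i rule: induct_list012)
  case (3 A B L)
  have P: "is_biproduct C A (dsum C (B # L)) (biproduct C A (dsum C (B # L)))"
    using 3 by (intro biproduct dsum_Ob) auto
  note b = biproduct_rules[OF P]
  show ?case
  proof (cases i)
    case 0
    then show ?thesis using b by (simp add: mor_iff)
  next
    case (Suc j)
    then have "dinj C (B # L) j \<in> mor ((B # L) ! j) (dsum C (B # L))"
      using 3 by auto
    then show ?thesis using b Suc by (simp add: mor_iff)
  qed
qed (simp_all add: mor_iff)

lemma dprj_arr:
  assumes "set L \<subseteq> Ob C" "i < length L"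
  shows "dprj C L i \<in> mor (dsum C L) (L ! i)"
  using assms
proof (induction L arbitrary: i rule: induct_list012)
  case (3 A B L)
  have P: "is_biproduct C A (dsum C (B # L)) (biproduct C A (dsum C (B # L)))"
    using 3 by (intro biproduct dsum_Ob) auto
  note b = biproduct_rules[OF P]
  show ?case
  proof (cases i)
    case 0
    then show ?thesis using b by (simp add: mor_iff)
  next
    case (Suc j)
    then have "dprj C (B # L) j \<in> mor (dsum C (B # L)) ((B # L) ! j)"
      using 3 by auto
    then show ?thesis using b Suc by (simp add: mor_iff)
  qed
qed (simp_all add: mor_iff)

lemma dprj_dinj:
  assumes "set L \<subseteq> Ob C" "i < length L" "j < length L"
  shows "dprj C L i \<cdot> dinj C L j = (if i = j then \<one>\<^bsub>L ! i\<^esub> else \<zero>\<^bsub>L ! j,L ! i\<^esub>)"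
  using assms
proof (induction L arbitrary: i j rule: induct_list012)
  case (3 A B L)
  have P: "is_biproduct C A (dsum C (B # L)) (biproduct C A (dsum C (B # L)))"
    using 3 by (intro biproduct dsum_Ob) auto
  note b = biproduct_rules[OF P]
  have L: "set (B # L) \<subseteq> Ob C" using 3 by auto
  note t = dprj_arr[OF L, unfolded mor_iff] dinj_arr[OF L, unfolded mor_iff]
  have Ob: "(B # L) ! k \<in> Ob C" if "k < length (B # L)" for k
    using that L by (meson nth_mem subsetD)
  show ?case
    using 3 t b Ob by (cases i; cases j) simp_all
qed simp_all

lemma dprj_mono:
  assumes "set L \<subseteq> Ob C" "x \<in> mor D (dsum C L)" "y \<in> mor D (dsum C L)"
    "\<And>i. i < length L \<Longrightarrow> dprj C L i \<cdot> x = dprj C L i \<cdot> y"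
  shows "x = y"
  using assms
proof (induction L arbitrary: x y rule: induct_list012)
  case 1
  then show ?case using to_zero_ob[of x] to_zero_ob[of y] by (simp add: mor_iff)
next
  case (2 A)
  then show ?case by (auto simp: mor_iff)
next
  case (3 A B L)
  have P: "is_biproduct C A (dsum C (B # L)) (biproduct C A (dsum C (B # L)))"
    using 3 by (intro biproduct dsum_Ob) auto
  note b = biproduct_rules[OF P]
  have L: "set (B # L) \<subseteq> Ob C" using 3 by auto
  note t = dprj_arr[OF L, unfolded mor_iff]
  let ?P = "biproduct C A (dsum C (B # L))"
  show ?case
  proof (rule biproduct_mono[OF P])
    show "x \<in> mor D (BOb ?P)" "y \<in> mor D (BOb ?P)" using 3 by simp_all
    show "Prj1 ?P \<cdot> x = Prj1 ?P \<cdot> y" using "3.prems"(4)[of 0] by simp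
    show "Prj2 ?P \<cdot> x = Prj2 ?P \<cdot> y"
    proof (rule "3.IH"(2)[OF L])
      show "Prj2 ?P \<cdot> x \<in> mor D (dsum C (B # L))" "Prj2 ?P \<cdot> y \<in> mor D (dsum C (B # L))"
        using 3 b by (simp_all add: mor_iff)
      fix i assume "i < length (B # L)"
      then show "dprj C (B # L) i \<cdot> (Prj2 ?P \<cdot> x) = dprj C (B # L) i \<cdot> (Prj2 ?P \<cdot> y)"
        using "3.prems"(4)[of "Suc i"] t[of i] b "3.prems"(2,3) by (simp add: mor_iff)
    qed
  qed
qed

text \<open>Bilinearity of composition, extended to finite sums. The typing claim is proved
  alongside because the induction step of the second claim composes with the partial sum.\<close>

lemma comp_finprod:
  assumes "finite I" "\<And>i. i \<in> I \<Longrightarrow> t i \<in> mor A B" "f \<in> mor B B'" "g \<in> mor A' A" "A \<in> Ob C" "B \<in> Ob C"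
  shows "finprod (hom_grp C A B) t I \<in> mor A B"
    "f \<cdot> (finprod (hom_grp C A B) t I \<cdot> g) = finprod (hom_grp C A' B') (\<lambda>i. f \<cdot> (t i \<cdot> g)) I"
  using assms
proof (induction I rule: finite_induct)
  case empty
  { case 1
    interpret G: comm_group "hom_grp C A B" by (rule hom_comm_group) fact+
    show ?case using 1 G.finprod_empty[of t] by (simp add: hom_grp_def mor_iff) }
  { case 2
    then have Ob: "A' \<in> Ob C" "B' \<in> Ob C" by (auto simp: mor_iff)
    interpret G: comm_group "hom_grp C A B" by (rule hom_comm_group) fact+
    interpret G': comm_group "hom_grp C A' B'" by (rule hom_comm_group) fact+
    show ?case
      using 2 Ob G.finprod_empty[of t] G'.finprod_empty[of "\<lambda>i. f \<cdot> (t i \<cdot> g)"]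
      by (simp add: hom_grp_def mor_iff) }
next
  case (insert x F)
  have Ob: "A' \<in> Ob C" "B' \<in> Ob C" if "f \<in> mor B B'" "g \<in> mor A' A" using that by (auto simp: mor_iff)
  { case 1
    interpret G: comm_group "hom_grp C A B" by (rule hom_comm_group) fact+
    show ?case using G.finprod_closed[of t "insert x F"] 1 by (auto simp: hom_grp_def Pi_def) }
  { case 2
    interpret G: comm_group "hom_grp C A B" by (rule hom_comm_group) fact+
    interpret G': comm_group "hom_grp C A' B'" by (rule hom_comm_group) (use Ob 2 in auto)
    have "finprod (hom_grp C A B) t (insert x F) = t x \<oplus> finprod (hom_grp C A B) t F"
      using G.finprod_insert[of F x t] insert 2 by (auto simp: hom_grp_def Pi_def)
    moreover have "finprod (hom_grp C A' B') (\<lambda>i. f \<cdot> (t i \<cdot> g)) (insert x F) =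
        f \<cdot> (t x \<cdot> g) \<oplus> finprod (hom_grp C A' B') (\<lambda>i. f \<cdot> (t i \<cdot> g)) F"
      using G'.finprod_insert[of F x "\<lambda>i. f \<cdot> (t i \<cdot> g)"] insert 2
      by (auto simp: hom_grp_def Pi_def mor_iff)
    moreover have "finprod (hom_grp C A B) t F \<in> mor A B"
      using insert.IH(1) 2 by auto
    moreover have "t x \<in> mor A B" using 2 by auto
    moreover have "f \<cdot> (finprod (hom_grp C A B) t F \<cdot> g) =
        finprod (hom_grp C A' B') (\<lambda>i. f \<cdot> (t i \<cdot> g)) F"
      using insert.IH(2) 2 by auto
    ultimately show ?case using 2(2,3) by (simp add: mor_iff) }
qed

lemma mat_arr_component:
  assumes As: "set As \<subseteq> Ob C" and Bs: "set Bs \<subseteq> Ob C"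
    and M: "\<And>i j. i < length Bs \<Longrightarrow> j < length As \<Longrightarrow> M ! i ! j \<in> mor (As ! j) (Bs ! i)"
  shows "mat C As Bs M \<in> mor (dsum C As) (dsum C Bs)"
    "i < length Bs \<Longrightarrow> j < length As \<Longrightarrow> dprj C Bs i \<cdot> (mat C As Bs M \<cdot> dinj C As j) = M ! i ! j"
proof -
  let ?I = "{..<length Bs} \<times> {..<length As}"
  let ?t = "\<lambda>(i, j). dinj C Bs i \<cdot> (M ! i ! j) \<cdot> dprj C As j"
  have Ob: "\<And>j. j < length As \<Longrightarrow> As ! j \<in> Ob C" "\<And>j. j < length Bs \<Longrightarrow> Bs ! j \<in> Ob C"
    using As Bs by (meson nth_mem subsetD)+
  note ty = dinj_arr[OF As] dprj_arr[OF As] dinj_arr[OF Bs] dprj_arr[OF Bs] M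
  have t: "?t x \<in> mor (dsum C As) (dsum C Bs)" if "x \<in> ?I" for x
    using that ty by (auto simp: mor_iff)
  have m: "mat C As Bs M = finprod (hom_grp C (dsum C As) (dsum C Bs)) ?t ?I"
    by (simp add: mat_def)
  show "mat C As Bs M \<in> mor (dsum C As) (dsum C Bs)"
    unfolding m
    by (rule comp_finprod(1)[where f = "\<one>\<^bsub>dsum C Bs\<^esub>" and g = "\<one>\<^bsub>dsum C As\<^esub>"])
      (use t As Bs in \<open>auto intro!: morI\<close>)
  assume ij: "i < length Bs" "j < length As"
  interpret G: comm_group "hom_grp C (As ! j) (Bs ! i)"
    by (rule hom_comm_group) (use Ob ij in auto)
  \<comment> \<open>A Kronecker delta: projecting and injecting kills every term of the sum except
    the one at position \<open>(i, j)\<close>, so the finite sum reduces to a single entry.\<close>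
  have e: "dprj C Bs i \<cdot> (?t x \<cdot> dinj C As j) = (if (i, j) = x then M ! i ! j else \<zero>\<^bsub>As ! j,Bs ! i\<^esub>)"
    if "x \<in> ?I" for x
  proof -
    obtain i' j' where x: "x = (i', j')" "i' < length Bs" "j' < length As" using \<open>x \<in> ?I\<close> by auto
    have "dprj C Bs i \<cdot> (?t x \<cdot> dinj C As j)
        = (dprj C Bs i \<cdot> dinj C Bs i') \<cdot> (M ! i' ! j' \<cdot> (dprj C As j' \<cdot> dinj C As j))"
      using x ij ty[unfolded mor_iff] by simp
    also have "\<dots> = (if (i, j) = x then M ! i ! j else \<zero>\<^bsub>As ! j,Bs ! i\<^esub>)"
      using x ij ty[unfolded mor_iff] Ob by (simp add: dprj_dinj As Bs)
    finally show ?thesis .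
  qed
  have "dprj C Bs i \<cdot> (mat C As Bs M \<cdot> dinj C As j)
      = finprod (hom_grp C (As ! j) (Bs ! i)) (\<lambda>x. dprj C Bs i \<cdot> (?t x \<cdot> dinj C As j)) ?I"
    unfolding m by (rule comp_finprod(2)) (use t ty ij As Bs in auto)
  also have "\<dots> = finprod (hom_grp C (As ! j) (Bs ! i))
      (\<lambda>x. if (i, j) = x then (\<lambda>_. M ! i ! j) x else monoid.one (hom_grp C (As ! j) (Bs ! i))) ?I"
    using e M ij Ob by (intro G.finprod_cong') (auto simp: hom_grp_def mor_iff)
  also have "\<dots> = M ! i ! j"
    by (subst G.finprod_singleton) (use M ij in \<open>auto simp: hom_grp_def\<close>)
  finally show "dprj C Bs i \<cdot> (mat C As Bs M \<cdot> dinj C As j) = M ! i ! j" .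
qed

text \<open>An omitted summand is treated as a zero object at its old position. With
  \<open>minj\<close> and \<open>mprj\<close> every position then carries an injection and a
  projection, and the biproduct identities hold without asking which summands were deleted.\<close>

definition kob :: "bool \<Rightarrow> 'o \<Rightarrow> 'o" where "kob b A = (if b then A else N)"

definition minj :: "bool list \<Rightarrow> 'o list \<Rightarrow> nat \<Rightarrow> 'm" where
  "minj bs L i = (if bs ! i then dinj C (keep bs L) (pos bs i) else \<zero>\<^bsub>N,dsum C (keep bs L)\<^esub>)"

definition mprj :: "bool list \<Rightarrow> 'o list \<Rightarrow> nat \<Rightarrow> 'm" where
  "mprj bs L i = (if bs ! i then dprj C (keep bs L) (pos bs i) else \<zero>\<^bsub>dsum C (keep bs L),N\<^esub>)"

definition kept_Ob :: "bool list \<Rightarrow> 'o list \<Rightarrow> bool" where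
  "kept_Ob bs L \<longleftrightarrow> length bs = length L \<and> set (keep bs L) \<subseteq> Ob C"

lemma kept_ObD:
  assumes "kept_Ob bs L" "i < length L"
  shows "kob (bs ! i) (L ! i) \<in> Ob C"
  using assms keep_nth[of bs L i] unfolding kept_Ob_def kob_def
  by (auto dest!: nth_mem)

lemma minj_arr:
  assumes "kept_Ob bs L" "i < length L"
  shows "minj bs L i \<in> mor (kob (bs ! i) (L ! i)) (dsum C (keep bs L))"
  using assms keep_nth[of bs L i] dinj_arr[of "keep bs L" "pos bs i"]
  by (auto simp: minj_def kob_def kept_Ob_def mor_iff)

lemma mprj_arr:
  assumes "kept_Ob bs L" "i < length L"
  shows "mprj bs L i \<in> mor (dsum C (keep bs L)) (kob (bs ! i) (L ! i))"
  using assms keep_nth[of bs L i] dprj_arr[of "keep bs L" "pos bs i"]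
  by (auto simp: mprj_def kob_def kept_Ob_def mor_iff)

lemma mprj_minj:
  assumes L: "kept_Ob bs L" and i: "i < length L" and j: "j < length L"
  shows "mprj bs L i \<cdot> minj bs L j =
    (if i = j then \<one>\<^bsub>kob (bs ! i) (L ! i)\<^esub> else \<zero>\<^bsub>kob (bs ! j) (L ! j),kob (bs ! i) (L ! i)\<^esub>)"
proof (cases "bs ! i \<and> bs ! j")
  case True
  have l: "length bs = length L" "set (keep bs L) \<subseteq> Ob C" using L by (auto simp: kept_Ob_def)
  show ?thesis
    using True l i j dprj_dinj[OF l(2), of "pos bs i" "pos bs j"] pos_inj[of i bs j]
      keep_nth[of bs L i] keep_nth[of bs L j]
    by (auto simp: mprj_def minj_def kob_def)
next
  case False
  have l: "length bs = length L" "set (keep bs L) \<subseteq> Ob C" using L by (auto simp: kept_Ob_def)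
  note t = minj_arr[OF L j, unfolded mor_iff] mprj_arr[OF L i, unfolded mor_iff]
  have d: "dsum C (keep bs L) \<in> Ob C" using l by simp
  show ?thesis
    using False t l d by (auto simp: mprj_def minj_def kob_def split: if_splits)
qed

lemma mprj_mono:
  assumes L: "kept_Ob bs L"
    and x: "x \<in> mor D (dsum C (keep bs L))" "y \<in> mor D (dsum C (keep bs L))"
    and e: "\<And>i. i < length L \<Longrightarrow> mprj bs L i \<cdot> x = mprj bs L i \<cdot> y"
  shows "x = y"
proof (rule dprj_mono[OF _ x])
  fix j assume "j < length (keep bs L)"
  then obtain i where "i < length bs" "bs ! i" "pos bs i = j"
    using pos_surj[of bs L j] L by (auto simp: kept_Ob_def)
  then show "dprj C (keep bs L) j \<cdot> x = dprj C (keep bs L) j \<cdot> y"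
    using e[of i] L by (auto simp: mprj_def kept_Ob_def)
qed (use L in \<open>auto simp: kept_Ob_def\<close>)

text \<open>Typing is required of retained entries only: the deleted ones mention objects with
  indices out of range, about which nothing is known. Under the zero-object convention they count as
  zero entries.\<close>

lemma mat_keep_arr_component:
  assumes As: "kept_Ob cs As" and Bs: "kept_Ob rs Bs"
    and len: "length M = length Bs" "\<And>i. i < length Bs \<Longrightarrow> length (M ! i) = length As"
    and M: "\<And>i j. i < length Bs \<Longrightarrow> j < length As \<Longrightarrow> rs ! i \<Longrightarrow> cs ! j \<Longrightarrow> M ! i ! j \<in> mor (As ! j) (Bs ! i)"
  shows "mat_keep C cs As rs Bs M \<in> mor (dsum C (keep cs As)) (dsum C (keep rs Bs))"
    "i < length Bs \<Longrightarrow> j < length As \<Longrightarrow> mprj rs Bs i \<cdot> (mat_keep C cs As rs Bs M \<cdot> minj cs As j) =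
      (if rs ! i \<and> cs ! j then M ! i ! j else \<zero>\<^bsub>kob (cs ! j) (As ! j),kob (rs ! i) (Bs ! i)\<^esub>)"
proof -
  have a: "length cs = length As" "set (keep cs As) \<subseteq> Ob C" using As by (auto simp: kept_Ob_def)
  have b: "length rs = length Bs" "set (keep rs Bs) \<subseteq> Ob C" using Bs by (auto simp: kept_Ob_def)
  let ?M = "map (keep cs) (keep rs M)"
  have comp: "?M ! pos rs i ! pos cs j = M ! i ! j"
    if "i < length Bs" "j < length As" "rs ! i" "cs ! j" for i j
    using that a b len keep_nth[of rs M i] keep_nth[of cs "M ! i" j] by simp
  have t: "?M ! i ! j \<in> mor (keep cs As ! j) (keep rs Bs ! i)"
    if ij: "i < length (keep rs Bs)" "j < length (keep cs As)" for i j
  proof -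
    obtain i' where i': "i' < length rs" "rs ! i'" "pos rs i' = i" using pos_surj[OF b(1) ij(1)] by blast
    obtain j' where j': "j' < length cs" "cs ! j'" "pos cs j' = j" using pos_surj[OF a(1) ij(2)] by blast
    show ?thesis
      using comp[of i' j'] M[of i' j'] i' j' a b keep_nth[of rs Bs i'] keep_nth[of cs As j'] by auto
  qed
  note m = mat_arr_component[OF a(2) b(2) t]
  show ty: "mat_keep C cs As rs Bs M \<in> mor (dsum C (keep cs As)) (dsum C (keep rs Bs))"
    unfolding mat_keep_def by (rule m(1))
  assume ij: "i < length Bs" "j < length As"
  show "mprj rs Bs i \<cdot> (mat_keep C cs As rs Bs M \<cdot> minj cs As j) =
      (if rs ! i \<and> cs ! j then M ! i ! j else \<zero>\<^bsub>kob (cs ! j) (As ! j),kob (rs ! i) (Bs ! i)\<^esub>)"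
  proof (cases "rs ! i \<and> cs ! j")
    case True
    then show ?thesis
      using m(2)[of "pos rs i" "pos cs j"] ij a b keep_nth[of rs Bs i] keep_nth[of cs As j] comp[of i j]
      by (simp add: mat_keep_def mprj_def minj_def)
  next
    case False
    note tt = minj_arr[OF As ij(2), unfolded mor_iff] mprj_arr[OF Bs ij(1), unfolded mor_iff]
      ty[unfolded mor_iff]
    have d: "dsum C (keep cs As) \<in> Ob C" "dsum C (keep rs Bs) \<in> Ob C" using a b by simp_all
    show ?thesis
    proof (cases "rs ! i")
      case True
      then have "minj cs As j = \<zero>\<^bsub>N,dsum C (keep cs As)\<^esub>" "\<not> cs ! j"
        using False by (simp_all add: minj_def)
      then show ?thesis using tt d by (simp add: kob_def)
    next
      case False
      then have "mprj rs Bs i = \<zero>\<^bsub>dsum C (keep rs Bs),N\<^esub>" by (simp add: mprj_def)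
      then show ?thesis using False tt d by (simp add: kob_def)
    qed
  qed
qed

lemma mat_diag:
  assumes A: "A \<in> Ob C" "B \<in> Ob C" and f: "f \<in> mor A A'" and g: "g \<in> mor B B'"
  defines "P \<equiv> biproduct C A B" and "P' \<equiv> biproduct C A' B'"
  defines "m \<equiv> mat C [A, B] [A', B'] [[f, \<zero>\<^bsub>B,A'\<^esub>], [\<zero>\<^bsub>A,B'\<^esub>, g]]"
  shows "m \<in> mor (BOb P) (BOb P')"
    "m \<cdot> Inj1 P = Inj1 P' \<cdot> f" "m \<cdot> Inj2 P = Inj2 P' \<cdot> g"
    "Prj1 P' \<cdot> m = f \<cdot> Prj1 P" "Prj2 P' \<cdot> m = g \<cdot> Prj2 P"
proof -
  have A': "A' \<in> Ob C" "B' \<in> Ob C" using f g by (auto simp: mor_iff)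
  have P: "is_biproduct C A B P" and P': "is_biproduct C A' B' P'"
    unfolding P_def P'_def using A A' by (simp_all add: biproduct)
  note b = biproduct_rules[OF P] and b' = biproduct_rules[OF P']
  have t: "[[f, \<zero>\<^bsub>B,A'\<^esub>], [\<zero>\<^bsub>A,B'\<^esub>, g]] ! i ! j \<in> mor ([A, B] ! j) ([A', B'] ! i)"
    if "i < length [A', B']" "j < length [A, B]" for i j
    using that A A' f g by (auto simp: less_Suc_eq mor_iff)
  note c = mat_arr_component[of "[A, B]" "[A', B']", OF _ _ t, folded m_def, simplified, OF conjI[OF A] conjI[OF A']]
  have d: "BOb (biproduct C A B) = BOb P" "BOb (biproduct C A' B') = BOb P'"
     "dinj C [A, B] 0 = Inj1 P" "dinj C [A, B] (Suc 0) = Inj2 P"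
     "dprj C [A', B'] 0 = Prj1 P'" "dprj C [A', B'] (Suc 0) = Prj2 P'"
    using b b' by (simp_all flip: P_def P'_def)
  show m: "m \<in> mor (BOb P) (BOb P')" using c(1) d by simp
  then have mt: "m \<in> Arr C" "Dom C m = BOb P" "Cod C m = BOb P'" by (simp_all add: mor_iff)
  have cc: "Prj1 P' \<cdot> (m \<cdot> Inj1 P) = f" "Prj1 P' \<cdot> (m \<cdot> Inj2 P) = \<zero>\<^bsub>B,A'\<^esub>"
    "Prj2 P' \<cdot> (m \<cdot> Inj1 P) = \<zero>\<^bsub>A,B'\<^esub>" "Prj2 P' \<cdot> (m \<cdot> Inj2 P) = g"
    using c(2)[of 0 0] c(2)[of 0 1] c(2)[of 1 0] c(2)[of 1 1] unfolding d[symmetric] by simp_all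
  have ft: "f \<in> Arr C" "Dom C f = A" "Cod C f = A'" "g \<in> Arr C" "Dom C g = B" "Cod C g = B'"
    using f g by (auto simp: mor_iff)
  show r1: "m \<cdot> Inj1 P = Inj1 P' \<cdot> f"
    by (rule biproduct_mono[OF P']) (use mt ft b b' cc in \<open>simp_all add: mor_iff\<close>)
  show r2: "m \<cdot> Inj2 P = Inj2 P' \<cdot> g"
    by (rule biproduct_mono[OF P']) (use mt ft b b' cc in \<open>simp_all add: mor_iff\<close>)
  show "Prj1 P' \<cdot> m = f \<cdot> Prj1 P" "Prj2 P' \<cdot> m = g \<cdot> Prj2 P"
    by (rule biproduct_epi[OF P], use mt ft b b' in \<open>simp_all add: mor_iff r1 r2\<close>)+
qed

section \<open>Summand inclusions\<close>

text \<open>Only a complement is recorded; the projection \<open>Prj1 P\<close> of the witness need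
  not agree with a retraction of \<open>f\<close> that is given elsewhere.\<close>

definition is_summand :: "'m \<Rightarrow> bool" where
  "is_summand f \<longleftrightarrow> (\<exists>Q P. is_biproduct C (Dom C f) Q P \<and> BOb P = Cod C f \<and> Inj1 P = f)"

lemma is_summandI:
  assumes "is_biproduct C A Q P" "f = Inj1 P"
  shows "is_summand f"
  unfolding is_summand_def using assms biproduct_rules(5,6)[OF assms(1)] by auto

lemma iso_is_summand:
  assumes "is_iso C f" shows "is_summand f"
proof -
  obtain g where g: "f \<in> Arr C" "g \<in> mor (Cod C f) (Dom C f)" "g \<cdot> f = \<one>\<^bsub>Dom C f\<^esub>" "f \<cdot> g = \<one>\<^bsub>Cod C f\<^esub>"
    using assms unfolding is_iso_def by auto
  let ?P = "\<lparr>BOb = Cod C f, Inj1 = f, Inj2 = \<zero>\<^bsub>N,Cod C f\<^esub>, Prj1 = g, Prj2 = \<zero>\<^bsub>Cod C f,N\<^esub>\<rparr>"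
  have "is_biproduct C (Dom C f) N ?P"
    by (rule is_biproductI) (use g in \<open>auto simp: mor_iff\<close>)
  then show ?thesis by (rule is_summandI) simp
qed

text \<open>The shear of the biproduct by \<open>f\<close> fixes the first injection and carries the
  second one to this map, so \<open>W\<close> remains a complement.\<close>

lemma graph_is_summand:
  assumes P: "is_biproduct C W V P" and f: "f \<in> mor V W"
  shows "is_summand (Inj1 P \<cdot> f \<oplus> Inj2 P)"
proof -
  note b = biproduct_rules[OF P]
  have t: "f \<in> Arr C" "Dom C f = V" "Cod C f = W" using f by (simp_all add: mor_iff)
  let ?P = "\<lparr>BOb = BOb P, Inj1 = Inj1 P \<cdot> f \<oplus> Inj2 P, Inj2 = Inj1 P, Prj1 = Prj2 P,
    Prj2 = Prj1 P \<oplus> \<ominus> (f \<cdot> Prj2 P)\<rparr>"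
  have "is_biproduct C V W ?P"
  proof (rule is_biproductI)
    have "Inj1 ?P \<cdot> Prj1 ?P \<oplus> Inj2 ?P \<cdot> Prj2 ?P =
        Inj1 P \<cdot> (f \<cdot> Prj2 P) \<oplus> (Inj2 P \<cdot> Prj2 P \<oplus> Inj1 P \<cdot> Prj1 P) \<oplus> \<ominus> (Inj1 P \<cdot> (f \<cdot> Prj2 P))"
      by (simp add: b(1-15) t)
    also have "\<dots> = Inj2 P \<cdot> Prj2 P \<oplus> Inj1 P \<cdot> Prj1 P"
      by (rule add_neg_cancel') (simp_all add: b(1-15) t)
    also have "\<dots> = Inj1 P \<cdot> Prj1 P \<oplus> Inj2 P \<cdot> Prj2 P"
      by (rule add_commute) (simp_all add: b(1-15))
    also have "\<dots> = \<one>\<^bsub>BOb ?P\<^esub>" by (simp add: b)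
    finally show "Inj1 ?P \<cdot> Prj1 ?P \<oplus> Inj2 ?P \<cdot> Prj2 ?P = \<one>\<^bsub>BOb ?P\<^esub>" .
  qed (simp_all add: mor_iff b t)
  then show ?thesis by (rule is_summandI) simp
qed

text \<open>A retraction of \<open>f\<close> extends \<open>g\<close> to all of \<open>W\<close>,
  and the shear along this extension turns the pair (f, g) into (f, 0). The complement is therefore
  a complement of \<open>f\<close> together with \<open>E\<close>.\<close>

lemma pair_is_summand:
  assumes P: "is_biproduct C W E P" and f: "f \<in> mor V W" "is_summand f" and g: "g \<in> mor V E"
  shows "is_summand (Inj1 P \<cdot> f \<oplus> Inj2 P \<cdot> g)"
proof -
  note b = biproduct_rules[OF P]
  have t: "f \<in> Arr C" "Dom C f = V" "Cod C f = W" "g \<in> Arr C" "Dom C g = V" "Cod C g = E"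
    using f g by (simp_all add: mor_iff)
  obtain Q P0 where P0: "is_biproduct C V Q P0" "BOb P0 = W" "Inj1 P0 = f"
    using f(2) t unfolding is_summand_def by auto
  note b0 = biproduct_rules[OF P0(1), unfolded P0(2,3)]
  define R where "R = biproduct C Q E"
  have R: "is_biproduct C Q E R" unfolding R_def by (rule biproduct) (simp_all add: b b0)
  note c = biproduct_rules[OF R]
  let ?P = "\<lparr>BOb = BOb P, Inj1 = Inj1 P \<cdot> f \<oplus> Inj2 P \<cdot> g,
    Inj2 = Inj1 P \<cdot> (Inj2 P0 \<cdot> Prj1 R) \<oplus> Inj2 P \<cdot> Prj2 R, Prj1 = Prj1 P0 \<cdot> Prj1 P,
    Prj2 = Inj1 R \<cdot> (Prj2 P0 \<cdot> Prj1 P) \<oplus> Inj2 R \<cdot> (Prj2 P \<oplus> \<ominus> (g \<cdot> (Prj1 P0 \<cdot> Prj1 P)))\<rparr>"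
  have "is_biproduct C V (BOb R) ?P"
  proof (rule is_biproductI)
    let ?z = "Inj2 P \<cdot> (g \<cdot> (Prj1 P0 \<cdot> Prj1 P))"
    have "Inj1 ?P \<cdot> Prj1 ?P \<oplus> Inj2 ?P \<cdot> Prj2 ?P =
        Inj1 P \<cdot> (f \<cdot> (Prj1 P0 \<cdot> Prj1 P)) \<oplus> (?z \<oplus> Inj1 P \<cdot> (Inj2 P0 \<cdot> (Prj2 P0 \<cdot> Prj1 P))
          \<oplus> Inj2 P \<cdot> Prj2 P \<oplus> \<ominus> ?z)"
      by (simp add: b(1-15) b0(1-15) c t)
    also have "?z \<oplus> Inj1 P \<cdot> (Inj2 P0 \<cdot> (Prj2 P0 \<cdot> Prj1 P)) \<oplus> Inj2 P \<cdot> Prj2 P \<oplus> \<ominus> ?z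
        = ?z \<oplus> (Inj1 P \<cdot> (Inj2 P0 \<cdot> (Prj2 P0 \<cdot> Prj1 P)) \<oplus> Inj2 P \<cdot> Prj2 P) \<oplus> \<ominus> ?z"
      by (simp add: b(1-15) b0(1-15) t)
    also have "\<dots> = Inj1 P \<cdot> (Inj2 P0 \<cdot> (Prj2 P0 \<cdot> Prj1 P)) \<oplus> Inj2 P \<cdot> Prj2 P"
      by (rule add_neg_cancel') (simp_all add: b(1-15) b0(1-15) t)
    also have "Inj1 P \<cdot> (f \<cdot> (Prj1 P0 \<cdot> Prj1 P)) \<oplus> \<dots> =
      Inj1 P \<cdot> ((f \<cdot> Prj1 P0 \<oplus> Inj2 P0 \<cdot> Prj2 P0) \<cdot> Prj1 P) \<oplus> Inj2 P \<cdot> Prj2 P"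
      by (simp add: b(1-15) b0(1-15) t)
    also have "\<dots> = \<one>\<^bsub>BOb ?P\<^esub>" by (simp add: b b0)
    finally show "Inj1 ?P \<cdot> Prj1 ?P \<oplus> Inj2 ?P \<cdot> Prj2 ?P = \<one>\<^bsub>BOb ?P\<^esub>" .
  qed (simp_all add: mor_iff b b0 c t)
  then show ?thesis by (rule is_summandI) simp
qed

text \<open>A mask that deletes a summand leaves the biproduct of the other one with a zero object,
  so every mask yields a genuine binary biproduct.\<close>

lemma masked_biproduct:
  assumes "kept_Ob bs [A, B]"
  shows "is_biproduct C (kob (bs ! 0) A) (kob (bs ! 1) B)
    \<lparr>BOb = dsum C (keep bs [A, B]), Inj1 = minj bs [A, B] 0, Inj2 = minj bs [A, B] 1,
      Prj1 = mprj bs [A, B] 0, Prj2 = mprj bs [A, B] 1\<rparr>" (is "is_biproduct C ?A ?B ?P")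
proof -
  note i = minj_arr[OF assms, of 0] minj_arr[OF assms, of 1]
  note p = mprj_arr[OF assms, of 0] mprj_arr[OF assms, of 1]
  note r = mprj_minj[OF assms, of 0 0] mprj_minj[OF assms, of 0 1] mprj_minj[OF assms, of 1 0] mprj_minj[OF assms, of 1 1]
  have o: "?A \<in> Ob C" "?B \<in> Ob C" using kept_ObD[OF assms, of 0] kept_ObD[OF assms, of 1] by simp_all
  have d: "dsum C (keep bs [A, B]) \<in> Ob C" using assms by (simp add: kept_Ob_def)
  note r' = r[THEN reassoc]
  have [simp]: "\<not> Suc 0 = 0" by simp
  show ?thesis
  proof (rule is_biproductI)
    show "Inj1 ?P \<cdot> Prj1 ?P \<oplus> Inj2 ?P \<cdot> Prj2 ?P = \<one>\<^bsub>BOb ?P\<^esub>"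
    proof (rule mprj_mono[OF assms])
      fix j assume "j < length [A, B]"
      then have "j = 0 \<or> j = Suc 0" by auto
      then show "mprj bs [A, B] j \<cdot> (Inj1 ?P \<cdot> Prj1 ?P \<oplus> Inj2 ?P \<cdot> Prj2 ?P) = mprj bs [A, B] j \<cdot> \<one>\<^bsub>BOb ?P\<^esub>"
        using i p o d by (auto simp: mor_iff r'[simplified])
    qed (use i p o d in \<open>auto simp: mor_iff\<close>)
  qed (use i p o d r in \<open>simp_all add: mor_iff\<close>)
qed

lemma add_cancel3:
  assumes "x \<in> Arr C" "y \<in> Arr C" "z \<in> Arr C"
    "Dom C x = Dom C z" "Cod C x = Cod C z" "Dom C y = Dom C z" "Cod C y = Cod C z"
  shows "\<ominus> z \<oplus> x \<oplus> y \<oplus> z = x \<oplus> y"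
proof -
  have "\<ominus> z \<oplus> x \<oplus> y \<oplus> z = \<ominus> z \<oplus> (x \<oplus> y) \<oplus> z" using assms by simp
  also have "\<dots> = x \<oplus> y" by (rule add_neg_cancel') (use assms in simp_all)
  finally show ?thesis .
qed

text \<open>Ternary biproducts are described by their maps and not by a chosen object, because row 5
  is a shortened list of three summands while the iterated cone is a biproduct inside a biproduct.
  \<open>masked_trisum\<close> and \<open>nested_trisum\<close> bring both into this form.\<close>

definition trisum :: "'o \<Rightarrow> 'o \<Rightarrow> 'o \<Rightarrow> 'o \<Rightarrow> 'm \<Rightarrow> 'm \<Rightarrow> 'm \<Rightarrow> 'm \<Rightarrow> 'm \<Rightarrow> 'm \<Rightarrow> bool" where
  "trisum W A B D i j k p q r \<longleftrightarrow>
     i \<in> mor A W \<and> j \<in> mor B W \<and> k \<in> mor D W \<and> p \<in> mor W A \<and> q \<in> mor W B \<and> r \<in> mor W D \<and>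
     p \<cdot> i = \<one>\<^bsub>A\<^esub> \<and> q \<cdot> j = \<one>\<^bsub>B\<^esub> \<and> r \<cdot> k = \<one>\<^bsub>D\<^esub> \<and>
     p \<cdot> j = \<zero>\<^bsub>B,A\<^esub> \<and> p \<cdot> k = \<zero>\<^bsub>D,A\<^esub> \<and> q \<cdot> i = \<zero>\<^bsub>A,B\<^esub> \<and> q \<cdot> k = \<zero>\<^bsub>D,B\<^esub> \<and>
     r \<cdot> i = \<zero>\<^bsub>A,D\<^esub> \<and> r \<cdot> j = \<zero>\<^bsub>B,D\<^esub> \<and> i \<cdot> p \<oplus> j \<cdot> q \<oplus> k \<cdot> r = \<one>\<^bsub>W\<^esub>"

lemma trisumD:
  assumes "trisum W A B D i j k p q r"
  shows "i \<in> Arr C" "Dom C i = A" "Cod C i = W" "j \<in> Arr C" "Dom C j = B" "Cod C j = W"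
    "k \<in> Arr C" "Dom C k = D" "Cod C k = W" "p \<in> Arr C" "Dom C p = W" "Cod C p = A"
    "q \<in> Arr C" "Dom C q = W" "Cod C q = B" "r \<in> Arr C" "Dom C r = W" "Cod C r = D"
    "W \<in> Ob C" "A \<in> Ob C" "B \<in> Ob C" "D \<in> Ob C"
    "p \<cdot> i = \<one>\<^bsub>A\<^esub>" "q \<cdot> j = \<one>\<^bsub>B\<^esub>" "r \<cdot> k = \<one>\<^bsub>D\<^esub>"
    "p \<cdot> j = \<zero>\<^bsub>B,A\<^esub>" "p \<cdot> k = \<zero>\<^bsub>D,A\<^esub>" "q \<cdot> i = \<zero>\<^bsub>A,B\<^esub>" "q \<cdot> k = \<zero>\<^bsub>D,B\<^esub>"
    "r \<cdot> i = \<zero>\<^bsub>A,D\<^esub>" "r \<cdot> j = \<zero>\<^bsub>B,D\<^esub>" "i \<cdot> p \<oplus> j \<cdot> q \<oplus> k \<cdot> r = \<one>\<^bsub>W\<^esub>"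
  using assms unfolding trisum_def mor_iff by auto

lemma trisum_comp:
  assumes t: "trisum W A B D i j k p q r" and x: "x \<in> Arr C"
  shows "Cod C x = A \<Longrightarrow> p \<cdot> (i \<cdot> x) = x" "Cod C x = B \<Longrightarrow> q \<cdot> (j \<cdot> x) = x" "Cod C x = D \<Longrightarrow> r \<cdot> (k \<cdot> x) = x"
    "Cod C x = B \<Longrightarrow> p \<cdot> (j \<cdot> x) = \<zero>\<^bsub>Dom C x,A\<^esub>" "Cod C x = D \<Longrightarrow> p \<cdot> (k \<cdot> x) = \<zero>\<^bsub>Dom C x,A\<^esub>"
    "Cod C x = A \<Longrightarrow> q \<cdot> (i \<cdot> x) = \<zero>\<^bsub>Dom C x,B\<^esub>" "Cod C x = D \<Longrightarrow> q \<cdot> (k \<cdot> x) = \<zero>\<^bsub>Dom C x,B\<^esub>"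
    "Cod C x = A \<Longrightarrow> r \<cdot> (i \<cdot> x) = \<zero>\<^bsub>Dom C x,D\<^esub>" "Cod C x = B \<Longrightarrow> r \<cdot> (j \<cdot> x) = \<zero>\<^bsub>Dom C x,D\<^esub>"
  by (simp_all add: trisumD[OF t] trisumD(23-31)[OF t, THEN reassoc] x)

lemma trisum_epi:
  assumes t: "trisum W A B D i j k p q r" and f: "f \<in> mor W E" and g: "g \<in> mor W E"
    and e: "f \<cdot> i = g \<cdot> i" "f \<cdot> j = g \<cdot> j" "f \<cdot> k = g \<cdot> k"
  shows "f = g"
proof -
  note d = trisumD[OF t]
  have *: "h = h \<cdot> i \<cdot> p \<oplus> h \<cdot> j \<cdot> q \<oplus> h \<cdot> k \<cdot> r" if "h \<in> mor W E" for h
    using arg_cong[OF d(32), of "\<lambda>u. h \<cdot> u", symmetric] that d(1-22) by (simp add: mor_iff)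
  show ?thesis by (subst *[OF f], subst *[OF g], simp only: e)
qed

lemma masked_trisum:
  assumes L: "kept_Ob bs [A, B, D]"
  shows "trisum (dsum C (keep bs [A, B, D])) (kob (bs ! 0) A) (kob (bs ! 1) B) (kob (bs ! 2) D)
    (minj bs [A, B, D] 0) (minj bs [A, B, D] 1) (minj bs [A, B, D] 2)
    (mprj bs [A, B, D] 0) (mprj bs [A, B, D] 1) (mprj bs [A, B, D] 2)"
proof -
  let ?L = "[A, B, D]"
  have l: "0 < length ?L" "1 < length ?L" "2 < length ?L" by simp_all
  have nth: "?L ! 0 = A" "?L ! 1 = B" "?L ! 2 = D" by simp_all
  note i = minj_arr[OF L l(1), unfolded nth] minj_arr[OF L l(2), unfolded nth] minj_arr[OF L l(3), unfolded nth]
  note p = mprj_arr[OF L l(1), unfolded nth] mprj_arr[OF L l(2), unfolded nth] mprj_arr[OF L l(3), unfolded nth]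
  note r0 = mprj_minj[OF L]
  have r: "mprj bs ?L 0 \<cdot> minj bs ?L 0 = \<one>\<^bsub>kob (bs ! 0) A\<^esub>" "mprj bs ?L 1 \<cdot> minj bs ?L 1 = \<one>\<^bsub>kob (bs ! 1) B\<^esub>"
    "mprj bs ?L 2 \<cdot> minj bs ?L 2 = \<one>\<^bsub>kob (bs ! 2) D\<^esub>"
    "mprj bs ?L 0 \<cdot> minj bs ?L 1 = \<zero>\<^bsub>kob (bs ! 1) B,kob (bs ! 0) A\<^esub>"
    "mprj bs ?L 0 \<cdot> minj bs ?L 2 = \<zero>\<^bsub>kob (bs ! 2) D,kob (bs ! 0) A\<^esub>"
    "mprj bs ?L 1 \<cdot> minj bs ?L 0 = \<zero>\<^bsub>kob (bs ! 0) A,kob (bs ! 1) B\<^esub>"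
    "mprj bs ?L 1 \<cdot> minj bs ?L 2 = \<zero>\<^bsub>kob (bs ! 2) D,kob (bs ! 1) B\<^esub>"
    "mprj bs ?L 2 \<cdot> minj bs ?L 0 = \<zero>\<^bsub>kob (bs ! 0) A,kob (bs ! 2) D\<^esub>"
    "mprj bs ?L 2 \<cdot> minj bs ?L 1 = \<zero>\<^bsub>kob (bs ! 1) B,kob (bs ! 2) D\<^esub>"
    using r0[OF l(1,1)] r0[OF l(2,2)] r0[OF l(3,3)] r0[OF l(1,2)] r0[OF l(1,3)] r0[OF l(2,1)] r0[OF l(2,3)]
      r0[OF l(3,1)] r0[OF l(3,2)] unfolding nth by (simp_all only: if_True if_False refl zero_neq_one one_neq_zero zero_neq_numeral numeral_eq_one_iff one_eq_numeral_iff numeral_neq_zero num.simps)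
  have o: "kob (bs ! 0) A \<in> Ob C" "kob (bs ! 1) B \<in> Ob C" "kob (bs ! 2) D \<in> Ob C"
    by (fact mor_Ob(1)[OF i(1)], fact mor_Ob(1)[OF i(2)], fact mor_Ob(1)[OF i(3)])
  have d: "dsum C (keep bs ?L) \<in> Ob C" using L by (simp add: kept_Ob_def)
  let ?e = "minj bs ?L 0 \<cdot> mprj bs ?L 0 \<oplus> minj bs ?L 1 \<cdot> mprj bs ?L 1 \<oplus> minj bs ?L 2 \<cdot> mprj bs ?L 2"
  have "?e = \<one>\<^bsub>dsum C (keep bs ?L)\<^esub>"
  proof (rule mprj_mono[OF L])
    show "?e \<in> mor (dsum C (keep bs ?L)) (dsum C (keep bs ?L))"
      using i p by (simp add: mor_iff del: One_nat_def)
    fix a assume "a < length ?L"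
    then have "a = 0 \<or> a = 1 \<or> a = 2" by auto
    then show "mprj bs ?L a \<cdot> ?e = mprj bs ?L a \<cdot> \<one>\<^bsub>dsum C (keep bs ?L)\<^esub>"
      using i p o d by (elim disjE) (simp_all add: mor_iff r[THEN reassoc] del: One_nat_def)
  qed (use d in \<open>simp add: mor_iff\<close>)
  then show ?thesis unfolding trisum_def using i p r by blast
qed

lemma trisum_mono:
  assumes t: "trisum W A B D i j k p q r" and f: "f \<in> mor E W" and g: "g \<in> mor E W"
    and e: "p \<cdot> f = p \<cdot> g" "q \<cdot> f = q \<cdot> g" "r \<cdot> f = r \<cdot> g"
  shows "f = g"
proof -
  note d = trisumD[OF t]
  have *: "h = i \<cdot> (p \<cdot> h) \<oplus> j \<cdot> (q \<cdot> h) \<oplus> k \<cdot> (r \<cdot> h)" if "h \<in> mor E W" for h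
    using arg_cong[OF d(32), of "\<lambda>u. u \<cdot> h", symmetric] that d(1-22) by (simp add: mor_iff)
  show ?thesis by (subst *[OF f], subst *[OF g], simp only: e)
qed

lemma nested_trisum:
  assumes P: "is_biproduct C M D P" and Q: "is_biproduct C A B Q" and M: "BOb Q = M"
  shows "trisum (BOb P) A B D (Inj1 P \<cdot> Inj1 Q) (Inj1 P \<cdot> Inj2 Q) (Inj2 P)
    (Prj1 Q \<cdot> Prj1 P) (Prj2 Q \<cdot> Prj1 P) (Prj2 P)"
proof -
  note p = biproduct_rules[OF P] and q = biproduct_rules[OF Q, unfolded M]
  have "Inj1 P \<cdot> (Inj1 Q \<cdot> (Prj1 Q \<cdot> Prj1 P)) \<oplus> Inj1 P \<cdot> (Inj2 Q \<cdot> (Prj2 Q \<cdot> Prj1 P)) \<oplus> Inj2 P \<cdot> Prj2 P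
      = Inj1 P \<cdot> (Inj1 Q \<cdot> (Prj1 Q \<cdot> Prj1 P) \<oplus> Inj2 Q \<cdot> (Prj2 Q \<cdot> Prj1 P)) \<oplus> Inj2 P \<cdot> Prj2 P"
    by (simp add: p(1-15) q(1-15))
  also have "\<dots> = \<one>\<^bsub>BOb P\<^esub>" by (simp add: p q)
  finally show ?thesis unfolding trisum_def by (simp add: mor_iff p(1-19) p(21-24) q(1-19) q(21-24))
qed

lemma mat_column:
  assumes "A \<in> Ob C" "B \<in> Ob C" "B' \<in> Ob C" and a: "a \<in> mor A B" and b: "b \<in> mor A B'"
  shows "mat C [A] [B, B'] [[a], [b]] = dinj C [B, B'] 0 \<cdot> a \<oplus> dinj C [B, B'] 1 \<cdot> b"
proof -
  define P where "P = biproduct C B B'"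
  have P: "is_biproduct C B B' P" unfolding P_def by (rule biproduct) fact+
  note r = biproduct_rules[OF P]
  have d: "dinj C [B, B'] 0 = Inj1 P" "dinj C [B, B'] 1 = Inj2 P" "dprj C [B, B'] 0 = Prj1 P" "dprj C [B, B'] 1 = Prj2 P"
    "dsum C [B, B'] = BOb P"
    using r by (simp_all add: P_def)
  let ?m = "mat C [A] [B, B'] [[a], [b]]"
  have ty: "[[a], [b]] ! i ! j \<in> mor ([A] ! j) ([B, B'] ! i)" if "i < length [B, B']" "j < length [A]" for i j
    using that a b by (auto simp: less_Suc_eq)
  have As: "set [A] \<subseteq> Ob C" and Bs: "set [B, B'] \<subseteq> Ob C" using assms by auto
  have mt: "?m \<in> mor A (BOb P)"
    using mat_arr_component(1)[OF As Bs, of "[[a], [b]]"] ty d by simp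
  have c: "dprj C [B, B'] i \<cdot> (?m \<cdot> dinj C [A] 0) = [[a], [b]] ! i ! 0" if "i < length [B, B']" for i
    by (rule mat_arr_component(2)[OF As Bs]) (use ty that in auto)
  have "Prj1 P \<cdot> ?m = a" "Prj2 P \<cdot> ?m = b"
    using c[of 0] c[of 1] mt unfolding d by (simp_all add: mor_iff)
  then show ?thesis
    unfolding d using a b mt by (intro biproduct_mono[OF P mt]) (simp_all add: mor_iff r)
qed

lemma mat_row:
  assumes "A \<in> Ob C" "A' \<in> Ob C" "B \<in> Ob C" and a: "a \<in> mor A B" and b: "b \<in> mor A' B"
  shows "mat C [A, A'] [B] [[a, b]] = a \<cdot> dprj C [A, A'] 0 \<oplus> b \<cdot> dprj C [A, A'] 1"
proof -
  define P where "P = biproduct C A A'"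
  have P: "is_biproduct C A A' P" unfolding P_def by (rule biproduct) fact+
  note r = biproduct_rules[OF P]
  have d: "dinj C [A, A'] 0 = Inj1 P" "dinj C [A, A'] 1 = Inj2 P" "dprj C [A, A'] 0 = Prj1 P" "dprj C [A, A'] 1 = Prj2 P"
    "dsum C [A, A'] = BOb P"
    using r by (simp_all add: P_def)
  let ?m = "mat C [A, A'] [B] [[a, b]]"
  have ty: "[[a, b]] ! i ! j \<in> mor ([A, A'] ! j) ([B] ! i)" if "i < length [B]" "j < length [A, A']" for i j
    using that a b by (auto simp: less_Suc_eq)
  have As: "set [A, A'] \<subseteq> Ob C" and Bs: "set [B] \<subseteq> Ob C" using assms by auto
  have mt: "?m \<in> mor (BOb P) B"
    using mat_arr_component(1)[OF As Bs, of "[[a, b]]"] ty d by simp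
  have c: "dprj C [B] 0 \<cdot> (?m \<cdot> dinj C [A, A'] j) = [[a, b]] ! 0 ! j" if "j < length [A, A']" for j
    by (rule mat_arr_component(2)[OF As Bs]) (use ty that in auto)
  have m12: "?m \<cdot> Inj1 P = a" "?m \<cdot> Inj2 P = b"
    using c[of 0] c[of 1] mt r unfolding d by (simp_all add: mor_iff)
  have at: "a \<in> Arr C" "Dom C a = A" "Cod C a = B" "b \<in> Arr C" "Dom C b = A'" "Cod C b = B" 
    using a b by (simp_all add: mor_iff)
  show ?thesis
    unfolding d by (rule biproduct_epi[OF P mt]) (simp_all add: mor_iff r at m12)
qed

end

section \<open>Additivity of the automorphism \<Sigma>\<close>

context pre_n_angulated
begin

abbreviation SO :: "'o \<Rightarrow> 'o" where "SO \<equiv> OMap S"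
abbreviation SA :: "'m \<Rightarrow> 'm" where "SA \<equiv> AMap S"

lemma S_functor: "is_endofunctor C S"
  using automorphism by (simp add: is_automorphism_def)

lemma SO_Ob [simp]: "A \<in> Ob C \<Longrightarrow> SO A \<in> Ob C"
  using S_functor by (simp add: is_endofunctor_def)

lemma SA_arr [simp]:
  assumes "f \<in> Arr C"
  shows "SA f \<in> Arr C" "Dom C (SA f) = SO (Dom C f)" "Cod C (SA f) = SO (Cod C f)"
  using S_functor assms by (auto simp: is_endofunctor_def mor_iff)

lemma SA_ident [simp]: "A \<in> Ob C \<Longrightarrow> SA \<one>\<^bsub>A\<^esub> = \<one>\<^bsub>SO A\<^esub>"
  using S_functor by (simp add: is_endofunctor_def)

lemma SA_comp [simp]:
  "f \<in> Arr C \<Longrightarrow> g \<in> Arr C \<Longrightarrow> Dom C g = Cod C f \<Longrightarrow> SA (g \<cdot> f) = SA g \<cdot> SA f"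
  using S_functor by (simp add: is_endofunctor_def)

lemma S_inverse:
  obtains G where "is_endofunctor C G"
    "\<And>A. A \<in> Ob C \<Longrightarrow> OMap G (SO A) = A" "\<And>A. A \<in> Ob C \<Longrightarrow> SO (OMap G A) = A"
    "\<And>f. f \<in> Arr C \<Longrightarrow> AMap G (SA f) = f" "\<And>f. f \<in> Arr C \<Longrightarrow> SA (AMap G f) = f"
  using automorphism unfolding is_automorphism_def by blast

lemma SA_full:
  assumes "x \<in> mor (SO A) (SO B)" "A \<in> Ob C" "B \<in> Ob C"
  obtains y where "y \<in> mor A B" "SA y = x"
proof -
  obtain G where G: "is_endofunctor C G"
    "\<And>A. A \<in> Ob C \<Longrightarrow> OMap G (SO A) = A" "\<And>A. A \<in> Ob C \<Longrightarrow> SO (OMap G A) = A"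
    "\<And>f. f \<in> Arr C \<Longrightarrow> AMap G (SA f) = f" "\<And>f. f \<in> Arr C \<Longrightarrow> SA (AMap G f) = f"
    using S_inverse by blast
  have "AMap G x \<in> mor A B"
    using G(1,2) assms by (auto simp: is_endofunctor_def mor_iff)
  moreover have "SA (AMap G x) = x" using G(5) assms by (simp add: mor_iff)
  ultimately show ?thesis by (rule that)
qed

lemma SA_inj: "f \<in> Arr C \<Longrightarrow> g \<in> Arr C \<Longrightarrow> SA f = SA g \<Longrightarrow> f = g"
  by (metis S_inverse)

text \<open>By fullness the zero endomorphism of \<open>SO N\<close> is the image of an endomorphism
  of \<open>N\<close>, and the identity is the only one.\<close>

lemma SA_zero_ob: "\<one>\<^bsub>SO N\<^esub> = \<zero>\<^bsub>SO N,SO N\<^esub>"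
proof -
  obtain y where y: "y \<in> mor N N" "SA y = \<zero>\<^bsub>SO N,SO N\<^esub>"
    by (rule SA_full[of "\<zero>\<^bsub>SO N,SO N\<^esub>" N N]) (auto simp: mor_iff)
  have "y = \<one>\<^bsub>N\<^esub>" using y(1) from_zero_ob[of y] by (simp add: mor_iff)
  then show ?thesis using y(2) SA_ident[of N] by (simp del: ident_zero_ob)
qed

lemma SA_zero [simp]:
  assumes "A \<in> Ob C" "B \<in> Ob C"
  shows "SA \<zero>\<^bsub>A,B\<^esub> = \<zero>\<^bsub>SO A,SO B\<^esub>"
proof -
  have "SA \<zero>\<^bsub>A,B\<^esub> = SA (\<zero>\<^bsub>N,B\<^esub> \<cdot> (\<one>\<^bsub>N\<^esub> \<cdot> \<zero>\<^bsub>A,N\<^esub>))" using assms by simp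
  also have "\<dots> = SA \<zero>\<^bsub>N,B\<^esub> \<cdot> (SA \<one>\<^bsub>N\<^esub> \<cdot> SA \<zero>\<^bsub>A,N\<^esub>)"
    using assms by (simp del: ident_zero_ob SA_ident ident_comp comp_zero zero_comp)
  also have "\<dots> = \<zero>\<^bsub>SO A,SO B\<^esub>"
    using assms by (simp del: ident_zero_ob add: SA_zero_ob)
  finally show ?thesis .
qed

text \<open>A full and faithful functor preserves the property that maps into a biproduct are
  determined by their components. The sum of f and g is the map with components f and g into the
  biproduct of \<open>B\<close> with itself, followed by the codiagonal \<open>?p\<close>, and both
  factors are preserved.\<close>

lemma SA_add [simp]:
  assumes "f \<in> Arr C" "g \<in> Arr C" "Dom C g = Dom C f" "Cod C g = Cod C f"
  shows "SA (f \<oplus> g) = SA f \<oplus> SA g"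
proof -
  define A B where "A = Dom C f" and "B = Cod C f"
  have AB: "A \<in> Ob C" "B \<in> Ob C" using assms by (auto simp: A_def B_def)
  have t: "Dom C f = A" "Cod C f = B" "Dom C g = A" "Cod C g = B" using assms by (auto simp: A_def B_def)
  define P where "P = biproduct C B B"
  have P: "is_biproduct C B B P" unfolding P_def by (rule biproduct[OF AB(2) AB(2)])
  note b = biproduct_rules[OF P]
  have s: "SA (Prj1 P) \<cdot> SA (Inj1 P) = \<one>\<^bsub>SO B\<^esub>" "SA (Prj2 P) \<cdot> SA (Inj2 P) = \<one>\<^bsub>SO B\<^esub>"
    "SA (Prj2 P) \<cdot> SA (Inj1 P) = \<zero>\<^bsub>SO B,SO B\<^esub>" "SA (Prj1 P) \<cdot> SA (Inj2 P) = \<zero>\<^bsub>SO B,SO B\<^esub>"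
    using b(1-19) AB by (simp_all flip: SA_comp)
  have ty: "SA (Inj1 P) \<in> Arr C" "Dom C (SA (Inj1 P)) = SO B" "Cod C (SA (Inj1 P)) = SO (BOb P)"
    "SA (Inj2 P) \<in> Arr C" "Dom C (SA (Inj2 P)) = SO B" "Cod C (SA (Inj2 P)) = SO (BOb P)"
    "SA (Prj1 P) \<in> Arr C" "Dom C (SA (Prj1 P)) = SO (BOb P)" "Cod C (SA (Prj1 P)) = SO B"
    "SA (Prj2 P) \<in> Arr C" "Dom C (SA (Prj2 P)) = SO (BOb P)" "Cod C (SA (Prj2 P)) = SO B"
    using b by simp_all
  have SP: "SO (BOb P) \<in> Ob C" "SO B \<in> Ob C" using b(1) AB by simp_all
  note s' = s[THEN reassoc]
  \<comment> \<open>The images of the projections are jointly monic: fullness lifts both maps,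
    faithfulness reflects the two equations.\<close>
  have eq: "x = y" if xy: "x \<in> mor (SO D) (SO (BOb P))" "y \<in> mor (SO D) (SO (BOb P))" "D \<in> Ob C"
    and e: "SA (Prj1 P) \<cdot> x = SA (Prj1 P) \<cdot> y" "SA (Prj2 P) \<cdot> x = SA (Prj2 P) \<cdot> y" for x y D
  proof -
    obtain x' where x': "x' \<in> mor D (BOb P)" "SA x' = x" using SA_full[OF xy(1,3) b(1)] by blast
    obtain y' where y': "y' \<in> mor D (BOb P)" "SA y' = y" using SA_full[OF xy(2,3) b(1)] by blast
    have "SA (Prj1 P \<cdot> x') = SA (Prj1 P \<cdot> y')" "SA (Prj2 P \<cdot> x') = SA (Prj2 P \<cdot> y')"
      using e x' y' b(1-15) by (simp_all add: mor_iff)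
    note e' = this
    have "Prj1 P \<cdot> x' = Prj1 P \<cdot> y'" "Prj2 P \<cdot> x' = Prj2 P \<cdot> y'"
      by (rule SA_inj[OF _ _ e'(1)] SA_inj[OF _ _ e'(2)];
          use x'(1) y'(1) b(1-15) in \<open>simp add: mor_iff\<close>)+
    then have "x' = y'" by (rule biproduct_mono[OF P x'(1) y'(1)])
    then show ?thesis using x' y' by simp
  qed
  let ?m = "Inj1 P \<cdot> f \<oplus> Inj2 P \<cdot> g"
  have m: "?m \<in> mor A (BOb P)" using b(1-15) assms t by (simp add: mor_iff)
  have m1: "Prj1 P \<cdot> ?m = f" "Prj2 P \<cdot> ?m = g" using b assms t by simp_all
  have Sm: "SA ?m = SA (Inj1 P) \<cdot> SA f \<oplus> SA (Inj2 P) \<cdot> SA g"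
  proof (rule eq[of _ A])
    have "SA (Prj1 P) \<cdot> SA ?m = SA (Prj1 P \<cdot> ?m)" "SA (Prj2 P) \<cdot> SA ?m = SA (Prj2 P \<cdot> ?m)"
      using m b(1-15) by (simp_all add: mor_iff del: comp_add)
    then have "SA (Prj1 P) \<cdot> SA ?m = SA f" "SA (Prj2 P) \<cdot> SA ?m = SA g"
      unfolding m1 by simp_all
    then show "SA (Prj1 P) \<cdot> SA ?m = SA (Prj1 P) \<cdot> (SA (Inj1 P) \<cdot> SA f \<oplus> SA (Inj2 P) \<cdot> SA g)"
      "SA (Prj2 P) \<cdot> SA ?m = SA (Prj2 P) \<cdot> (SA (Inj1 P) \<cdot> SA f \<oplus> SA (Inj2 P) \<cdot> SA g)"
      using ty SP assms(1,2) t s' AB by simp_all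
  qed (use m ty assms(1,2) t AB in \<open>simp_all add: mor_iff\<close>)
  have id: "SA (Inj1 P) \<cdot> SA (Prj1 P) \<oplus> SA (Inj2 P) \<cdot> SA (Prj2 P) = \<one>\<^bsub>SO (BOb P)\<^esub>"
    by (rule eq[of _ "BOb P"]) (use ty SP s' b(1) in \<open>simp_all add: mor_iff\<close>)
  let ?p = "Prj1 P \<oplus> Prj2 P"
  have p: "SA ?p \<cdot> SA (Inj1 P) = \<one>\<^bsub>SO B\<^esub>" "SA ?p \<cdot> SA (Inj2 P) = \<one>\<^bsub>SO B\<^esub>"
    using b(1-19) AB by (simp_all flip: SA_comp)
  have tp: "SA ?p \<in> Arr C" "Dom C (SA ?p) = SO (BOb P)" "Cod C (SA ?p) = SO B" using b by simp_all
  have "f \<oplus> g = ?p \<cdot> ?m" using b(1-15) assms(1,2) t b(21-24) by simp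
  then have "SA (f \<oplus> g) = SA ?p \<cdot> SA ?m" using b(1-15) assms(1,2) t by (simp del: comp_add add_comp)
  also have "\<dots> = SA f \<oplus> SA g"
    unfolding Sm using p[THEN reassoc] tp ty assms(1,2) t by simp
  finally show ?thesis .
qed

lemma SA_neg [simp]:
  assumes "f \<in> Arr C" shows "SA (\<ominus> f) = \<ominus> SA f"
proof (rule neg_unique[symmetric])
  show "SA f \<oplus> SA (\<ominus> f) = \<zero>\<^bsub>Dom C (SA f),Cod C (SA f)\<^esub>"
    using assms by (simp flip: SA_add)
qed (use assms in simp_all)

section \<open>Sequences, their morphisms and their direct sums\<close>

lemma nseqD:
  assumes "is_nseq n C S (X, f)"
  shows "1 \<le> i \<Longrightarrow> i \<le> n \<Longrightarrow> X i \<in> Ob C" "1 \<le> i \<Longrightarrow> i \<le> n \<Longrightarrow> f i \<in> Arr C"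
    "1 \<le> i \<Longrightarrow> i \<le> n \<Longrightarrow> Dom C (f i) = X i" "1 \<le> i \<Longrightarrow> i < n \<Longrightarrow> Cod C (f i) = X (Suc i)"
    "Cod C (f n) = SO (X 1)" "f n \<in> Arr C" "Dom C (f n) = X n" "X 1 \<in> Ob C" "X n \<in> Ob C"
  using assms n_ge_3 unfolding is_nseq_def
  by (auto simp: mor_iff less_le)

lemma nseqI:
  assumes "\<And>i. 1 \<le> i \<Longrightarrow> i < n \<Longrightarrow> f i \<in> mor (X i) (X (Suc i))" "f n \<in> mor (X n) (SO (X 1))"
  shows "is_nseq n C S (X, f)"
proof -
  have "X i \<in> Ob C" if "1 \<le> i" "i \<le> n" for i
    using assms(1)[of i] assms(2) that mor_Ob(1) by (cases "i = n") (auto simp: less_le)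
  then show ?thesis using assms unfolding is_nseq_def by auto
qed

lemma morphismD:
  assumes "nseq_morphism n C S (X, f) (Y, g) \<phi>"
  shows "1 \<le> i \<Longrightarrow> i \<le> n \<Longrightarrow> \<phi> i \<in> Arr C" "1 \<le> i \<Longrightarrow> i \<le> n \<Longrightarrow> Dom C (\<phi> i) = X i"
    "1 \<le> i \<Longrightarrow> i \<le> n \<Longrightarrow> Cod C (\<phi> i) = Y i"
    "1 \<le> i \<Longrightarrow> i < n \<Longrightarrow> \<phi> (Suc i) \<cdot> f i = g i \<cdot> \<phi> i" "SA (\<phi> 1) \<cdot> f n = g n \<cdot> \<phi> n"
    "\<phi> 1 \<in> Arr C" "Dom C (\<phi> 1) = X 1" "Cod C (\<phi> 1) = Y 1"
    "\<phi> n \<in> Arr C" "Dom C (\<phi> n) = X n" "Cod C (\<phi> n) = Y n"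
  using assms n_ge_3 unfolding nseq_morphism_def by (auto simp: mor_iff)

lemma morphismI:
  assumes "\<And>i. 1 \<le> i \<Longrightarrow> i \<le> n \<Longrightarrow> \<phi> i \<in> mor (X i) (Y i)"
    "\<And>i. 1 \<le> i \<Longrightarrow> i < n \<Longrightarrow> \<phi> (Suc i) \<cdot> f i = g i \<cdot> \<phi> i"
    "SA (\<phi> 1) \<cdot> f n = g n \<cdot> \<phi> n"
  shows "nseq_morphism n C S (X, f) (Y, g) \<phi>"
  using assms unfolding nseq_morphism_def by auto

lemma is_isoI:
  assumes "f \<in> mor A B" "g \<in> mor B A" "g \<cdot> f = \<one>\<^bsub>A\<^esub>" "f \<cdot> g = \<one>\<^bsub>B\<^esub>"
  shows "is_iso C f"
  using assms unfolding is_iso_def by (auto simp: mor_iff)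

text \<open>The last morphism of a direct sum passes through the images of the injections under
  \<open>S\<close>, so the final squares rest on \<open>S\<close> preserving the identities and
  zeros of a biproduct.\<close>

lemma nseq_sum:
  assumes X: "is_nseq n C S (X, f)" and Y: "is_nseq n C S (Y, g)"
  defines "W \<equiv> nseq_sum n C S (X, f) (Y, g)"
  defines "P \<equiv> \<lambda>k. biproduct C (X k) (Y k)"
  shows "fst W k = BOb (P k)" "is_nseq n C S W"
    "nseq_morphism n C S (X, f) W (\<lambda>k. Inj1 (P k))" "nseq_morphism n C S (Y, g) W (\<lambda>k. Inj2 (P k))"
    "nseq_morphism n C S W (X, f) (\<lambda>k. Prj1 (P k))" "nseq_morphism n C S W (Y, g) (\<lambda>k. Prj2 (P k))"
proof -
  define e where "e = snd W"
  have W: "W = (\<lambda>k. BOb (P k), e)"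
    unfolding e_def W_def nseq_sum_def P_def by simp
  show "fst W k = BOb (P k)" unfolding W by simp
  note x = nseqD[OF X] and y = nseqD[OF Y]
  have P: "is_biproduct C (X k) (Y k) (P k)" if "1 \<le> k" "k \<le> n" for k
    unfolding P_def using biproduct x y that by simp
  note b = biproduct_rules[OF P]
  have e: "e k \<in> mor (BOb (P k)) (BOb (P (Suc k)))"
    "e k \<cdot> Inj1 (P k) = Inj1 (P (Suc k)) \<cdot> f k" "e k \<cdot> Inj2 (P k) = Inj2 (P (Suc k)) \<cdot> g k"
    "Prj1 (P (Suc k)) \<cdot> e k = f k \<cdot> Prj1 (P k)" "Prj2 (P (Suc k)) \<cdot> e k = g k \<cdot> Prj2 (P k)"
    if k: "1 \<le> k" "k < n" for k
  proof -
    have "e k = mat C [X k, Y k] [X (Suc k), Y (Suc k)]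
        [[f k, \<zero>\<^bsub>Y k,X (Suc k)\<^esub>], [\<zero>\<^bsub>X k,Y (Suc k)\<^esub>, g k]]"
      using k unfolding e_def W_def nseq_sum_def by simp
    then show "e k \<in> mor (BOb (P k)) (BOb (P (Suc k)))"
    "e k \<cdot> Inj1 (P k) = Inj1 (P (Suc k)) \<cdot> f k" "e k \<cdot> Inj2 (P k) = Inj2 (P (Suc k)) \<cdot> g k"
    "Prj1 (P (Suc k)) \<cdot> e k = f k \<cdot> Prj1 (P k)" "Prj2 (P (Suc k)) \<cdot> e k = g k \<cdot> Prj2 (P k)"
      using mat_diag[of "X k" "Y k" "f k" "X (Suc k)" "g k" "Y (Suc k)"] x y k
      by (simp_all add: mor_iff P_def)
  qed
  have Pk: "biproduct C (X k) (Y k) = P k" for k by (simp add: P_def)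
  have n1: "1 \<le> n" "1 \<le> (1::nat)" using n_ge_3 by simp_all
  note bn = b[OF n1(1) order_refl] and b1 = b[OF n1(2,1), unfolded One_nat_def]
  note x' = x[unfolded One_nat_def] and y' = y[unfolded One_nat_def]
  have en: "e n = SA (Inj1 (P (Suc 0))) \<cdot> (f n \<cdot> Prj1 (P n)) \<oplus> SA (Inj2 (P (Suc 0))) \<cdot> (g n \<cdot> Prj2 (P n))"
    unfolding e_def W_def nseq_sum_def by (simp add: Pk bn b1 x' y')
  have SP: "SA (Prj1 (P (Suc 0))) \<cdot> SA (Inj1 (P (Suc 0))) = \<one>\<^bsub>SO (X (Suc 0))\<^esub>"
    "SA (Prj2 (P (Suc 0))) \<cdot> SA (Inj2 (P (Suc 0))) = \<one>\<^bsub>SO (Y (Suc 0))\<^esub>"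
    "SA (Prj2 (P (Suc 0))) \<cdot> SA (Inj1 (P (Suc 0))) = \<zero>\<^bsub>SO (X (Suc 0)),SO (Y (Suc 0))\<^esub>"
    "SA (Prj1 (P (Suc 0))) \<cdot> SA (Inj2 (P (Suc 0))) = \<zero>\<^bsub>SO (Y (Suc 0)),SO (X (Suc 0))\<^esub>"
    using b1 by (simp_all flip: SA_comp)
  note SP' = SP[THEN reassoc]
  have ent: "e n \<in> mor (BOb (P n)) (SO (BOb (P (Suc 0))))"
    unfolding en by (simp add: mor_iff bn b1 x' y')
  show "is_nseq n C S W"
    unfolding W by (rule nseqI) (use e ent in auto)
  show "nseq_morphism n C S (X, f) W (\<lambda>k. Inj1 (P k))"
    "nseq_morphism n C S (Y, g) W (\<lambda>k. Inj2 (P k))"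
    "nseq_morphism n C S W (X, f) (\<lambda>k. Prj1 (P k))"
    "nseq_morphism n C S W (Y, g) (\<lambda>k. Prj2 (P k))"
    unfolding W
    by (rule morphismI, simp_all add: mor_iff b e, simp add: en x' y' bn b1 SP')+
qed

text \<open>Positions are 1-based: the index 1 has to survive simplification and not become \<open>Suc 0\<close>.\<close>

declare One_nat_def [simp del]

lemma n_bounds [simp]: "1 \<le> n" "1 < n" "2 \<le> n" "2 < n" "3 \<le> n" "0 < n" "n \<noteq> 1" "n \<noteq> 2" "n \<noteq> 0"
  using n_ge_3 by simp_all

section \<open>Direct summands of \<open>n\<close>-angles\<close>

text \<open>(N1)(a) speaks of literal direct sums, so the larger n-angle has to be shown isomorphic
  to the sum of \<open>V\<close> and a second sequence built on the degreewise complements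
  \<open>Q\<close>.\<close>

lemma retract_in_Theta:
  assumes W: "(W, e) \<in> \<Theta>" and V: "is_nseq n C S (V, d)"
    and i: "nseq_morphism n C S (V, d) (W, e) i" and r: "nseq_morphism n C S (W, e) (V, d) r"
    and ri: "\<And>k. 1 \<le> k \<Longrightarrow> k \<le> n \<Longrightarrow> r k \<cdot> i k = \<one>\<^bsub>V k\<^esub>"
    and compl: "\<And>k. 1 \<le> k \<Longrightarrow> k \<le> n \<Longrightarrow> \<exists>Q P. is_biproduct C (V k) Q P \<and> BOb P = W k \<and> Inj1 P = i k"
  shows "(V, d) \<in> \<Theta>"
proof -
  obtain Q P where QP: "\<And>k. 1 \<le> k \<Longrightarrow> k \<le> n \<Longrightarrow>
      is_biproduct C (V k) (Q k) (P k) \<and> BOb (P k) = W k \<and> Inj1 (P k) = i k"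
    using compl by metis
  have P: "is_biproduct C (V k) (Q k) (P k)" and Pb: "BOb (P k) = W k" and Pi: "Inj1 (P k) = i k"
    if "1 \<le> k" "k \<le> n" for k using QP that by auto
  have W': "is_nseq n C S (W, e)" using Theta_nseq[OF W] .
  note v = nseqD[OF V] and w = nseqD[OF W']
  note im = morphismD[OF i] and rm = morphismD[OF r]
  define q where "q k = Prj2 (P k)" for k
  define j where "j k = Inj2 (P k) \<oplus> \<ominus> (i k \<cdot> (r k \<cdot> Inj2 (P k)))" for k
  have qt: "q k \<in> Arr C" "Dom C (q k) = W k" "Cod C (q k) = Q k" "Q k \<in> Ob C"
    and jt: "j k \<in> Arr C" "Dom C (j k) = Q k" "Cod C (j k) = W k"
    and qi: "q k \<cdot> i k = \<zero>\<^bsub>V k,Q k\<^esub>" and rj: "r k \<cdot> j k = \<zero>\<^bsub>Q k,V k\<^esub>" and qj: "q k \<cdot> j k = \<one>\<^bsub>Q k\<^esub>"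
    and ij: "i k \<cdot> r k \<oplus> j k \<cdot> q k = \<one>\<^bsub>W k\<^esub>" and jq: "j k \<cdot> q k = \<one>\<^bsub>W k\<^esub> \<oplus> \<ominus> (i k \<cdot> r k)"
    if k: "1 \<le> k" "k \<le> n" for k
  proof -
    note b = biproduct_rules[OF P[OF k], unfolded Pb[OF k] Pi[OF k]]
    note t = im(1-3)[OF k(1)] rm(1-3)[OF k(1)] v(1)[OF k(1)] w(1)[OF k(1)]
    have rt: "r k \<cdot> (i k \<cdot> x) = x" if "x \<in> Arr C" "Cod C x = V k" for x
      using reassoc[OF ri[OF k], of x] that by (simp add: t k)
    show qt: "q k \<in> Arr C" "Dom C (q k) = W k" "Cod C (q k) = Q k" "Q k \<in> Ob C"
      unfolding q_def by (simp_all add: b)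
    show jt: "j k \<in> Arr C" "Dom C (j k) = Q k" "Cod C (j k) = W k"
      unfolding j_def by (simp_all add: b t k)
    show qi: "q k \<cdot> i k = \<zero>\<^bsub>V k,Q k\<^esub>" unfolding q_def by (simp add: b)
    show rj: "r k \<cdot> j k = \<zero>\<^bsub>Q k,V k\<^esub>" unfolding j_def by (simp add: b t k rt)
    show qj: "q k \<cdot> j k = \<one>\<^bsub>Q k\<^esub>" unfolding j_def q_def by (simp add: b t k)
    show jq: "j k \<cdot> q k = \<one>\<^bsub>W k\<^esub> \<oplus> \<ominus> (i k \<cdot> r k)"
      by (rule biproduct_epi[OF P[OF k], unfolded Pb[OF k] Pi[OF k], of _ "W k"])
        (simp_all add: mor_iff q_def j_def b t k ri rt)
    show "i k \<cdot> r k \<oplus> j k \<cdot> q k = \<one>\<^bsub>W k\<^esub>"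
      unfolding jq by (simp add: t k)
  qed
  define dQ where "dQ k = (if k = n then SA (q 1) \<cdot> (e n \<cdot> j n) else q (Suc k) \<cdot> (e k \<cdot> j k))" for k
  have dQ: "is_nseq n C S (Q, dQ)"
    by (rule nseqI) (simp_all add: dQ_def mor_iff qt jt w)
  define B where "B k = biproduct C (V k) (Q k)" for k
  define U u where "U = fst (nseq_sum n C S (V, d) (Q, dQ))" and "u = snd (nseq_sum n C S (V, d) (Q, dQ))"
  have Uu: "nseq_sum n C S (V, d) (Q, dQ) = (U, u)" by (simp add: U_def u_def)
  have B: "is_biproduct C (V k) (Q k) (B k)" if "1 \<le> k" "k \<le> n" for k
    unfolding B_def by (rule biproduct) (use that v qt in auto)
  note b = biproduct_rules[OF B]
  note ns = nseq_sum[OF V dQ, unfolded Uu, folded B_def]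
  have UB: "U k = BOb (B k)" for k using ns(1) by simp
  note u = nseqD[OF ns(2), unfolded UB]
  note um = morphismD[OF ns(3), unfolded UB] morphismD[OF ns(4), unfolded UB]
     morphismD[OF ns(5), unfolded UB] morphismD[OF ns(6), unfolded UB]
  define x where "x k = Inj1 (B k) \<cdot> r k \<oplus> Inj2 (B k) \<cdot> q k" for k
  define y where "y k = i k \<cdot> Prj1 (B k) \<oplus> j k \<cdot> Prj2 (B k)" for k
  have xt: "x k \<in> Arr C" "Dom C (x k) = W k" "Cod C (x k) = BOb (B k)"
    and yt: "y k \<in> Arr C" "Dom C (y k) = BOb (B k)" "Cod C (y k) = W k"
    if k: "1 \<le> k" "k \<le> n" for k
    by (simp_all add: x_def y_def b qt jt im rm k)
  have yx: "y k \<cdot> x k = \<one>\<^bsub>W k\<^esub>" if k: "1 \<le> k" "k \<le> n" for k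
    by (simp add: x_def y_def b qt jt im rm ij v w k)
  have rt: "r k \<cdot> (i k \<cdot> x) = x" if "1 \<le> k" "k \<le> n" "x \<in> Arr C" "Cod C x = V k" for x k
    using reassoc[OF ri, of k x] that by (simp add: im rm)
  note rel = qi qj rj qi[THEN reassoc] qj[THEN reassoc] rj[THEN reassoc] ri rt
  have xy: "x k \<cdot> y k = \<one>\<^bsub>BOb (B k)\<^esub>" if k: "1 \<le> k" "k \<le> n" for k
    by (simp add: x_def y_def b qt jt im rm rel v w k)
  have iso: "is_iso C (x k)" if k: "1 \<le> k" "k \<le> n" for k
    by (rule is_isoI[of _ "W k" "BOb (B k)" "y k"]) (simp_all add: mor_iff xt yt k xy yx)
  \<comment> \<open>\<open>q\<close> commutes with the differentials because
    \<open>j k \<cdot> q k\<close> is the identity minus \<open>i k \<cdot> r k\<close>, and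
    \<open>q\<close> annihilates everything that comes through the morphism
    \<open>i\<close>.\<close>
  have qe: "dQ k \<cdot> q k = q (Suc k) \<cdot> e k" if k: "1 \<le> k" "k < n" for k
  proof -
    have "dQ k \<cdot> q k = q (Suc k) \<cdot> (e k \<cdot> (j k \<cdot> q k))"
      using k by (simp add: dQ_def qt jt w)
    also have "\<dots> = q (Suc k) \<cdot> e k \<oplus> \<ominus> (q (Suc k) \<cdot> ((e k \<cdot> i k) \<cdot> r k))"
      using k by (simp add: jq qt w im rm)
    also have "(e k \<cdot> i k) \<cdot> r k = i (Suc k) \<cdot> (d k \<cdot> r k)"
      using k by (simp add: im(4)[THEN reassoc] im v w rm)
    also have "q (Suc k) \<cdot> (i (Suc k) \<cdot> (d k \<cdot> r k)) = \<zero>\<^bsub>W k,Q (Suc k)\<^esub>"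
      using k by (simp add: rel qt im rm v)
    finally show ?thesis using k by (simp add: qt w)
  qed
  have qen: "dQ n \<cdot> q n = SA (q 1) \<cdot> e n"
  proof -
    have "dQ n \<cdot> q n = SA (q 1) \<cdot> (e n \<cdot> (j n \<cdot> q n))"
      by (simp add: dQ_def qt jt w)
    also have "\<dots> = SA (q 1) \<cdot> e n \<oplus> \<ominus> (SA (q 1) \<cdot> ((e n \<cdot> i n) \<cdot> r n))"
      by (simp add: jq qt w im rm)
    also have "(e n \<cdot> i n) \<cdot> r n = SA (i 1) \<cdot> (d n \<cdot> r n)"
      by (simp add: im(5)[THEN reassoc] im v w rm)
    also have "SA (q 1) \<cdot> (SA (i 1) \<cdot> (d n \<cdot> r n)) = SA (q 1 \<cdot> i 1) \<cdot> (d n \<cdot> r n)"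
      by (simp add: qt im rm v)
    also have "\<dots> = \<zero>\<^bsub>W n,SO (Q 1)\<^esub>"
      by (simp add: rel qt v rm del: SA_comp)
    finally show ?thesis by (simp add: qt w)
  qed
  have "nseq_morphism n C S (W, e) (U, u) x"
  proof (rule morphismI)
    fix k assume k: "1 \<le> k" "k \<le> n"
    then show "x k \<in> mor (W k) (U k)" by (simp add: mor_iff xt UB)
  next
    fix k assume k: "1 \<le> k" "k < n"
    have "x (Suc k) \<cdot> e k = Inj1 (B (Suc k)) \<cdot> (d k \<cdot> r k) \<oplus> Inj2 (B (Suc k)) \<cdot> (dQ k \<cdot> q k)"
      using k by (simp add: x_def rm qt b w qe)
    also have "\<dots> = u k \<cdot> x k"
      using k nseqD[OF dQ] by (simp add: x_def rm qt b v u um um(4,15)[THEN reassoc])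
    finally show "x (Suc k) \<cdot> e k = u k \<cdot> x k" .
  next
    have "SA (x 1) \<cdot> e n = SA (Inj1 (B 1)) \<cdot> (d n \<cdot> r n) \<oplus> SA (Inj2 (B 1)) \<cdot> (dQ n \<cdot> q n)"
      by (simp add: x_def rm qt b w qen)
    also have "\<dots> = u n \<cdot> x n"
      using nseqD[OF dQ] by (simp add: x_def rm qt b v u um(5,16)[THEN reassoc])
    finally show "SA (x 1) \<cdot> e n = u n \<cdot> x n" .
  qed
  then have "nseq_isomorphism n C S (W, e) (U, u) x"
    using iso by (simp add: nseq_isomorphism_def)
  then have "(U, u) \<in> \<Theta>"
    using N1a_iso[OF W] ns(2) Uu by simp
  then show ?thesis using N1a_summand[OF V dQ] Uu by simp
qed

text \<open>Sequences are functions on all naturals; the identities at positions 1 to n are an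
  isomorphism between two that agree there.\<close>

lemma Theta_cong:
  assumes "(X, f) \<in> \<Theta>" "\<And>i. 1 \<le> i \<Longrightarrow> i \<le> n \<Longrightarrow> Y i = X i \<and> g i = f i"
  shows "(Y, g) \<in> \<Theta>"
proof (rule N1a_iso[OF assms(1)])
  note x = nseqD[OF Theta_nseq[OF assms(1)]]
  show "is_nseq n C S (Y, g)"
    by (rule nseqI) (simp_all add: assms(2) x mor_iff)
  have "nseq_morphism n C S (X, f) (Y, g) (\<lambda>i. \<one>\<^bsub>X i\<^esub>)"
    by (rule morphismI) (simp_all add: assms(2) x mor_iff)
  moreover have "is_iso C (\<one>\<^bsub>X i\<^esub>)" if "1 \<le> i" "i \<le> n" for i
    by (rule is_isoI[of _ "X i" "X i" "\<one>\<^bsub>X i\<^esub>"]) (simp_all add: mor_iff x that)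
  ultimately show "nseq_isomorphism n C S (X, f) (Y, g) (\<lambda>i. \<one>\<^bsub>X i\<^esub>)"
    by (simp add: nseq_isomorphism_def)
qed

text \<open>The trivial sequence on \<open>A\<close>, rotated so that its identity goes from position \<open>m\<close> to position \<open>m + 1\<close>.\<close>

definition elem_ob :: "nat \<Rightarrow> 'o \<Rightarrow> nat \<Rightarrow> 'o" where
  "elem_ob m A i = (if i = m \<or> i = Suc m then A else N)"

definition elem_arr :: "nat \<Rightarrow> 'o \<Rightarrow> nat \<Rightarrow> 'm" where
  "elem_arr m A i = (if i = m then \<one>\<^bsub>A\<^esub>
     else if i = n then \<zero>\<^bsub>elem_ob m A n,SO (elem_ob m A 1)\<^esub>
     else \<zero>\<^bsub>elem_ob m A i,elem_ob m A (Suc i)\<^esub>)"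

lemma elem_ob_Ob [simp]: "A \<in> Ob C \<Longrightarrow> elem_ob m A i \<in> Ob C"
  by (simp add: elem_ob_def)

lemma elem_nseq: "A \<in> Ob C \<Longrightarrow> 1 \<le> m \<Longrightarrow> m < n \<Longrightarrow> is_nseq n C S (elem_ob m A, elem_arr m A)"
  by (rule nseqI) (auto simp: elem_arr_def elem_ob_def mor_iff)

text \<open>(N2) is used backwards: rotating the sequence with its identity at \<open>Suc m\<close>
  gives the one with its identity at \<open>m\<close>, up to a zero object. The sign of the rotation
  is harmless because it falls on a zero morphism.\<close>

lemma elem_Theta:
  assumes A: "A \<in> Ob C" and m: "1 \<le> m" "m < n"
  shows "(elem_ob m A, elem_arr m A) \<in> \<Theta>"
  using m
proof (induction m rule: dec_induct)
  case base
  have *: "i \<le> 2 \<longleftrightarrow> i = 1 \<or> i = Suc 1" if "1 \<le> i" for i :: nat using that by auto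
  from N1b[OF A] show ?case
    unfolding trivial_nseq_def Let_def
    by (rule Theta_cong) (use n_ge_3 in \<open>auto simp: elem_arr_def elem_ob_def * simp flip: Suc_eq_plus1\<close>)
next
  case (step m)
  let ?X = "elem_ob (Suc m) A" and ?f = "elem_arr (Suc m) A"
  define Y g where "Y = fst (left_rotation n C S (?X, ?f))" and "g = snd (left_rotation n C S (?X, ?f))"
  have X1: "?X 1 = N" using step by (simp add: elem_ob_def)
  have f1: "?f 1 = \<zero>\<^bsub>N,?X 2\<^esub>" using step X1 by (simp add: elem_arr_def)
  have Y: "Y i = (if i = n then SO N else ?X (Suc i))" for i
    unfolding Y_def left_rotation_def by (simp add: X1 flip: Suc_eq_plus1)
  have g: "g i = (if i = n then \<zero>\<^bsub>SO N,SO (?X 2)\<^esub> else ?f (Suc i))" for i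
    unfolding g_def left_rotation_def using A by (simp add: f1 flip: Suc_eq_plus1)
  have nY: "is_nseq n C S (Y, g)"
  proof (rule nseqI)
    fix i assume i: "1 \<le> i" "i < n"
    have "?f (Suc i) \<in> mor (?X (Suc i)) (if Suc i = n then SO N else ?X (Suc (Suc i)))"
      using nseqD[OF elem_nseq[of A "Suc m"]] A step i X1 by (simp add: mor_iff)
    then show "g i \<in> mor (Y i) (Y (Suc i))" using i by (simp add: Y g)
  next
    have "Suc 1 = 2" by simp
    then show "g n \<in> mor (Y n) (SO (Y 1))" using A by (simp add: Y g mor_iff)
  qed
  \<comment> \<open>At position n the rotated sequence has \<open>SO N\<close>, a zero object but
    not the chosen one; everywhere else the identity serves.\<close>
  let ?p = "\<lambda>i. if i = n then \<zero>\<^bsub>N,SO N\<^esub> else \<one>\<^bsub>elem_ob m A i\<^esub>"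
  have em: "elem_ob m A n = N" "elem_ob m A i = ?X (Suc i)" for i
    using step by (auto simp: elem_ob_def)
  have "(Y, g) \<in> \<Theta>"
  proof (rule N1a_iso[OF _ nY])
    show "(elem_ob m A, elem_arr m A) \<in> \<Theta>" using step by simp
    note x = nseqD[OF elem_nseq[of A m]]
    have "nseq_morphism n C S (elem_ob m A, elem_arr m A) (Y, g) ?p"
    proof (rule morphismI)
      fix i assume "1 \<le> i" "i \<le> n"
      then show "?p i \<in> mor (elem_ob m A i) (Y i)" using A em by (auto simp: Y mor_iff)
    next
      fix i assume i: "1 \<le> i" "i < n"
      show "?p (Suc i) \<cdot> elem_arr m A i = g i \<cdot> ?p i"
      proof (cases "Suc i = n")
        case True
        then have "elem_arr m A i = \<zero>\<^bsub>?X n,N\<^esub>" "g i = \<zero>\<^bsub>?X n,SO N\<^esub>" "elem_ob m A i = ?X n"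
          using i step X1 em(1) by (auto simp: elem_arr_def g em(2))
        then show ?thesis using True A i by simp
      next
        case False
        have "elem_arr m A i = ?f (Suc i)" using i step False by (auto simp: elem_arr_def em(2))
        moreover have "?f (Suc i) \<in> mor (?X (Suc i)) (?X (Suc (Suc i)))"
          using nseqD[OF elem_nseq[of A "Suc m"]] A step i False by (simp add: mor_iff)
        ultimately show ?thesis
          using i False by (simp add: g em(2) mor_iff)
      qed
    next
      have "elem_arr m A n = \<zero>\<^bsub>N,SO (?X 2)\<^esub>" using step em by (simp add: elem_arr_def)
      moreover have "elem_ob m A 1 = ?X 2" by (simp add: em)
      ultimately show "SA (?p 1) \<cdot> elem_arr m A n = g n \<cdot> ?p n"
        using A by (simp add: g)
    qed
    moreover have "is_iso C (?p i)" if "1 \<le> i" "i \<le> n" for i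
    proof (cases "i = n")
      case True
      show ?thesis
        by (rule is_isoI[of _ N "SO N" "\<zero>\<^bsub>SO N,N\<^esub>"]) (simp_all add: True mor_iff SA_zero_ob)
    next
      case False
      then show ?thesis
        by (intro is_isoI[of _ "elem_ob m A i" "elem_ob m A i" "\<one>\<^bsub>elem_ob m A i\<^esub>"])
          (simp_all add: mor_iff A)
    qed
    ultimately show "nseq_isomorphism n C S (elem_ob m A, elem_arr m A) (Y, g) ?p"
      unfolding nseq_isomorphism_def by simp
  qed
  then show ?case
    using N2[OF elem_nseq[of A "Suc m"]] A step by (simp add: Y_def g_def)
qed

text \<open>Vanishing composites and factorizations do not depend on the sign (-1)^n, so both signs
  are allowed instead of following the parity of n.\<close>

lemma rotation:
  assumes "(X, f) \<in> \<Theta>"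
  obtains Y g where "(Y, g) \<in> \<Theta>" "\<And>i. i < n \<Longrightarrow> Y i = X (Suc i)" "\<And>i. i < n \<Longrightarrow> g i = f (Suc i)"
    "Y n = SO (X 1)" "g n = SA (f 1) \<or> g n = \<ominus> SA (f 1)"
proof
  have "left_rotation n C S (X, f) \<in> \<Theta>" using N2[OF Theta_nseq] assms by blast
  then show "(fst (left_rotation n C S (X, f)), snd (left_rotation n C S (X, f))) \<in> \<Theta>" by simp
qed (auto simp: left_rotation_def simp flip: Suc_eq_plus1)

text \<open>For the first composite, (N3) extends the identity of \<open>X 1\<close> and
  \<open>f 1\<close> to a morphism out of the trivial n-angle on \<open>X 1\<close>, so
  \<open>f 2 \<cdot> f 1\<close> passes through a zero object. Rotation carries this to the other
  positions.\<close>

lemma composites_zero: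
  assumes "(X, f) \<in> \<Theta>" "1 \<le> k" "k < n"
  shows "f (Suc k) \<cdot> f k = \<zero>\<^bsub>X k,Cod C (f (Suc k))\<^esub>"
  using assms(2,3,1)
proof (induction k arbitrary: X f rule: dec_induct)
  case base
  note x = nseqD[OF Theta_nseq[OF base(2)]]
  have X: "X 1 \<in> Ob C" using x by simp
  obtain \<phi> where \<phi>: "\<phi> 2 = f 1" "nseq_morphism n C S (elem_ob 1 (X 1), elem_arr 1 (X 1)) (X, f) \<phi>"
    using N3[OF elem_Theta[OF X, of 1] base(2), of "\<one>\<^bsub>X 1\<^esub>" "f 1"] x
    by (auto simp: mor_iff elem_ob_def elem_arr_def)
  note m = morphismD[OF \<phi>(2)]
  have "elem_arr 1 (X 1) 2 = \<zero>\<^bsub>X 1,N\<^esub>" by (simp add: elem_arr_def elem_ob_def)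
  then have "f 2 \<cdot> f 1 = \<phi> 3 \<cdot> \<zero>\<^bsub>X 1,N\<^esub>"
    using m(4)[of 2] \<phi>(1) by simp
  also have "\<dots> = \<zero>\<^bsub>X 1,X 3\<^esub>"
    using m(1-3)[of 3] X by (simp add: elem_ob_def)
  finally show ?case using x(4)[of 2] by simp
next
  case (step k)
  obtain Y g where Y: "(Y, g) \<in> \<Theta>" "\<And>i. i < n \<Longrightarrow> Y i = X (Suc i)" "\<And>i. i < n \<Longrightarrow> g i = f (Suc i)"
    using rotation[OF step.prems(2)] by metis
  then show ?case using step.IH[OF _ Y(1)] step.prems(1) by simp
qed

lemma last_composite_zero:
  assumes X: "(X, f) \<in> \<Theta>"
  shows "SA (f 1) \<cdot> f n = \<zero>\<^bsub>X n,SO (X 2)\<^esub>"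
proof -
  note x = nseqD[OF Theta_nseq[OF X]]
  obtain Y g where Y: "(Y, g) \<in> \<Theta>" "\<And>i. i < n \<Longrightarrow> Y i = X (Suc i)" "\<And>i. i < n \<Longrightarrow> g i = f (Suc i)"
    and gn: "g n = SA (f 1) \<or> g n = \<ominus> SA (f 1)"
    using rotation[OF X] by metis
  have n: "Suc (n - 1) = n" "n - 1 < n" "1 \<le> n - 1" using n_ge_3 by linarith+
  have c: "Cod C (f 1) = X 2" using x(4)[of 1] by simp
  have "g n \<cdot> f n = \<zero>\<^bsub>X n,Cod C (g n)\<^esub>"
    using composites_zero[OF Y(1) n(3,2)] Y(2,3)[OF n(2)] n(1) by simp
  then have "g n \<cdot> f n = \<zero>\<^bsub>X n,SO (X 2)\<^esub>" using gn x c by auto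
  then have "SA (f 1) \<cdot> f n = \<zero>\<^bsub>X n,SO (X 2)\<^esub> \<or> \<ominus> (SA (f 1) \<cdot> f n) = \<zero>\<^bsub>X n,SO (X 2)\<^esub>"
    using gn x by auto
  moreover have "SA (f 1) \<cdot> f n = \<ominus> \<ominus> (SA (f 1) \<cdot> f n)" using x by simp
  moreover have "X n \<in> Ob C" "X 2 \<in> Ob C" using x by simp_all
  ultimately show ?thesis by (metis neg_zero SO_Ob)
qed

text \<open>By (N3), zero and \<open>u\<close> extend to a morphism into the elementary n-angle with
  its identity at position 2, and the third component is the factorization. Rotation reduces the
  other positions to this one.\<close>

lemma factor:
  assumes "(X, f) \<in> \<Theta>" "1 \<le> k" "k < n" "u \<in> mor (X (Suc k)) A" "u \<cdot> f k = \<zero>\<^bsub>X k,A\<^esub>"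
  shows "\<exists>v. v \<in> mor (Cod C (f (Suc k))) A \<and> v \<cdot> f (Suc k) = u"
  using assms(2,3,1,4,5)
proof (induction k arbitrary: X f rule: dec_induct)
  case base
  note x = nseqD[OF Theta_nseq[OF base(2)]]
  have u: "u \<in> Arr C" "Dom C u = X 2" "Cod C u = A" "A \<in> Ob C" using base(3) by (auto simp: mor_iff)
  obtain \<phi> where \<phi>: "\<phi> 2 = u" "nseq_morphism n C S (X, f) (elem_ob 2 A, elem_arr 2 A) \<phi>"
    using N3[OF base(2) elem_Theta[OF u(4), of 2], of "\<zero>\<^bsub>X 1,N\<^esub>" u] x u base(4)
    by (auto simp: mor_iff elem_ob_def elem_arr_def)
  note m = morphismD[OF \<phi>(2)]
  have "\<phi> 3 \<cdot> f 2 = u"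
    using m(4)[of 2] \<phi>(1) u by (simp add: elem_arr_def)
  moreover have "\<phi> 3 \<in> mor (X 3) A" using m(1-3)[of 3] by (simp add: mor_iff elem_ob_def)
  ultimately show ?case using x(4)[of 2] by auto
next
  case (step k)
  obtain Y g where Y: "(Y, g) \<in> \<Theta>" "\<And>i. i < n \<Longrightarrow> Y i = X (Suc i)" "\<And>i. i < n \<Longrightarrow> g i = f (Suc i)"
    using rotation[OF step.prems(2)] by metis
  then show ?case using step.IH[OF _ Y(1)] step.prems by simp
qed

text \<open>The analogue of \<open>factor\<close> one step beyond the last position, obtained after
  one rotation; a possible sign is moved into the factoring map.\<close>

lemma factor_last:
  assumes X: "(X, f) \<in> \<Theta>" and u: "u \<in> mor (SO (X 1)) A" "u \<cdot> f n = \<zero>\<^bsub>X n,A\<^esub>"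
  shows "\<exists>v. v \<in> mor (SO (X 2)) A \<and> v \<cdot> SA (f 1) = u"
proof -
  note x = nseqD[OF Theta_nseq[OF X]]
  obtain Y g where Y: "(Y, g) \<in> \<Theta>" "\<And>i. i < n \<Longrightarrow> Y i = X (Suc i)" "\<And>i. i < n \<Longrightarrow> g i = f (Suc i)"
    and gn: "Y n = SO (X 1)" "g n = SA (f 1) \<or> g n = \<ominus> SA (f 1)"
    using rotation[OF X] by metis
  have n: "Suc (n - 1) = n" "n - 1 < n" "1 \<le> n - 1" using n_ge_3 by linarith+
  have c: "Cod C (f 1) = X 2" using x(4)[of 1] by simp
  obtain v where v: "v \<in> mor (Cod C (g n)) A" "v \<cdot> g n = u"
    using factor[OF Y(1) n(3,2), of u A] Y(2,3)[OF n(2)] n(1) u gn by auto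
  show ?thesis
  proof (cases "g n = SA (f 1)")
    case True
    then show ?thesis using v c x by auto
  next
    case False
    then have "g n = \<ominus> SA (f 1)" using gn by simp
    then have "\<ominus> v \<in> mor (SO (X 2)) A" "\<ominus> v \<cdot> SA (f 1) = u"
      using v c x by (simp_all add: mor_iff)
    then show ?thesis by blast
  qed
qed

section \<open>Exactness\<close>

text \<open>Exactness of the functors Hom(-, A) at positions 2 to n; at \<open>SO (V 1)\<close> only
  the vanishing of the composite is asked. The codomain is written \<open>Cod C (d (Suc k))\<close>
  because for \<open>Suc k = n\<close> it is \<open>SO (V 1)\<close>, whereas
  \<open>V (Suc n)\<close> has no meaning.\<close>

definition hom_exact :: "(nat \<Rightarrow> 'o) \<Rightarrow> (nat \<Rightarrow> 'm) \<Rightarrow> bool" where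
  "hom_exact V d \<longleftrightarrow> is_nseq n C S (V, d) \<and>
     (\<forall>k. 1 \<le> k \<and> k < n \<longrightarrow> d (Suc k) \<cdot> d k = \<zero>\<^bsub>V k,Cod C (d (Suc k))\<^esub>) \<and>
     SA (d 1) \<cdot> d n = \<zero>\<^bsub>V n,SO (V 2)\<^esub> \<and>
     (\<forall>k u A. 1 \<le> k \<and> k < n \<and> u \<in> mor (V (Suc k)) A \<and> u \<cdot> d k = \<zero>\<^bsub>V k,A\<^esub> \<longrightarrow>
        (\<exists>v. v \<in> mor (Cod C (d (Suc k))) A \<and> v \<cdot> d (Suc k) = u))"

lemma Theta_hom_exact: "(X, f) \<in> \<Theta> \<Longrightarrow> hom_exact X f"
  unfolding hom_exact_def
  using Theta_nseq composites_zero last_composite_zero factor by metis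

lemma hom_exactD:
  assumes "hom_exact V d"
  shows "is_nseq n C S (V, d)"
    "1 \<le> k \<Longrightarrow> k < n \<Longrightarrow> d (Suc k) \<cdot> d k = \<zero>\<^bsub>V k,Cod C (d (Suc k))\<^esub>"
    "SA (d 1) \<cdot> d n = \<zero>\<^bsub>V n,SO (V 2)\<^esub>"
  using assms unfolding hom_exact_def by auto

lemma hom_exact_factor:
  assumes "hom_exact V d" "1 \<le> k" "k < n" "u \<in> mor (V (Suc k)) A" "u \<cdot> d k = \<zero>\<^bsub>V k,A\<^esub>"
  obtains v where "v \<in> mor (Cod C (d (Suc k))) A" "v \<cdot> d (Suc k) = u"
  using assms unfolding hom_exact_def by blast

section \<open>Homotopy retracts\<close>

lemma morphism_comp:
  assumes X: "is_nseq n C S (X, f)" and Z: "is_nseq n C S (Z, h)" and Y: "is_nseq n C S (Y, g)"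
    and p: "nseq_morphism n C S (X, f) (Y, g) \<phi>" and q: "nseq_morphism n C S (Y, g) (Z, h) \<psi>"
  shows "nseq_morphism n C S (X, f) (Z, h) (\<lambda>k. \<psi> k \<cdot> \<phi> k)"
proof -
  note x = nseqD[OF X] nseqD[OF Y] nseqD[OF Z] and p = morphismD[OF p] and q = morphismD[OF q]
  show ?thesis
  proof (rule morphismI)
    fix k assume k: "1 \<le> k" "k < n"
    have "(\<psi> (Suc k) \<cdot> \<phi> (Suc k)) \<cdot> f k = \<psi> (Suc k) \<cdot> (g k \<cdot> \<phi> k)"
      using k by (simp add: p q x)
    also have "\<dots> = h k \<cdot> (\<psi> k \<cdot> \<phi> k)"
      using k by (simp add: p q x q(4)[THEN reassoc])
    finally show "(\<psi> (Suc k) \<cdot> \<phi> (Suc k)) \<cdot> f k = h k \<cdot> (\<psi> k \<cdot> \<phi> k)" .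
  next
    have "SA (\<psi> 1 \<cdot> \<phi> 1) \<cdot> f n = SA (\<psi> 1) \<cdot> (g n \<cdot> \<phi> n)"
      by (simp add: p q x)
    also have "\<dots> = h n \<cdot> (\<psi> n \<cdot> \<phi> n)"
      by (simp add: p q x q(5)[THEN reassoc])
    finally show "SA (\<psi> 1 \<cdot> \<phi> 1) \<cdot> f n = h n \<cdot> (\<psi> n \<cdot> \<phi> n)" .
  qed (simp add: p q mor_iff)
qed

lemma morphism_add:
  assumes X: "is_nseq n C S (X, f)" and Y: "is_nseq n C S (Y, g)"
    and p: "nseq_morphism n C S (X, f) (Y, g) \<phi>" and q: "nseq_morphism n C S (X, f) (Y, g) \<psi>"
  shows "nseq_morphism n C S (X, f) (Y, g) (\<lambda>k. \<phi> k \<oplus> \<psi> k)"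
proof -
  note x = nseqD[OF X] nseqD[OF Y] and p = morphismD[OF p] and q = morphismD[OF q]
  show ?thesis
    by (rule morphismI) (simp_all add: mor_iff p q x)
qed

text \<open>A homotopy with the single component \<open>s\<close> from degree m + 1 to degree m
  changes a morphism by \<open>s \<cdot> d m\<close> and \<open>d m \<cdot> s\<close>. This change
  factors through the elementary n-angle on \<open>V (Suc m)\<close>.\<close>

lemma elem_morphisms:
  assumes V: "hom_exact V d" and m: "1 \<le> m" "m < n" and s: "s \<in> mor (V (Suc m)) (V m)"
  defines "E \<equiv> elem_ob m (V (Suc m))" and "\<epsilon> \<equiv> elem_arr m (V (Suc m))"
  defines "a \<equiv> \<lambda>k. if k = m then d m else if k = Suc m then \<one>\<^bsub>V k\<^esub> else \<zero>\<^bsub>V k,N\<^esub>"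
    and "b \<equiv> \<lambda>k. if k = m then s else if k = Suc m then d m \<cdot> s else \<zero>\<^bsub>N,V k\<^esub>"
  shows "nseq_morphism n C S (V, d) (E, \<epsilon>) a" "nseq_morphism n C S (E, \<epsilon>) (V, d) b"
    "1 \<le> k \<Longrightarrow> k \<le> n \<Longrightarrow> b k \<cdot> a k = (if k = m then s \<cdot> d m else if k = Suc m then d m \<cdot> s else \<zero>\<^bsub>V k,V k\<^esub>)"
proof -
  note v = nseqD[OF hom_exactD(1)[OF V]] and dd = hom_exactD(2)[OF V]
  have s: "s \<in> Arr C" "Dom C s = V (Suc m)" "Cod C s = V m" using s by (simp_all add: mor_iff)
  have Ob: "V (Suc m) \<in> Ob C" "V m \<in> Ob C" using m v by simp_all
  have m1: "m \<noteq> n" "Suc m \<noteq> 1" "m \<le> n" using m by simp_all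
  show "nseq_morphism n C S (V, d) (E, \<epsilon>) a"
  proof (rule morphismI)
    fix k assume k: "1 \<le> k" "k \<le> n"
    show "a k \<in> mor (V k) (E k)"
      using k m by (auto simp: a_def E_def elem_ob_def mor_iff v)
  next
    fix k assume k: "1 \<le> k" "k < n"
    consider "k = m" | "k = Suc m" | "Suc k = m" | "k \<noteq> m" "k \<noteq> Suc m" "Suc k \<noteq> m" by blast
    then show "a (Suc k) \<cdot> d k = \<epsilon> k \<cdot> a k"
    proof cases
      case 3
      then show ?thesis using k m dd[of k]
        by (auto simp: a_def \<epsilon>_def elem_ob_def elem_arr_def v)
    qed (use k m in \<open>auto simp: a_def \<epsilon>_def elem_ob_def elem_arr_def v\<close>)
  next
    \<comment> \<open>For m = 1 the last square closes by the vanishing of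
      \<open>SA (d 1) \<cdot> d n\<close> in \<open>hom_exact\<close>.\<close>
    have "SA (a 1) \<cdot> d n = \<zero>\<^bsub>V n,SO (E 1)\<^esub>"
    proof (cases "m = 1")
      case True
      then show ?thesis using hom_exactD(3)[OF V] by (simp add: a_def E_def elem_ob_def)
    next
      case False
      then show ?thesis using m1 v(1)[of 1] by (simp add: a_def E_def elem_ob_def v)
    qed
    moreover have "\<epsilon> n = \<zero>\<^bsub>E n,SO (E 1)\<^esub>" using m1 by (auto simp: \<epsilon>_def elem_arr_def E_def)
    moreover have "a n \<in> mor (V n) (E n)"
      using m1 by (auto simp: a_def E_def elem_ob_def mor_iff v)
    moreover have "SO (E 1) \<in> Ob C" using Ob by (simp add: E_def)
    ultimately show "SA (a 1) \<cdot> d n = \<epsilon> n \<cdot> a n" by (simp add: mor_iff)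
  qed
  show "nseq_morphism n C S (E, \<epsilon>) (V, d) b"
  proof (rule morphismI)
    fix k assume k: "1 \<le> k" "k \<le> n"
    show "b k \<in> mor (E k) (V k)"
      using k m by (auto simp: b_def E_def elem_ob_def mor_iff v s)
  next
    fix k assume k: "1 \<le> k" "k < n"
    consider "k = m" | "k = Suc m" | "Suc k = m" | "k \<noteq> m" "k \<noteq> Suc m" "Suc k \<noteq> m" by blast
    then show "b (Suc k) \<cdot> \<epsilon> k = d k \<cdot> b k"
    proof cases
      case 2
      then show ?thesis using k m
        by (auto simp: b_def \<epsilon>_def elem_ob_def elem_arr_def v s dd[THEN reassoc])
    qed (use k m in \<open>auto simp: b_def \<epsilon>_def elem_ob_def elem_arr_def v s\<close>)
  next
    have "d n \<cdot> b n = \<zero>\<^bsub>E n,SO (V 1)\<^esub>"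
    proof (cases "n = Suc m")
      case True
      have "d n \<cdot> d m = \<zero>\<^bsub>V m,SO (V 1)\<^esub>"
        using dd[of m] m v(5) unfolding True by simp
      then have "d n \<cdot> (d m \<cdot> s) = \<zero>\<^bsub>V m,SO (V 1)\<^esub> \<cdot> s"
        by (rule reassoc) (use m s v True in auto)
      then show ?thesis using m s v(8) unfolding True by (simp add: b_def E_def elem_ob_def)
    next
      case False
      then show ?thesis using m by (simp add: b_def E_def elem_ob_def v)
    qed
    moreover have "\<epsilon> n = \<zero>\<^bsub>E n,SO (E 1)\<^esub>" using m1 by (auto simp: \<epsilon>_def elem_arr_def E_def)
    moreover have "b 1 \<in> mor (E 1) (V 1)"
      using m1 m by (auto simp: b_def E_def elem_ob_def mor_iff v s)
    moreover have "E n \<in> Ob C" "V 1 \<in> Ob C" using Ob v by (simp_all add: E_def)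
    ultimately show "SA (b 1) \<cdot> \<epsilon> n = d n \<cdot> b n" by (simp add: mor_iff)
  qed
  show "b k \<cdot> a k = (if k = m then s \<cdot> d m else if k = Suc m then d m \<cdot> s else \<zero>\<^bsub>V k,V k\<^esub>)"
    if "1 \<le> k" "k \<le> n"
    using that m by (auto simp: a_def b_def v s)
qed

text \<open>With the elementary n-angle as a new direct summand, \<open>i\<close> becomes a column
  (i, a) and \<open>r\<close> a row (r, b), so the composite gains \<open>b \<cdot> a\<close>. In
  degree m + 1 the component of \<open>a\<close> is an identity, hence the new inclusion is a graph
  and has a complement there, whatever \<open>i\<close> was.\<close>

lemma add_elem:
  assumes V: "hom_exact V d" and m: "1 \<le> m" "m < n" and s: "s \<in> mor (V (Suc m)) (V m)"
    and W: "(W, e) \<in> \<Theta>" and i: "nseq_morphism n C S (V, d) (W, e) i"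
    and r: "nseq_morphism n C S (W, e) (V, d) r"
  obtains W' e' i' r' where "(W', e') \<in> \<Theta>" "nseq_morphism n C S (V, d) (W', e') i'"
    "nseq_morphism n C S (W', e') (V, d) r'"
    "\<And>k. 1 \<le> k \<Longrightarrow> k \<le> n \<Longrightarrow> r' k \<cdot> i' k = r k \<cdot> i k \<oplus>
       (if k = m then s \<cdot> d m else if k = Suc m then d m \<cdot> s else \<zero>\<^bsub>V k,V k\<^esub>)"
    "\<And>k. 1 \<le> k \<Longrightarrow> k \<le> n \<Longrightarrow> is_summand (i k) \<Longrightarrow> is_summand (i' k)" "is_summand (i' (Suc m))"
proof -
  note nV = hom_exactD(1)[OF V] and nW = Theta_nseq[OF W]
  note v = nseqD[OF nV] and w = nseqD[OF nW]
  have A: "V (Suc m) \<in> Ob C" using v m by simp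
  define E \<epsilon> where "E = elem_ob m (V (Suc m))" and "\<epsilon> = elem_arr m (V (Suc m))"
  have E: "(E, \<epsilon>) \<in> \<Theta>" unfolding E_def \<epsilon>_def by (rule elem_Theta[OF A m])
  note nE = Theta_nseq[OF E]
  define a where "a = (\<lambda>k. if k = m then d m else if k = Suc m then \<one>\<^bsub>V k\<^esub> else \<zero>\<^bsub>V k,N\<^esub>)"
  define b where "b = (\<lambda>k. if k = m then s else if k = Suc m then d m \<cdot> s else \<zero>\<^bsub>N,V k\<^esub>)"
  note em = elem_morphisms[OF V m s, folded E_def \<epsilon>_def a_def b_def]
  have ba: "b k \<cdot> a k = (if k = m then s \<cdot> d m else if k = Suc m then d m \<cdot> s else \<zero>\<^bsub>V k,V k\<^esub>)"
    if "1 \<le> k" "k \<le> n" for k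
    using em(3)[OF that] unfolding a_def b_def by simp
  define W' e' where "W' = fst (nseq_sum n C S (W, e) (E, \<epsilon>))" and "e' = snd (nseq_sum n C S (W, e) (E, \<epsilon>))"
  have W'e': "nseq_sum n C S (W, e) (E, \<epsilon>) = (W', e')" by (simp add: W'_def e'_def)
  have W'\<Theta>: "(W', e') \<in> \<Theta>" using N1a_sum[OF W E] W'e' by simp
  define P where "P k = biproduct C (W k) (E k)" for k
  have P: "is_biproduct C (W k) (E k) (P k)" if "1 \<le> k" "k \<le> n" for k
    unfolding P_def by (rule biproduct) (use that w nseqD[OF nE] in auto)
  note ns = nseq_sum[OF nW nE, unfolded W'e', folded P_def]
  define i' where "i' k = Inj1 (P k) \<cdot> i k \<oplus> Inj2 (P k) \<cdot> a k" for k
  define r' where "r' k = r k \<cdot> Prj1 (P k) \<oplus> b k \<cdot> Prj2 (P k)" for k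
  note am = morphismD[OF em(1)] and bm = morphismD[OF em(2)] and im = morphismD[OF i] and rm = morphismD[OF r]
  show thesis
  proof (rule that[OF W'\<Theta>])
    show "nseq_morphism n C S (V, d) (W', e') i'"
      unfolding i'_def
      by (rule morphism_add[OF nV ns(2)]; rule morphism_comp; fact)
    show "nseq_morphism n C S (W', e') (V, d) r'"
      unfolding r'_def
      by (rule morphism_add[OF ns(2) nV]; rule morphism_comp; fact)
    show "r' k \<cdot> i' k = r k \<cdot> i k \<oplus> (if k = m then s \<cdot> d m else if k = Suc m then d m \<cdot> s else \<zero>\<^bsub>V k,V k\<^esub>)"
      if k: "1 \<le> k" "k \<le> n" for k
      unfolding r'_def i'_def ba[OF k, symmetric]
      by (simp add: biproduct_rules[OF P] am bm im rm k v w)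
    show "is_summand (i' k)" if k: "1 \<le> k" "k \<le> n" and "is_summand (i k)" for k
      unfolding i'_def
      by (rule pair_is_summand[OF P[OF k], of _ "V k"]) (simp_all add: mor_iff im am k \<open>is_summand (i k)\<close>)
    have Sm: "1 \<le> Suc m" "Suc m \<le> n" using m by simp_all
    have "E (Suc m) = V (Suc m)" by (simp add: E_def elem_ob_def)
    then have "is_summand (Inj1 (P (Suc m)) \<cdot> i (Suc m) \<oplus> Inj2 (P (Suc m)))"
      using P[OF Sm] by (intro graph_is_summand[of "W (Suc m)" "V (Suc m)"]) (simp_all add: mor_iff im Sm)
    moreover have "Inj2 (P (Suc m)) \<cdot> a (Suc m) = Inj2 (P (Suc m))"
      using biproduct_rules[OF P[OF Sm]] by (simp add: a_def E_def elem_ob_def)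
    ultimately show "is_summand (i' (Suc m))" by (simp add: i'_def)
  qed
qed

text \<open>The correction \<open>c\<close> of the retraction in degree \<open>n\<close> is absorbed by the map itself, because a trivial \<open>n\<close>-angle
  between degrees \<open>n\<close> and 1 would spoil degree 1.\<close>

lemma fix_last:
  assumes V: "hom_exact V d" and U: "is_nseq n C S (U, e)"
    and i: "nseq_morphism n C S (V, d) (U, e) i" and r: "nseq_morphism n C S (U, e) (V, d) r"
    and ri: "r 1 \<cdot> i 1 = \<one>\<^bsub>V 1\<^esub>"
    and c: "c \<in> mor (V n) (V n)" "c \<cdot> d (n - 1) = \<zero>\<^bsub>V (n - 1),V n\<^esub>"
    and dc: "d n \<cdot> (r n \<cdot> i n \<oplus> c) = d n"
  obtains r' where "nseq_morphism n C S (U, e) (V, d) r'" "\<And>k. k < n \<Longrightarrow> 1 \<le> k \<Longrightarrow> r' k = r k"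
    "r' n \<cdot> i n = r n \<cdot> i n \<oplus> c"
proof -
  note nV = hom_exactD(1)[OF V]
  note v = nseqD[OF nV] and u = nseqD[OF U] and im = morphismD[OF i] and rm = morphismD[OF r]
  have n: "Suc (n - 1) = n" "n - 1 < n" "1 \<le> n - 1" using n_ge_3 by linarith+
  have ct: "c \<in> Arr C" "Dom C c = V n" "Cod C c = V n" using c by (simp_all add: mor_iff)
  \<comment> \<open>Exactness at degree n writes \<open>c\<close> as \<open>t \<cdot> d n\<close>.
    Since \<open>r n \<cdot> i n\<close> does not change \<open>d n\<close>, also
    \<open>c \<cdot> (r n \<cdot> i n) = c\<close>; multiplying \<open>r\<close> by 1 + c in degree
    n therefore adds exactly \<open>c\<close> to the composite.\<close>
  obtain t where t: "t \<in> mor (SO (V 1)) (V n)" "t \<cdot> d n = c"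
    using hom_exact_factor[OF V n(3,2), of c "V n"] c v unfolding n(1) by auto
  have tt: "t \<in> Arr C" "Dom C t = SO (V 1)" "Cod C t = V n" using t by (simp_all add: mor_iff)
  have dri: "d n \<cdot> (r n \<cdot> i n) = d n"
  proof -
    have "d n \<cdot> (r n \<cdot> i n) = SA (r 1) \<cdot> (e n \<cdot> i n)"
      by (simp add: rm im v u rm(5)[THEN reassoc])
    also have "e n \<cdot> i n = SA (i 1) \<cdot> d n" by (simp add: im)
    also have "SA (r 1) \<cdot> (SA (i 1) \<cdot> d n) = SA (r 1 \<cdot> i 1) \<cdot> d n"
      by (simp add: rm im v)
    also have "\<dots> = d n" by (simp add: ri v del: SA_comp)
    finally show ?thesis .
  qed
  have dcz: "d n \<cdot> c = \<zero>\<^bsub>V n,SO (V 1)\<^esub>"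
  proof -
    have "d n \<oplus> d n \<cdot> c = d n \<oplus> \<zero>\<^bsub>V n,SO (V 1)\<^esub>"
      using dc by (simp add: rm im v ct dri)
    then show ?thesis by (rule add_left_cancel[rotated -1]) (simp_all add: v ct)
  qed
  \<comment> \<open>An endomorphism of the sequence supported in degree n: \<open>c\<close>
    annihilates the incoming differential and is annihilated by the outgoing one.\<close>
  define \<delta> where "\<delta> k = (if k = n then c else \<zero>\<^bsub>V k,V k\<^esub>)" for k
  have \<delta>: "nseq_morphism n C S (V, d) (V, d) \<delta>"
  proof (rule morphismI)
    fix k assume k: "1 \<le> k" "k < n"
    show "\<delta> (Suc k) \<cdot> d k = d k \<cdot> \<delta> k"
    proof (cases "Suc k = n")
      case True
      then have kn: "k = n - 1" by simp
      have "k \<noteq> n" using k by simp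
      then show ?thesis using True k c(2)[folded kn] v(3)[of k] v(4)[OF k] v(1,2)[of k] by (simp add: \<delta>_def)
    qed (use k in \<open>simp add: \<delta>_def v\<close>)
  qed (simp_all add: \<delta>_def v dcz mor_iff ct)
  note \<delta>m = morphismD[OF \<delta>]
  define r' where "r' k = r k \<oplus> \<delta> k \<cdot> r k" for k
  show thesis
  proof (rule that)
    show "nseq_morphism n C S (U, e) (V, d) r'"
      unfolding r'_def by (rule morphism_add[OF U nV r morphism_comp[OF U nV nV r \<delta>]])
    show "r' k = r k" if "k < n" "1 \<le> k" for k
      using that by (simp add: r'_def \<delta>_def rm v)
    have "r' n \<cdot> i n = r n \<cdot> i n \<oplus> c \<cdot> (r n \<cdot> i n)"
      by (simp add: r'_def \<delta>_def rm im v ct)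
    also have "c \<cdot> (r n \<cdot> i n) = c"
      unfolding t(2)[symmetric] by (simp add: tt v rm im dri)
    finally show "r' n \<cdot> i n = r n \<cdot> i n \<oplus> c" .
  qed
qed

text \<open>Once the defect of the retraction in degree k + 1 kills \<open>d k\<close>, exactness
  factors it through \<open>d (Suc k)\<close>, and this supplies the next homotopy
  component.\<close>

lemma defect_vanishes:
  assumes V: "is_nseq n C S (V, d)" and U: "is_nseq n C S (U, e)"
    and i: "nseq_morphism n C S (V, d) (U, e) i" and r: "nseq_morphism n C S (U, e) (V, d) r"
    and k: "1 \<le> k" "k < n" and ri: "d k \<cdot> (r k \<cdot> i k) = d k"
  shows "(\<one>\<^bsub>V (Suc k)\<^esub> \<oplus> \<ominus> (r (Suc k) \<cdot> i (Suc k))) \<cdot> d k = \<zero>\<^bsub>V k,V (Suc k)\<^esub>"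
proof -
  note v = nseqD[OF V] and u = nseqD[OF U] and im = morphismD[OF i] and rm = morphismD[OF r]
  have "r (Suc k) \<cdot> (i (Suc k) \<cdot> d k) = r (Suc k) \<cdot> (e k \<cdot> i k)"
    using k by (simp add: im)
  also have "\<dots> = d k \<cdot> (r k \<cdot> i k)"
    using k by (simp add: rm im v u rm(4)[THEN reassoc])
  finally show ?thesis using k ri by (simp add: v im rm)
qed

text \<open>No homotopy is given: exactness constructs the one between \<open>r \<cdot> i\<close>
  and the identity degree by degree, starting from degree 1, and each component is absorbed as soon
  as it is found.\<close>

theorem homotopy_retract_in_Theta:
  assumes V: "hom_exact V d" and U: "(U, e) \<in> \<Theta>"
    and i: "nseq_morphism n C S (V, d) (U, e) i" and r: "nseq_morphism n C S (U, e) (V, d) r"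
    and ri: "r 1 \<cdot> i 1 = \<one>\<^bsub>V 1\<^esub>" and sm: "is_summand (i 1)"
  shows "(V, d) \<in> \<Theta>"
proof -
  note nV = hom_exactD(1)[OF V]
  note v = nseqD[OF nV]
  \<comment> \<open>Invariant: below degree m the retraction is strict, and up to degree m the
    inclusion has a complement. The clause \<open>k = 1\<close> keeps the hypothesis on degree 1
    available in the first step, where no degree lies below m.\<close>
  define st where "st m \<longleftrightarrow> (\<exists>W e i r. (W, e) \<in> \<Theta> \<and> nseq_morphism n C S (V, d) (W, e) i \<and>
      nseq_morphism n C S (W, e) (V, d) r \<and> (\<forall>k. 1 \<le> k \<and> k \<le> n \<and> (k < m \<or> k = 1) \<longrightarrow> r k \<cdot> i k = \<one>\<^bsub>V k\<^esub>) \<and>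
      (\<forall>k. 1 \<le> k \<and> k \<le> m \<longrightarrow> is_summand (i k)))" for m
  have "st m" if "1 \<le> m" "m \<le> n" for m
    using that
  proof (induction m rule: dec_induct)
    case base
    show ?case unfolding st_def
      by (rule exI[of _ U], rule exI[of _ e], rule exI[of _ i], rule exI[of _ r])
        (use U i r ri sm in auto)
  next
    case (step m)
    then have m: "1 \<le> m" "m < n" by simp_all
    from step obtain W e i r where W: "(W, e) \<in> \<Theta>" and i: "nseq_morphism n C S (V, d) (W, e) i"
      and r: "nseq_morphism n C S (W, e) (V, d) r"
      and ri: "\<And>k. 1 \<le> k \<Longrightarrow> k \<le> n \<Longrightarrow> k < m \<or> k = 1 \<Longrightarrow> r k \<cdot> i k = \<one>\<^bsub>V k\<^esub>"
      and sm: "\<And>k. 1 \<le> k \<Longrightarrow> k \<le> m \<Longrightarrow> is_summand (i k)"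
      unfolding st_def by auto
    note im = morphismD[OF i] and rm = morphismD[OF r]
    have "\<exists>s. s \<in> mor (V (Suc m)) (V m) \<and> r m \<cdot> i m \<oplus> s \<cdot> d m = \<one>\<^bsub>V m\<^esub>"
    proof (cases "m = 1")
      case True
      \<comment> \<open>Degree 1 has no defect, so \<open>s\<close> is zero. The elementary n-angle
        is added all the same: it gives \<open>i 2\<close> a complement.\<close>
      then show ?thesis using m v(1)[of "Suc m"] by (intro exI[of _ "\<zero>\<^bsub>V (Suc m),V m\<^esub>"]) (simp add: mor_iff v ri)
    next
      case False
      then obtain k where k: "m = Suc k" "1 \<le> k" "k < n" using m by (cases m) auto
      let ?c = "\<one>\<^bsub>V m\<^esub> \<oplus> \<ominus> (r m \<cdot> i m)"
      have "?c \<cdot> d k = \<zero>\<^bsub>V k,V m\<^esub>"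
        unfolding k(1)
        by (rule defect_vanishes[OF nV Theta_nseq[OF W] i r k(2,3)]) (use k in \<open>simp add: ri v\<close>)
      moreover have "?c \<in> mor (V m) (V m)" using m by (simp add: mor_iff v im rm)
      ultimately obtain s where s: "s \<in> mor (Cod C (d m)) (V m)" "s \<cdot> d m = ?c"
        using hom_exact_factor[OF V k(2,3)] unfolding k(1) by metis
      then show ?thesis using m False by (intro exI[of _ s]) (simp add: v im rm)
    qed
    then obtain s where s: "s \<in> mor (V (Suc m)) (V m)" "r m \<cdot> i m \<oplus> s \<cdot> d m = \<one>\<^bsub>V m\<^esub>" by blast
    obtain W' e' i' r' where W': "(W', e') \<in> \<Theta>" "nseq_morphism n C S (V, d) (W', e') i'"
      "nseq_morphism n C S (W', e') (V, d) r'"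
      and ri': "\<And>k. 1 \<le> k \<Longrightarrow> k \<le> n \<Longrightarrow> r' k \<cdot> i' k = r k \<cdot> i k \<oplus>
         (if k = m then s \<cdot> d m else if k = Suc m then d m \<cdot> s else \<zero>\<^bsub>V k,V k\<^esub>)"
      and sm': "\<And>k. 1 \<le> k \<Longrightarrow> k \<le> n \<Longrightarrow> is_summand (i k) \<Longrightarrow> is_summand (i' k)" "is_summand (i' (Suc m))"
      using add_elem[OF V m s(1) W i r] by blast
    show ?case unfolding st_def
    proof (rule exI[of _ W'], rule exI[of _ e'], rule exI[of _ i'], rule exI[of _ r'], intro conjI allI impI W')
      fix k assume k: "1 \<le> k \<and> k \<le> n \<and> (k < Suc m \<or> k = 1)"
      show "r' k \<cdot> i' k = \<one>\<^bsub>V k\<^esub>"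
      proof (cases "k = m")
        case True
        then show ?thesis using ri' k s(2) by simp
      next
        case False
        then show ?thesis using ri'[of k] ri[of k] k m v(1)[of k] by (auto simp: less_Suc_eq)
      qed
    next
      fix k assume "1 \<le> k \<and> k \<le> Suc m"
      then show "is_summand (i' k)" using sm sm' m by (cases "k = Suc m") auto
    qed
  qed
  then have "st n" by simp
  then obtain W e i r where W: "(W, e) \<in> \<Theta>" and i: "nseq_morphism n C S (V, d) (W, e) i"
    and r: "nseq_morphism n C S (W, e) (V, d) r"
    and ri: "\<And>k. 1 \<le> k \<Longrightarrow> k < n \<Longrightarrow> r k \<cdot> i k = \<one>\<^bsub>V k\<^esub>"
    and sm: "\<And>k. 1 \<le> k \<Longrightarrow> k \<le> n \<Longrightarrow> is_summand (i k)"
    unfolding st_def by (metis less_imp_le)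
  note im = morphismD[OF i] and rm = morphismD[OF r]
  have n: "Suc (n - 1) = n" "n - 1 < n" "1 \<le> n - 1" using n_ge_3 by linarith+
  \<comment> \<open>In degree n no further elementary n-angle is added. The inclusion already has a
    complement there, so it suffices to change \<open>r\<close>.\<close>
  let ?c = "\<one>\<^bsub>V n\<^esub> \<oplus> \<ominus> (r n \<cdot> i n)"
  have "?c \<cdot> d (n - 1) = \<zero>\<^bsub>V (n - 1),V n\<^esub>"
    using defect_vanishes[OF nV Theta_nseq[OF W] i r n(3,2)] n by (simp add: ri v)
  moreover have id: "r n \<cdot> i n \<oplus> ?c = \<one>\<^bsub>V n\<^esub>"
    by (simp add: im rm v)
  moreover have "?c \<in> mor (V n) (V n)" by (simp add: mor_iff v im rm)
  ultimately obtain r' where r': "nseq_morphism n C S (W, e) (V, d) r'"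
    "\<And>k. k < n \<Longrightarrow> 1 \<le> k \<Longrightarrow> r' k = r k" "r' n \<cdot> i n = \<one>\<^bsub>V n\<^esub>"
    using fix_last[OF V Theta_nseq[OF W] i r, of ?c] ri[of 1] v(6,7) by auto
  show ?thesis
  proof (rule retract_in_Theta[OF W nV i r'(1)])
    fix k assume k: "1 \<le> k" "k \<le> n"
    then show "r' k \<cdot> i k = \<one>\<^bsub>V k\<^esub>" using r' ri by (cases "k = n") auto
    show "\<exists>Q P. is_biproduct C (V k) Q P \<and> BOb P = W k \<and> Inj1 P = i k"
      using sm[OF k] k unfolding is_summand_def by (simp add: im)
  qed
qed

section \<open>Mapping cones\<close>

text \<open>In degrees 1 and 2 the composite is already the identity, so the homotopy may start with
  zeros, and exactness gives the further components. In degree n a component from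
  \<open>SO (V 1)\<close> is avoided by changing \<open>r\<close> there.\<close>

lemma null_homotopy:
  assumes V: "hom_exact V d" and U: "is_nseq n C S (U, e)"
    and i: "nseq_morphism n C S (V, d) (U, e) i" and r: "nseq_morphism n C S (U, e) (V, d) r"
    and ri: "r 1 \<cdot> i 1 = \<one>\<^bsub>V 1\<^esub>" "r 2 \<cdot> i 2 = \<one>\<^bsub>V 2\<^esub>"
  obtains r' s where "nseq_morphism n C S (U, e) (V, d) r'" "\<And>k. 1 \<le> k \<Longrightarrow> k < n \<Longrightarrow> r' k = r k"
    "\<And>k. 1 \<le> k \<Longrightarrow> k < n \<Longrightarrow> s k \<in> mor (V (Suc k)) (V k)" "s 2 = \<zero>\<^bsub>V 3,V 2\<^esub>"
    "\<And>k. 2 \<le> k \<Longrightarrow> Suc k < n \<Longrightarrow>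
       r' (Suc k) \<cdot> i (Suc k) \<oplus> d k \<cdot> s k \<oplus> s (Suc k) \<cdot> d (Suc k) = \<one>\<^bsub>V (Suc k)\<^esub>"
    "r' n \<cdot> i n \<oplus> d (n - 1) \<cdot> s (n - 1) = \<one>\<^bsub>V n\<^esub>"
proof -
  note nV = hom_exactD(1)[OF V] and dd = hom_exactD(2)[OF V]
  note v = nseqD[OF nV] and u = nseqD[OF U] and im = morphismD[OF i] and rm = morphismD[OF r]
  define hp where "hp m s \<longleftrightarrow> (\<forall>k. 1 \<le> k \<and> k \<le> m \<longrightarrow> s k \<in> mor (V (Suc k)) (V k)) \<and>
      s 1 = \<zero>\<^bsub>V 2,V 1\<^esub> \<and> s 2 = \<zero>\<^bsub>V 3,V 2\<^esub> \<and>
      (\<forall>k. 1 \<le> k \<and> Suc k \<le> m \<longrightarrow>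
         r (Suc k) \<cdot> i (Suc k) \<oplus> d k \<cdot> s k \<oplus> s (Suc k) \<cdot> d (Suc k) = \<one>\<^bsub>V (Suc k)\<^esub>)" for m s
  have S12: "Suc 1 = 2" "Suc 2 = 3" by simp_all
  \<comment> \<open>The usual induction: given the homotopy up to degree m, the defect left in
    degree m + 1 kills \<open>d m\<close>, because \<open>r\<close> and \<open>i\<close> are
    morphisms and consecutive differentials compose to zero.\<close>
  have defect: "(\<one>\<^bsub>V (Suc m)\<^esub> \<oplus> \<ominus> (r (Suc m) \<cdot> i (Suc m)) \<oplus> \<ominus> (d m \<cdot> s m)) \<cdot> d m = \<zero>\<^bsub>V m,V (Suc m)\<^esub>"
    if hp: "hp m s" and m: "2 \<le> m" "m < n" for m s
  proof -
    obtain k where k: "m = Suc k" "1 \<le> k" using m by (cases m) auto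
    have m1: "1 \<le> m" "m \<le> n" "Suc m \<le> n" using m by simp_all
    have st: "s m \<in> Arr C" "Dom C (s m) = V (Suc m)" "Cod C (s m) = V m"
       "s k \<in> Arr C" "Dom C (s k) = V m" "Cod C (s k) = V k"
      using hp m1(1) k unfolding hp_def by (auto simp: mor_iff)
    note t = st v u im rm m1 m k(2)
    have kt: "d k \<in> Arr C" "Dom C (d k) = V k" "Cod C (d k) = V m" "V k \<in> Ob C"
      using v k m by auto
    have "d m \<cdot> (r m \<cdot> i m \<oplus> d k \<cdot> s k \<oplus> s m \<cdot> d m) = d m \<cdot> \<one>\<^bsub>V m\<^esub>"
      using hp k unfolding hp_def by auto
    moreover have "d m \<cdot> d k = \<zero>\<^bsub>V k,V (Suc m)\<^esub>"
      using dd[of k] k m v(4)[of m] by simp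
    then have "d m \<cdot> (d k \<cdot> s k) = \<zero>\<^bsub>V m,V (Suc m)\<^esub>"
      by (subst reassoc[of _ _ "\<zero>\<^bsub>V k,V (Suc m)\<^esub>"]) (simp_all add: t kt)
    ultimately have e: "d m \<cdot> (r m \<cdot> i m) \<oplus> d m \<cdot> (s m \<cdot> d m) = d m"
      by (simp add: t kt)
    have "r (Suc m) \<cdot> (i (Suc m) \<cdot> d m) = r (Suc m) \<cdot> (e m \<cdot> i m)"
      by (simp add: t)
    also have "\<dots> = d m \<cdot> (r m \<cdot> i m)"
      by (simp add: t rm(4)[THEN reassoc])
    finally have "(\<one>\<^bsub>V (Suc m)\<^esub> \<oplus> \<ominus> (r (Suc m) \<cdot> i (Suc m)) \<oplus> \<ominus> (d m \<cdot> s m)) \<cdot> d m =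
      d m \<oplus> \<ominus> (d m \<cdot> (r m \<cdot> i m) \<oplus> d m \<cdot> (s m \<cdot> d m))"
      by (simp add: t)
    also have "\<dots> = \<zero>\<^bsub>V m,V (Suc m)\<^esub>" unfolding e by (simp add: t)
    finally show ?thesis .
  qed
  have "\<exists>s. hp m s" if "2 \<le> m" "m < n" for m
    using that
  proof (induction m rule: dec_induct)
    case base
    define s where "s k = \<zero>\<^bsub>V (Suc k),V k\<^esub>" for k
    have "hp 2 s" unfolding hp_def
    proof (intro conjI allI impI)
      fix k :: nat assume k: "1 \<le> k \<and> k \<le> 2"
      then have "V (Suc k) \<in> Ob C" "V k \<in> Ob C" by (auto intro!: v(1) intro: order_trans)
      then show "s k \<in> mor (V (Suc k)) (V k)" by (simp add: s_def mor_iff)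
    next
      fix k :: nat assume "1 \<le> k \<and> Suc k \<le> 2"
      then have k: "k = 1" by simp
      show "r (Suc k) \<cdot> i (Suc k) \<oplus> d k \<cdot> s k \<oplus> s (Suc k) \<cdot> d (Suc k) = \<one>\<^bsub>V (Suc k)\<^esub>"
        using v(4)[of 1] v(4)[of 2] by (simp add: k s_def ri v)
    qed (simp_all add: s_def)
    then show ?case by blast
  next
    case (step m)
    then have m: "2 \<le> m" "m < n" "1 \<le> m" "Suc m < n" by simp_all
    obtain s where s: "hp m s" using step by auto
    have st: "s m \<in> Arr C" "Dom C (s m) = V (Suc m)" "Cod C (s m) = V m"
      using s m unfolding hp_def by (auto simp: mor_iff)
    let ?c = "\<one>\<^bsub>V (Suc m)\<^esub> \<oplus> \<ominus> (r (Suc m) \<cdot> i (Suc m)) \<oplus> \<ominus> (d m \<cdot> s m)"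
    have "?c \<in> mor (V (Suc m)) (V (Suc m))" using m by (simp add: mor_iff st v im rm)
    then obtain t where t: "t \<in> mor (Cod C (d (Suc m))) (V (Suc m))" "t \<cdot> d (Suc m) = ?c"
      using hom_exact_factor[OF V m(3,2)] defect[OF s m(1,2)] by metis
    have tt: "t \<in> mor (V (Suc (Suc m))) (V (Suc m))" using t m v(4)[of "Suc m"] by simp
    have "r (Suc m) \<cdot> i (Suc m) \<oplus> d m \<cdot> s m \<oplus> ?c = \<one>\<^bsub>V (Suc m)\<^esub>"
      using m by (simp add: st v im rm add_ac)
    then have "hp (Suc m) (s(Suc m := t))"
      using s tt m t(2) unfolding hp_def by (auto simp: le_Suc_eq)
    then show ?case by blast
  qed
  moreover have n: "Suc (n - 1) = n" "n - 1 < n" "1 \<le> n - 1" "2 \<le> n - 1" using n_ge_3 by linarith+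
  ultimately obtain s where s: "hp (n - 1) s" by blast
  have st: "s (n - 1) \<in> Arr C" "Dom C (s (n - 1)) = V n" "Cod C (s (n - 1)) = V (n - 1)"
    using s n unfolding hp_def by (auto simp: mor_iff)
  have dn: "d (n - 1) \<in> Arr C" "Dom C (d (n - 1)) = V (n - 1)" "Cod C (d (n - 1)) = V n"
    using v(2-4)[of "n - 1"] n by simp_all
  \<comment> \<open>What the homotopy leaves over in degree n. \<open>fix_last\<close> adds it to
    the composite; its hypothesis on \<open>d n\<close> holds since \<open>d n\<close> kills
    \<open>d (n - 1) \<cdot> s (n - 1)\<close>.\<close>
  let ?c = "\<one>\<^bsub>V n\<^esub> \<oplus> \<ominus> (r n \<cdot> i n) \<oplus> \<ominus> (d (n - 1) \<cdot> s (n - 1))"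
  have ct: "?c \<in> mor (V n) (V n)" by (simp add: mor_iff st dn v im rm)
  have c0: "?c \<cdot> d (n - 1) = \<zero>\<^bsub>V (n - 1),V n\<^esub>"
    using defect[OF s n(4,2)] unfolding n(1) .
  have dnn: "d n \<cdot> d (n - 1) = \<zero>\<^bsub>V (n - 1),SO (V 1)\<^esub>"
    using dd[of "n - 1"] n v(5) by simp
  have sum: "r n \<cdot> i n \<oplus> ?c = \<one>\<^bsub>V n\<^esub> \<oplus> \<ominus> (d (n - 1) \<cdot> s (n - 1))"
    by (simp add: st dn v im rm add_ac)
  have "d n \<cdot> (d (n - 1) \<cdot> s (n - 1)) = \<zero>\<^bsub>V n,SO (V 1)\<^esub>"
    by (subst reassoc[OF dnn]) (simp_all add: st dn v)
  then have "d n \<cdot> (r n \<cdot> i n \<oplus> ?c) = d n"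
    unfolding sum by (simp add: st dn v)
  then obtain r' where r': "nseq_morphism n C S (U, e) (V, d) r'" "\<And>k. k < n \<Longrightarrow> 1 \<le> k \<Longrightarrow> r' k = r k"
    "r' n \<cdot> i n = r n \<cdot> i n \<oplus> ?c"
    using fix_last[OF V U i r ri(1) ct c0] by metis
  show thesis
  proof (rule that[OF r'(1), of s])
    show "r' k = r k" if "1 \<le> k" "k < n" for k using that r' by simp
    show "s k \<in> mor (V (Suc k)) (V k)" if "1 \<le> k" "k < n" for k using that s n unfolding hp_def by auto
    show "s 2 = \<zero>\<^bsub>V 3,V 2\<^esub>" using s unfolding hp_def by blast
    show "r' (Suc k) \<cdot> i (Suc k) \<oplus> d k \<cdot> s k \<oplus> s (Suc k) \<cdot> d (Suc k) = \<one>\<^bsub>V (Suc k)\<^esub>"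
      if "2 \<le> k" "Suc k < n" for k
      using that s r'(2)[of "Suc k"] unfolding hp_def by auto
    show "r' n \<cdot> i n \<oplus> d (n - 1) \<cdot> s (n - 1) = \<one>\<^bsub>V n\<^esub>"
      unfolding r'(3) sum by (simp add: st dn v)
  qed
qed

text \<open>Replacing the objects outside positions \<open>l, \<dots>, n\<close> by zero objects turns the omitted summands of rows 3 and 5
  into zero summands, which makes the matrices uniform in the position.\<close>

definition tob :: "nat \<Rightarrow> (nat \<Rightarrow> 'o) \<Rightarrow> nat \<Rightarrow> 'o" where
  "tob l X k = (if l \<le> k \<and> k \<le> n then X k else N)"

definition tar :: "nat \<Rightarrow> (nat \<Rightarrow> 'o) \<Rightarrow> (nat \<Rightarrow> 'm) \<Rightarrow> nat \<Rightarrow> 'm" where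
  "tar l X f k = (if l \<le> k \<and> k < n then f k else \<zero>\<^bsub>tob l X k,tob l X (Suc k)\<^esub>)"

lemma tob_Ob: "is_nseq n C S (X, f) \<Longrightarrow> 1 \<le> l \<Longrightarrow> tob l X k \<in> Ob C"
  by (auto simp: tob_def nseqD(1))

lemma tar_arr:
  assumes X: "is_nseq n C S (X, f)" and l: "1 \<le> l"
  shows "tar l X f k \<in> Arr C" "Dom C (tar l X f k) = tob l X k" "Cod C (tar l X f k) = tob l X (Suc k)"
  using nseqD[OF X] tob_Ob[OF X l] l by (auto simp: tar_def) (auto simp: tob_def)

lemma tar_tar:
  assumes X: "hom_exact X f" and l: "1 \<le> l"
  shows "tar l X f (Suc k) \<cdot> tar l X f k = \<zero>\<^bsub>tob l X k,tob l X (Suc (Suc k))\<^esub>"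
proof (cases "l \<le> k \<and> Suc k < n")
  case True
  then show ?thesis
    using hom_exactD(2)[OF X, of k] nseqD[OF hom_exactD(1)[OF X]] l by (simp add: tar_def tob_def)
next
  case False
  note t = tar_arr[OF hom_exactD(1)[OF X] l] and o = tob_Ob[OF hom_exactD(1)[OF X] l]
  show ?thesis
  proof (cases "l \<le> k")
    case True
    then have "tar l X f (Suc k) = \<zero>\<^bsub>tob l X (Suc k),tob l X (Suc (Suc k))\<^esub>"
      using False by (simp add: tar_def)
    then show ?thesis using t o by simp
  next
    case False
    then have "tar l X f k = \<zero>\<^bsub>N,tob l X (Suc k)\<^esub>" "tob l X k = N" by (simp_all add: tar_def tob_def)
    then show ?thesis using t o by simp
  qed
qed

section \<open>Row 3 in terms of truncated sequences, and its Hom-exactness\<close>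

definition cone_bip :: "(nat \<Rightarrow> 'o) \<Rightarrow> (nat \<Rightarrow> 'o) \<Rightarrow> nat \<Rightarrow> ('o, 'm) biproduct_data" where
  "cone_bip X Y k = (let bs = row3_mask n k; L = [X (Suc k), Y k] in
     \<lparr>BOb = dsum C (keep bs L), Inj1 = minj bs L 0, Inj2 = minj bs L 1,
      Prj1 = mprj bs L 0, Prj2 = mprj bs L 1\<rparr>)"

lemma tob_in: "l \<le> k \<Longrightarrow> k \<le> n \<Longrightarrow> tob l X k = X k"
  and tob_low: "k < l \<Longrightarrow> tob l X k = N" and tob_high: "n < k \<Longrightarrow> tob l X k = N"
  and tar_in: "l \<le> k \<Longrightarrow> k < n \<Longrightarrow> tar l X f k = f k"
  by (simp_all add: tob_def tar_def)

text \<open>Replaces the matrices of row 3 by their effect on the two injections, with zero objects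
  standing for omitted summands. \<open>\<phi>\<close> appears untruncated since its index
  \<open>Suc k\<close> stays between 2 and n.\<close>

lemma row3_model:
  assumes X: "is_nseq n C S (X, f)" and Y: "is_nseq n C S (Y, g)"
    and \<phi>: "\<forall>k\<in>{2..n}. \<phi> k \<in> mor (X k) (Y k)" and XY: "Y 1 = X 1"
  defines "T \<equiv> fst (row3 n C S X f Y g \<phi>)" and "d \<equiv> snd (row3 n C S X f Y g \<phi>)"
  defines "P \<equiv> cone_bip X Y"
  shows "1 \<le> k \<Longrightarrow> k \<le> n \<Longrightarrow> is_biproduct C (tob 2 X (Suc k)) (tob 2 Y k) (P k)"
    and "BOb (P k) = T k"
    and "1 \<le> k \<Longrightarrow> k < n \<Longrightarrow> d k \<in> mor (T k) (T (Suc k))"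
    and "1 \<le> k \<Longrightarrow> k < n \<Longrightarrow> d k \<cdot> Inj1 (P k) =
       \<ominus> (Inj1 (P (Suc k)) \<cdot> tar 2 X f (Suc k)) \<oplus> Inj2 (P (Suc k)) \<cdot> \<phi> (Suc k)"
    and "1 \<le> k \<Longrightarrow> k < n \<Longrightarrow> d k \<cdot> Inj2 (P k) = Inj2 (P (Suc k)) \<cdot> tar 2 Y g k"
    and "T 1 = X 2" and "T n = Y n" and "d n = SA (f 1) \<cdot> g n"
    and "Inj1 (P 1) = \<one>\<^bsub>X 2\<^esub>" and "Prj1 (P 1) = \<one>\<^bsub>X 2\<^esub>"
    and "Inj2 (P n) = \<one>\<^bsub>Y n\<^esub>" and "Prj2 (P n) = \<one>\<^bsub>Y n\<^esub>"
    and "is_nseq n C S (T, d)"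
proof -
  note x = nseqD[OF X] and y = nseqD[OF Y]
  have kept: "kept_Ob (row3_mask n k) [X (Suc k), Y k]" if "1 \<le> k" "k \<le> n" for k
    using that x y by (auto simp: kept_Ob_def row3_mask_def)
  have kob: "kob (row3_mask n k ! 0) (X (Suc k)) = tob 2 X (Suc k)" "kob (row3_mask n k ! 1) (Y k) = tob 2 Y k"
    if "1 \<le> k" "k \<le> n" for k
    using that by (auto simp: kob_def row3_mask_def tob_def One_nat_def)
  show P: "is_biproduct C (tob 2 X (Suc k)) (tob 2 Y k) (P k)" if "1 \<le> k" "k \<le> n" for k
    using masked_biproduct[OF kept[OF that]] unfolding kob[OF that] by (simp add: P_def cone_bip_def Let_def)
  show PT: "BOb (P k) = T k" for k
    unfolding P_def cone_bip_def T_def row3_def Let_def by (simp flip: Suc_eq_plus1)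
  have M: "d k \<in> mor (T k) (T (Suc k)) \<and>
      Prj1 (P (Suc k)) \<cdot> (d k \<cdot> Inj1 (P k)) = \<ominus> tar 2 X f (Suc k) \<and>
      Prj2 (P (Suc k)) \<cdot> (d k \<cdot> Inj1 (P k)) = \<phi> (Suc k) \<and>
      Prj1 (P (Suc k)) \<cdot> (d k \<cdot> Inj2 (P k)) = \<zero>\<^bsub>tob 2 Y k,tob 2 X (Suc (Suc k))\<^esub> \<and>
      Prj2 (P (Suc k)) \<cdot> (d k \<cdot> Inj2 (P k)) = tar 2 Y g k"
    if k: "1 \<le> k" "k < n" for k
  proof -
    let ?cs = "row3_mask n k" and ?rs = "row3_mask n (Suc k)"
    let ?As = "[X (Suc k), Y k]" and ?Bs = "[X (Suc (Suc k)), Y (Suc k)]"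
    let ?M = "[[neg C (f (Suc k)), \<zero>\<^bsub>Y k,X (Suc (Suc k))\<^esub>], [\<phi> (Suc k), g k]]"
    have dk: "d k = mat_keep C ?cs ?As ?rs ?Bs ?M"
      using k unfolding d_def row3_def by (simp flip: Suc_eq_plus1 add: One_nat_def)
    have cs: "kept_Ob ?cs ?As" and rs: "kept_Ob ?rs ?Bs" using kept[of k] kept[of "Suc k"] k by auto
    have ty: "?M ! i ! j \<in> mor (?As ! j) (?Bs ! i)"
      if "i < length ?Bs" "j < length ?As" "?rs ! i" "?cs ! j" for i j
    proof -
      have "(i = 0 \<or> i = Suc 0) \<and> (j = 0 \<or> j = Suc 0)" using that by auto
      then show ?thesis
        using that k x y bspec[OF \<phi>, of "Suc k"] by (auto simp: row3_mask_def mor_iff)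
    qed
    have len: "length ?M = length ?Bs" "\<And>i. i < length ?Bs \<Longrightarrow> length (?M ! i) = length ?As"
      by (auto simp: less_Suc_eq)
    note mk = mat_keep_arr_component[OF cs rs len ty, folded dk]
    have 1: "d k \<in> mor (T k) (T (Suc k))"
      using mk(1) unfolding PT[symmetric] P_def cone_bip_def Let_def by simp
    have kk: "kob (?rs ! 0) (?Bs ! 0) = tob 2 X (Suc (Suc k))" "kob (?cs ! Suc 0) (?As ! Suc 0) = tob 2 Y k"
       "kob (?cs ! 0) (?As ! 0) = tob 2 X (Suc k)" "kob (?rs ! Suc 0) (?Bs ! Suc 0) = tob 2 Y (Suc k)"
      using kob[of k] kob[of "Suc k"] k by (simp_all add: One_nat_def)
    have rc: "?rs ! 0 \<longleftrightarrow> Suc k < n" "?rs ! Suc 0" "?cs ! 0" "?cs ! Suc 0 \<longleftrightarrow> 2 \<le> k"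
      using k by (auto simp: row3_mask_def)
    have t0: "\<ominus> tar 2 X f (Suc k) = (if Suc k < n then neg C (f (Suc k)) else \<zero>\<^bsub>tob 2 X (Suc k),tob 2 X (Suc (Suc k))\<^esub>)"
      using k tob_Ob[OF X, of 2] by (simp add: tar_def)
    have t1: "tar 2 Y g k = (if 2 \<le> k then g k else \<zero>\<^bsub>tob 2 Y k,tob 2 Y (Suc k)\<^esub>)"
      using k by (simp add: tar_def)
    have rc': "(?rs ! Suc 0) = True" "(?cs ! 0) = True" using rc by simp_all
    note c = mk(2)[of 0 0, unfolded kk, unfolded rc(1,4) rc'] mk(2)[of 0 "Suc 0", unfolded kk, unfolded rc(1,4) rc']
      mk(2)[of "Suc 0" 0, unfolded kk, unfolded rc(1,4) rc'] mk(2)[of "Suc 0" "Suc 0", unfolded kk, unfolded rc(1,4) rc']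
    have c': "Prj1 (P (Suc k)) = mprj ?rs ?Bs 0" "Prj2 (P (Suc k)) = mprj ?rs ?Bs (Suc 0)"
      "Inj1 (P k) = minj ?cs ?As 0" "Inj2 (P k) = minj ?cs ?As (Suc 0)"
      by (simp_all add: P_def cone_bip_def Let_def One_nat_def)
    have "\<zero>\<^bsub>Y k,X (Suc (Suc k))\<^esub> = \<zero>\<^bsub>tob 2 Y k,tob 2 X (Suc (Suc k))\<^esub>" if "Suc k < n" "2 \<le> k"
      using that k by (simp add: tob_def)
    then show ?thesis
      unfolding c' t0 t1 using 1 c by simp
  qed
  note b = biproduct_rules[OF P]
  have tx: "tar 2 X f k \<in> Arr C" "Dom C (tar 2 X f k) = tob 2 X k" "Cod C (tar 2 X f k) = tob 2 X (Suc k)" 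
    and ty: "tar 2 Y g k \<in> Arr C" "Dom C (tar 2 Y g k) = tob 2 Y k" "Cod C (tar 2 Y g k) = tob 2 Y (Suc k)" for k
    using tar_arr[OF X, of 2] tar_arr[OF Y, of 2] by simp_all
  have tb: "tob 2 X k \<in> Ob C" "tob 2 Y k \<in> Ob C" for k using tob_Ob[OF X, of 2] tob_Ob[OF Y, of 2] by simp_all
  show dt: "d k \<in> mor (T k) (T (Suc k))" if "1 \<le> k" "k < n" for k using M[OF that] by blast
  show "d k \<cdot> Inj1 (P k) = \<ominus> (Inj1 (P (Suc k)) \<cdot> tar 2 X f (Suc k)) \<oplus> Inj2 (P (Suc k)) \<cdot> \<phi> (Suc k)"
    and "d k \<cdot> Inj2 (P k) = Inj2 (P (Suc k)) \<cdot> tar 2 Y g k"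
    if k: "1 \<le> k" "k < n" for k
  proof -
    have k': "1 \<le> k" "k \<le> n" "1 \<le> Suc k" "Suc k \<le> n" "2 \<le> Suc k" using k by simp_all
    have ph: "\<phi> (Suc k) \<in> Arr C" "Dom C (\<phi> (Suc k)) = tob 2 X (Suc k)" "Cod C (\<phi> (Suc k)) = tob 2 Y (Suc k)"
      using bspec[OF \<phi>, of "Suc k"] k' by (simp_all add: mor_iff tob_in)
    note bb = b[OF k'(1,2)] b[OF k'(3,4)]
    have dk: "d k \<in> Arr C" "Dom C (d k) = BOb (P k)" "Cod C (d k) = BOb (P (Suc k))"
      using dt[OF k] by (simp_all add: mor_iff PT)
    have Mk: "Prj1 (P (Suc k)) \<cdot> (d k \<cdot> Inj1 (P k)) = \<ominus> tar 2 X f (Suc k)"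
      "Prj2 (P (Suc k)) \<cdot> (d k \<cdot> Inj1 (P k)) = \<phi> (Suc k)"
      "Prj1 (P (Suc k)) \<cdot> (d k \<cdot> Inj2 (P k)) = \<zero>\<^bsub>tob 2 Y k,tob 2 X (Suc (Suc k))\<^esub>"
      "Prj2 (P (Suc k)) \<cdot> (d k \<cdot> Inj2 (P k)) = tar 2 Y g k" using M[OF k] by simp_all
    show "d k \<cdot> Inj1 (P k) = \<ominus> (Inj1 (P (Suc k)) \<cdot> tar 2 X f (Suc k)) \<oplus> Inj2 (P (Suc k)) \<cdot> \<phi> (Suc k)"
      by (rule biproduct_mono[OF P[OF k'(3,4)]]) (simp_all add: mor_iff bb dk ph tx ty tb Mk)
    show "d k \<cdot> Inj2 (P k) = Inj2 (P (Suc k)) \<cdot> tar 2 Y g k"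
      by (rule biproduct_mono[OF P[OF k'(3,4)]]) (simp_all add: mor_iff bb dk ph tx ty tb Mk)
  qed
  show T1: "T 1 = X 2" and Tn: "T n = Y n" and "Inj1 (P 1) = \<one>\<^bsub>X 2\<^esub>" and "Prj1 (P 1) = \<one>\<^bsub>X 2\<^esub>"
    and "Inj2 (P n) = \<one>\<^bsub>Y n\<^esub>" and "Prj2 (P n) = \<one>\<^bsub>Y n\<^esub>" and dn: "d n = SA (f 1) \<cdot> g n"
    by (simp_all add: T_def d_def row3_def P_def cone_bip_def row3_mask_def Let_def minj_def mprj_def One_nat_def)
       (simp_all add: numeral_2_eq_2 n_bounds(3)[unfolded numeral_2_eq_2])
  have "f 1 \<in> Arr C" "Dom C (f 1) = X 1" "Cod C (f 1) = X 2" using x(2-4)[of 1] by simp_all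
  then have "d n \<in> mor (T n) (SO (T 1))"
    unfolding dn T1 Tn using y XY by (simp add: mor_iff)
  then show "is_nseq n C S (T, d)" by (intro nseqI dt)
qed

text \<open>In column 1 the square commutes because \<open>f 2 \<cdot> f 1\<close> vanishes and
  \<open>\<phi> 2 \<cdot> f 1 = g 1\<close>. Besides the step from row 2 to row 3, this also serves
  for the cone of the morphism from row 3 to row 4.\<close>

lemma cone_inclusion:
  assumes X: "(X, f) \<in> \<Theta>" and Y: "is_nseq n C S (Y, g)" and XY: "Y 1 = X 1"
    and \<phi>: "nseq_morphism n C S (X, f) (Y, g) \<phi>" and \<phi>1: "\<phi> 1 = \<one>\<^bsub>X 1\<^esub>"
  shows "nseq_morphism n C S (Y, g) (row3 n C S X f Y g \<phi>) (\<lambda>k. if k = 1 then f 1 else Inj2 (cone_bip X Y k))"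
proof -
  note nX = Theta_nseq[OF X] and eX = Theta_hom_exact[OF X]
  note x = nseqD[OF nX] and y = nseqD[OF Y, unfolded XY] and p = morphismD[OF \<phi>]
  have pm: "\<forall>k\<in>{2..n}. \<phi> k \<in> mor (X k) (Y k)" by (simp add: mor_iff p)
  define T d P where "T = fst (row3 n C S X f Y g \<phi>)" and "d = snd (row3 n C S X f Y g \<phi>)"
    and "P = cone_bip X Y"
  note mdl = row3_model[OF nX Y pm XY, folded T_def d_def P_def]
  note b = biproduct_rules[OF mdl(1), unfolded mdl(2)] and t = nseqD[OF mdl(13)]
  have f1: "f 1 \<in> Arr C" "Dom C (f 1) = X 1" "Cod C (f 1) = X 2" using x(2-4)[of 1] by simp_all
  have S: "Suc 1 = 2" "Suc 2 = 3" by simp_all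
  have "nseq_morphism n C S (Y, g) (T, d) (\<lambda>k. if k = 1 then f 1 else Inj2 (P k))"
  proof (rule morphismI)
    fix k assume k: "1 \<le> k" "k \<le> n"
    then show "(if k = 1 then f 1 else Inj2 (P k)) \<in> mor (Y k) (T k)"
      using b(7-9)[OF k] f1 mdl(6) XY by (auto simp: mor_iff tob_in)
  next
    fix k assume k: "1 \<le> k" "k < n"
    show "(if Suc k = 1 then f 1 else Inj2 (P (Suc k))) \<cdot> g k = d k \<cdot> (if k = 1 then f 1 else Inj2 (P k))"
    proof (cases "k = 1")
      case False
      then show ?thesis using k mdl(5)[OF k] by (simp add: tar_in)
    next
      case True
      have d1: "d 1 = \<ominus> (Inj1 (P 2) \<cdot> tar 2 X f 2) \<oplus> Inj2 (P 2) \<cdot> \<phi> 2"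
        using mdl(4)[of 1] t(2-4)[of 1] mdl(6) unfolding S mdl(9) by simp
      have x2: "tob 2 X 2 = X 2" "tob 2 X 3 = X 3" "tob 2 Y 2 = Y 2" "tar 2 X f 2 = f 2" by (simp_all add: tob_in tar_in)
      note b2 = b[of 2, unfolded S x2, simplified]
      have f2: "f 2 \<in> Arr C" "Dom C (f 2) = X 2" "Cod C (f 2) = X 3" using x(2-4)[of 2] by simp_all
      have p2t: "\<phi> 2 \<in> Arr C" "Dom C (\<phi> 2) = X 2" "Cod C (\<phi> 2) = Y 2" using p(1-3)[of 2] by simp_all
      have ff: "f 2 \<cdot> f 1 = \<zero>\<^bsub>X 1,X 3\<^esub>" using hom_exactD(2)[OF eX, of 1] f2 by simp
      have g1: "g 1 \<in> Arr C" "Dom C (g 1) = X 1" "Cod C (g 1) = Y 2" using y(2-4)[of 1] XY by simp_all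
      have p2: "\<phi> 2 \<cdot> f 1 = g 1" using p(4)[of 1] \<phi>1 g1 by simp
      have "d 1 \<cdot> f 1 = Inj2 (P 2) \<cdot> g 1"
        unfolding d1 x2 by (simp add: b2 f2 f1 p2t ff p2 x g1)
      then show ?thesis by (simp add: True)
    qed
  next
    show "SA (if 1 = 1 then f 1 else Inj2 (P 1)) \<cdot> g n = d n \<cdot> (if n = 1 then f 1 else Inj2 (P n))"
      using f1 y by (simp add: mdl(8,11))
  qed
  then show ?thesis unfolding T_def d_def P_def prod.collapse .
qed

text \<open>The cone of an arbitrary filler is not known to be an n-angle, so exactness comes from a
  direct chase. The identity in degree 1 ties the two n-angles together at both ends:
  \<open>\<phi> 2 \<cdot> f 1 = g 1\<close> and \<open>g n \<cdot> \<phi> n = f n\<close>.\<close>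

lemma row3_hom_exact:
  assumes X: "(X, f) \<in> \<Theta>" and Y: "(Y, g) \<in> \<Theta>" and XY: "Y 1 = X 1"
    and \<phi>: "nseq_morphism n C S (X, f) (Y, g) \<phi>" and \<phi>1: "\<phi> 1 = \<one>\<^bsub>X 1\<^esub>"
  shows "hom_exact (fst (row3 n C S X f Y g \<phi>)) (snd (row3 n C S X f Y g \<phi>))"
proof -
  note eX = Theta_hom_exact[OF X] and eY = Theta_hom_exact[OF Y]
  note nX = Theta_nseq[OF X] and nY = Theta_nseq[OF Y]
  note x = nseqD[OF nX] and y = nseqD[OF nY, unfolded XY] and p = morphismD[OF \<phi>]
  have pm: "\<forall>k\<in>{2..n}. \<phi> k \<in> mor (X k) (Y k)"
    by (simp add: mor_iff p)
  define T d P where "T = fst (row3 n C S X f Y g \<phi>)" and "d = snd (row3 n C S X f Y g \<phi>)"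
    and "P = cone_bip X Y"
  note mdl = row3_model[OF nX nY pm XY, folded T_def d_def P_def]
  note P = mdl(1) and PT = mdl(2) and nT = mdl(13)
  note b = biproduct_rules[OF P, unfolded PT] and t = nseqD[OF nT]
  note tx = tar_arr[OF nX, of 2, simplified] tar_arr[OF nY, of 2, simplified] tob_Ob[OF nX, of 2, simplified] tob_Ob[OF nY, of 2, simplified]
  have f1: "f 1 \<in> Arr C" "Dom C (f 1) = X 1" "Cod C (f 1) = X 2" using x(2-4)[of 1] by simp_all
  have g1: "g 1 \<in> Arr C" "Dom C (g 1) = X 1" "Cod C (g 1) = Y 2" using y(2-4)[of 1] XY by simp_all
  have p2: "\<phi> 2 \<cdot> f 1 = g 1" using p(4)[of 1] \<phi>1 g1 by simp
  have gn: "Cod C (g n) = SO (X 1)" using y XY by simp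
  have fn: "g n \<cdot> \<phi> n = f n" using p(5) \<phi>1 x by simp
  have S2: "Suc 1 = 2" by simp
  have i1: "Inj1 (P n) = \<zero>\<^bsub>N,Y n\<^esub>"
    using from_zero_ob[of "Inj1 (P n)"] b(4-6)[of n] mdl(7) by (simp add: tob_high)
  have tk: "tar 2 X f n \<in> Arr C" "Dom C (tar 2 X f n) = X n" "Cod C (tar 2 X f n) = N"
    using tx(1-3)[of n] by (simp_all add: tob_in tob_high)
  have "hom_exact T d" unfolding hom_exact_def
  proof (intro conjI allI impI nT)
    fix k assume "1 \<le> k \<and> k < n"
    then have k: "1 \<le> k" "k < n" by auto
    then have k': "k \<le> n" "1 \<le> Suc k" "Suc k \<le> n" "2 \<le> Suc k" by simp_all
    show "d (Suc k) \<cdot> d k = \<zero>\<^bsub>T k,Cod C (d (Suc k))\<^esub>"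
    proof (cases "Suc k = n")
      case False
      then have kn: "Suc k < n" using k by simp
      then have k'': "1 \<le> Suc (Suc k)" "Suc (Suc k) \<le> n" "2 \<le> Suc (Suc k)" by simp_all
      have tp: "\<phi> (Suc (Suc k)) \<cdot> tar 2 X f (Suc k) = tar 2 Y g (Suc k) \<cdot> \<phi> (Suc k)"
        using p(4)[OF k'(2) kn] k' kn by (simp add: tar_in)
      have pt: "\<phi> (Suc k) \<in> Arr C" "Dom C (\<phi> (Suc k)) = tob 2 X (Suc k)" "Cod C (\<phi> (Suc k)) = tob 2 Y (Suc k)"
        "\<phi> (Suc (Suc k)) \<in> Arr C" "Dom C (\<phi> (Suc (Suc k))) = tob 2 X (Suc (Suc k))" "Cod C (\<phi> (Suc (Suc k))) = tob 2 Y (Suc (Suc k))"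
        using k' k'' by (simp_all add: p tob_in)
      note all = k k' k'' kn b tx t pt mdl(4,5) mdl(4,5)[THEN reassoc] tar_tar[OF eX, of 2]
        tar_tar[OF eY, of 2] tp
      show ?thesis
        by (rule biproduct_epi[OF P[OF k(1) k'(1)], unfolded PT, of _ "T (Suc (Suc k))"])
           (simp_all add: mor_iff all)
    next
      case True
      have gg: "g n \<cdot> tar 2 Y g k = \<zero>\<^bsub>tob 2 Y k,SO (X 1)\<^esub>"
      proof (cases "2 \<le> k")
        case True
        then show ?thesis using hom_exactD(2)[OF eY k] \<open>Suc k = n\<close> gn k by (simp add: tar_in tob_in)
      next
        case False
        then show ?thesis using k True n_ge_3 by linarith
      qed
      have "tob 2 Y (Suc k) = Y n" using True by (simp add: tob_in)
      note tk' = tx(1-6)[of k, unfolded this]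
      show ?thesis unfolding True
      proof (rule biproduct_epi[OF P[OF k(1) k'(1)], unfolded PT, of _ "SO (T 1)"])
        note e = mdl(4,5)[OF k, unfolded True mdl(11) i1]
        have dT: "d k \<in> Arr C" "Dom C (d k) = T k" "Cod C (d k) = Y n"
          using t(2-4)[of k] k True mdl(7) by auto
        have tX: "tob 2 X n = X n" by (simp add: tob_in)
        have "d k \<cdot> Inj1 (P k) = \<phi> n" unfolding e using tk p x y by simp
        then show "(d n \<cdot> d k) \<cdot> Inj1 (P k) = \<zero>\<^bsub>T k,Cod C (d n)\<^esub> \<cdot> Inj1 (P k)"
          using hom_exactD(3)[OF eX] tX True
          by (simp add: mdl(8) x y f1 gn dT b[OF k(1) k'(1)] fn mdl(6) x(1) t(5))
        have "d k \<cdot> Inj2 (P k) = tar 2 Y g k" unfolding e using tk' y by simp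
        then show "(d n \<cdot> d k) \<cdot> Inj2 (P k) = \<zero>\<^bsub>T k,Cod C (d n)\<^esub> \<cdot> Inj2 (P k)"
          by (simp add: mdl(8) x y f1 gn dT b[OF k(1) k'(1)] gg tx mdl(6) t(5))
      qed (use t True k in \<open>auto simp: mor_iff\<close>)
    qed
  next
    have obY: "tob 2 Y 2 = Y 2" by (simp add: tob_in)
    note b2 = b[of 2, unfolded obY, simplified]
    have "row3 n C S X f Y g \<phi> = (T, d)" by (simp add: T_def d_def)
    note ci = cone_inclusion[OF X nY XY \<phi> \<phi>1, unfolded this]
    have "d 1 \<cdot> f 1 = Inj2 (P 2) \<cdot> g 1"
      using morphismD(4)[OF ci, of 1] by (simp add: P_def)
    moreover have "d 1 \<in> Arr C" "Dom C (d 1) = X 2" "Cod C (d 1) = T 2" using t(2-4)[of 1] mdl(6) by simp_all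
    moreover have "SA (d 1) \<cdot> d n = SA (d 1 \<cdot> f 1) \<cdot> g n"
      using calculation(2-4) f1 y gn by (simp add: mdl(8))
    ultimately have "SA (d 1) \<cdot> d n = SA (Inj2 (P 2)) \<cdot> (SA (g 1) \<cdot> g n)"
      using b2 g1 y gn by simp
    then show "SA (d 1) \<cdot> d n = \<zero>\<^bsub>T n,SO (T 2)\<^esub>"
      using hom_exactD(3)[OF eY] b2 y by (simp add: mdl(7))
  next
    fix k u A
    assume "1 \<le> k \<and> k < n \<and> u \<in> mor (T (Suc k)) A \<and> u \<cdot> d k = \<zero>\<^bsub>T k,A\<^esub>"
    then have k: "1 \<le> k" "k < n" and u: "u \<in> Arr C" "Dom C u = T (Suc k)" "Cod C u = A" "A \<in> Ob C"
      and ud: "u \<cdot> d k = \<zero>\<^bsub>T k,A\<^esub>" by (auto simp: mor_iff)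
    then have k': "k \<le> n" "1 \<le> Suc k" "Suc k \<le> n" "2 \<le> Suc k" by simp_all
    \<comment> \<open>A map out of the biproduct is a pair (v, w). Vanishing on \<open>d k\<close>
      relates \<open>w \<cdot> \<phi>\<close> to \<open>v \<cdot> f\<close> and makes
      \<open>w\<close> kill \<open>g k\<close>; first \<open>w\<close> is lifted, then the remainder
      of \<open>v\<close>.\<close>
    define v w where "v = u \<cdot> Inj1 (P (Suc k))" and "w = u \<cdot> Inj2 (P (Suc k))"
    note b1 = b[OF k(1) k'(1)] and b2 = b[OF k'(2,3)]
    have xk: "tob 2 X (Suc k) = X (Suc k)" "tob 2 Y (Suc k) = Y (Suc k)" using k' by (simp_all add: tob_in)
    have vt: "v \<in> Arr C" "Dom C v = tob 2 X (Suc (Suc k))" "Cod C v = A"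
      and wt: "w \<in> Arr C" "Dom C w = Y (Suc k)" "Cod C w = A"
      unfolding v_def w_def by (simp_all add: b2 u xk)
    have pk: "\<phi> (Suc k) \<in> Arr C" "Dom C (\<phi> (Suc k)) = X (Suc k)" "Cod C (\<phi> (Suc k)) = Y (Suc k)"
      using k' by (simp_all add: p)
    note tsk = tx(1-3)[of "Suc k", unfolded xk]
    have dk: "d k \<in> Arr C" "Dom C (d k) = T k" "Cod C (d k) = T (Suc k)" "T k \<in> Ob C" using t k by simp_all
    have "\<ominus> (v \<cdot> tar 2 X f (Suc k)) \<oplus> w \<cdot> \<phi> (Suc k) = u \<cdot> (d k \<cdot> Inj1 (P k))"
      unfolding mdl(4)[OF k] v_def w_def by (simp add: b2 u tsk pk xk)
    also have "\<dots> = \<zero>\<^bsub>T k,A\<^esub> \<cdot> Inj1 (P k)"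
      by (rule reassoc[OF ud]) (simp_all add: dk u b1)
    finally have e1: "\<ominus> (v \<cdot> tar 2 X f (Suc k)) \<oplus> w \<cdot> \<phi> (Suc k) = \<zero>\<^bsub>X (Suc k),A\<^esub>"
      by (simp add: b1 u xk)
    have vw: "w \<cdot> \<phi> (Suc k) = v \<cdot> tar 2 X f (Suc k)"
      using neg_unique[of "\<ominus> (v \<cdot> tar 2 X f (Suc k))" "w \<cdot> \<phi> (Suc k)"] e1 vt wt tsk pk by simp
    have "w \<cdot> tar 2 Y g k = u \<cdot> (d k \<cdot> Inj2 (P k))"
      unfolding mdl(5)[OF k] w_def by (simp add: b2 u tx)
    also have "\<dots> = \<zero>\<^bsub>T k,A\<^esub> \<cdot> Inj2 (P k)"
      by (rule reassoc[OF ud]) (simp_all add: dk u b1)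
    finally have e2: "w \<cdot> tar 2 Y g k = \<zero>\<^bsub>tob 2 Y k,A\<^esub>"
      by (simp add: b1 u xk)
    \<comment> \<open>For k = 1 the object \<open>Y 1\<close> is truncated away and
      \<open>e2\<close> says nothing. Instead \<open>g 1\<close> is written as
      \<open>\<phi> 2 \<cdot> f 1\<close>, so that \<open>w \<cdot> g 1\<close> becomes
      \<open>v \<cdot> f 2 \<cdot> f 1\<close>.\<close>
    have wg: "w \<cdot> g k = \<zero>\<^bsub>Y k,A\<^esub>"
    proof (cases "k = 1")
      case False
      then show ?thesis using e2 k by (simp add: tar_in tob_in)
    next
      case True
      have f2: "f 2 \<in> Arr C" "Dom C (f 2) = X 2" "Cod C (f 2) = X 3" using x(2-4)[of 2] by simp_all
      have t2: "tar 2 X f 2 = f 2" "tob 2 X 3 = X 3" by (simp_all add: tob_in tar_in)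
      have S3: "Suc 2 = 3" by simp
      have ff: "f 2 \<cdot> f 1 = \<zero>\<^bsub>X 1,X 3\<^esub>" using hom_exactD(2)[OF eX, of 1] f2 by simp
      have "w \<cdot> g 1 = (w \<cdot> \<phi> 2) \<cdot> f 1" using wt pk f1 p2 True by simp
      also have "w \<cdot> \<phi> 2 = v \<cdot> f 2" using vw unfolding True S2 t2 .
      also have "(v \<cdot> f 2) \<cdot> f 1 = \<zero>\<^bsub>X 1,A\<^esub>"
        using vt unfolding True S2 S3 t2 by (simp add: f1 f2 ff x)
      finally show ?thesis using True XY by simp
    qed
    obtain w' where w': "w' \<in> mor (Cod C (g (Suc k))) A" "w' \<cdot> g (Suc k) = w"
      using hom_exact_factor[OF eY k _ wg] wt by (auto simp: mor_iff)
    show "\<exists>v. v \<in> mor (Cod C (d (Suc k))) A \<and> v \<cdot> d (Suc k) = u"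
    proof (cases "Suc k = n")
      case True
      have tn: "tar 2 X f n = \<zero>\<^bsub>X n,N\<^esub>" using to_zero_ob[OF tk(1,3)] tk(2) by simp
      have w't: "w' \<in> Arr C" "Dom C w' = SO (X 1)" "Cod C w' = A" "w' \<cdot> g n = w"
        using w' True gn by (simp_all add: mor_iff)
      \<comment> \<open>The differential here is \<open>SA (f 1) \<cdot> g n\<close>, so
        \<open>w'\<close> must factor through \<open>SA (f 1)\<close>. It kills \<open>f n\<close>,
        and exactness at \<open>SO (X 1)\<close> applies.\<close>
      have "w' \<cdot> f n = w' \<cdot> (g n \<cdot> \<phi> n)" by (simp add: fn)
      also have "\<dots> = w \<cdot> \<phi> n" by (rule reassoc[OF w't(4)]) (simp_all add: w't y gn p)
      also have "\<dots> = \<zero>\<^bsub>X n,A\<^esub>"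
        using vw vt x w't(4) unfolding True tn by (simp add: tob_high)
      finally obtain z where z: "z \<in> mor (SO (X 2)) A" "z \<cdot> SA (f 1) = w'"
        using factor_last[OF X, of w' A] w't by (auto simp: mor_iff)
      have "z \<cdot> d n = z \<cdot> (SA (f 1) \<cdot> g n)" by (simp add: mdl(8))
      also have "\<dots> = w' \<cdot> g n"
        by (rule reassoc[OF z(2)]) (use z(1) in \<open>simp_all add: f1 y gn mor_iff\<close>)
      also have "\<dots> = u" unfolding w't(4) w_def True mdl(11) using u True mdl(7) by simp
      finally show ?thesis unfolding True using z(1) t(5) mdl(6) by auto
    next
      case False
      define j where "j = Suc k"
      have j: "1 \<le> j" "2 \<le> j" "j < n" "j \<le> n" "1 \<le> Suc j" "2 \<le> Suc j" "Suc j \<le> n"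
        using False k by (simp_all add: j_def)
      have vj: "v = u \<cdot> Inj1 (P j)" "w = u \<cdot> Inj2 (P j)" by (simp_all add: v_def w_def j_def)
      note vt' = vt[folded j_def] and wt' = wt[folded j_def] and u' = u[folded j_def] and pk' = pk[folded j_def]
      have tfj: "tar 2 X f j = f j" "tob 2 X (Suc j) = X (Suc j)" "tob 2 X j = X j" "tob 2 Y j = Y j"
        "tar 2 Y g j = g j" "tob 2 Y (Suc j) = Y (Suc j)"
        using j by (simp_all add: tar_in tob_in)
      have w't: "w' \<in> Arr C" "Dom C w' = Y (Suc j)" "Cod C w' = A" "w' \<cdot> g j = w"
        using w' y(4)[OF j(1,3)] by (simp_all add: mor_iff j_def)
      note pj = p(1-3)[OF j(5,7)] and fj = x(1-4)[OF j(1)] x(1)[OF j(5,7)] and gj = y(1-4)[OF j(1)]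
      let ?q = "w' \<cdot> \<phi> (Suc j)"
      \<comment> \<open>The part of \<open>v\<close> that \<open>w'\<close> does not account for, up
        to sign. It kills \<open>f j\<close> and lifts to \<open>c'\<close>, which supplies the
        first component of the lift of \<open>u\<close>; the sign fits the entry -f of the
        cone.\<close>
      define c where "c = \<ominus> v \<oplus> ?q"
      have ct: "c \<in> Arr C" "Dom C c = X (Suc j)" "Cod C c = A"
        unfolding c_def by (simp_all add: vt' tfj w't pj)
      have "?q \<cdot> f j = w' \<cdot> (g j \<cdot> \<phi> j)" using p(4)[OF j(1,3)] w't pj fj j by simp
      also have "\<dots> = w \<cdot> \<phi> j" by (rule reassoc[OF w't(4)]) (simp_all add: w't gj pk' j)
      also have "\<dots> = v \<cdot> f j" using vw unfolding j_def[symmetric] tfj .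
      finally have "c \<cdot> f j = \<zero>\<^bsub>X j,A\<^esub>"
        unfolding c_def using vt' tfj w't pj fj j by simp
      then obtain c' where c': "c' \<in> mor (Cod C (f (Suc j))) A" "c' \<cdot> f (Suc j) = c"
        using hom_exact_factor[OF eX j(1,3)] ct by (metis morI)
      have vq: "\<ominus> c \<oplus> ?q = v"
        unfolding c_def using vt' tfj w't pj by simp
      note bj = b[OF j(1,4)] and bS = b[OF j(5,7)]
      note ej = mdl(4,5)[OF j(1,3), unfolded tfj]
      have dj: "d j \<in> Arr C" "Dom C (d j) = T j" "Cod C (d j) = T (Suc j)" using t j by simp_all
      show ?thesis
      proof (cases "Suc j = n")
        case False
        then have Sj: "Suc j < n" "1 \<le> Suc (Suc j)" "Suc (Suc j) \<le> n" "2 \<le> Suc (Suc j)" using j by simp_all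
        have t2: "tar 2 X f (Suc j) = f (Suc j)" "tob 2 X (Suc (Suc j)) = X (Suc (Suc j))"
          using j Sj by (simp_all add: tar_in tob_in)
        have c't: "c' \<in> Arr C" "Dom C c' = X (Suc (Suc j))" "Cod C c' = A"
          using c'(1) x(4)[OF j(5) Sj(1)] by (simp_all add: mor_iff)
        have fS: "f (Suc j) \<in> Arr C" "Dom C (f (Suc j)) = X (Suc j)" "Cod C (f (Suc j)) = X (Suc (Suc j))"
          using x(2-4)[of "Suc j"] j Sj by simp_all
        note bS' = bS[unfolded t2 tfj]
        let ?z = "c' \<cdot> Prj1 (P (Suc j)) \<oplus> w' \<cdot> Prj2 (P (Suc j))"
        have zt: "?z \<in> mor (T (Suc j)) A" by (simp add: mor_iff bS' c't w't)
        have "?z \<cdot> d j = u"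
        proof (rule biproduct_epi[OF P[OF j(1,4)], unfolded PT, of _ A])
          have "(?z \<cdot> d j) \<cdot> Inj1 (P j) = ?z \<cdot> (d j \<cdot> Inj1 (P j))"
            by (simp add: bS' bj c't w't dj)
          also have "\<dots> = \<ominus> (c' \<cdot> f (Suc j)) \<oplus> ?q"
            unfolding ej t2 by (simp add: bS' c't w't pj fS fj)
          also have "\<dots> = u \<cdot> Inj1 (P j)" unfolding c'(2) vq by (rule vj(1))
          finally show "(?z \<cdot> d j) \<cdot> Inj1 (P j) = u \<cdot> Inj1 (P j)" .
          have "(?z \<cdot> d j) \<cdot> Inj2 (P j) = ?z \<cdot> (d j \<cdot> Inj2 (P j))"
            by (simp add: bS' bj c't w't dj)
          also have "\<dots> = w' \<cdot> g j"
            unfolding ej using j by (simp add: bS' c't w't gj wt')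
          also have "\<dots> = u \<cdot> Inj2 (P j)" unfolding w't(4) by (rule vj(2))
          finally show "(?z \<cdot> d j) \<cdot> Inj2 (P j) = u \<cdot> Inj2 (P j)" .
        qed (use zt u' in \<open>simp_all add: mor_iff dj\<close>)
        moreover have "Cod C (d (Suc k)) = T (Suc j)" using dj by (simp add: j_def)
        ultimately show ?thesis using zt unfolding j_def by auto
      next
        case True
        have c't: "c' \<in> Arr C" "Dom C c' = SO (X 1)" "Cod C c' = A" "c' \<cdot> f n = c"
          using c' x True by (simp_all add: mor_iff)
        \<comment> \<open>At position n the summand from X is omitted; \<open>c'\<close> starts at
          \<open>SO (X 1)\<close> and is brought in through \<open>g n\<close>. The second component
          is undisturbed, as \<open>g n \<cdot> g j\<close> vanishes.\<close>
        let ?z = "w' \<oplus> \<ominus> (c' \<cdot> g n)"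
        have w'n: "Dom C w' = Y n" "?q = w' \<cdot> \<phi> n" using w't True by simp_all
        have zt: "?z \<in> mor (T n) A" by (simp add: mor_iff mdl(7) w't(1,3) w'n(1) c't y gn)
        have gg: "g n \<cdot> g j = \<zero>\<^bsub>Y j,SO (X 1)\<^esub>" using hom_exactD(2)[OF eY j(1,3)] True gn by simp
        have dj': "Cod C (d j) = Y n" "Cod C (g j) = Y n" using dj True mdl(7) gj j by simp_all
        note ej' = ej[unfolded True mdl(11) i1]
        have "?z \<cdot> d j = u"
        proof (rule biproduct_epi[OF P[OF j(1,4)], unfolded PT, of _ A])
          have "(?z \<cdot> d j) \<cdot> Inj1 (P j) = ?z \<cdot> (d j \<cdot> Inj1 (P j))"
            by (simp add: bj c't w't(1,3) w'n(1) dj(1,2) dj' y gn)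
          also have "d j \<cdot> Inj1 (P j) = \<phi> n"
            unfolding ej' using tk p x y by simp
          also have "?z \<cdot> \<phi> n = ?q \<oplus> \<ominus> (c' \<cdot> f n)"
            by (simp add: w't(1,3) w'n c't y gn p fn)
          also have "\<dots> = \<ominus> c \<oplus> ?q" unfolding c't(4)
            by (rule add_commute) (simp_all add: ct w't pj)
          also have "\<dots> = u \<cdot> Inj1 (P j)" unfolding vq by (rule vj(1))
          finally show "(?z \<cdot> d j) \<cdot> Inj1 (P j) = u \<cdot> Inj1 (P j)" .
          have "(?z \<cdot> d j) \<cdot> Inj2 (P j) = ?z \<cdot> (d j \<cdot> Inj2 (P j))"
            by (simp add: bj c't w't(1,3) w'n(1) dj(1,2) dj' y gn)
          also have "d j \<cdot> Inj2 (P j) = g j"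
            unfolding ej' using j by (simp add: gj(1-3) dj')
          also have "?z \<cdot> g j = w"
            using j by (simp add: gj(1-3) dj' w't(1,3,4) w'n(1) c't y gn gg wt' u(4))
          also have "w = u \<cdot> Inj2 (P j)" by (rule vj(2))
          finally show "(?z \<cdot> d j) \<cdot> Inj2 (P j) = u \<cdot> Inj2 (P j)" .
        qed (use zt u' True in \<open>simp_all add: mor_iff dj\<close>)
        moreover have "Cod C (d (Suc k)) = T n" using dj True by (simp add: j_def)
        ultimately show ?thesis using zt unfolding j_def by auto
      qed
    qed
  qed
  then show ?thesis by (simp add: T_def d_def)
qed

section \<open>Maps between cones induced by homotopy commutative squares\<close>

definition tmo :: "(nat \<Rightarrow> 'o) \<Rightarrow> (nat \<Rightarrow> 'o) \<Rightarrow> (nat \<Rightarrow> 'm) \<Rightarrow> nat \<Rightarrow> 'm" where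
  "tmo X Y \<phi> k = (if 2 \<le> k \<and> k \<le> n then \<phi> k else \<zero>\<^bsub>tob 2 X k,tob 2 Y k\<^esub>)"

lemma tmo_in: "2 \<le> k \<Longrightarrow> k \<le> n \<Longrightarrow> tmo X Y \<phi> k = \<phi> k"
  by (simp add: tmo_def)

lemma tmo_arr:
  assumes X: "is_nseq n C S (X, f)" and Y: "is_nseq n C S (Y, g)"
    and \<phi>: "nseq_morphism n C S (X, f) (Y, g) \<phi>"
  shows "tmo X Y \<phi> k \<in> Arr C" "Dom C (tmo X Y \<phi> k) = tob 2 X k" "Cod C (tmo X Y \<phi> k) = tob 2 Y k"
  using tob_Ob[OF X, of 2 k] tob_Ob[OF Y, of 2 k] morphismD(1-3)[OF \<phi>, of k]
  by (auto simp: tmo_def tob_def)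

lemma tmo_tar:
  assumes X: "is_nseq n C S (X, f)" and Y: "is_nseq n C S (Y, g)"
    and \<phi>: "nseq_morphism n C S (X, f) (Y, g) \<phi>"
  shows "tmo X Y \<phi> (Suc k) \<cdot> tar 2 X f k = tar 2 Y g k \<cdot> tmo X Y \<phi> k"
proof -
  note t = tmo_arr[OF assms] tar_arr[OF X, of 2, simplified] tar_arr[OF Y, of 2, simplified]
  let ?l = "tmo X Y \<phi> (Suc k) \<cdot> tar 2 X f k" and ?r = "tar 2 Y g k \<cdot> tmo X Y \<phi> k"
  consider "k < 2" | "n \<le> k" | "2 \<le> k" "k < n" by linarith
  then show ?thesis
  proof cases
    case 1
    then have "tob 2 X k = N" by (simp add: tob_low)
    then show ?thesis using from_zero_ob[of ?l] from_zero_ob[of ?r] t by simp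
  next
    case 2
    then have "tob 2 Y (Suc k) = N" by (simp add: tob_high)
    then show ?thesis using to_zero_ob[of ?l] to_zero_ob[of ?r] t by simp
  next
    case 3
    then have "1 \<le> k" "2 \<le> Suc k" "Suc k \<le> n" "k \<le> n" by simp_all
    then show ?thesis using 3 morphismD(4)[OF \<phi>, of k] by (simp add: tmo_in tar_in)
  qed
qed

text \<open>A square commuting up to the homotopy \<open>\<sigma>\<close> induces a map of cones
  with a lower triangular matrix: \<open>a\<close> and \<open>b\<close> on the diagonal,
  \<open>\<sigma>\<close> below it. The condition \<open>a 1 = b 1\<close> closes the last square,
  whose differentials pass through the first objects.\<close>

lemma row3_morphism:
  assumes X: "is_nseq n C S (X, f)" and Y: "is_nseq n C S (Y, g)"
    and \<phi>: "nseq_morphism n C S (X, f) (Y, g) \<phi>" and XY: "Y 1 = X 1"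
    and X': "is_nseq n C S (X', f')" and Y': "is_nseq n C S (Y', g')"
    and \<phi>': "nseq_morphism n C S (X', f') (Y', g') \<phi>'" and XY': "Y' 1 = X' 1"
    and a: "nseq_morphism n C S (X, f) (X', f') a" and b: "nseq_morphism n C S (Y, g) (Y', g') b"
    and ab: "a 1 = b 1"
    and \<sigma>: "\<And>k. \<sigma> k \<in> mor (tob 2 X (Suc k)) (tob 2 Y' k)"
    and h: "\<And>k. 1 \<le> k \<Longrightarrow> k < n \<Longrightarrow> b (Suc k) \<cdot> \<phi> (Suc k) =
       \<phi>' (Suc k) \<cdot> a (Suc k) \<oplus> tar 2 Y' g' k \<cdot> \<sigma> k \<oplus> \<sigma> (Suc k) \<cdot> tar 2 X f (Suc k)"
  obtains i where "nseq_morphism n C S (row3 n C S X f Y g \<phi>) (row3 n C S X' f' Y' g' \<phi>') i" "i 1 = a 2"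
proof -
  have pm: "\<forall>k\<in>{2..n}. \<phi> k \<in> mor (X k) (Y k)" "\<forall>k\<in>{2..n}. \<phi>' k \<in> mor (X' k) (Y' k)"
    using morphismD(1-3)[OF \<phi>] morphismD(1-3)[OF \<phi>'] by (simp_all add: mor_iff)
  define T d P where "T = fst (row3 n C S X f Y g \<phi>)" and "d = snd (row3 n C S X f Y g \<phi>)"
    and "P = cone_bip X Y"
  define T' d' P' where "T' = fst (row3 n C S X' f' Y' g' \<phi>')" and "d' = snd (row3 n C S X' f' Y' g' \<phi>')"
    and "P' = cone_bip X' Y'"
  note m = row3_model[OF X Y pm(1) XY, folded T_def d_def P_def]
  note m' = row3_model[OF X' Y' pm(2) XY', folded T'_def d'_def P'_def]
  note B = biproduct_rules[OF m(1), unfolded m(2)] and B' = biproduct_rules[OF m'(1), unfolded m'(2)]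
  note t = nseqD[OF m(13)] and t' = nseqD[OF m'(13)]
  note s = \<sigma>[unfolded mor_iff, THEN conjunct1] \<sigma>[unfolded mor_iff, THEN conjunct2, THEN conjunct1]
    \<sigma>[unfolded mor_iff, THEN conjunct2, THEN conjunct2]
  note ta = tmo_arr[OF X X' a] and tb = tmo_arr[OF Y Y' b]
  note tr = tar_arr[OF X, of 2, simplified] tar_arr[OF Y, of 2, simplified]
    tar_arr[OF X', of 2, simplified] tar_arr[OF Y', of 2, simplified]
  note o = tob_Ob[OF X, of 2, simplified] tob_Ob[OF Y, of 2, simplified]
    tob_Ob[OF X', of 2, simplified] tob_Ob[OF Y', of 2, simplified]
  note x = nseqD[OF X] and y = nseqD[OF Y, unfolded XY] and x' = nseqD[OF X'] and y' = nseqD[OF Y', unfolded XY']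
  let ?a = "tmo X X' a" and ?b = "tmo Y Y' b"
  define i where "i k = Inj1 (P' k) \<cdot> (?a (Suc k) \<cdot> Prj1 (P k)) \<oplus> Inj2 (P' k) \<cdot> (\<sigma> k \<cdot> Prj1 (P k))
    \<oplus> Inj2 (P' k) \<cdot> (?b k \<cdot> Prj2 (P k))" for k
  have it: "i k \<in> Arr C" "Dom C (i k) = T k" "Cod C (i k) = T' k"
    and i1: "i k \<cdot> Inj1 (P k) = Inj1 (P' k) \<cdot> ?a (Suc k) \<oplus> Inj2 (P' k) \<cdot> \<sigma> k"
    and i2: "i k \<cdot> Inj2 (P k) = Inj2 (P' k) \<cdot> ?b k"
    if k: "1 \<le> k" "k \<le> n" for k
    unfolding i_def by (simp_all add: B B' ta tb s o k)
  \<comment> \<open>At position 1 the component \<open>\<sigma> 1\<close> ends in the zero object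
    that replaces \<open>Y' 1\<close>, so only \<open>a 2\<close> remains.\<close>
  have i_1: "i 1 = a 2"
  proof -
    have a2: "a 2 \<in> Arr C" "Dom C (a 2) = X 2" "Cod C (a 2) = X' 2" using morphismD(1-3)[OF a, of 2] by simp_all
    have "(i 1 \<cdot> Inj1 (P 1)) = i 1" using it[of 1] m(6) unfolding m(9) by simp
    moreover have "Inj2 (P' 1) = \<zero>\<^bsub>N,X' 2\<^esub>"
      using from_zero_ob[of "Inj2 (P' 1)"] B'(7-9)[of 1] m'(6) by (simp add: tob_low)
    moreover have "\<sigma> 1 \<in> Arr C" "Dom C (\<sigma> 1) = X 2" "Cod C (\<sigma> 1) = N"
      using s[of 1] by (simp_all add: tob_low tob_in)
    moreover have "X' 2 \<in> Ob C" "Suc 1 = 2" using x'(1)[of 2] by simp_all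
    ultimately show ?thesis using i1[of 1] a2 m'(9) by (simp add: tmo_in)
  qed
  have mi: "nseq_morphism n C S (T, d) (T', d') i"
  proof (rule morphismI)
    fix k assume "1 \<le> k" "k \<le> n" then show "i k \<in> mor (T k) (T' k)" by (simp add: mor_iff it)
  next
    fix k assume k: "1 \<le> k" "k < n"
    then have k': "k \<le> n" "1 \<le> Suc k" "Suc k \<le> n" "2 \<le> Suc k" by simp_all
    note bk = B[OF k(1) k'(1)] B[OF k'(2,3)] B'[OF k(1) k'(1)] B'[OF k'(2,3)]
    note ik = it[OF k(1) k'(1)] it[OF k'(2,3)] i1[OF k(1) k'(1)] i1[OF k'(2,3)] i2[OF k(1) k'(1)] i2[OF k'(2,3)]
    have e: "\<phi> (Suc k) \<in> Arr C" "Dom C (\<phi> (Suc k)) = tob 2 X (Suc k)" "Cod C (\<phi> (Suc k)) = tob 2 Y (Suc k)"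
      "\<phi>' (Suc k) \<in> Arr C" "Dom C (\<phi>' (Suc k)) = tob 2 X' (Suc k)" "Cod C (\<phi>' (Suc k)) = tob 2 Y' (Suc k)"
      using morphismD(1-3)[OF \<phi>, of "Suc k"] morphismD(1-3)[OF \<phi>', of "Suc k"] k' by (simp_all add: tob_in)
    have dk: "d k \<in> Arr C" "Dom C (d k) = T k" "Cod C (d k) = T (Suc k)"
      "d' k \<in> Arr C" "Dom C (d' k) = T' k" "Cod C (d' k) = T' (Suc k)" using t t' k by simp_all
    have hk: "?b (Suc k) \<cdot> \<phi> (Suc k) =
       \<phi>' (Suc k) \<cdot> ?a (Suc k) \<oplus> tar 2 Y' g' k \<cdot> \<sigma> k \<oplus> \<sigma> (Suc k) \<cdot> tar 2 X f (Suc k)"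
      using h[OF k] k' by (simp add: tmo_in)
    note ct = tmo_tar[OF X X' a] tmo_tar[OF Y Y' b]
    note all = bk ik e dk s ta tb tr o
    show "i (Suc k) \<cdot> d k = d' k \<cdot> i k"
    proof (rule biproduct_epi[OF m(1)[OF k(1) k'(1)], unfolded m(2), of _ "T' (Suc k)"])
      have "(i (Suc k) \<cdot> d k) \<cdot> Inj1 (P k) = \<ominus> (i (Suc k) \<cdot> Inj1 (P (Suc k)) \<cdot> tar 2 X f (Suc k)) \<oplus>
          i (Suc k) \<cdot> Inj2 (P (Suc k)) \<cdot> \<phi> (Suc k)"
        by (simp add: m(4)[OF k] bk ik(1-6) e dk tr)
      also have "\<dots> = \<ominus> (Inj1 (P' (Suc k)) \<cdot> (?a (Suc (Suc k)) \<cdot> tar 2 X f (Suc k))) \<oplus>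
          \<ominus> (Inj2 (P' (Suc k)) \<cdot> (\<sigma> (Suc k) \<cdot> tar 2 X f (Suc k))) \<oplus>
          Inj2 (P' (Suc k)) \<cdot> (?b (Suc k) \<cdot> \<phi> (Suc k))"
        unfolding ik(8,10) by (simp add: bk(1-15) bk(26-40) bk(51-65) bk(76-90) e dk tr s ta tb)
      also have "\<dots> = \<ominus> (Inj1 (P' (Suc k)) \<cdot> (tar 2 X' f' (Suc k) \<cdot> ?a (Suc k))) \<oplus>
          Inj2 (P' (Suc k)) \<cdot> (\<phi>' (Suc k) \<cdot> ?a (Suc k)) \<oplus> Inj2 (P' (Suc k)) \<cdot> (tar 2 Y' g' k \<cdot> \<sigma> k)"
        unfolding hk ct by (simp add: bk e dk tr s ta tb o add_cancel3)
      also have "\<dots> = d' k \<cdot> Inj1 (P' k) \<cdot> ?a (Suc k) \<oplus> d' k \<cdot> Inj2 (P' k) \<cdot> \<sigma> k"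
        unfolding m'(4,5)[OF k] by (simp add: bk e dk tr s ta tb)
      also have "\<dots> = (d' k \<cdot> i k) \<cdot> Inj1 (P k)"
        by (simp add: bk ik(1-7) dk ta s)
      finally show "(i (Suc k) \<cdot> d k) \<cdot> Inj1 (P k) = (d' k \<cdot> i k) \<cdot> Inj1 (P k)" .
      have "(i (Suc k) \<cdot> d k) \<cdot> Inj2 (P k) = i (Suc k) \<cdot> Inj2 (P (Suc k)) \<cdot> tar 2 Y g k"
        by (simp add: m(5)[OF k] bk ik(1-6) e dk tr)
      also have "\<dots> = Inj2 (P' (Suc k)) \<cdot> (?b (Suc k) \<cdot> tar 2 Y g k)"
        unfolding ik(10) by (simp add: bk e dk tr s ta tb)
      also have "\<dots> = d' k \<cdot> Inj2 (P' k) \<cdot> ?b k"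
        unfolding ct m'(5)[OF k] by (simp add: bk e dk tr s ta tb)
      also have "\<dots> = (d' k \<cdot> i k) \<cdot> Inj2 (P k)"
        by (simp add: bk ik(1-6) ik(9) dk tb s)
      finally show "(i (Suc k) \<cdot> d k) \<cdot> Inj2 (P k) = (d' k \<cdot> i k) \<cdot> Inj2 (P k)" .
    qed (simp_all add: mor_iff all)
  next
    have f1: "f 1 \<in> Arr C" "Dom C (f 1) = X 1" "Cod C (f 1) = X 2"
      "f' 1 \<in> Arr C" "Dom C (f' 1) = X' 1" "Cod C (f' 1) = X' 2" using x(2-4)[of 1] x'(2-4)[of 1] by simp_all
    have a12: "a 1 \<in> Arr C" "Dom C (a 1) = X 1" "Cod C (a 1) = X' 1"
      "a 2 \<in> Arr C" "Dom C (a 2) = X 2" "Cod C (a 2) = X' 2" using morphismD(1-3)[OF a, of 1] morphismD(1-3)[OF a, of 2] by simp_all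
    have bn: "b n \<in> Arr C" "Dom C (b n) = Y n" "Cod C (b n) = Y' n" using morphismD(9-11)[OF b] .
    have sn: "\<sigma> n = \<zero>\<^bsub>N,Y' n\<^esub>" using from_zero_ob[of "\<sigma> n"] s[of n] by (simp add: tob_high tob_in)
    have pn: "Prj1 (P n) \<in> Arr C" "Dom C (Prj1 (P n)) = Y n" "Cod C (Prj1 (P n)) = N"
      using B(10-12)[of n] m(7) by (simp_all add: tob_high)
    have tan: "?a (Suc n) \<in> Arr C" "Dom C (?a (Suc n)) = N" "Cod C (?a (Suc n)) = N" using ta[of "Suc n"] by (simp_all add: tob_high)
    have jn: "Inj1 (P' n) = \<zero>\<^bsub>N,Y' n\<^esub>"
      using from_zero_ob[of "Inj1 (P' n)"] B'(4-6)[of n] m'(7) by (simp add: tob_high)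
    have i_n: "i n = b n"
      unfolding i_def m(12) m'(11) jn sn by (simp add: tmo_in bn pn tan y y')
    have "SA (i 1) \<cdot> d n = SA (a 2 \<cdot> f 1) \<cdot> g n"
      unfolding i_1 m(8) by (simp add: a12 f1 y)
    also have "a 2 \<cdot> f 1 = f' 1 \<cdot> b 1" using morphismD(4)[OF a, of 1] ab by simp
    also have "SA (f' 1 \<cdot> b 1) \<cdot> g n = SA (f' 1) \<cdot> (SA (b 1) \<cdot> g n)"
      using a12 f1 y ab by simp
    also have "\<dots> = d' n \<cdot> i n"
      unfolding i_n m'(8) morphismD(5)[OF b] using f1 y' bn by simp
    finally show "SA (i 1) \<cdot> d n = d' n \<cdot> i n" .
  qed
  show thesis using that mi i_1 by (simp add: T_def d_def T'_def d'_def)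
qed

text \<open>The homotopy is extended by zeros to all indices of the sequence truncated to positions
  2 to n, the shape that maps between cones require. Nothing is lost: it begins with zeros and has
  no component from \<open>SO (V 1)\<close>.\<close>

lemma null_homotopy_trunc:
  assumes V: "hom_exact V d" and U: "is_nseq n C S (U, e)"
    and i: "nseq_morphism n C S (V, d) (U, e) i" and r: "nseq_morphism n C S (U, e) (V, d) r"
    and ri: "r 1 \<cdot> i 1 = \<one>\<^bsub>V 1\<^esub>" "r 2 \<cdot> i 2 = \<one>\<^bsub>V 2\<^esub>"
  obtains r' s where "nseq_morphism n C S (U, e) (V, d) r'" "r' 1 = r 1" "r' 2 = r 2"
    "\<And>k. s k \<in> mor (tob 2 V (Suc k)) (tob 2 V k)"
    "\<And>k. 1 \<le> k \<Longrightarrow> k < n \<Longrightarrow>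
       r' (Suc k) \<cdot> i (Suc k) \<oplus> tar 2 V d k \<cdot> s k \<oplus> s (Suc k) \<cdot> tar 2 V d (Suc k) = \<one>\<^bsub>V (Suc k)\<^esub>"
proof -
  note nV = hom_exactD(1)[OF V]
  obtain r' s where r': "nseq_morphism n C S (U, e) (V, d) r'" "\<And>k. 1 \<le> k \<Longrightarrow> k < n \<Longrightarrow> r' k = r k"
    and s: "\<And>k. 1 \<le> k \<Longrightarrow> k < n \<Longrightarrow> s k \<in> mor (V (Suc k)) (V k)" and s2: "s 2 = \<zero>\<^bsub>V 3,V 2\<^esub>"
    and mid: "\<And>k. 2 \<le> k \<Longrightarrow> Suc k < n \<Longrightarrow>
       r' (Suc k) \<cdot> i (Suc k) \<oplus> d k \<cdot> s k \<oplus> s (Suc k) \<cdot> d (Suc k) = \<one>\<^bsub>V (Suc k)\<^esub>"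
    and last: "r' n \<cdot> i n \<oplus> d (n - 1) \<cdot> s (n - 1) = \<one>\<^bsub>V n\<^esub>"
    using null_homotopy[OF assms] by blast
  note v = nseqD[OF nV] and rm = morphismD[OF r'(1)] and im = morphismD[OF i]
  note o = tob_Ob[OF nV, of 2, simplified] and ta = tar_arr[OF nV, of 2, simplified]
  define s' where "s' k = (if 2 \<le> k \<and> k < n then s k else \<zero>\<^bsub>tob 2 V (Suc k),tob 2 V k\<^esub>)" for k
  have s': "s' k \<in> mor (tob 2 V (Suc k)) (tob 2 V k)" for k
  proof (cases "2 \<le> k \<and> k < n")
    case True
    then have "1 \<le> k" "2 \<le> Suc k" "Suc k \<le> n" by simp_all
    then show ?thesis using s[of k] True by (simp add: s'_def tob_in)
  next
    case False
    then show ?thesis using o by (auto simp: s'_def mor_iff)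
  qed
  show thesis
  proof (rule that[OF r'(1) _ _ s'])
    show "r' 1 = r 1" "r' 2 = r 2" using r'(2) by simp_all
    fix k assume k: "1 \<le> k" "k < n"
    then have k': "1 \<le> Suc k" "Suc k \<le> n" "2 \<le> Suc k" by simp_all
    have tk: "tob 2 V (Suc k) = V (Suc k)" using k' by (simp add: tob_in)
    have rit: "r' (Suc k) \<cdot> i (Suc k) \<in> mor (V (Suc k)) (V (Suc k))" using k' by (simp add: mor_iff rm im)
    have oS: "V (Suc k) \<in> Ob C" using v(1)[OF k'(1,2)] .
    consider "k = 1" | "2 \<le> k" "Suc k < n" | "2 \<le> k" "Suc k = n" using k by linarith
    then show "r' (Suc k) \<cdot> i (Suc k) \<oplus> tar 2 V d k \<cdot> s' k \<oplus> s' (Suc k) \<cdot> tar 2 V d (Suc k) = \<one>\<^bsub>V (Suc k)\<^esub>"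
    proof cases
      case 1
      have S: "Suc 1 = 2" "Suc 2 = 3" by simp_all
      have "s' 1 = \<zero>\<^bsub>V 2,N\<^esub>" "s' 2 = \<zero>\<^bsub>V 3,V 2\<^esub>" by (simp_all add: s'_def tob_in tob_low s2)
      moreover have "tar 2 V d 1 \<in> Arr C" "Dom C (tar 2 V d 1) = N" "Cod C (tar 2 V d 1) = V 2"
        using ta[of 1] by (simp_all add: tob_in tob_low)
      moreover have "tar 2 V d 2 \<in> Arr C" "Dom C (tar 2 V d 2) = V 2" "Cod C (tar 2 V d 2) = V 3"
        using ta[of 2] by (simp_all add: tob_in tob_low)
      moreover have "r' 2 \<cdot> i 2 = \<one>\<^bsub>V 2\<^esub>" "V 2 \<in> Ob C" using r'(2)[of 2] ri(2) v(1)[of 2] by simp_all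
      ultimately show ?thesis unfolding 1 S by simp
    next
      case 2
      then show ?thesis using mid[of k] k by (simp add: s'_def tar_in)
    next
      case 3
      have "s' (Suc k) \<cdot> tar 2 V d (Suc k) = \<zero>\<^bsub>V (Suc k),V (Suc k)\<^esub>"
      proof -
        have "s' (Suc k) = \<zero>\<^bsub>tob 2 V (Suc (Suc k)),V (Suc k)\<^esub>" using 3 tk by (simp add: s'_def)
        then show ?thesis using ta[of "Suc k"] oS unfolding tk by simp
      qed
      moreover have kn: "n - 1 = k" using 3 by simp
      have "s' k = s k" "tar 2 V d k = d k" using 3 k by (simp_all add: s'_def tar_in)
      moreover have "d k \<cdot> s k \<in> mor (V (Suc k)) (V (Suc k))" using s[OF k] k v(2-4)[of k] by (simp add: mor_iff)
      ultimately show ?thesis using last[unfolded kn] 3 by (simp add: mor_iff)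
    qed
  qed
qed

section \<open>From (N4-5) to (N4-1)\<close>

lemma cone_nseq_shift:
  assumes "1 \<le> k"
  shows "fst (cone_nseq n C (\<lambda>i. X (i + 1)) (\<lambda>i. f (i + 1)) (\<lambda>i. Y (i + 1)) (\<lambda>i. g (i + 1)) (\<lambda>i. \<phi> (i + 1))
       (SA (f 1) \<cdot> g n)) k = fst (row3 n C S X f Y g \<phi>) k"
    "snd (cone_nseq n C (\<lambda>i. X (i + 1)) (\<lambda>i. f (i + 1)) (\<lambda>i. Y (i + 1)) (\<lambda>i. g (i + 1)) (\<lambda>i. \<phi> (i + 1))
       (SA (f 1) \<cdot> g n)) k = snd (row3 n C S X f Y g \<phi>) k"
proof -
  have "cone_mask n j = row3_mask n j" for j by (simp add: cone_mask_def row3_mask_def Suc_le_eq flip: Suc_eq_plus1)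
  moreover have "k - 1 + 1 = k" "k + 1 + 1 = k + 2" using assms by simp_all
  ultimately show "fst (cone_nseq n C (\<lambda>i. X (i + 1)) (\<lambda>i. f (i + 1)) (\<lambda>i. Y (i + 1)) (\<lambda>i. g (i + 1)) (\<lambda>i. \<phi> (i + 1))
       (SA (f 1) \<cdot> g n)) k = fst (row3 n C S X f Y g \<phi>) k"
    "snd (cone_nseq n C (\<lambda>i. X (i + 1)) (\<lambda>i. f (i + 1)) (\<lambda>i. Y (i + 1)) (\<lambda>i. g (i + 1)) (\<lambda>i. \<phi> (i + 1))
       (SA (f 1) \<cdot> g n)) k = snd (row3 n C S X f Y g \<phi>) k"
    unfolding cone_nseq_def row3_def by (simp_all only: fst_conv snd_conv)
qed

lemma homotopy_cartesian_row3:
  assumes X: "is_nseq n C S (X, f)" and Y: "is_nseq n C S (Y, g)" and XY: "Y 1 = X 1"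
    and \<phi>: "nseq_morphism n C S (X, f) (Y, g) \<phi>"
  shows "homotopy_cartesian n C S \<Theta> (\<lambda>i. X (i + 1)) (\<lambda>i. f (i + 1)) (\<lambda>i. Y (i + 1)) (\<lambda>i. g (i + 1)) (\<lambda>i. \<phi> (i + 1))
       (SA (f 1) \<cdot> g n) \<longleftrightarrow> row3 n C S X f Y g \<phi> \<in> \<Theta>"
proof -
  let ?c = "cone_nseq n C (\<lambda>i. X (i + 1)) (\<lambda>i. f (i + 1)) (\<lambda>i. Y (i + 1)) (\<lambda>i. g (i + 1)) (\<lambda>i. \<phi> (i + 1)) (SA (f 1) \<cdot> g n)"
  let ?r = "row3 n C S X f Y g \<phi>"
  note s = cone_nseq_shift[of _ X f Y g \<phi>]
  have "?r \<in> \<Theta> \<Longrightarrow> ?c \<in> \<Theta>"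
    using Theta_cong[of "fst ?r" "snd ?r" "fst ?c" "snd ?c"] s by simp
  moreover have "?c \<in> \<Theta> \<Longrightarrow> ?r \<in> \<Theta>"
    using Theta_cong[of "fst ?c" "snd ?c" "fst ?r" "snd ?r"] s by simp
  moreover note x = nseqD[OF X] and y = nseqD[OF Y, unfolded XY] and p = morphismD[OF \<phi>]
  have "SA (f 1) \<cdot> g n \<in> mor (Y (n - 1 + 1)) (SO (X (1 + 1)))"
    using x(2-4)[of 1] y by (simp add: mor_iff)
  moreover have "X (i + 1) \<in> Ob C \<and> Y (i + 1) \<in> Ob C \<and> \<phi> (i + 1) \<in> mor (X (i + 1)) (Y (i + 1))"
    if "i \<in> {1..n - 1}" for i
  proof -
    have "1 \<le> i + 1" "i + 1 \<le> n" using that by auto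
    then show ?thesis by (simp add: x y p mor_iff)
  qed
  moreover have "f (i + 1) \<in> mor (X (i + 1)) (X (i + 1 + 1)) \<and> g (i + 1) \<in> mor (Y (i + 1)) (Y (i + 1 + 1)) \<and>
        \<phi> (i + 1 + 1) \<cdot> f (i + 1) = g (i + 1) \<cdot> \<phi> (i + 1)" if "i \<in> {1..<n - 1}" for i
  proof -
    have i: "1 \<le> Suc i" "Suc i < n" "Suc i \<le> n" using that by auto
    then have "f (Suc i) \<in> mor (X (Suc i)) (X (Suc (Suc i))) \<and> g (Suc i) \<in> mor (Y (Suc i)) (Y (Suc (Suc i))) \<and>
        \<phi> (Suc (Suc i)) \<cdot> f (Suc i) = g (Suc i) \<cdot> \<phi> (Suc i)"
      by (simp add: x y p mor_iff)
    then show ?thesis by (simp flip: Suc_eq_plus1)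
  qed
  ultimately show ?thesis unfolding homotopy_cartesian_def by blast
qed

theorem N4_5_imp_N4_1:
  assumes "N4_5 n C S \<Theta>"
  shows "N4_1 n C S \<Theta>"
  unfolding N4_1_def
proof (intro allI impI, elim conjE)
  fix X f Y g p
  assume X: "(X, f) \<in> \<Theta>" and Y: "(Y, g) \<in> \<Theta>" and XY: "Y 1 = X 1"
    and p: "p \<in> mor (X 2) (Y 2)" and pf: "p \<cdot> f 1 = g 1"
  note nX = Theta_nseq[OF X] and nY = Theta_nseq[OF Y]
  note x = nseqD[OF nX] and y = nseqD[OF nY, unfolded XY]
  have S2: "Suc 1 = 2" by simp
  have f1: "f 1 \<in> Arr C" "Dom C (f 1) = X 1" "Cod C (f 1) = X 2" using x(2-4)[of 1] by simp_all
  have g1: "g 1 \<in> Arr C" "Dom C (g 1) = X 1" "Cod C (g 1) = Y 2" using y(2-4)[of 1] XY by simp_all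
  obtain X' f' Y' g' Z' h' \<phi>' \<psi>' \<theta>' where f'1: "f' 1 = f 1" and \<phi>'2: "\<phi>' 2 = p"
    and D: "diagram_D n C S \<Theta> X' f' Y' g' Z' h' \<phi>' \<psi>' \<theta>'"
    using assms f1 p unfolding N4_5_def mor_iff by metis
  have XY': "Y' 1 = X' 1" and \<phi>'1: "\<phi>' 1 = \<one>\<^bsub>X' 1\<^esub>" and X': "(X', f') \<in> \<Theta>" and Y': "(Y', g') \<in> \<Theta>"
    and R: "row3 n C S X' f' Y' g' \<phi>' \<in> \<Theta>" and \<phi>': "nseq_morphism n C S (X', f') (Y', g') \<phi>'"
    using D unfolding diagram_D_def by auto
  note nX' = Theta_nseq[OF X'] and nY' = Theta_nseq[OF Y']
  note x' = nseqD[OF nX'] and y' = nseqD[OF nY'] and pm' = morphismD[OF \<phi>']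
  have X1: "X' 1 = X 1" "X' 2 = X 2" using x'(3,4)[of 1] f'1 f1 by simp_all
  have Y1: "Y' 1 = X 1" "Y' 2 = Y 2" using XY' X1 pm'(3)[of 2] \<phi>'2 p by (simp_all add: mor_iff)
  have X1o: "X 1 \<in> Ob C" "X 2 \<in> Ob C" "Y 2 \<in> Ob C" using x(1)[of 1] x(1)[of 2] y(1)[of 2] by simp_all
  have g'1: "g' 1 = g 1"
    using pm'(4)[of 1] y'(2,3)[of 1] by (simp add: \<phi>'2 f'1 pf \<phi>'1 XY')
  \<comment> \<open>The n-angles supplied by (N4-5) are tied to the given ones only through their
    first morphisms; (N3) yields comparison maps in both directions that are identities in degrees 1
    and 2.\<close>
  obtain u where u: "u 1 = \<one>\<^bsub>X 1\<^esub>" "u 2 = \<one>\<^bsub>X 2\<^esub>" "nseq_morphism n C S (X, f) (X', f') u"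
    using N3[OF X X', of "\<one>\<^bsub>X 1\<^esub>" "\<one>\<^bsub>X 2\<^esub>"] X1 X1o f'1 f1 by (auto simp: mor_iff)
  obtain v where v: "v 1 = \<one>\<^bsub>X 1\<^esub>" "v 2 = \<one>\<^bsub>X 2\<^esub>" "nseq_morphism n C S (X', f') (X, f) v"
    using N3[OF X' X, of "\<one>\<^bsub>X 1\<^esub>" "\<one>\<^bsub>X 2\<^esub>"] X1 X1o f'1 f1 by (auto simp: mor_iff)
  obtain w where w: "w 1 = \<one>\<^bsub>X 1\<^esub>" "w 2 = \<one>\<^bsub>Y 2\<^esub>" "nseq_morphism n C S (Y', g') (Y, g) w"
    using N3[OF Y' Y, of "\<one>\<^bsub>X 1\<^esub>" "\<one>\<^bsub>Y 2\<^esub>"] XY Y1 X1o g'1 g1 by (auto simp: mor_iff)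
  obtain t where t: "t 1 = \<one>\<^bsub>X 1\<^esub>" "t 2 = \<one>\<^bsub>Y 2\<^esub>" "nseq_morphism n C S (Y, g) (Y', g') t"
    using N3[OF Y Y', of "\<one>\<^bsub>X 1\<^esub>" "\<one>\<^bsub>Y 2\<^esub>"] XY Y1 X1o g'1 g1 by (auto simp: mor_iff)
  \<comment> \<open>After a correction in degree n, \<open>u' \<cdot> v\<close> is homotopic to the
    identity of the supplied n-angle on \<open>f 1\<close>. The next step does the same with
    \<open>t' \<cdot> w\<close> for the one on \<open>g 1\<close>.\<close>
  obtain u' \<tau> where u': "nseq_morphism n C S (X, f) (X', f') u'" "u' 1 = u 1" "u' 2 = u 2"
    and \<tau>: "\<And>k. \<tau> k \<in> mor (tob 2 X' (Suc k)) (tob 2 X' k)"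
    and \<tau>h: "\<And>k. 1 \<le> k \<Longrightarrow> k < n \<Longrightarrow> u' (Suc k) \<cdot> v (Suc k) \<oplus> tar 2 X' f' k \<cdot> \<tau> k \<oplus>
        \<tau> (Suc k) \<cdot> tar 2 X' f' (Suc k) = \<one>\<^bsub>X' (Suc k)\<^esub>"
    using null_homotopy_trunc[OF Theta_hom_exact[OF X'] nX v(3) u(3)] u v X1 X1o by auto
  obtain t' \<rho> where t': "nseq_morphism n C S (Y, g) (Y', g') t'" "t' 1 = t 1" "t' 2 = t 2"
    and \<rho>: "\<And>k. \<rho> k \<in> mor (tob 2 Y' (Suc k)) (tob 2 Y' k)"
    and \<rho>h: "\<And>k. 1 \<le> k \<Longrightarrow> k < n \<Longrightarrow> t' (Suc k) \<cdot> w (Suc k) \<oplus> tar 2 Y' g' k \<cdot> \<rho> k \<oplus>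
        \<rho> (Suc k) \<cdot> tar 2 Y' g' (Suc k) = \<one>\<^bsub>Y' (Suc k)\<^esub>"
    using null_homotopy_trunc[OF Theta_hom_exact[OF Y'] nY w(3) t(3)] t w Y1 X1o by auto
  define \<phi> where "\<phi> k = w k \<cdot> (\<phi>' k \<cdot> u' k)" for k
  have \<phi>: "nseq_morphism n C S (X, f) (Y, g) \<phi>"
    unfolding \<phi>_def by (rule morphism_comp[OF nX nY nY' morphism_comp[OF nX nY' nX' u'(1) \<phi>'] w(3)])
  have \<phi>1: "\<phi> 1 = \<one>\<^bsub>X 1\<^esub>" by (simp add: \<phi>_def w u' u \<phi>'1 X1 X1o)
  have \<phi>2: "\<phi> 2 = p" using p by (simp add: \<phi>_def w u' u \<phi>'2 mor_iff)
  let ?p = "tmo X' Y' \<phi>'" and ?u = "tmo X X' u'" and ?w = "tmo Y' Y w"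
  note at = tmo_arr[OF nX' nY' \<phi>'] tmo_arr[OF nX nX' u'(1)] tmo_arr[OF nY' nY w(3)]
  note ct = tmo_tar[OF nX' nY' \<phi>'] tmo_tar[OF nX nX' u'(1)] tmo_tar[OF nY' nY w(3)]
  note ar = tar_arr[OF nX, of 2, simplified] tar_arr[OF nX', of 2, simplified]
    tar_arr[OF nY, of 2, simplified] tar_arr[OF nY', of 2, simplified]
  note ht = \<tau>[unfolded mor_iff, THEN conjunct1] \<tau>[unfolded mor_iff, THEN conjunct2, THEN conjunct1]
    \<tau>[unfolded mor_iff, THEN conjunct2, THEN conjunct2]
    \<rho>[unfolded mor_iff, THEN conjunct1] \<rho>[unfolded mor_iff, THEN conjunct2, THEN conjunct1]
    \<rho>[unfolded mor_iff, THEN conjunct2, THEN conjunct2]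
  note all = at ar ht
  have ob: "X (Suc k) = tob 2 X (Suc k)" "X' (Suc k) = tob 2 X' (Suc k)" "Y (Suc k) = tob 2 Y (Suc k)"
    "Y' (Suc k) = tob 2 Y' (Suc k)" "\<phi>' (Suc k) = ?p (Suc k)" "u' (Suc k) = ?u (Suc k)" "w (Suc k) = ?w (Suc k)"
    if "1 \<le> k" "k < n" for k
    using that by (simp_all add: tob_in tmo_in)
  \<comment> \<open>Since \<open>\<phi>\<close> is \<open>w \<cdot> \<phi>' \<cdot> u'\<close>,
    composing the homotopy \<open>\<rho>\<close> for \<open>t' \<cdot> w\<close> with
    \<open>\<phi>' \<cdot> u'\<close> compares \<open>t' \<cdot> \<phi>\<close> with
    \<open>\<phi>' \<cdot> u'\<close>. Likewise \<open>w \<cdot> \<phi>'\<close> applied to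
    \<open>\<tau>\<close> compares \<open>\<phi> \<cdot> v\<close> with
    \<open>w \<cdot> \<phi>'\<close>. These are the homotopies of the two maps between
    cones.\<close>
  define \<sigma> where "\<sigma> k = \<ominus> (\<rho> k \<cdot> (?p (Suc k) \<cdot> ?u (Suc k)))" for k
  define \<kappa> where "\<kappa> k = ?w k \<cdot> (?p k \<cdot> \<tau> k)" for k
  have \<sigma>t: "\<sigma> k \<in> mor (tob 2 X (Suc k)) (tob 2 Y' k)" for k
    by (simp add: \<sigma>_def mor_iff all)
  have \<kappa>t: "\<kappa> k \<in> mor (tob 2 X' (Suc k)) (tob 2 Y k)" for k
    by (simp add: \<kappa>_def mor_iff all)
  have \<sigma>h: "t' (Suc k) \<cdot> \<phi> (Suc k) = \<phi>' (Suc k) \<cdot> u' (Suc k) \<oplus> tar 2 Y' g' k \<cdot> \<sigma> k \<oplus> \<sigma> (Suc k) \<cdot> tar 2 X f (Suc k)"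
    if k: "1 \<le> k" "k < n" for k
  proof -
    let ?t = "tmo Y Y' t'" and ?S = "Suc k"
    note tt = tmo_arr[OF nY nY' t'(1)]
    have o: "t' ?S = ?t ?S" "tob 2 Y' ?S \<in> Ob C" using k tob_Ob[OF nY', of 2] by (simp_all add: tmo_in)
    have "(?t ?S \<cdot> ?w ?S \<oplus> tar 2 Y' g' k \<cdot> \<rho> k \<oplus> \<rho> ?S \<cdot> tar 2 Y' g' ?S) \<cdot> (?p ?S \<cdot> ?u ?S)
        = \<one>\<^bsub>tob 2 Y' ?S\<^esub> \<cdot> (?p ?S \<cdot> ?u ?S)"
      using \<rho>h[OF k] unfolding ob[OF k] o(1) by simp
    then have "?t ?S \<cdot> (?w ?S \<cdot> (?p ?S \<cdot> ?u ?S)) \<oplus>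
        (tar 2 Y' g' k \<cdot> (\<rho> k \<cdot> (?p ?S \<cdot> ?u ?S)) \<oplus> \<rho> ?S \<cdot> (tar 2 Y' g' ?S \<cdot> (?p ?S \<cdot> ?u ?S))) = ?p ?S \<cdot> ?u ?S"
      by (simp add: all tt o(2))
    then have "?t ?S \<cdot> (?w ?S \<cdot> (?p ?S \<cdot> ?u ?S)) = ?p ?S \<cdot> ?u ?S \<oplus>
       \<ominus> (tar 2 Y' g' k \<cdot> (\<rho> k \<cdot> (?p ?S \<cdot> ?u ?S)) \<oplus> \<rho> ?S \<cdot> (tar 2 Y' g' ?S \<cdot> (?p ?S \<cdot> ?u ?S)))"
      by (subst (asm) add_eq_iff) (simp_all add: all tt)
    also have "\<rho> ?S \<cdot> (tar 2 Y' g' ?S \<cdot> (?p ?S \<cdot> ?u ?S)) = \<ominus> (\<sigma> ?S \<cdot> tar 2 X f ?S)"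
      by (simp add: \<sigma>_def all ct ct(1)[THEN reassoc])
    finally show ?thesis
      unfolding \<phi>_def ob[OF k] o(1) by (simp add: \<sigma>_def all)
  qed
  have \<kappa>h: "w (Suc k) \<cdot> \<phi>' (Suc k) = \<phi> (Suc k) \<cdot> v (Suc k) \<oplus> tar 2 Y g k \<cdot> \<kappa> k \<oplus> \<kappa> (Suc k) \<cdot> tar 2 X' f' (Suc k)"
    if k: "1 \<le> k" "k < n" for k
  proof -
    let ?v = "tmo X' X v" and ?S = "Suc k"
    note vt = tmo_arr[OF nX' nX v(3)]
    have o: "v ?S = ?v ?S" "tob 2 X' ?S \<in> Ob C" using k tob_Ob[OF nX', of 2] by (simp_all add: tmo_in)
    have "?w ?S \<cdot> ?p ?S = (?w ?S \<cdot> ?p ?S) \<cdot> \<one>\<^bsub>tob 2 X' ?S\<^esub>"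
      by (simp add: all o(2))
    also have "\<dots> = (?w ?S \<cdot> ?p ?S) \<cdot> (?u ?S \<cdot> ?v ?S \<oplus> tar 2 X' f' k \<cdot> \<tau> k \<oplus> \<tau> ?S \<cdot> tar 2 X' f' ?S)"
      using \<tau>h[OF k] unfolding ob[OF k] o(1) by simp
    also have "\<dots> = (?w ?S \<cdot> (?p ?S \<cdot> ?u ?S)) \<cdot> ?v ?S \<oplus> tar 2 Y g k \<cdot> \<kappa> k \<oplus> \<kappa> ?S \<cdot> tar 2 X' f' ?S"
      by (simp add: \<kappa>_def all vt ct(1,3)[THEN reassoc])
    finally show ?thesis unfolding \<phi>_def ob[OF k] o(1) .
  qed
  obtain i where i: "nseq_morphism n C S (row3 n C S X f Y g \<phi>) (row3 n C S X' f' Y' g' \<phi>') i" "i 1 = u' 2"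
    using row3_morphism[OF nX nY \<phi> XY nX' nY' \<phi>' XY' u'(1) t'(1) _ \<sigma>t \<sigma>h] u t u' t' by auto
  obtain r where r: "nseq_morphism n C S (row3 n C S X' f' Y' g' \<phi>') (row3 n C S X f Y g \<phi>) r" "r 1 = v 2"
    using row3_morphism[OF nX' nY' \<phi>' XY' nX nY \<phi> XY v(3) w(3) _ \<kappa>t \<kappa>h] v w by auto
  let ?T = "fst (row3 n C S X f Y g \<phi>)" and ?d = "snd (row3 n C S X f Y g \<phi>)"
  have T1: "?T 1 = X 2" by (simp add: row3_def row3_mask_def)
  \<comment> \<open>Only degree 1 has to be inspected: both maps of cones are the identity of
    \<open>X 2\<close> there.\<close>
  have "is_summand (i 1)"
    unfolding i(2) u'(3) u(2)
    by (rule iso_is_summand, rule is_isoI[of _ "X 2" "X 2" "\<one>\<^bsub>X 2\<^esub>"]) (simp_all add: mor_iff X1o)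
  moreover have "r 1 \<cdot> i 1 = \<one>\<^bsub>?T 1\<^esub>" using T1 X1o by (simp add: r i u u' v)
  ultimately have "(?T, ?d) \<in> \<Theta>"
    using homotopy_retract_in_Theta[OF row3_hom_exact[OF X Y XY \<phi> \<phi>1],
        of "fst (row3 n C S X' f' Y' g' \<phi>')" "snd (row3 n C S X' f' Y' g' \<phi>')" i r] R i r
    by simp
  then have "homotopy_cartesian n C S \<Theta> (\<lambda>i. X (i + 1)) (\<lambda>i. f (i + 1)) (\<lambda>i. Y (i + 1)) (\<lambda>i. g (i + 1))
      (\<lambda>i. \<phi> (i + 1)) (SA (f 1) \<cdot> g n)"
    using homotopy_cartesian_row3[OF nX nY XY \<phi>] by simp
  then show "\<exists>\<phi>. \<phi> 1 = \<one>\<^bsub>X 1\<^esub> \<and> \<phi> 2 = p \<and> nseq_morphism n C S (X, f) (Y, g) \<phi> \<and>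
      homotopy_cartesian n C S \<Theta> (\<lambda>i. X (i + 1)) (\<lambda>i. f (i + 1)) (\<lambda>i. Y (i + 1)) (\<lambda>i. g (i + 1))
      (\<lambda>i. \<phi> (i + 1)) (SA (f 1) \<cdot> g n)"
    using \<phi> \<phi>1 \<phi>2 by blast
qed

section \<open>The fifth row\<close>

definition r5i :: "(nat \<Rightarrow> 'o) \<Rightarrow> (nat \<Rightarrow> 'o) \<Rightarrow> (nat \<Rightarrow> 'o) \<Rightarrow> nat \<Rightarrow> nat \<Rightarrow> 'm" where
  "r5i X Y Z a k = minj (row5_mask n k) [X (Suc (Suc k)), Y (Suc k), Z k] a"

definition r5p :: "(nat \<Rightarrow> 'o) \<Rightarrow> (nat \<Rightarrow> 'o) \<Rightarrow> (nat \<Rightarrow> 'o) \<Rightarrow> nat \<Rightarrow> nat \<Rightarrow> 'm" where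
  "r5p X Y Z a k = mprj (row5_mask n k) [X (Suc (Suc k)), Y (Suc k), Z k] a"

text \<open>Row 5 begins with \<open>X 3\<close> and omits \<open>Y 2\<close> and
  \<open>Z 2\<close>, so truncation at 3 describes its summands in all three sequences, where row 3
  was described by truncation at 2.\<close>

lemma row5_trisum:
  assumes X: "is_nseq n C S (X, f)" and Y: "is_nseq n C S (Y, g)" and Z: "is_nseq n C S (Z, h)"
    and k: "1 \<le> k" "k \<le> n"
  shows "kept_Ob (row5_mask n k) [X (Suc (Suc k)), Y (Suc k), Z k]"
    "kob (row5_mask n k ! 0) (X (Suc (Suc k))) = tob 3 X (Suc (Suc k))"
    "kob (row5_mask n k ! 1) (Y (Suc k)) = tob 3 Y (Suc k)"
    "kob (row5_mask n k ! 2) (Z k) = tob 3 Z k"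
    "trisum (fst (row5 n C S X f Y g Z h \<phi> \<psi> \<theta>) k) (tob 3 X (Suc (Suc k))) (tob 3 Y (Suc k)) (tob 3 Z k)
       (r5i X Y Z 0 k) (r5i X Y Z 1 k) (r5i X Y Z 2 k) (r5p X Y Z 0 k) (r5p X Y Z 1 k) (r5p X Y Z 2 k)"
proof -
  show K: "kept_Ob (row5_mask n k) [X (Suc (Suc k)), Y (Suc k), Z k]"
    using nseqD(1)[OF X] nseqD(1)[OF Y] nseqD(1)[OF Z] k by (auto simp: kept_Ob_def row5_mask_def)
  show k1: "kob (row5_mask n k ! 0) (X (Suc (Suc k))) = tob 3 X (Suc (Suc k))"
    using k by (auto simp: kob_def row5_mask_def tob_def)
  show k2: "kob (row5_mask n k ! 1) (Y (Suc k)) = tob 3 Y (Suc k)"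
    using k by (auto simp: kob_def row5_mask_def tob_def One_nat_def)
  show k3: "kob (row5_mask n k ! 2) (Z k) = tob 3 Z k"
    using k by (auto simp: kob_def row5_mask_def tob_def)
  have "fst (row5 n C S X f Y g Z h \<phi> \<psi> \<theta>) k = dsum C (keep (row5_mask n k) [X (Suc (Suc k)), Y (Suc k), Z k])"
    unfolding row5_def by (simp flip: Suc_eq_plus1)
  then show "trisum (fst (row5 n C S X f Y g Z h \<phi> \<psi> \<theta>) k) (tob 3 X (Suc (Suc k))) (tob 3 Y (Suc k)) (tob 3 Z k)
       (r5i X Y Z 0 k) (r5i X Y Z 1 k) (r5i X Y Z 2 k) (r5p X Y Z 0 k) (r5p X Y Z 1 k) (r5p X Y Z 2 k)"
    using masked_trisum[OF K] unfolding k1 k2 k3 r5i_def r5p_def by simp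
qed

text \<open>The entries get zero as default where a summand is missing: \<open>\<psi>\<close> and
  \<open>\<theta>\<close> enter only from k = 2 on, since \<open>Y 2\<close> and \<open>Z 2\<close>
  are omitted, and \<open>\<phi>\<close>, \<open>\<theta>\<close> stop with the last object of
  X.\<close>

lemma row5_columns:
  assumes X: "is_nseq n C S (X, f)" and Y: "is_nseq n C S (Y, g)" and Z: "is_nseq n C S (Z, h)"
    and \<phi>: "\<forall>k\<in>{3..n}. \<phi> k \<in> mor (X k) (Y k)" and \<psi>: "\<forall>k\<in>{3..n}. \<psi> k \<in> mor (Y k) (Z k)"
    and \<theta>: "\<forall>k\<in>{4..n}. \<theta> k \<in> mor (X k) (Z (k - 1))" and k: "1 \<le> k" "k < n"
  defines "e \<equiv> snd (row5 n C S X f Y g Z h \<phi> \<psi> \<theta>)" and "R \<equiv> fst (row5 n C S X f Y g Z h \<phi> \<psi> \<theta>)"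
  defines "p \<equiv> if Suc (Suc k) \<le> n then \<phi> (Suc (Suc k)) else \<zero>\<^bsub>tob 3 X (Suc (Suc k)),tob 3 Y (Suc (Suc k))\<^esub>"
    and "s \<equiv> if 2 \<le> k then \<psi> (Suc k) else \<zero>\<^bsub>tob 3 Y (Suc k),tob 3 Z (Suc k)\<^esub>"
    and "t \<equiv> if 2 \<le> k \<and> Suc (Suc k) \<le> n then \<theta> (Suc (Suc k)) else \<zero>\<^bsub>tob 3 X (Suc (Suc k)),tob 3 Z (Suc k)\<^esub>"
  shows "e k \<in> mor (R k) (R (Suc k))"
    "p \<in> mor (tob 3 X (Suc (Suc k))) (tob 3 Y (Suc (Suc k)))"
    "s \<in> mor (tob 3 Y (Suc k)) (tob 3 Z (Suc k))" "t \<in> mor (tob 3 X (Suc (Suc k))) (tob 3 Z (Suc k))"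
    "e k \<cdot> r5i X Y Z 0 k = r5i X Y Z 0 (Suc k) \<cdot> tar 3 X f (Suc (Suc k)) \<oplus> \<ominus> (r5i X Y Z 1 (Suc k) \<cdot> p)
       \<oplus> r5i X Y Z 2 (Suc k) \<cdot> t"
    "e k \<cdot> r5i X Y Z 1 k = \<ominus> (r5i X Y Z 1 (Suc k) \<cdot> tar 3 Y g (Suc k)) \<oplus> r5i X Y Z 2 (Suc k) \<cdot> s"
    "e k \<cdot> r5i X Y Z 2 k = r5i X Y Z 2 (Suc k) \<cdot> tar 3 Z h k"
proof -
  note x = nseqD[OF X] and y = nseqD[OF Y] and z = nseqD[OF Z]
  have k': "k \<le> n" "1 \<le> Suc k" "Suc k \<le> n" using k by simp_all
  note T = row5_trisum(1-4)[OF X Y Z k(1) k'(1)] row5_trisum(5)[OF X Y Z k(1) k'(1), of \<phi> \<psi> \<theta>, folded R_def]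
  note T' = row5_trisum(1-4)[OF X Y Z k'(2,3)] row5_trisum(5)[OF X Y Z k'(2,3), of \<phi> \<psi> \<theta>, folded R_def]
  note o = tob_Ob[OF X, of 3, simplified] tob_Ob[OF Y, of 3, simplified] tob_Ob[OF Z, of 3, simplified]
  note ta = tar_arr[OF X, of 3, simplified] tar_arr[OF Y, of 3, simplified] tar_arr[OF Z, of 3, simplified]
  have ph: "\<phi> (Suc (Suc k)) \<in> mor (X (Suc (Suc k))) (Y (Suc (Suc k)))" if "Suc (Suc k) \<le> n"
    using bspec[OF \<phi>, of "Suc (Suc k)"] that k by simp
  have ps: "\<psi> (Suc k) \<in> mor (Y (Suc k)) (Z (Suc k))" if "2 \<le> k"
    using bspec[OF \<psi>, of "Suc k"] that k by simp
  have th: "\<theta> (Suc (Suc k)) \<in> mor (X (Suc (Suc k))) (Z (Suc k))" if "Suc (Suc k) \<le> n" "2 \<le> k"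
    using bspec[OF \<theta>, of "Suc (Suc k)"] that by simp
  show pt: "p \<in> mor (tob 3 X (Suc (Suc k))) (tob 3 Y (Suc (Suc k)))"
    using ph k o by (auto simp: p_def tob_in mor_iff)
  show st: "s \<in> mor (tob 3 Y (Suc k)) (tob 3 Z (Suc k))"
    using ps k o by (auto simp: s_def tob_in mor_iff)
  show tt: "t \<in> mor (tob 3 X (Suc (Suc k))) (tob 3 Z (Suc k))"
    using th k o by (auto simp: t_def tob_in mor_iff)
  let ?cs = "row5_mask n k" and ?rs = "row5_mask n (Suc k)"
  let ?As = "[X (Suc (Suc k)), Y (Suc k), Z k]" and ?Bs = "[X (Suc (Suc (Suc k))), Y (Suc (Suc k)), Z (Suc k)]"
  let ?M = "[[f (Suc (Suc k)), \<zero>\<^bsub>Y (Suc k),X (Suc (Suc (Suc k)))\<^esub>, \<zero>\<^bsub>Z k,X (Suc (Suc (Suc k)))\<^esub>],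
             [\<ominus> \<phi> (Suc (Suc k)), \<ominus> g (Suc k), \<zero>\<^bsub>Z k,Y (Suc (Suc k))\<^esub>],
             [\<theta> (Suc (Suc k)), \<psi> (Suc k), h k]]"
  have ar: "k + 1 = Suc k" "k + 2 = Suc (Suc k)" "k + 3 = Suc (Suc (Suc k))" by simp_all
  have ek: "e k = mat_keep C ?cs ?As ?rs ?Bs ?M"
    using k unfolding e_def row5_def by (simp add: ar)
  have cs: "?cs ! 0 \<longleftrightarrow> Suc (Suc k) \<le> n" "?cs ! 1 \<longleftrightarrow> 2 \<le> k" "?cs ! 2 \<longleftrightarrow> 3 \<le> k"
    using k unfolding row5_mask_def nth3 by auto
  have rs: "?rs ! 0 \<longleftrightarrow> Suc (Suc k) < n" "?rs ! 1 \<longleftrightarrow> Suc (Suc k) \<le> n" "?rs ! 2 \<longleftrightarrow> 2 \<le> k"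
    using k unfolding row5_mask_def nth3 by auto
  have ty: "?M ! a ! b \<in> mor (?As ! b) (?Bs ! a)"
    if ab: "a < length ?Bs" "b < length ?As" and kept: "?rs ! a" "?cs ! b" for a b
  proof -
    have ks: "Suc (Suc k) < n \<Longrightarrow> X (Suc (Suc (Suc k))) \<in> Ob C" "Suc (Suc k) \<le> n \<Longrightarrow> Y (Suc (Suc k)) \<in> Ob C"
      "Y (Suc k) \<in> Ob C" "Z k \<in> Ob C" using x(1) y(1) z(1) k by simp_all
    have "a = 0 \<or> a = 1 \<or> a = 2" "b = 0 \<or> b = 1 \<or> b = 2" using ab less_3_cases by simp_all
    then show ?thesis
      using kept k ks ph ps th x(2-4)[of "Suc (Suc k)"] y(2-4)[of "Suc k"] z(2-4)[of k]
      by (elim disjE) (simp_all add: nth3 cs rs mor_iff)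
  qed
  have len: "length ?M = length ?Bs" "length (?M ! a) = length ?As" if "a < length ?Bs" for a
    using that less_3_cases[of a] by (auto simp: nth3)
  have len1: "length ?M = length ?Bs" by simp
  have mk1: "e k \<in> mor (dsum C (keep ?cs ?As)) (dsum C (keep ?rs ?Bs))"
    unfolding ek by (rule mat_keep_arr_component(1)[OF T(1) T'(1) len1]) (fact len(2), fact ty)
  have mk: "mprj ?rs ?Bs a \<cdot> (e k \<cdot> minj ?cs ?As b) =
      (if ?rs ! a \<and> ?cs ! b then ?M ! a ! b else \<zero>\<^bsub>kob (?cs ! b) (?As ! b),kob (?rs ! a) (?Bs ! a)\<^esub>)"
    if "a < length ?Bs" "b < length ?As" for a b
    unfolding ek by (rule mat_keep_arr_component(2)[OF T(1) T'(1) len1 _ _ that]) (fact len(2), fact ty)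
  have et: "e k \<in> mor (R k) (R (Suc k))"
  proof -
    have "R j = dsum C (keep (row5_mask n j) [X (Suc (Suc j)), Y (Suc j), Z j])" for j
      unfolding R_def row5_def by (simp flip: Suc_eq_plus1)
    then show ?thesis using mk1 by simp
  qed
  then show "e k \<in> mor (R k) (R (Suc k))" .
  have l: "0 < length ?As" "1 < length ?As" "2 < length ?As" "0 < length ?Bs" "1 < length ?Bs" "2 < length ?Bs" by simp_all
  note c = mk[OF l(4,1), unfolded nth3, unfolded T(2) T'(2), unfolded cs rs, folded r5p_def r5i_def]
    mk[OF l(4,2), unfolded nth3, unfolded T(3) T'(2), unfolded cs rs, folded r5p_def r5i_def]
    mk[OF l(4,3), unfolded nth3, unfolded T(4) T'(2), unfolded cs rs, folded r5p_def r5i_def]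
    mk[OF l(5,1), unfolded nth3, unfolded T(2) T'(3), unfolded cs rs, folded r5p_def r5i_def]
    mk[OF l(5,2), unfolded nth3, unfolded T(3) T'(3), unfolded cs rs, folded r5p_def r5i_def]
    mk[OF l(5,3), unfolded nth3, unfolded T(4) T'(3), unfolded cs rs, folded r5p_def r5i_def]
    mk[OF l(6,1), unfolded nth3, unfolded T(2) T'(4), unfolded cs rs, folded r5p_def r5i_def]
    mk[OF l(6,2), unfolded nth3, unfolded T(3) T'(4), unfolded cs rs, folded r5p_def r5i_def]
    mk[OF l(6,3), unfolded nth3, unfolded T(4) T'(4), unfolded cs rs, folded r5p_def r5i_def]
  let ?q = "r5p X Y Z" and ?j = "r5i X Y Z"
  have d: "?q 0 (Suc k) \<cdot> (e k \<cdot> ?j 0 k) = tar 3 X f (Suc (Suc k))"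
    "?q 0 (Suc k) \<cdot> (e k \<cdot> ?j 1 k) = \<zero>\<^bsub>tob 3 Y (Suc k),tob 3 X (Suc (Suc (Suc k)))\<^esub>"
    "?q 0 (Suc k) \<cdot> (e k \<cdot> ?j 2 k) = \<zero>\<^bsub>tob 3 Z k,tob 3 X (Suc (Suc (Suc k)))\<^esub>"
    "?q 1 (Suc k) \<cdot> (e k \<cdot> ?j 0 k) = \<ominus> p"
    "?q 1 (Suc k) \<cdot> (e k \<cdot> ?j 1 k) = \<ominus> tar 3 Y g (Suc k)"
    "?q 1 (Suc k) \<cdot> (e k \<cdot> ?j 2 k) = \<zero>\<^bsub>tob 3 Z k,tob 3 Y (Suc (Suc k))\<^esub>"
    "?q 2 (Suc k) \<cdot> (e k \<cdot> ?j 0 k) = t"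
    "?q 2 (Suc k) \<cdot> (e k \<cdot> ?j 1 k) = s"
    "?q 2 (Suc k) \<cdot> (e k \<cdot> ?j 2 k) = tar 3 Z h k"
    unfolding c using k o by (auto simp: tar_def p_def s_def t_def tob_in)
  note tr = trisumD[OF T(5)] trisumD[OF T'(5)] trisum_comp[OF T'(5)]
  note tm = pt[unfolded mor_iff] st[unfolded mor_iff] tt[unfolded mor_iff] et[unfolded mor_iff]
  show "e k \<cdot> ?j 0 k = ?j 0 (Suc k) \<cdot> tar 3 X f (Suc (Suc k)) \<oplus> \<ominus> (?j 1 (Suc k) \<cdot> p) \<oplus> ?j 2 (Suc k) \<cdot> t"
    by (rule trisum_mono[OF T'(5), of _ "tob 3 X (Suc (Suc k))"]) (simp_all add: mor_iff tr tm ta o d)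
  show "e k \<cdot> ?j 1 k = \<ominus> (?j 1 (Suc k) \<cdot> tar 3 Y g (Suc k)) \<oplus> ?j 2 (Suc k) \<cdot> s"
    by (rule trisum_mono[OF T'(5), of _ "tob 3 Y (Suc k)"]) (simp_all add: mor_iff tr tm ta o d)
  show "e k \<cdot> ?j 2 k = ?j 2 (Suc k) \<cdot> tar 3 Z h k"
    by (rule trisum_mono[OF T'(5), of _ "tob 3 Z k"]) (simp_all add: mor_iff tr tm ta o d)
qed

lemma row5_ends:
  "fst (row5 n C S X f Y g Z h \<phi> \<psi> \<theta>) 1 = X 3" "fst (row5 n C S X f Y g Z h \<phi> \<psi> \<theta>) n = Z n"
  "snd (row5 n C S X f Y g Z h \<phi> \<psi> \<theta>) n = \<ominus> (SA (f 2) \<cdot> h n)"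
  "r5i X Y Z 0 1 = \<one>\<^bsub>X 3\<^esub>" "r5p X Y Z 0 1 = \<one>\<^bsub>X 3\<^esub>"
  "r5i X Y Z 2 n = \<one>\<^bsub>Z n\<^esub>" "r5p X Y Z 2 n = \<one>\<^bsub>Z n\<^esub>"
proof -
  have m: "row5_mask n 1 = [True, False, False]" "row5_mask n n = [False, False, True]"
    by (simp_all add: row5_mask_def)
  have e: "(1::nat) + 2 = 3" "Suc (Suc 1) = 3" by simp_all
  have pos: "pos [False, False, True] 2 = 0" by (simp add: pos_def)
  show "fst (row5 n C S X f Y g Z h \<phi> \<psi> \<theta>) 1 = X 3" "fst (row5 n C S X f Y g Z h \<phi> \<psi> \<theta>) n = Z n"
    "snd (row5 n C S X f Y g Z h \<phi> \<psi> \<theta>) n = \<ominus> (SA (f 2) \<cdot> h n)"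
    by (simp_all add: row5_def m e)
  show "r5i X Y Z 0 1 = \<one>\<^bsub>X 3\<^esub>" "r5p X Y Z 0 1 = \<one>\<^bsub>X 3\<^esub>"
    "r5i X Y Z 2 n = \<one>\<^bsub>Z n\<^esub>" "r5p X Y Z 2 n = \<one>\<^bsub>Z n\<^esub>"
    unfolding r5i_def r5p_def minj_def mprj_def m e nth3 by (simp_all add: pos)
qed

lemma cone_bip_full:
  assumes "2 \<le> k" "k < n"
  shows "Inj1 (cone_bip X Y k) = dinj C [X (Suc k), Y k] 0" "Inj2 (cone_bip X Y k) = dinj C [X (Suc k), Y k] 1"
    "Prj1 (cone_bip X Y k) = dprj C [X (Suc k), Y k] 0" "Prj2 (cone_bip X Y k) = dprj C [X (Suc k), Y k] 1"
proof -
  have "row3_mask n k = [True, True]" using assms by (simp add: row3_mask_def)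
  then show "Inj1 (cone_bip X Y k) = dinj C [X (Suc k), Y k] 0" "Inj2 (cone_bip X Y k) = dinj C [X (Suc k), Y k] 1"
    "Prj1 (cone_bip X Y k) = dprj C [X (Suc k), Y k] 0" "Prj2 (cone_bip X Y k) = dprj C [X (Suc k), Y k] 1"
    by (simp_all add: cone_bip_def Let_def minj_def mprj_def One_nat_def)
qed

lemma morphism_cong:
  assumes "nseq_morphism n C S U V \<phi>" "\<And>k. 1 \<le> k \<Longrightarrow> k \<le> n \<Longrightarrow> \<psi> k = \<phi> k"
  shows "nseq_morphism n C S U V \<psi>"
  using assms(1) assms(2) unfolding nseq_morphism_def by (auto split: prod.splits)

lemma vert23_eq:
  assumes X: "is_nseq n C S (X, f)" and Y: "is_nseq n C S (Y, g)" and k: "1 \<le> k" "k \<le> n"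
    and last: "Inj2 (cone_bip X Y n) = \<one>\<^bsub>Y n\<^esub>"
  shows "vert23 n C X f Y k = (if k = 1 then f 1 else Inj2 (cone_bip X Y k))"
proof -
  consider "k = 1" | "k = n" | "2 \<le> k" "k < n" using k by linarith
  then show ?thesis
  proof cases
    case 3
    have o: "X (Suc k) \<in> Ob C" "Y k \<in> Ob C" using nseqD(1)[OF X, of "Suc k"] nseqD(1)[OF Y, of k] 3 by simp_all
    have L: "set [X (Suc k), Y k] \<subseteq> Ob C" using o by simp
    have l: "0 < length [X (Suc k), Y k]" "1 < length [X (Suc k), Y k]" by (simp_all add: One_nat_def)
    note i = dinj_arr[OF L l(1), unfolded mor_iff] dinj_arr[OF L l(2), unfolded mor_iff]
    have ar: "k + 1 = Suc k" by simp
    have n1: "[X (Suc k), Y k] ! 1 = Y k" by (simp add: One_nat_def)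
    show ?thesis
      using 3 i o mat_column[OF o(2,1,2), of "\<zero>\<^bsub>Y k,X (Suc k)\<^esub>" "\<one>\<^bsub>Y k\<^esub>"] cone_bip_full(2)[OF 3, of X Y]
      unfolding vert23_def ar n1 by (simp add: mor_iff)
  qed (simp_all add: vert23_def last)
qed

text \<open>\<open>\<psi>\<close> and \<open>\<theta>\<close> are read off as the two columns of
  \<open>\<chi>\<close>; the index shift in \<open>\<theta>\<close> comes from
  \<open>X (k + 1)\<close> sitting at position k of row 3. In column 2 the diagram prescribes the
  projection, hence the hypothesis on \<open>\<chi> 2\<close>.\<close>

lemma vert34_eq:
  assumes X: "is_nseq n C S (X, f)" and Y: "is_nseq n C S (Y, g)" and Z: "is_nseq n C S (Z, h)"
    and XY: "Y 1 = X 1" and Z2: "Z 2 = Y 2" and \<phi>: "\<forall>k\<in>{2..n}. \<phi> k \<in> mor (X k) (Y k)"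
    and \<chi>: "nseq_morphism n C S (row3 n C S X f Y g \<phi>) (Z, h) \<chi>"
    and \<chi>1: "\<chi> 1 = \<one>\<^bsub>X 2\<^esub>" and \<chi>2: "\<chi> 2 = Prj2 (cone_bip X Y 2)" and k: "1 \<le> k" "k \<le> n"
  shows "vert34 n C X Y Z (\<lambda>k. \<chi> k \<cdot> Inj2 (cone_bip X Y k)) (\<lambda>k. \<chi> (k - 1) \<cdot> Inj1 (cone_bip X Y (k - 1))) k = \<chi> k"
proof -
  note mdl = row3_model[OF X Y \<phi> XY]
  have \<chi>': "nseq_morphism n C S (fst (row3 n C S X f Y g \<phi>), snd (row3 n C S X f Y g \<phi>)) (Z, h) \<chi>"
    using \<chi> by simp
  note cm = morphismD[OF \<chi>']
  consider "k = 1" | "k = n" "k \<noteq> 1" "k \<noteq> 2" | "2 \<le> k" "k < n" using k n_ge_3 by linarith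
  then show ?thesis
  proof cases
    case 1 then show ?thesis by (simp add: vert34_def \<chi>1)
  next
    case 2 then show ?thesis using cm(9,10) mdl(7,11) by (simp add: vert34_def)
  next
    case 3
    have k': "1 \<le> k" "k \<le> n" using 3 by simp_all
    have o: "X (Suc k) \<in> Ob C" "Y k \<in> Ob C" using nseqD(1)[OF X, of "Suc k"] nseqD(1)[OF Y, of k] 3 by simp_all
    have L: "set [X (Suc k), Y k] \<subseteq> Ob C" using o by simp
    have l: "0 < length [X (Suc k), Y k]" "1 < length [X (Suc k), Y k]" by (simp_all add: One_nat_def)
    note p = dprj_arr[OF L l(1), unfolded mor_iff] dprj_arr[OF L l(2), unfolded mor_iff]
    note b = biproduct_rules[OF mdl(1)[OF k'], unfolded mdl(2)]
    have ar: "k + 1 = Suc k" "Suc k - 1 = k" by simp_all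
    have n1: "[X (Suc k), Y k] ! 1 = Y k" "[X (Suc k), Y k] ! 0 = X (Suc k)" by (simp_all add: One_nat_def)
    have zk: "Z k \<in> Ob C" using nseqD(1)[OF Z k'] .
    show ?thesis
    proof (cases "k = 2")
      case True
      have S: "Suc 2 = 3" by simp
      have "mat C [X 3, Y 2] [Y 2] [[\<zero>\<^bsub>X 3,Y 2\<^esub>, \<one>\<^bsub>Y 2\<^esub>]] = dprj C [X 3, Y 2] 1"
        using mat_row[of "X 3" "Y 2" "Y 2" "\<zero>\<^bsub>X 3,Y 2\<^esub>" "\<one>\<^bsub>Y 2\<^esub>"] o p unfolding True S n1[unfolded True S]
        by (simp add: mor_iff)
      then show ?thesis using cone_bip_full(4)[of 2 X Y] unfolding True S by (simp add: vert34_def \<chi>2)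
    next
      case False
      have t: "tob 2 X (Suc k) = X (Suc k)" "tob 2 Y k = Y k" using 3 by (simp_all add: tob_in)
      let ?P = "cone_bip X Y k"
      have "mat C [X (Suc k), Y k] [Z k] [[\<chi> k \<cdot> Inj1 ?P, \<chi> k \<cdot> Inj2 ?P]] = \<chi> k \<cdot> Inj1 ?P \<cdot> Prj1 ?P \<oplus> \<chi> k \<cdot> Inj2 ?P \<cdot> Prj2 ?P"
        using mat_row[OF o zk, of "\<chi> k \<cdot> Inj1 ?P" "\<chi> k \<cdot> Inj2 ?P"] cone_bip_full[OF 3, of X Y] b(1-15) k'
        by (simp add: mor_iff cm t)
      also have "\<dots> = \<chi> k \<cdot> (Inj1 ?P \<cdot> Prj1 ?P \<oplus> Inj2 ?P \<cdot> Prj2 ?P)"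
        using k' by (simp add: b(1-15) cm)
      also have "\<dots> = \<chi> k" using k' by (simp add: b(20) cm)
      finally show ?thesis using False 3 unfolding vert34_def by (simp add: ar)
    qed
  qed
qed

end

section \<open>Row 5 as a direct summand of an iterated cone\<close>

locale composable = pre_n_angulated n C S \<Theta>
  for n :: nat and C :: "('o, 'm) precat" (structure)
    and S :: "('o, 'm) endo" and \<Theta> :: "('o, 'm) nseq set" +
  fixes X :: "nat \<Rightarrow> 'o" and f :: "nat \<Rightarrow> 'm" and Y :: "nat \<Rightarrow> 'o" and g :: "nat \<Rightarrow> 'm"
    and Z :: "nat \<Rightarrow> 'o" and h :: "nat \<Rightarrow> 'm" and \<phi> :: "nat \<Rightarrow> 'm" and \<chi> :: "nat \<Rightarrow> 'm"
  assumes X: "(X, f) \<in> \<Theta>" and Y: "(Y, g) \<in> \<Theta>" and Z: "(Z, h) \<in> \<Theta>"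
    and XY: "Y 1 = X 1" and XZ: "Z 1 = X 2" and YZ: "Z 2 = Y 2"
    and \<phi>: "nseq_morphism n C S (X, f) (Y, g) \<phi>" and \<phi>1: "\<phi> 1 = \<one>\<^bsub>X 1\<^esub>" and h1: "h 1 = \<phi> 2"
    and T: "row3 n C S X f Y g \<phi> \<in> \<Theta>"
    and \<chi>: "nseq_morphism n C S (row3 n C S X f Y g \<phi>) (Z, h) \<chi>"
    and \<chi>1: "\<chi> 1 = \<one>\<^bsub>X 2\<^esub>" and \<chi>2: "\<chi> 2 = Prj2 (cone_bip X Y 2)"
    and W: "row3 n C S (fst (row3 n C S X f Y g \<phi>)) (snd (row3 n C S X f Y g \<phi>)) Z h \<chi> \<in> \<Theta>"
begin

text \<open>The letters t, w and r stand for row 3, for the cone of \<open>\<chi>\<close> from row 3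
  to row 4, and for row 5.\<close>

definition "tT = fst (row3 n C S X f Y g \<phi>)"
definition "tD = snd (row3 n C S X f Y g \<phi>)"
definition "wT = fst (row3 n C S tT tD Z h \<chi>)"
definition "wD = snd (row3 n C S tT tD Z h \<chi>)"
definition "\<psi> k = \<chi> k \<cdot> Inj2 (cone_bip X Y k)"
definition "\<theta> k = \<chi> (k - 1) \<cdot> Inj1 (cone_bip X Y (k - 1))"
definition "rT = fst (row5 n C S X f Y g Z h \<phi> \<psi> \<theta>)"
definition "rD = snd (row5 n C S X f Y g Z h \<phi> \<psi> \<theta>)"

text \<open>The second biproduct decomposition of an object of row 3 is extended by zero to index \<open>n + 1\<close>.\<close>

definition "qB k = (if k < n then cone_bip X Y (Suc k)
  else \<lparr>BOb = N, Inj1 = \<zero>\<^bsub>N,N\<^esub>, Inj2 = \<zero>\<^bsub>N,N\<^esub>, Prj1 = \<zero>\<^bsub>N,N\<^esub>, Prj2 = \<zero>\<^bsub>N,N\<^esub>\<rparr>)"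

text \<open>\<open>e1\<close>, \<open>e2\<close>, \<open>e3\<close> and \<open>p1\<close>,
  \<open>p2\<close>, \<open>p3\<close> belong to the summands from X, Y and Z of the iterated cone,
  in the order of row 5 but with truncation at 2 instead of 3.\<close>

definition "e1 k = Inj1 (cone_bip tT Z k) \<cdot> Inj1 (qB k)"
definition "e2 k = Inj1 (cone_bip tT Z k) \<cdot> Inj2 (qB k)"
definition "e3 k = Inj2 (cone_bip tT Z k)"
definition "p1 k = Prj1 (qB k) \<cdot> Prj1 (cone_bip tT Z k)"
definition "p2 k = Prj2 (qB k) \<cdot> Prj1 (cone_bip tT Z k)"
definition "p3 k = Prj2 (cone_bip tT Z k)"

lemmas nX = Theta_nseq[OF X] and nY = Theta_nseq[OF Y] and nZ = Theta_nseq[OF Z]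

lemma T\<Theta>: "(tT, tD) \<in> \<Theta>" using T by (simp add: tT_def tD_def)
lemma W\<Theta>: "(wT, wD) \<in> \<Theta>" using W by (simp add: wT_def wD_def tT_def tD_def)
lemma \<chi>m: "nseq_morphism n C S (tT, tD) (Z, h) \<chi>" using \<chi> by (simp add: tT_def tD_def)

lemmas nT = Theta_nseq[OF T\<Theta>] and nW = Theta_nseq[OF W\<Theta>]

lemma \<phi>_mor: "\<forall>k\<in>{2..n}. \<phi> k \<in> mor (X k) (Y k)"
  using morphismD(1-3)[OF \<phi>] by (simp add: mor_iff)

lemma \<chi>_mor: "\<forall>k\<in>{2..n}. \<chi> k \<in> mor (tT k) (Z k)"
  using morphismD(1-3)[OF \<chi>m] by (simp add: mor_iff)

lemmas modT = row3_model[OF nX nY \<phi>_mor XY, folded tT_def tD_def]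

lemma ZT: "Z 1 = tT 1" using modT(6) XZ by simp

lemmas modW = row3_model[OF nT nZ \<chi>_mor ZT, folded wT_def wD_def]

lemma qB:
  assumes "1 \<le> k" "k \<le> n"
  shows "is_biproduct C (tob 2 X (Suc (Suc k))) (tob 2 Y (Suc k)) (qB k)" "BOb (qB k) = tob 2 tT (Suc k)"
proof -
  have "is_biproduct C N N \<lparr>BOb = N, Inj1 = \<zero>\<^bsub>N,N\<^esub>, Inj2 = \<zero>\<^bsub>N,N\<^esub>, Prj1 = \<zero>\<^bsub>N,N\<^esub>, Prj2 = \<zero>\<^bsub>N,N\<^esub>\<rparr>"
    by (rule is_biproductI) (simp_all add: mor_iff)
  then show "is_biproduct C (tob 2 X (Suc (Suc k))) (tob 2 Y (Suc k)) (qB k)" "BOb (qB k) = tob 2 tT (Suc k)"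
    using modT(1,2)[of "Suc k"] assms by (cases "k < n", simp_all add: qB_def tob_in tob_high)
qed

lemma W_trisum:
  assumes k: "1 \<le> k" "k \<le> n"
  shows "trisum (wT k) (tob 2 X (Suc (Suc k))) (tob 2 Y (Suc k)) (tob 2 Z k) (e1 k) (e2 k) (e3 k) (p1 k) (p2 k) (p3 k)"
  using nested_trisum[OF modW(1)[OF k] qB(1)[OF k] qB(2)[OF k]]
  unfolding modW(2) e1_def e2_def e3_def p1_def p2_def p3_def .

lemma R_trisum:
  assumes k: "1 \<le> k" "k \<le> n"
  shows "trisum (rT k) (tob 3 X (Suc (Suc k))) (tob 3 Y (Suc k)) (tob 3 Z k)
       (r5i X Y Z 0 k) (r5i X Y Z 1 k) (r5i X Y Z 2 k) (r5p X Y Z 0 k) (r5p X Y Z 1 k) (r5p X Y Z 2 k)"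
  using row5_trisum(5)[OF nX nY nZ k, of \<phi> \<psi> \<theta>, folded rT_def] .

text \<open>Forming a cone negates the differential of its source, here row 3: the entry -f becomes
  f, while \<open>\<phi>\<close> and g acquire minus signs. This accounts for the signs in row
  5.\<close>

lemma W_columns:
  assumes k: "1 \<le> k" "k < n"
  shows "wD k \<cdot> e1 k = e1 (Suc k) \<cdot> tar 2 X f (Suc (Suc k)) \<oplus> \<ominus> (e2 (Suc k) \<cdot> tmo X Y \<phi> (Suc (Suc k)))
      \<oplus> e3 (Suc k) \<cdot> (\<chi> (Suc k) \<cdot> Inj1 (qB k))" (is ?A)
    "wD k \<cdot> e2 k = \<ominus> (e2 (Suc k) \<cdot> tar 2 Y g (Suc k)) \<oplus> e3 (Suc k) \<cdot> (\<chi> (Suc k) \<cdot> Inj2 (qB k))" (is ?B)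
    "wD k \<cdot> e3 k = e3 (Suc k) \<cdot> tar 2 Z h k" (is ?C)
proof -
  have k': "k \<le> n" "1 \<le> Suc k" "Suc k \<le> n" "2 \<le> Suc k" using k by simp_all
  note q = biproduct_rules[OF qB(1)[OF k(1) k'(1)], unfolded qB(2)[OF k(1) k'(1)]]
    biproduct_rules[OF qB(1)[OF k'(2,3)], unfolded qB(2)[OF k'(2,3)]]
  note w = biproduct_rules[OF modW(1)[OF k(1) k'(1)], unfolded modW(2)]
    biproduct_rules[OF modW(1)[OF k'(2,3)], unfolded modW(2)]
  note o = tob_Ob[OF nX, of 2, simplified] tob_Ob[OF nY, of 2, simplified] tob_Ob[OF nZ, of 2, simplified] tob_Ob[OF nT, of 2, simplified]
  note ta = tar_arr[OF nX, of 2, simplified] tar_arr[OF nY, of 2, simplified] tar_arr[OF nZ, of 2, simplified] tar_arr[OF nT, of 2, simplified]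
  note tm = tmo_arr[OF nX nY \<phi>]
  have ch: "\<chi> (Suc k) \<in> Arr C" "Dom C (\<chi> (Suc k)) = tob 2 tT (Suc k)" "Cod C (\<chi> (Suc k)) = tob 2 Z (Suc k)"
    using morphismD(1-3)[OF \<chi>m, of "Suc k"] k' by (simp_all add: tob_in)
  have wt: "wD k \<in> Arr C" "Dom C (wD k) = wT k" "Cod C (wD k) = wT (Suc k)" using nseqD[OF nW] k by simp_all
  have c1: "tar 2 tT tD (Suc k) \<cdot> Inj1 (qB k) = \<ominus> (Inj1 (qB (Suc k)) \<cdot> tar 2 X f (Suc (Suc k))) \<oplus>
      Inj2 (qB (Suc k)) \<cdot> tmo X Y \<phi> (Suc (Suc k))" (is "?l = ?r")
    and c2: "tar 2 tT tD (Suc k) \<cdot> Inj2 (qB k) = Inj2 (qB (Suc k)) \<cdot> tar 2 Y g (Suc k)" (is "?l' = ?r'")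
  proof -
    have "?l = ?r \<and> ?l' = ?r'"
    proof (cases "Suc k < n")
      case True
      then show ?thesis
        using modT(4,5)[of "Suc k"] k k' by (simp add: qB_def tar_in tmo_in)
    next
      case False
      then have N: "tob 2 tT (Suc (Suc k)) = N" by (simp add: tob_high)
      have t: "?l \<in> Arr C" "Cod C ?l = N" "Dom C ?l = tob 2 X (Suc (Suc k))"
        "?r \<in> Arr C" "Cod C ?r = N" "Dom C ?r = tob 2 X (Suc (Suc k))"
        "?l' \<in> Arr C" "Cod C ?l' = N" "Dom C ?l' = tob 2 Y (Suc k)"
        "?r' \<in> Arr C" "Cod C ?r' = N" "Dom C ?r' = tob 2 Y (Suc k)"
        by (simp_all add: q ta tm N)
      show ?thesis
        using to_zero_ob[OF t(1,2)] to_zero_ob[OF t(4,5)] to_zero_ob[OF t(7,8)] to_zero_ob[OF t(10,11)]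
        unfolding t(3,6,9,12) by simp
    qed
    then show "?l = ?r" "?l' = ?r'" by auto
  qed
  have "wD k \<cdot> e1 k = (wD k \<cdot> Inj1 (cone_bip tT Z k)) \<cdot> Inj1 (qB k)"
    unfolding e1_def by (simp add: w q wt)
  also have "\<dots> = \<ominus> (Inj1 (cone_bip tT Z (Suc k)) \<cdot> (tar 2 tT tD (Suc k) \<cdot> Inj1 (qB k))) \<oplus>
      Inj2 (cone_bip tT Z (Suc k)) \<cdot> (\<chi> (Suc k) \<cdot> Inj1 (qB k))"
    unfolding modW(4)[OF k] by (simp add: w q ta ch)
  finally show ?A
    unfolding c1 e1_def e2_def e3_def by (simp add: w q ta ch tm)
  have "wD k \<cdot> e2 k = (wD k \<cdot> Inj1 (cone_bip tT Z k)) \<cdot> Inj2 (qB k)"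
    unfolding e2_def by (simp add: w q wt)
  also have "\<dots> = \<ominus> (Inj1 (cone_bip tT Z (Suc k)) \<cdot> (tar 2 tT tD (Suc k) \<cdot> Inj2 (qB k))) \<oplus>
      Inj2 (cone_bip tT Z (Suc k)) \<cdot> (\<chi> (Suc k) \<cdot> Inj2 (qB k))"
    unfolding modW(4)[OF k] by (simp add: w q ta ch)
  finally show ?B
    unfolding c2 e1_def e2_def e3_def by (simp add: w q ta ch tm)
  show ?C unfolding e3_def by (rule modW(5)[OF k])
qed

text \<open>At positions 1 and 2, the cone contains the contractible summand \<open>Y\<^sub>2 \<rightarrow> Y\<^sub>2\<close>, which row 5 omits. Eliminating
  it produces the correction term \<open>\<gamma>\<close>.\<close>

definition "cY k = (if k = 1 then \<zero>\<^bsub>N,Y 2\<^esub> else \<one>\<^bsub>tob 2 Y (Suc k)\<^esub>)"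
definition "cY' k = (if k = 1 then \<zero>\<^bsub>Y 2,N\<^esub> else \<one>\<^bsub>tob 2 Y (Suc k)\<^esub>)"
definition "cZ k = (if k = 2 then \<zero>\<^bsub>N,Y 2\<^esub> else \<one>\<^bsub>tob 2 Z k\<^esub>)"
definition "cZ' k = (if k = 2 then \<zero>\<^bsub>Y 2,N\<^esub> else \<one>\<^bsub>tob 2 Z k\<^esub>)"
definition "\<gamma> k = (if k = 2 then g 2 else \<zero>\<^bsub>tob 2 Z k,tob 3 Y (Suc k)\<^esub>)"

text \<open>The pivot is the identity from \<open>Y 2\<close> at position 1 to \<open>Z 2\<close> at
  position 2. Its source also maps to \<open>Y 3\<close> by minus \<open>g 2\<close>, so
  \<open>wp\<close> sends \<open>Z 2\<close> to \<open>Y 3\<close> by \<open>g 2\<close> to cancel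
  this. \<open>wi\<close> carries no such term: \<open>\<chi> 2\<close> is the projection to
  \<open>Y 2\<close>, so \<open>X 3\<close> has zero component in \<open>Z 2\<close>.\<close>

definition "wi k = e1 k \<cdot> r5p X Y Z 0 k \<oplus> e2 k \<cdot> (cY k \<cdot> r5p X Y Z 1 k) \<oplus> e3 k \<cdot> (cZ k \<cdot> r5p X Y Z 2 k)"
definition "wp k = r5i X Y Z 0 k \<cdot> p1 k \<oplus> r5i X Y Z 1 k \<cdot> (cY' k \<cdot> p2 k) \<oplus>
  r5i X Y Z 2 k \<cdot> (cZ' k \<cdot> p3 k) \<oplus> r5i X Y Z 1 k \<cdot> (\<gamma> k \<cdot> p3 k)"

lemma tob23: "1 \<le> k \<Longrightarrow> tob 3 X (Suc (Suc k)) = tob 2 X (Suc (Suc k))"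
  "3 \<le> k \<Longrightarrow> tob 3 V k = tob 2 V k"
  by (auto simp: tob_def)

lemma canonical:
  assumes k: "1 \<le> k" "k \<le> n"
  shows "cY k \<in> Arr C" "Dom C (cY k) = tob 3 Y (Suc k)" "Cod C (cY k) = tob 2 Y (Suc k)"
    "cY' k \<in> Arr C" "Dom C (cY' k) = tob 2 Y (Suc k)" "Cod C (cY' k) = tob 3 Y (Suc k)"
    "cZ k \<in> Arr C" "Dom C (cZ k) = tob 3 Z k" "Cod C (cZ k) = tob 2 Z k"
    "cZ' k \<in> Arr C" "Dom C (cZ' k) = tob 2 Z k" "Cod C (cZ' k) = tob 3 Z k"
    "\<gamma> k \<in> Arr C" "Dom C (\<gamma> k) = tob 2 Z k" "Cod C (\<gamma> k) = tob 3 Y (Suc k)"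
    "cY' k \<cdot> cY k = \<one>\<^bsub>tob 3 Y (Suc k)\<^esub>" "cZ' k \<cdot> cZ k = \<one>\<^bsub>tob 3 Z k\<^esub>"
    "\<gamma> k \<cdot> cZ k = \<zero>\<^bsub>tob 3 Z k,tob 3 Y (Suc k)\<^esub>"
proof -
  have oY: "tob 2 Y j \<in> Ob C" "tob 3 Y j \<in> Ob C" for j using tob_Ob[OF nY, of 2] tob_Ob[OF nY, of 3] by simp_all
  have oZ: "tob 2 Z j \<in> Ob C" "tob 3 Z j \<in> Ob C" for j using tob_Ob[OF nZ, of 2] tob_Ob[OF nZ, of 3] by simp_all
  have Y2: "Y 2 \<in> Ob C" using nseqD(1)[OF nY, of 2] by simp
  have s: "Suc 1 = 2" "Suc 2 = 3" by simp_all
  have y1: "tob 3 Y 2 = N" "tob 2 Y 2 = Y 2" and z2: "tob 3 Z 2 = N" "tob 2 Z 2 = Y 2"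
    by (simp_all add: tob_low tob_in YZ)
  have z1: "tob 3 Z 1 = N" "tob 2 Z 1 = N" by (simp_all add: tob_low)
  have g2: "g 2 \<in> Arr C" "Dom C (g 2) = Y 2" "Cod C (g 2) = tob 3 Y 3"
    using nseqD(2-4)[OF nY, of 2] by (simp_all add: tob_in)
  have yk: "tob 3 Y (Suc k) = tob 2 Y (Suc k)" if "k \<noteq> 1" using that k by (intro tob23) simp
  have zk: "tob 3 Z k = tob 2 Z k" if "k \<noteq> 2"
  proof (cases "k = 1")
    case False then show ?thesis using that k by (intro tob23) simp
  qed (simp add: z1)
  show "cY k \<in> Arr C" "Dom C (cY k) = tob 3 Y (Suc k)" "Cod C (cY k) = tob 2 Y (Suc k)"
    "cY' k \<in> Arr C" "Dom C (cY' k) = tob 2 Y (Suc k)" "Cod C (cY' k) = tob 3 Y (Suc k)"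
    "cY' k \<cdot> cY k = \<one>\<^bsub>tob 3 Y (Suc k)\<^esub>"
    unfolding cY_def cY'_def by (cases "k = 1"; simp add: s y1 Y2 oY yk)+
  show cz: "cZ k \<in> Arr C" "Dom C (cZ k) = tob 3 Z k" "Cod C (cZ k) = tob 2 Z k"
    "cZ' k \<in> Arr C" "Dom C (cZ' k) = tob 2 Z k" "Cod C (cZ' k) = tob 3 Z k"
    "cZ' k \<cdot> cZ k = \<one>\<^bsub>tob 3 Z k\<^esub>"
    unfolding cZ_def cZ'_def by (cases "k = 2"; simp add: z2 Y2 oZ zk)+
  show "\<gamma> k \<in> Arr C" "Dom C (\<gamma> k) = tob 2 Z k" "Cod C (\<gamma> k) = tob 3 Y (Suc k)"
    unfolding \<gamma>_def by (cases "k = 2"; simp add: s z2 g2 oY oZ)+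
  show "\<gamma> k \<cdot> cZ k = \<zero>\<^bsub>tob 3 Z k,tob 3 Y (Suc k)\<^esub>"
    using cz(1-3) unfolding \<gamma>_def by (cases "k = 2") (simp_all add: s z2 g2 oY oZ zk cZ_def)
qed

lemma wi_wp:
  assumes k: "1 \<le> k" "k \<le> n"
  shows "wi k \<in> Arr C" "Dom C (wi k) = rT k" "Cod C (wi k) = wT k"
    "wp k \<in> Arr C" "Dom C (wp k) = wT k" "Cod C (wp k) = rT k"
    "wi k \<cdot> r5i X Y Z 0 k = e1 k" "wi k \<cdot> r5i X Y Z 1 k = e2 k \<cdot> cY k" "wi k \<cdot> r5i X Y Z 2 k = e3 k \<cdot> cZ k"
    "wp k \<cdot> e1 k = r5i X Y Z 0 k" "wp k \<cdot> e2 k = r5i X Y Z 1 k \<cdot> cY' k"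
    "wp k \<cdot> e3 k = r5i X Y Z 2 k \<cdot> cZ' k \<oplus> r5i X Y Z 1 k \<cdot> \<gamma> k"
    "wp k \<cdot> wi k = \<one>\<^bsub>rT k\<^esub>"
proof -
  note c = canonical[OF k] and x3 = tob23(1)[OF k(1)]
  note w = trisumD[OF W_trisum[OF k]] trisum_comp[OF W_trisum[OF k]]
  note r = trisumD[OF R_trisum[OF k], unfolded x3] trisum_comp[OF R_trisum[OF k], unfolded x3]
  show t: "wi k \<in> Arr C" "Dom C (wi k) = rT k" "Cod C (wi k) = wT k"
    "wp k \<in> Arr C" "Dom C (wp k) = wT k" "Cod C (wp k) = rT k"
    unfolding wi_def wp_def by (simp_all add: c w r)
  show i: "wi k \<cdot> r5i X Y Z 0 k = e1 k" "wi k \<cdot> r5i X Y Z 1 k = e2 k \<cdot> cY k" "wi k \<cdot> r5i X Y Z 2 k = e3 k \<cdot> cZ k"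
    unfolding wi_def by (simp_all add: c w r)
  show p: "wp k \<cdot> e1 k = r5i X Y Z 0 k" "wp k \<cdot> e2 k = r5i X Y Z 1 k \<cdot> cY' k"
    "wp k \<cdot> e3 k = r5i X Y Z 2 k \<cdot> cZ' k \<oplus> r5i X Y Z 1 k \<cdot> \<gamma> k"
    unfolding wp_def by (simp_all add: c w r)
  show "wp k \<cdot> wi k = \<one>\<^bsub>rT k\<^esub>"
    by (rule trisum_epi[OF R_trisum[OF k], of _ "rT k"])
      (simp_all add: mor_iff t c w r i p p[THEN reassoc])
qed

definition "pc k = (if Suc (Suc k) \<le> n then \<phi> (Suc (Suc k)) else \<zero>\<^bsub>tob 3 X (Suc (Suc k)),tob 3 Y (Suc (Suc k))\<^esub>)"
definition "sc k = (if 2 \<le> k then \<psi> (Suc k) else \<zero>\<^bsub>tob 3 Y (Suc k),tob 3 Z (Suc k)\<^esub>)"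
definition "tc k = (if 2 \<le> k \<and> Suc (Suc k) \<le> n then \<theta> (Suc (Suc k)) else \<zero>\<^bsub>tob 3 X (Suc (Suc k)),tob 3 Z (Suc k)\<^esub>)"

lemma \<psi>_mor: "2 \<le> k \<Longrightarrow> k \<le> n \<Longrightarrow> \<psi> k \<in> mor (Y k) (Z k)"
  using biproduct_rules[OF modT(1), of k] morphismD[OF \<chi>m] by (simp add: \<psi>_def mor_iff modT(2) tob_in)

lemma \<theta>_mor: "3 \<le> k \<Longrightarrow> k \<le> n \<Longrightarrow> \<theta> k \<in> mor (X k) (Z (k - 1))"
  using biproduct_rules[OF modT(1), of "k - 1"] morphismD(1-3)[OF \<chi>m, of "k - 1"]
  by (simp add: \<theta>_def mor_iff modT(2) tob_in)

lemma coefficient_mor: "\<forall>k\<in>{3..n}. \<phi> k \<in> mor (X k) (Y k)" "\<forall>k\<in>{3..n}. \<psi> k \<in> mor (Y k) (Z k)"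
  "\<forall>k\<in>{4..n}. \<theta> k \<in> mor (X k) (Z (k - 1))"
  using \<phi>_mor \<psi>_mor \<theta>_mor by auto

lemmas R_columns = row5_columns[OF nX nY nZ coefficient_mor, folded rT_def rD_def pc_def sc_def tc_def]

text \<open>The square of \<open>\<chi>\<close> at position 2, restricted to \<open>Y 2\<close>, on
  which \<open>\<chi> 2\<close> is the identity. It makes the correction \<open>\<gamma>\<close>
  compatible with the differentials at position 2, where \<open>h 2\<close> reappears as
  \<open>\<psi> 3 \<cdot> g 2\<close>.\<close>

lemma \<psi>3: "\<psi> 3 \<cdot> g 2 = h 2"
proof -
  note c = morphismD[OF \<chi>m] and t = nseqD[OF nT]
  have S: "Suc 2 = 3" by simp
  have s2: "tob 2 X 3 = X 3" "tob 2 Y 2 = Y 2" "tar 2 Y g 2 = g 2" by (simp_all add: tob_in tar_in)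
  note b2 = biproduct_rules[OF modT(1), of 2, unfolded modT(2) S s2, simplified]
  note b3 = biproduct_rules[OF modT(1), of 3, unfolded modT(2), simplified]
  have g2: "g 2 \<in> Arr C" "Dom C (g 2) = Y 2" "Cod C (g 2) = tob 2 Y 3"
    using nseqD(2-4)[OF nY, of 2] by (simp_all add: tob_in)
  have h2: "h 2 \<in> Arr C" "Dom C (h 2) = Y 2" using nseqD(2,3)[OF nZ, of 2] YZ by simp_all
  have c3: "\<chi> 3 \<in> Arr C" "Dom C (\<chi> 3) = tT 3" using c(1,2)[of 3] by simp_all
  have d2: "tD 2 \<in> Arr C" "Dom C (tD 2) = tT 2" "Cod C (tD 2) = tT 3" using t(2-4)[of 2] by simp_all
  have "\<psi> 3 \<cdot> g 2 = \<chi> 3 \<cdot> (Inj2 (cone_bip X Y 3) \<cdot> g 2)"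
    using g2 b3 c3 by (simp add: \<psi>_def)
  also have "Inj2 (cone_bip X Y 3) \<cdot> g 2 = tD 2 \<cdot> Inj2 (cone_bip X Y 2)"
    using modT(5)[of 2] unfolding S s2 by simp
  also have "\<chi> 3 \<cdot> \<dots> = (h 2 \<cdot> \<chi> 2) \<cdot> Inj2 (cone_bip X Y 2)"
    by (rule reassoc) (use c(4)[of 2] in \<open>simp_all add: S c3 d2 b2\<close>)
  also have "\<dots> = h 2" using h2 by (simp add: \<chi>2 b2)
  finally show ?thesis .
qed

text \<open>The entrywise content of \<open>chain\<close>. From k = 3 on the canonical maps are
  identities and \<open>\<gamma>\<close> vanishes. The case k = 1 contains the pivot; k = 2 rests on
  \<open>\<psi>3\<close> and on the vanishing of consecutive maps of row 2.\<close>

lemma coefficients: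
  assumes k: "1 \<le> k" "k < n"
  defines "a \<equiv> \<chi> (Suc k) \<cdot> Inj1 (qB k)" and "b \<equiv> \<chi> (Suc k) \<cdot> Inj2 (qB k)"
  shows "tmo X Y \<phi> (Suc (Suc k)) = pc k" "tar 2 X f (Suc (Suc k)) = tar 3 X f (Suc (Suc k))"
    "cZ' (Suc k) \<cdot> a = tc k" "\<gamma> (Suc k) \<cdot> a = \<zero>\<^bsub>tob 2 X (Suc (Suc k)),tob 3 Y (Suc (Suc k))\<^esub>" "cZ (Suc k) \<cdot> tc k = a"
    "cZ' (Suc k) \<cdot> b = sc k \<cdot> cY' k" "\<ominus> tar 2 Y g (Suc k) \<oplus> \<gamma> (Suc k) \<cdot> b = \<ominus> (tar 3 Y g (Suc k) \<cdot> cY' k)"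
    "tar 3 Y g (Suc k) = tar 2 Y g (Suc k) \<cdot> cY k" "cZ (Suc k) \<cdot> sc k = b \<cdot> cY k"
    "cZ' (Suc k) \<cdot> tar 2 Z h k = tar 3 Z h k \<cdot> cZ' k \<oplus> sc k \<cdot> \<gamma> k"
    "\<gamma> (Suc k) \<cdot> tar 2 Z h k = \<ominus> (tar 3 Y g (Suc k) \<cdot> \<gamma> k)" "cZ (Suc k) \<cdot> tar 3 Z h k = tar 2 Z h k \<cdot> cZ k"
proof -
  have k': "k \<le> n" "1 \<le> Suc k" "Suc k \<le> n" "2 \<le> Suc k" using k by simp_all
  note o = tob_Ob[OF nX, of 2, simplified] tob_Ob[OF nY, of 2, simplified] tob_Ob[OF nZ, of 2, simplified]
    tob_Ob[OF nX, of 3, simplified] tob_Ob[OF nY, of 3, simplified] tob_Ob[OF nZ, of 3, simplified]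
  note ta = tar_arr[OF nX, of 2, simplified] tar_arr[OF nY, of 2, simplified] tar_arr[OF nZ, of 2, simplified]
    tar_arr[OF nX, of 3, simplified] tar_arr[OF nY, of 3, simplified] tar_arr[OF nZ, of 3, simplified]
  note q = biproduct_rules[OF qB(1)[OF k(1) k'(1)], unfolded qB(2)[OF k(1) k'(1)]]
  have ch: "\<chi> (Suc k) \<in> Arr C" "Dom C (\<chi> (Suc k)) = tob 2 tT (Suc k)" "Cod C (\<chi> (Suc k)) = tob 2 Z (Suc k)"
    using morphismD(1-3)[OF \<chi>m, of "Suc k"] k' by (simp_all add: tob_in)
  have at: "a \<in> Arr C" "Dom C a = tob 2 X (Suc (Suc k))" "Cod C a = tob 2 Z (Suc k)"
    and bt: "b \<in> Arr C" "Dom C b = tob 2 Y (Suc k)" "Cod C b = tob 2 Z (Suc k)"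
    unfolding a_def b_def by (simp_all add: q ch)
  have k2: "3 \<le> Suc (Suc k)" "2 \<le> Suc (Suc k)" using k by simp_all
  show "tmo X Y \<phi> (Suc (Suc k)) = pc k" "tar 2 X f (Suc (Suc k)) = tar 3 X f (Suc (Suc k))"
    using k k2 by (simp_all add: tmo_def pc_def tar_def tob_def)
  note c = canonical[OF k(1) k'(1)] canonical[OF k'(2,3)]
  have "cZ' (Suc k) \<cdot> a = tc k \<and> \<gamma> (Suc k) \<cdot> a = \<zero>\<^bsub>tob 2 X (Suc (Suc k)),tob 3 Y (Suc (Suc k))\<^esub> \<and> cZ (Suc k) \<cdot> tc k = a \<and>
    cZ' (Suc k) \<cdot> b = sc k \<cdot> cY' k \<and> \<ominus> tar 2 Y g (Suc k) \<oplus> \<gamma> (Suc k) \<cdot> b = \<ominus> (tar 3 Y g (Suc k) \<cdot> cY' k) \<and>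
    tar 3 Y g (Suc k) = tar 2 Y g (Suc k) \<cdot> cY k \<and> cZ (Suc k) \<cdot> sc k = b \<cdot> cY k \<and>
    cZ' (Suc k) \<cdot> tar 2 Z h k = tar 3 Z h k \<cdot> cZ' k \<oplus> sc k \<cdot> \<gamma> k \<and>
    \<gamma> (Suc k) \<cdot> tar 2 Z h k = \<ominus> (tar 3 Y g (Suc k) \<cdot> \<gamma> k) \<and> cZ (Suc k) \<cdot> tar 3 Z h k = tar 2 Z h k \<cdot> cZ k"
  proof (cases "k = 1")
    case True
    have S: "Suc 1 = 2" "Suc 2 = 3" by simp_all
    have obs: "tob 2 X 3 = X 3" "tob 3 X 3 = X 3" "tob 2 Y 2 = Y 2" "tob 3 Y 2 = N" "tob 2 Y 3 = Y 3" "tob 3 Y 3 = Y 3"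
      "tob 2 Z 1 = N" "tob 3 Z 1 = N" "tob 2 Z 2 = Y 2" "tob 3 Z 2 = N"
      by (simp_all add: tob_in tob_low YZ)
    have oo: "X 3 \<in> Ob C" "Y 2 \<in> Ob C" "Y 3 \<in> Ob C" using nseqD(1)[OF nX, of 3] nseqD(1)[OF nY, of 2] nseqD(1)[OF nY, of 3] by simp_all
    have g2: "g 2 \<in> Arr C" "Dom C (g 2) = Y 2" "Cod C (g 2) = Y 3" using nseqD(2-4)[OF nY, of 2] by simp_all
    note b2 = biproduct_rules[OF modT(1), of 2, unfolded modT(2) S obs, simplified]
    have ab: "a = \<zero>\<^bsub>X 3,Y 2\<^esub>" "b = \<one>\<^bsub>Y 2\<^esub>" unfolding a_def b_def True S by (simp_all add: qB_def S \<chi>2 b2)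
    have ts: "tar 2 Y g 2 = g 2" "tar 3 Y g 2 = \<zero>\<^bsub>N,Y 3\<^esub>" "tar 2 Z h 1 = \<zero>\<^bsub>N,Y 2\<^esub>" "tar 3 Z h 1 = \<zero>\<^bsub>N,N\<^esub>"
      "tc 1 = \<zero>\<^bsub>X 3,N\<^esub>" "sc 1 = \<zero>\<^bsub>N,N\<^esub>" "\<gamma> 2 = g 2" "\<gamma> 1 = \<zero>\<^bsub>N,N\<^esub>"
      "cY 1 = \<zero>\<^bsub>N,Y 2\<^esub>" "cY' 1 = \<zero>\<^bsub>Y 2,N\<^esub>" "cZ 1 = \<zero>\<^bsub>N,N\<^esub>" "cZ' 1 = \<zero>\<^bsub>N,N\<^esub>" "cZ 2 = \<zero>\<^bsub>N,Y 2\<^esub>" "cZ' 2 = \<zero>\<^bsub>Y 2,N\<^esub>"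
      by (simp_all add: tar_def tc_def sc_def \<gamma>_def cY_def cY'_def cZ_def cZ'_def S obs)
    show ?thesis unfolding True S ab ts obs by (simp add: oo g2)
  next
    case False
    then have k2: "2 \<le> k" "3 \<le> Suc k" using k by simp_all
    have obs: "tob 3 Y (Suc k) = tob 2 Y (Suc k)" "tob 3 Z (Suc k) = tob 2 Z (Suc k)"
      "tob 3 Y (Suc (Suc k)) = tob 2 Y (Suc (Suc k))" "tob 3 X (Suc (Suc k)) = tob 2 X (Suc (Suc k))"
      using k2 by (simp_all add: tob_def)
    have cc: "cZ (Suc k) = \<one>\<^bsub>tob 2 Z (Suc k)\<^esub>" "cZ' (Suc k) = \<one>\<^bsub>tob 2 Z (Suc k)\<^esub>" "cY k = \<one>\<^bsub>tob 2 Y (Suc k)\<^esub>"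
      "cY' k = \<one>\<^bsub>tob 2 Y (Suc k)\<^esub>" "\<gamma> (Suc k) = \<zero>\<^bsub>tob 2 Z (Suc k),tob 2 Y (Suc (Suc k))\<^esub>"
      using k2 by (simp_all add: cZ_def cZ'_def cY_def cY'_def \<gamma>_def obs)
    have G: "tar 3 Y g (Suc k) = tar 2 Y g (Suc k)" using k2 by (simp add: tar_def obs)
    have qk: "qB k = cone_bip X Y (Suc k)" using k by (simp add: qB_def)
    have bs: "sc k = b" using k2 by (simp add: sc_def \<psi>_def b_def qk)
    have as: "tc k = a"
    proof (cases "Suc (Suc k) \<le> n")
      case True
      have "Suc (Suc k) - 1 = Suc k" by simp
      then show ?thesis using True k2 by (simp add: tc_def \<theta>_def a_def qk)
    next
      case False
      then have N: "tob 2 X (Suc (Suc k)) = N" by (simp add: tob_high)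
      then show ?thesis using from_zero_ob[OF at(1)] at(2,3) False by (simp add: tc_def obs)
    qed
    have H: "tar 2 Z h k = tar 3 Z h k \<cdot> cZ' k \<oplus> b \<cdot> \<gamma> k \<and>
        \<ominus> (tar 2 Y g (Suc k) \<cdot> \<gamma> k) = \<zero>\<^bsub>tob 2 Z k,tob 2 Y (Suc (Suc k))\<^esub> \<and> tar 3 Z h k = tar 2 Z h k \<cdot> cZ k"
    proof (cases "k = 2")
      case True
      have S: "Suc 2 = 3" by simp
      have z2: "tob 2 Z 2 = Y 2" "tob 3 Z 2 = N" "tob 2 Z 3 = Z 3" "tob 3 Z 3 = Z 3" "tob 2 Y 2 = Y 2" by (simp_all add: tob_in tob_low YZ)
      have ts: "tar 2 Z h 2 = h 2" "tar 3 Z h 2 = \<zero>\<^bsub>N,Z 3\<^esub>" "cZ 2 = \<zero>\<^bsub>N,Y 2\<^esub>" "cZ' 2 = \<zero>\<^bsub>Y 2,N\<^esub>" "\<gamma> 2 = g 2" "tar 2 Y g 2 = g 2"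
        by (simp_all add: tar_def cZ_def cZ'_def \<gamma>_def S z2)
      have h2: "h 2 \<in> Arr C" "Dom C (h 2) = Y 2" "Cod C (h 2) = Z 3" using nseqD(2-4)[OF nZ, of 2] YZ by simp_all
      have oo: "Y 2 \<in> Ob C" "Z 3 \<in> Ob C" using nseqD(1)[OF nY, of 2] nseqD(1)[OF nZ, of 3] by simp_all
      have "b = \<psi> 3" using bs True by (simp add: sc_def)
      moreover have "tar 2 Y g 3 \<cdot> g 2 = \<zero>\<^bsub>Y 2,tob 2 Y (Suc 3)\<^esub>"
        using tar_tar[OF Theta_hom_exact[OF Y], of 2 2] unfolding S ts z2 by simp
      ultimately show ?thesis
        unfolding True S z2 ts using h2 oo o by (simp add: \<psi>3)
    next
      case False
      then have k3: "3 \<le> k" using k2 by simp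
      have zk: "tob 3 Z k = tob 2 Z k" using k3 by (rule tob23)
      have "cZ k = \<one>\<^bsub>tob 2 Z k\<^esub>" "cZ' k = \<one>\<^bsub>tob 2 Z k\<^esub>" "\<gamma> k = \<zero>\<^bsub>tob 2 Z k,tob 2 Y (Suc k)\<^esub>" "tar 3 Z h k = tar 2 Z h k"
        using k3 k by (simp_all add: cZ_def cZ'_def \<gamma>_def obs tar_def zk)
      then show ?thesis by (simp add: ta o bt)
    qed
    have t3: "Cod C (tar 3 Z h k) = tob 2 Z (Suc k)" by (simp add: ta obs)
    have id: "\<one>\<^bsub>tob 2 Z (Suc k)\<^esub> \<cdot> tar 2 Z h k = tar 2 Z h k" "\<one>\<^bsub>tob 2 Z (Suc k)\<^esub> \<cdot> tar 3 Z h k = tar 3 Z h k"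
      "\<zero>\<^bsub>tob 2 Z (Suc k),tob 2 Y (Suc (Suc k))\<^esub> \<cdot> tar 2 Z h k = \<zero>\<^bsub>tob 2 Z k,tob 2 Y (Suc (Suc k))\<^esub>"
      using ta(7-9)[of k] ta(16)[of k] t3 o by simp_all
    show ?thesis
      unfolding cc G as bs obs id
      by (intro conjI; (rule H[THEN conjunct1] H[THEN conjunct2, THEN conjunct1, symmetric]
            H[THEN conjunct2, THEN conjunct2] | simp add: at bt ta o))
  qed
  then show "cZ' (Suc k) \<cdot> a = tc k" "\<gamma> (Suc k) \<cdot> a = \<zero>\<^bsub>tob 2 X (Suc (Suc k)),tob 3 Y (Suc (Suc k))\<^esub>" "cZ (Suc k) \<cdot> tc k = a"
    "cZ' (Suc k) \<cdot> b = sc k \<cdot> cY' k" "\<ominus> tar 2 Y g (Suc k) \<oplus> \<gamma> (Suc k) \<cdot> b = \<ominus> (tar 3 Y g (Suc k) \<cdot> cY' k)"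
    "tar 3 Y g (Suc k) = tar 2 Y g (Suc k) \<cdot> cY k" "cZ (Suc k) \<cdot> sc k = b \<cdot> cY k"
    "cZ' (Suc k) \<cdot> tar 2 Z h k = tar 3 Z h k \<cdot> cZ' k \<oplus> sc k \<cdot> \<gamma> k"
    "\<gamma> (Suc k) \<cdot> tar 2 Z h k = \<ominus> (tar 3 Y g (Suc k) \<cdot> \<gamma> k)" "cZ (Suc k) \<cdot> tar 3 Z h k = tar 2 Z h k \<cdot> cZ k"
    by blast+
qed

lemma chain:
  assumes k: "1 \<le> k" "k < n"
  shows "wp (Suc k) \<cdot> wD k = rD k \<cdot> wp k" "wi (Suc k) \<cdot> rD k = wD k \<cdot> wi k"
proof -
  have k': "k \<le> n" "1 \<le> Suc k" "Suc k \<le> n" "Suc k \<noteq> 1" using k by simp_all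
  let ?a = "\<chi> (Suc k) \<cdot> Inj1 (qB k)" and ?b = "\<chi> (Suc k) \<cdot> Inj2 (qB k)"
  note o = tob_Ob[OF nX, of 2, simplified] tob_Ob[OF nY, of 2, simplified] tob_Ob[OF nZ, of 2, simplified]
    tob_Ob[OF nX, of 3, simplified] tob_Ob[OF nY, of 3, simplified] tob_Ob[OF nZ, of 3, simplified]
  note ta = tar_arr[OF nX, of 2, simplified] tar_arr[OF nY, of 2, simplified] tar_arr[OF nZ, of 2, simplified]
    tar_arr[OF nX, of 3, simplified] tar_arr[OF nY, of 3, simplified] tar_arr[OF nZ, of 3, simplified]
  note q = biproduct_rules(1-15)[OF qB(1)[OF k(1) k'(1)], unfolded qB(2)[OF k(1) k'(1)]]
  have ch: "\<chi> (Suc k) \<in> Arr C" "Dom C (\<chi> (Suc k)) = tob 2 tT (Suc k)" "Cod C (\<chi> (Suc k)) = tob 2 Z (Suc k)"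
    using morphismD(1-3)[OF \<chi>m, of "Suc k"] k' by (simp_all add: tob_in)
  define a b where "a = ?a" and "b = ?b"
  have at: "a \<in> Arr C" "Dom C a = tob 2 X (Suc (Suc k))" "Cod C a = tob 2 Z (Suc k)"
    and bt: "b \<in> Arr C" "Dom C b = tob 2 Y (Suc k)" "Cod C b = tob 2 Z (Suc k)"
    unfolding a_def b_def by (simp_all add: q ch)
  note cf = coefficients[OF k, folded a_def b_def]
  have y3: "tob 3 Y (Suc (Suc k)) = tob 2 Y (Suc (Suc k))" using k by (intro tob23) simp
  note w = trisumD(1-22)[OF W_trisum[OF k(1) k'(1)]] trisumD(1-22)[OF W_trisum[OF k'(2,3)]]
  note r = trisumD(1-22)[OF R_trisum[OF k(1) k'(1)], unfolded tob23(1)[OF k(1)]] trisumD(1-22)[OF R_trisum[OF k'(2,3)], unfolded tob23(1)[OF k'(2)] y3]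
  note c = canonical(1-15)[OF k(1) k'(1)] canonical(1-15)[OF k'(2,3), unfolded y3]
  note wi = wi_wp[OF k(1) k'(1)] wi_wp[OF k'(2,3)]
  have rt: "rD k \<in> Arr C" "Dom C (rD k) = rT k" "Cod C (rD k) = rT (Suc k)"
    using R_columns(1)[OF k] by (simp_all add: mor_iff)
  have wt: "wD k \<in> Arr C" "Dom C (wD k) = wT k" "Cod C (wD k) = wT (Suc k)" using nseqD(2-4)[OF nW] k by simp_all
  have pst: "pc k \<in> Arr C" "Dom C (pc k) = tob 2 X (Suc (Suc k))" "Cod C (pc k) = tob 2 Y (Suc (Suc k))"
    "sc k \<in> Arr C" "Dom C (sc k) = tob 3 Y (Suc k)" "Cod C (sc k) = tob 3 Z (Suc k)"
    "tc k \<in> Arr C" "Dom C (tc k) = tob 2 X (Suc (Suc k))" "Cod C (tc k) = tob 3 Z (Suc k)"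
    using R_columns(2-4)[OF k] unfolding mor_iff tob23(1)[OF k(1)] y3 by simp_all
  have cY1: "cY (Suc k) = \<one>\<^bsub>tob 2 Y (Suc (Suc k))\<^esub>" "cY' (Suc k) = \<one>\<^bsub>tob 2 Y (Suc (Suc k))\<^esub>"
    using k' by (simp_all add: cY_def cY'_def)
  note Wc = W_columns[OF k, folded a_def b_def, unfolded cf(1,2)] and Rc = R_columns(5-7)[OF k]
  note all = w r c rt wt pst at bt ta o y3 tob23(1)[OF k(1)] tob23(1)[OF k'(2)]
  note ws = wi(7-12)[THEN reassoc] wi(20-25)[THEN reassoc]
  note Ws = Wc[THEN reassoc] and Rs = Rc[THEN reassoc]
  let ?j = "r5i X Y Z"
  show "wp (Suc k) \<cdot> wD k = rD k \<cdot> wp k"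
  proof (rule trisum_epi[OF W_trisum[OF k(1) k'(1)], of _ "rT (Suc k)"])
    show "(wp (Suc k) \<cdot> wD k) \<cdot> e1 k = (rD k \<cdot> wp k) \<cdot> e1 k"
      by (simp add: all wi ws Wc Rc cf(3,4) cY1)
    \<comment> \<open>Here the contribution of \<open>\<gamma>\<close> meets the entry -g. For k = 1
      the two cancel, as they must because row 5 omits \<open>Y 2\<close>.\<close>
    have "?j 1 (Suc k) \<cdot> (\<ominus> tar 2 Y g (Suc k) \<oplus> \<gamma> (Suc k) \<cdot> b) = ?j 1 (Suc k) \<cdot> \<ominus> (tar 3 Y g (Suc k) \<cdot> cY' k)"
      by (rule arg_cong[OF cf(7)])
    then have m: "\<ominus> (?j 1 (Suc k) \<cdot> tar 2 Y g (Suc k)) \<oplus> ?j 1 (Suc k) \<cdot> (\<gamma> (Suc k) \<cdot> b) =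
        \<ominus> (?j 1 (Suc k) \<cdot> (tar 3 Y g (Suc k) \<cdot> cY' k))"
      by (simp add: all)
    have "(wp (Suc k) \<cdot> wD k) \<cdot> e2 k = \<ominus> (?j 1 (Suc k) \<cdot> tar 2 Y g (Suc k)) \<oplus> (?j 2 (Suc k) \<cdot> (sc k \<cdot> cY' k) \<oplus>
        ?j 1 (Suc k) \<cdot> (\<gamma> (Suc k) \<cdot> b))"
      by (simp add: all wi ws Wc cf(6) cY1)
    also have "?j 2 (Suc k) \<cdot> (sc k \<cdot> cY' k) \<oplus> ?j 1 (Suc k) \<cdot> (\<gamma> (Suc k) \<cdot> b) =
        ?j 1 (Suc k) \<cdot> (\<gamma> (Suc k) \<cdot> b) \<oplus> ?j 2 (Suc k) \<cdot> (sc k \<cdot> cY' k)"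
      by (rule add_commute) (simp_all add: all)
    also have "\<ominus> (?j 1 (Suc k) \<cdot> tar 2 Y g (Suc k)) \<oplus> \<dots> =
        (\<ominus> (?j 1 (Suc k) \<cdot> tar 2 Y g (Suc k)) \<oplus> ?j 1 (Suc k) \<cdot> (\<gamma> (Suc k) \<cdot> b)) \<oplus> ?j 2 (Suc k) \<cdot> (sc k \<cdot> cY' k)"
      by (simp add: all)
    also have "\<dots> = (rD k \<cdot> wp k) \<cdot> e2 k"
      unfolding m by (simp add: all wi ws Rs)
    finally show "(wp (Suc k) \<cdot> wD k) \<cdot> e2 k = (rD k \<cdot> wp k) \<cdot> e2 k" .
    show "(wp (Suc k) \<cdot> wD k) \<cdot> e3 k = (rD k \<cdot> wp k) \<cdot> e3 k"
      by (simp add: all wi ws Wc Rs cf(10,11) add_ac)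
  qed (simp_all add: mor_iff all wi(4-6,17-19))
  show "wi (Suc k) \<cdot> rD k = wD k \<cdot> wi k"
  proof (rule trisum_epi[OF R_trisum[OF k(1) k'(1)], of _ "wT (Suc k)"])
    show "(wi (Suc k) \<cdot> rD k) \<cdot> ?j 0 k = (wD k \<cdot> wi k) \<cdot> ?j 0 k"
      by (simp add: all wi ws Wc Rc cf(5) cY1)
    show "(wi (Suc k) \<cdot> rD k) \<cdot> ?j 1 k = (wD k \<cdot> wi k) \<cdot> ?j 1 k"
      by (simp add: all wi ws Ws Rc cf(8,9) cY1)
    show "(wi (Suc k) \<cdot> rD k) \<cdot> ?j 2 k = (wD k \<cdot> wi k) \<cdot> ?j 2 k"
      by (simp add: all wi ws Ws Rc cf(12))
  qed (simp_all add: mor_iff all wi(1-3,14-16))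
qed

section \<open>The ends of row 5 and its membership in \<Theta>\<close>

lemmas R_ends = row5_ends(1-3)[of X f Y g Z h \<phi> \<psi> \<theta>, folded rT_def rD_def] row5_ends(4-)[of X Y Z]

lemma P2: "is_biproduct C (X 3) (Y 2) (cone_bip X Y 2)" "BOb (cone_bip X Y 2) = tT 2"
proof -
  have S: "Suc 2 = 3" by simp
  have obs: "tob 2 X 3 = X 3" "tob 2 Y 2 = Y 2" by (simp_all add: tob_in)
  show "is_biproduct C (X 3) (Y 2) (cone_bip X Y 2)" "BOb (cone_bip X Y 2) = tT 2"
    using modT(1,2)[of 2] unfolding S obs by simp_all
qed

lemma first_arrows:
  "f 2 \<in> Arr C" "Dom C (f 2) = X 2" "Cod C (f 2) = X 3" "\<phi> 2 \<in> Arr C" "Dom C (\<phi> 2) = X 2" "Cod C (\<phi> 2) = Y 2"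
  "h n \<in> Arr C" "Dom C (h n) = Z n" "Cod C (h n) = SO (X 2)" "X 2 \<in> Ob C" "X 3 \<in> Ob C" "Y 2 \<in> Ob C" "Z n \<in> Ob C"
  using nseqD(2-4)[OF nX, of 2] morphismD(1-3)[OF \<phi>, of 2] nseqD(5-7)[OF nZ] XZ nseqD(1)[OF nX, of 2]
    nseqD(1)[OF nX, of 3] nseqD(1)[OF nY, of 2] nseqD(9)[OF nZ] by simp_all

lemma tD1: "tD 1 = \<ominus> (Inj1 (cone_bip X Y 2) \<cdot> f 2) \<oplus> Inj2 (cone_bip X Y 2) \<cdot> \<phi> 2"
proof -
  have S: "Suc 1 = 2" by simp
  have "tar 2 X f 2 = f 2" by (simp add: tar_in)
  then show ?thesis
    using modT(4)[of 1] nseqD(2-4)[OF nT, of 1] modT(6) unfolding S modT(9) by simp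
qed

lemma wi_1: "wi 1 = Inj1 (cone_bip X Y 2)" and wp_1: "wp 1 = Prj1 (cone_bip X Y 2)"
  and wi_n: "wi n = \<one>\<^bsub>Z n\<^esub>" and wp_n: "wp n = \<one>\<^bsub>Z n\<^esub>"
proof -
  have S: "Suc 1 = 2" by simp
  note b = biproduct_rules[OF P2(1), unfolded P2(2)]
  have q1: "qB 1 = cone_bip X Y 2" by (simp add: qB_def S)
  have l1: "(1::nat) \<le> 1" "1 \<le> n" "1 \<le> n" "n \<le> n" by simp_all
  note w1 = wi_wp[OF l1(1,2)] and wn = wi_wp[OF l1(3,4)]
  show "wi 1 = Inj1 (cone_bip X Y 2)"
    using w1(1,2,7) R_ends(1,4) modW(9) b by (simp add: e1_def q1)
  note r = trisumD[OF R_trisum[OF l1(1,2)]] trisum_comp[OF R_trisum[OF l1(1,2)]]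
  note w = trisumD[OF W_trisum[OF l1(1,2)]]
  have s3: "tob 3 X 3 = X 3" "tob 2 X 3 = X 3" by (simp_all add: tob_in)
  have "wp 1 = r5p X Y Z 0 1 \<cdot> wp 1" using w1(4,6) R_ends(1,5) by simp
  also have "\<dots> = p1 1"
    unfolding wp_def using canonical[OF l1(1,2)] r w by (simp add: S s3)
  also have "\<dots> = Prj1 (cone_bip X Y 2)"
    unfolding p1_def q1 modW(10) using b by simp
  finally show "wp 1 = Prj1 (cone_bip X Y 2)" .
  have n: "tob 2 Z n = Z n" by (simp add: tob_in)
  have e3: "e3 n = \<one>\<^bsub>Z n\<^esub>" unfolding e3_def by (rule modW(11))
  have zn: "Z n \<in> Ob C" using first_arrows by simp
  have "wi n = wi n \<cdot> r5i X Y Z 2 n" using wn(1,2) R_ends(2,6) by simp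
  also have "\<dots> = \<one>\<^bsub>Z n\<^esub>" unfolding wn(9) e3 using zn by (simp add: cZ_def n)
  finally show "wi n = \<one>\<^bsub>Z n\<^esub>" .
  have "wp n = wp n \<cdot> e3 n" unfolding e3 using wn(4,5) modW(7) by simp
  also have "\<dots> = r5i X Y Z 2 n \<cdot> cZ' n \<oplus> r5i X Y Z 1 n \<cdot> \<gamma> n" by (rule wn(12))
  also have "\<dots> = \<one>\<^bsub>Z n\<^esub>"
    using trisumD(4-6)[OF R_trisum[OF l1(3,4)]] R_ends(2,6) zn tob_Ob[OF nY, of 3] by (simp add: cZ'_def n \<gamma>_def)
  finally show "wp n = \<one>\<^bsub>Z n\<^esub>" .
qed

lemma nR: "is_nseq n C S (rT, rD)"
proof (rule nseqI)
  show "rD k \<in> mor (rT k) (rT (Suc k))" if "1 \<le> k" "k < n" for k using R_columns(1)[OF that] .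
  show "rD n \<in> mor (rT n) (SO (rT 1))"
    unfolding R_ends(1-3) using first_arrows by (simp add: mor_iff)
qed

lemma wp_morphism: "nseq_morphism n C S (wT, wD) (rT, rD) wp"
  and wi_morphism: "nseq_morphism n C S (rT, rD) (wT, wD) wi"
proof -
  note b = biproduct_rules[OF P2(1), unfolded P2(2)] and a = first_arrows
  have t1: "tD 1 \<in> Arr C" "Dom C (tD 1) = X 2" "Cod C (tD 1) = tT 2" using nseqD(2-4)[OF nT, of 1] modT(6) by simp_all
  \<comment> \<open>\<open>\<phi> 2\<close> is the first morphism of the n-angle in row 4, so the
    \<open>Y 2\<close>-component of \<open>SA (tD 1) \<cdot> h n\<close> vanishes; what remains is
    the last morphism of row 5 followed by \<open>SA (wi 1)\<close>.\<close>
  have hz: "SA (\<phi> 2) \<cdot> h n = \<zero>\<^bsub>Z n,SO (Y 2)\<^esub>"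
    using last_composite_zero[OF Z] h1 YZ by simp
  show "nseq_morphism n C S (wT, wD) (rT, rD) wp"
  proof (rule morphismI)
    have "SA (wp 1) \<cdot> wD n = SA (Prj1 (cone_bip X Y 2) \<cdot> tD 1) \<cdot> h n"
      unfolding wp_1 modW(8) using b t1 a by simp
    also have "Prj1 (cone_bip X Y 2) \<cdot> tD 1 = \<ominus> f 2"
      unfolding tD1 by (simp add: b a)
    finally show "SA (wp 1) \<cdot> wD n = rD n \<cdot> wp n"
      unfolding wp_n R_ends(3) using a by simp
  qed (use wi_wp chain in \<open>simp_all add: mor_iff\<close>)
  show "nseq_morphism n C S (rT, rD) (wT, wD) wi"
  proof (rule morphismI)
    have "wD n \<cdot> wi n = SA (tD 1) \<cdot> h n"
      unfolding wi_n modW(8) using a t1 by simp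
    also have "\<dots> = SA (wi 1) \<cdot> rD n"
      unfolding wi_1 R_ends(3) tD1 by (simp add: b a hz)
    finally show "SA (wi 1) \<cdot> rD n = wD n \<cdot> wi n" ..
  qed (use wi_wp chain in \<open>simp_all add: mor_iff\<close>)
qed

text \<open>Up to isomorphism the complement is \<open>Y 2\<close> at positions 1 and 2, the two
  ends of the eliminated pivot, and zero from position 3 on, where \<open>wi\<close> is
  invertible.\<close>

lemma wi_summand:
  assumes k: "1 \<le> k" "k \<le> n"
  shows "is_summand (wi k)"
proof -
  note o = tob_Ob[OF nX, of 2, simplified] tob_Ob[OF nY, of 2, simplified] tob_Ob[OF nZ, of 2, simplified]
  note w = trisumD[OF W_trisum[OF k]] trisum_comp[OF W_trisum[OF k]]
  note r = trisumD[OF R_trisum[OF k], unfolded tob23(1)[OF k(1)]] trisum_comp[OF R_trisum[OF k], unfolded tob23(1)[OF k(1)]]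
  note m = wi_wp[OF k] and c = canonical[OF k]
  consider "k = 1" | "k = 2" | "3 \<le> k" using k by linarith
  then show ?thesis
  proof cases
    case 1
    show ?thesis unfolding 1 wi_1 by (rule is_summandI[OF P2(1)]) simp
  next
    case 2
    have S: "Suc 2 = 3" "Suc 3 = 4" by simp_all
    have y3: "tob 3 Y 3 = tob 2 Y 3" by (rule tob23) simp
    have z2: "tob 3 Z 2 = N" by (simp add: tob_low)
    have cY: "cY 2 = \<one>\<^bsub>tob 2 Y 3\<^esub>" "cZ 2 = \<zero>\<^bsub>N,Y 2\<^esub>" by (simp_all add: cY_def cZ_def S)
    note w2 = w[unfolded 2 S] and r2 = r[unfolded 2 S y3 z2]
    note q = biproduct_rules[OF qB(1)[OF k], unfolded qB(2)[OF k], unfolded 2 S]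
    have tz: "tob 2 Z 2 = Y 2" by (simp add: tob_in YZ)
    \<comment> \<open>For k = 2 the summands from X and Y are the same on both sides;
      \<open>a\<close> is the resulting isomorphism from the object of row 5 onto the row 3 part of
      the cone, and the component to \<open>Z 2\<close> is zero.\<close>
    define a where "a = Inj1 (qB 2) \<cdot> r5p X Y Z 0 2 \<oplus> Inj2 (qB 2) \<cdot> r5p X Y Z 1 2"
    define b where "b = r5i X Y Z 0 2 \<cdot> Prj1 (qB 2) \<oplus> r5i X Y Z 1 2 \<cdot> Prj2 (qB 2)"
    have at: "a \<in> Arr C" "Dom C a = rT 2" "Cod C a = tob 2 tT 3"
      and bt: "b \<in> Arr C" "Dom C b = tob 2 tT 3" "Cod C b = rT 2"
      unfolding a_def b_def by (simp_all add: q r2)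
    have ab: "a \<cdot> b = \<one>\<^bsub>tob 2 tT 3\<^esub>" unfolding a_def b_def by (simp add: q r2)
    have i2: "r5i X Y Z 2 2 = \<zero>\<^bsub>N,rT 2\<^esub>" using from_zero_ob[of "r5i X Y Z 2 2"] r2(7-9) by simp
    have l2: "(1::nat) \<le> 2" "2 \<le> n" by simp_all
    have ba: "b \<cdot> a = \<one>\<^bsub>rT 2\<^esub>"
      by (rule trisum_epi[OF R_trisum[OF l2], of _ "rT 2"])
        (simp_all add: mor_iff at bt r2 i2, simp_all add: a_def b_def q r2)
    have "is_summand a"
      by (rule iso_is_summand, rule is_isoI[of _ "rT 2" "tob 2 tT 3" b]) (simp_all add: mor_iff at bt ab ba)
    moreover note PW2 = modW(1)[OF l2, unfolded S]
    note pw = biproduct_rules[OF PW2, unfolded modW(2)]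
    have "is_summand (Inj1 (cone_bip tT Z 2) \<cdot> a \<oplus> Inj2 (cone_bip tT Z 2) \<cdot> \<zero>\<^bsub>rT 2,tob 2 Z 2\<^esub>)"
      by (rule pair_is_summand[OF PW2 _ calculation]) (simp_all add: mor_iff at o r2)
    moreover have "wi 2 = Inj1 (cone_bip tT Z 2) \<cdot> a \<oplus> Inj2 (cone_bip tT Z 2) \<cdot> \<zero>\<^bsub>rT 2,tob 2 Z 2\<^esub>"
      unfolding wi_def a_def cY e1_def e2_def e3_def tz using pw[unfolded tz] q r2 first_arrows(12) by simp
    ultimately show ?thesis by (simp add: 2)
  next
    case 3
    have cc: "cY k \<cdot> cY' k = \<one>\<^bsub>tob 2 Y (Suc k)\<^esub>" "cZ k \<cdot> cZ' k = \<one>\<^bsub>tob 2 Z k\<^esub>" "\<gamma> k = \<zero>\<^bsub>tob 2 Z k,tob 3 Y (Suc k)\<^esub>"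
      using 3 o by (simp_all add: cY_def cY'_def cZ_def cZ'_def \<gamma>_def)
    have "wi k \<cdot> wp k = \<one>\<^bsub>wT k\<^esub>"
      by (rule trisum_epi[OF W_trisum[OF k], of _ "wT k"])
        (simp_all add: mor_iff w r c m m(7-9)[THEN reassoc] cc)
    then show ?thesis
      by (intro iso_is_summand is_isoI[of _ "rT k" "wT k" "wp k"]) (simp_all add: mor_iff m)
  qed
qed

lemma R\<Theta>: "(rT, rD) \<in> \<Theta>"
proof (rule retract_in_Theta[OF W\<Theta> nR wi_morphism wp_morphism])
  fix k assume k: "1 \<le> k" "k \<le> n"
  show "wp k \<cdot> wi k = \<one>\<^bsub>rT k\<^esub>" by (rule wi_wp(13)[OF k])
  show "\<exists>Q P. is_biproduct C (rT k) Q P \<and> BOb P = wT k \<and> Inj1 P = wi k"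
    using wi_summand[OF k] wi_wp(1-3)[OF k] unfolding is_summand_def by simp
qed

text \<open>Row 4 enters the cone by the standard inclusion, and projecting with \<open>wp\<close>
  gives the prescribed vertical maps: \<open>\<ominus> f 2\<close> is the
  \<open>X 3\<close>-component of \<open>tD 1\<close>, and \<open>g 2\<close> in column 2 is the
  correction \<open>\<gamma>\<close>.\<close>

lemma vert45_eq:
  assumes k: "1 \<le> k" "k \<le> n"
  shows "vert45 n C X f Y g Z k = wp k \<cdot> (if k = 1 then tD 1 else Inj2 (cone_bip tT Z k))"
proof -
  note m = wi_wp[OF k] and c = canonical[OF k]
  note r = trisumD[OF R_trisum[OF k]]
  note b = biproduct_rules[OF P2(1), unfolded P2(2)] and a = first_arrows
  have e3: "Inj2 (cone_bip tT Z k) = e3 k" by (simp add: e3_def)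
  consider "k = 1" | "k = 2" | "3 \<le> k" "k < n" | "k = n" "k \<noteq> 1" "k \<noteq> 2" using k n_ge_3 by linarith
  then show ?thesis
  proof cases
    case 1
    show ?thesis unfolding 1 wp_1 tD1 by (simp add: vert45_def b a)
  next
    case 2
    have S: "Suc 2 = 3" by simp
    have j2: "r5i X Y Z 2 2 = \<zero>\<^bsub>N,rT 2\<^esub>" using from_zero_ob[of "r5i X Y Z 2 2"] r(7-9) by (simp add: 2 tob_low)
    have ct: "cZ' 2 = \<zero>\<^bsub>Y 2,N\<^esub>" "\<gamma> 2 = g 2" by (simp_all add: cZ'_def \<gamma>_def)
    have g2: "g 2 \<in> Arr C" "Dom C (g 2) = Y 2" "Cod C (g 2) = Y 3" using nseqD(2-4)[OF nY, of 2] by simp_all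
    have Y3: "Y 3 \<in> Ob C" using nseqD(1)[OF nY, of 3] by simp
    have r4: "r5i X Y Z 1 2 \<in> Arr C" "Dom C (r5i X Y Z 1 2) = Y 3" "Cod C (r5i X Y Z 1 2) = rT 2" "rT 2 \<in> Ob C"
      using r(4-6,19) unfolding 2 S by (simp_all add: tob_in)
    have "wp 2 \<cdot> e3 2 = r5i X Y Z 1 2 \<cdot> g 2"
      using m(12) unfolding 2 j2 ct using g2 r4 a(12) by simp
    moreover have "vert45 n C X f Y g Z 2 = r5i X Y Z 1 2 \<cdot> g 2"
    proof (cases "n = 3")
      case True
      have "row5_mask n 2 = [False, True, False]" by (simp add: row5_mask_def True)
      then have "r5i X Y Z 1 2 = \<one>\<^bsub>Y 3\<^esub>" by (simp add: r5i_def minj_def One_nat_def)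
      then show ?thesis using g2 True by (simp add: vert45_def)
    next
      case False
      then have n4: "4 \<le> n" using n_ge_3 by linarith
      have X4: "X 4 \<in> Ob C" using nseqD(1)[OF nX, of 4] n4 by simp
      have L: "set [X 4, Y 3] \<subseteq> Ob C" using X4 Y3 by simp
      have l: "0 < length [X 4, Y 3]" "1 < length [X 4, Y 3]" by (simp_all add: One_nat_def)
      have n1: "[X 4, Y 3] ! 1 = Y 3" by (simp add: One_nat_def)
      note i = dinj_arr[OF L l(1), unfolded mor_iff] dinj_arr[OF L l(2), unfolded mor_iff n1]
      have S4: "Suc (Suc 2) = 4" by simp
      have "row5_mask n 2 = [True, True, False]" using n4 by (simp add: row5_mask_def)
      then have "r5i X Y Z 1 2 = dinj C [X 4, Y 3] 1" unfolding r5i_def S S4 by (simp add: minj_def One_nat_def)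
      moreover have "mat C [Y 2] [X 4, Y 3] [[\<zero>\<^bsub>Y 2,X 4\<^esub>], [g 2]] = dinj C [X 4, Y 3] 1 \<cdot> g 2"
        using mat_column[OF a(12) X4 Y3, of "\<zero>\<^bsub>Y 2,X 4\<^esub>" "g 2"] i g2 a(12) X4 by (simp add: mor_iff)
      ultimately show ?thesis using False by (simp add: vert45_def)
    qed
    ultimately show ?thesis using e3 unfolding 2 by simp
  next
    case 3
    have t: "tob 2 Z k = Z k" "tob 3 Z k = Z k" using 3 by (simp_all add: tob_in)
    have zk: "Z k \<in> Ob C" using nseqD(1)[OF nZ k] .
    have "wp k \<cdot> e3 k = r5i X Y Z 2 k"
      unfolding m(12) using 3 t r(4-9) zk r(19-22) by (simp add: cZ'_def \<gamma>_def)
    moreover have "vert45 n C X f Y g Z k = r5i X Y Z 2 k"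
    proof -
      let ?L = "keep (row5_mask n k) [X (Suc (Suc k)), Y (Suc k), Z k]"
      have m3: "row5_mask n k = [Suc (Suc k) \<le> n, True, True]" using 3 by (simp add: row5_mask_def)
      have "length ?L - 1 = pos (row5_mask n k) 2" unfolding m3 by (simp add: pos_def One_nat_def)
      then have "r5i X Y Z 2 k = dinj C ?L (length ?L - 1)"
        unfolding r5i_def minj_def by (simp add: m3)
      then show ?thesis using 3 unfolding vert45_def Let_def by (simp flip: Suc_eq_plus1)
    qed
    ultimately show ?thesis using 3 e3 by simp
  next
    case 4
    show ?thesis using 4 a(13) by (simp add: wp_n vert45_def modW(11))
  qed
qed

lemma diagram: "diagram_D n C S \<Theta> X f Y g Z h \<phi> \<psi> \<theta>"
proof -
  have T': "row3 n C S X f Y g \<phi> = (tT, tD)" by (simp add: tT_def tD_def)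
  have R': "row5 n C S X f Y g Z h \<phi> \<psi> \<theta> = (rT, rD)" by (simp add: rT_def rD_def)
  have W': "row3 n C S tT tD Z h \<chi> = (wT, wD)" by (simp add: wT_def wD_def)
  have ps: "(\<lambda>k. \<chi> k \<cdot> Inj2 (cone_bip X Y k)) = \<psi>" "(\<lambda>k. \<chi> (k - 1) \<cdot> Inj1 (cone_bip X Y (k - 1))) = \<theta>"
    by (auto simp: \<psi>_def \<theta>_def)
  have "nseq_morphism n C S (Y, g) (tT, tD) (vert23 n C X f Y)"
    by (rule morphism_cong[OF cone_inclusion[OF X nY XY \<phi> \<phi>1, unfolded T']]) (rule vert23_eq[OF nX nY _ _ modT(11)])
  moreover have "nseq_morphism n C S (tT, tD) (Z, h) (vert34 n C X Y Z \<psi> \<theta>)"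
    by (rule morphism_cong[OF \<chi>m]) (rule vert34_eq[OF nX nY nZ XY YZ \<phi>_mor \<chi> \<chi>1 \<chi>2, unfolded ps])
  moreover have "nseq_morphism n C S (Z, h) (rT, rD) (vert45 n C X f Y g Z)"
  proof (rule morphism_cong)
    have "\<chi> 1 = \<one>\<^bsub>tT 1\<^esub>" using \<chi>1 modT(6) by simp
    \<comment> \<open>The same inclusion as between rows 2 and 3, now for the cone of
      \<open>\<chi>\<close>, whose source is row 3 and whose target is row 4.\<close>
    from cone_inclusion[OF T\<Theta> nZ ZT \<chi>m this]
    show "nseq_morphism n C S (Z, h) (rT, rD) (\<lambda>k. wp k \<cdot> (if k = 1 then tD 1 else Inj2 (cone_bip tT Z k)))"
      unfolding W' by (rule morphism_comp[OF nZ nR nW _ wp_morphism])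
  qed (rule vert45_eq)
  ultimately show ?thesis
    unfolding diagram_D_def T' R'
    using X Y Z XY XZ YZ h1 \<phi>1 \<phi>_mor coefficient_mor T\<Theta> R\<Theta> \<phi> by simp
qed

end

section \<open>From (N4-1) to (N4-4) and on to (N4-5)\<close>

context pre_n_angulated
begin

theorem N4_1_imp_N4_4:
  assumes a: "N4_1 n C S \<Theta>"
  shows "N4_4 n C S \<Theta>"
  unfolding N4_4_def
proof (intro allI impI, elim conjE)
  fix X f Y g Z h p
  assume X: "(X, f) \<in> \<Theta>" and Y: "(Y, g) \<in> \<Theta>" and Z: "(Z, h) \<in> \<Theta>"
    and XY: "Y 1 = X 1" and XZ: "Z 1 = X 2" and YZ: "Z 2 = Y 2"
    and p: "p \<in> mor (X 2) (Y 2)" and h1: "h 1 = p" and g1: "g 1 = p \<cdot> f 1"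
  note nX = Theta_nseq[OF X] and nY = Theta_nseq[OF Y] and nZ = Theta_nseq[OF Z]
  obtain \<phi> where \<phi>1: "\<phi> 1 = \<one>\<^bsub>X 1\<^esub>" and \<phi>2: "\<phi> 2 = p" and \<phi>: "nseq_morphism n C S (X, f) (Y, g) \<phi>"
    and T: "row3 n C S X f Y g \<phi> \<in> \<Theta>"
    using a[unfolded N4_1_def, rule_format, of X f Y g p] X Y XY p g1 homotopy_cartesian_row3[OF nX nY XY] by metis
  have pm: "\<forall>k\<in>{2..n}. \<phi> k \<in> mor (X k) (Y k)" using morphismD(1-3)[OF \<phi>] by (simp add: mor_iff)
  define T' d where "T' = fst (row3 n C S X f Y g \<phi>)" and "d = snd (row3 n C S X f Y g \<phi>)"
  have Td: "(T', d) \<in> \<Theta>" using T by (simp add: T'_def d_def)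
  note m = row3_model[OF nX nY pm XY, folded T'_def d_def] and t = nseqD[OF Theta_nseq[OF Td]]
  let ?P = "cone_bip X Y 2"
  have S: "Suc 1 = 2" "Suc 2 = 3" by simp_all
  have obs: "tob 2 X 2 = X 2" "tob 2 X 3 = X 3" "tob 2 Y 2 = Y 2" "tar 2 X f 2 = f 2" by (simp_all add: tob_in tar_in)
  note b = biproduct_rules[OF m(1), of 2, unfolded m(2) S obs, simplified]
  have f2: "f 2 \<in> Arr C" "Dom C (f 2) = X 2" "Cod C (f 2) = X 3" using nseqD(2-4)[OF nX, of 2] by simp_all
  have pt: "p \<in> Arr C" "Dom C p = X 2" "Cod C p = Y 2" using p by (simp_all add: mor_iff)
  have "d 1 = \<ominus> (Inj1 ?P \<cdot> f 2) \<oplus> Inj2 ?P \<cdot> p"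
    using m(4)[of 1] t(2-4)[of 1] m(6) unfolding S m(9) obs \<phi>2 by simp
  \<comment> \<open>The projection to \<open>Y 2\<close> composed with the first morphism of row 3
    is the first morphism of row 4: the compatibility that the second application of (N4-1) asks
    for.\<close>
  then have pd: "Prj2 ?P \<cdot> d 1 = h 1" unfolding h1 using nseqD(1)[OF nX, of 2] by (simp add: b f2 pt)
  have ZT: "Z 1 = T' 1" using XZ m(6) by simp
  have "Prj2 ?P \<in> mor (T' 2) (Z 2)" using b YZ by (simp add: mor_iff)
  then obtain \<chi> where \<chi>1: "\<chi> 1 = \<one>\<^bsub>T' 1\<^esub>" and \<chi>2: "\<chi> 2 = Prj2 ?P" and \<chi>: "nseq_morphism n C S (T', d) (Z, h) \<chi>"
    and W: "row3 n C S T' d Z h \<chi> \<in> \<Theta>"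
    using a[unfolded N4_1_def, rule_format, of T' d Z h "Prj2 ?P"] Td Z ZT pd
      homotopy_cartesian_row3[OF Theta_nseq[OF Td] nZ ZT] by metis
  interpret composable n C S \<Theta> X f Y g Z h \<phi> \<chi>
    by unfold_locales
      (use X Y Z XY XZ YZ \<phi> \<phi>1 \<phi>2 h1 T \<chi> \<chi>1 \<chi>2 W m(6) in \<open>simp_all add: T'_def d_def\<close>)
  show "\<exists>\<phi> \<psi> \<theta>. \<phi> 2 = p \<and> diagram_D n C S \<Theta> X f Y g Z h \<phi> \<psi> \<theta>"
    using diagram \<phi>2 by blast
qed

theorem N4_4_imp_N4_5:
  assumes a: "N4_4 n C S \<Theta>"
  shows "N4_5 n C S \<Theta>"
  unfolding N4_5_def
proof (intro allI impI, elim conjE)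
  fix a p assume ap: "a \<in> Arr C" "p \<in> Arr C" "Dom C p = Cod C a"
  obtain X f where X: "(X, f) \<in> \<Theta>" "f 1 = a" using N1c[OF ap(1)] by blast
  obtain Y g where Y: "(Y, g) \<in> \<Theta>" "g 1 = p \<cdot> a" using N1c[of "p \<cdot> a"] ap by auto
  obtain Z h where Z: "(Z, h) \<in> \<Theta>" "h 1 = p" using N1c[OF ap(2)] by blast
  have "Y 1 = X 1" "Z 1 = X 2" "Z 2 = Y 2" "p \<in> mor (X 2) (Y 2)"
    using nseqD(3,4)[OF Theta_nseq[OF X(1)], of 1] nseqD(3,4)[OF Theta_nseq[OF Y(1)], of 1]
      nseqD(3,4)[OF Theta_nseq[OF Z(1)], of 1] X(2) Y(2) Z(2) ap by (simp_all add: mor_iff)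
  then show "\<exists>X f Y g Z h \<phi> \<psi> \<theta>. f 1 = a \<and> \<phi> 2 = p \<and> diagram_D n C S \<Theta> X f Y g Z h \<phi> \<psi> \<theta>"
    using assms[unfolded N4_4_def, rule_format, of X f Y g Z h p] X Y Z by metis
qed

end

theorem theorem3p4:
  fixes n :: nat and C :: "('o, 'm) precat"
    and S :: "('o, 'm) endo" and \<Theta> :: "('o, 'm) nseq set"
  assumes "n \<ge> 3" and "pre_n_angulated n C S \<Theta>"
  shows "(N4_1 n C S \<Theta> \<longleftrightarrow> N4_4 n C S \<Theta>) \<and> (N4_4 n C S \<Theta> \<longleftrightarrow> N4_5 n C S \<Theta>)"
proof -
  interpret pre_n_angulated n C S \<Theta> by (rule assms(2))
  show ?thesis using N4_1_imp_N4_4 N4_4_imp_N4_5 N4_5_imp_N4_1 by blast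
qed

end
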